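(* The category $\mathbf{Cosp}$, whose objects are the (finite, JK) graphs without isolated edges and whose morphisms are isomorphism classes of cospans in the restricted Kleisli category $\widetilde{\mathbf{Gr}}$ with first leg a reduced cover and second leg a generic morphism, composed by pushout in $\widetilde{\mathbf{Gr}}$, is equivalent to the Borisov--Manin category $\mathbf{BM}$ of (finite) graphs.
   Context: **The Borisov--Manin category $\mathbf{BM}$.** A BM graph is a quadruple $\tau=(V_\tau,F_\tau,\partial_\tau,j_\tau)$ with $V_\tau$ (vertices) and $F_\tau$ (flags) finite sets, $\partial_\tau:F_\tau\to V_\tau$ a map and $j_\tau:F_\tau\to F_\tau$ an involution. Fixed points of $j_\tau$ are called tails (their set is $T_\tau$); two-element $j_\tau$-orbits are called edges. A morphism $h:\tau\to\sigma$ is a triple $(h^F,h_V,j_h)$ with $h^F:F_\sigma\to F_\tau$ a map, $h_V:V_\tau\to V_\sigma$ a map, and $j_h$ an involution on $F_\tau\setminus h^F(F_\sigma)$ such that: (i) $h^F$ is injective and $h_V$ is surjective; (ii) $h^F(F_\sigma)$ and its complement are $j_\tau$-invariant; (ii') $j_h$ is fixpoint free and agrees with $j_\tau$ on those flags of its domain that belong to edges of $\tau$; (iii) if $f_\tau=h^F(f_\sigma)$ then $h_V(\partial_\tau f_\tau)=\partial_\sigma f_\sigma$, and for every $f\in F_\tau\setminus h^F(F_\sigma)$ one has $h_V(\partial_\tau f)=h_V(\partial_\tau j_h(f))$; (iv) the bijection $(h^F)^{-1}:h^F(F_\sigma)\to F_\sigma$ maps edges of $\tau$ to edges of $\sigma$.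 The composite of $g:\tau\to\sigma$ and $c:\sigma\to\rho$ is $h=c\circ g$ with $h_V=c_V\circ g_V$, $h^F=g^F\circ c^F$, and $j_h$ equal to $j_g$ on $F_\tau\setminus g^F(F_\sigma)$ and to $j_c$ (transported along the injection $g^F$) on $g^F(F_\sigma\setminus c^F(F_\rho))$. **JK graphs.** A (JK) graph is a diagram of finite sets $A\xleftarrow{s}H\xrightarrow{p}V$ together with a fixpoint-free involution $i:A\to A$, with $s$ injective. $V$: vertices, $H$: half-edges (flags), $A$: arcs. An edge is an $i$-orbit; an inner edge is an $i$-orbit with both elements in the image of $s$; an edge is isolated if neither of its arcs is in the image of $s$. A port is an arc not in the image of $s$. An etale morphism of graphs is a triple of maps on $A,H,V$ commuting with $i,s,p$ and such that the square formed by $H\to V$ is a pullback. $\mathbf{Gr}$ is the category of graphs and etale morphisms. A graph is effective if it is nonempty and has no isolated edges. Between graphs without isolated edges, a reduced cover is an etale morphism that is bijective on vertices. **Elementary graphs and graphical species.** The unit graph $\mathsf I$ has two arcs interchanged by $i$ and $H=V=\emptyset$. For a finite set $n$, the corolla $\mathsf n$ has $V=1$, $H=n'$ a copy of $n$, $A=n+n'$, $s$ the inclusion of $n'$, and $i$ interchanging the two copies; its set of ports is $n$. $\mathbf{elGr}\subset\mathbf{Gr}$ is the full subcategory of the unit graph and the corollas. A graphical species is a presheaf $F:\mathbf{elGr}^{\mathrm{op}}\to\mathbf{Set}$. A graph $\mathsf G$ is regarded as the graphical species $\operatorname{Hom}_{\mathbf{Gr}}(-,\mathsf G)$ (this is a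 fully faithful embedding). An $F$-decoration of $\mathsf G$ is a natural transformation $\mathsf G\to F$. **The monad.** For a finite set $n$, an $\mathsf n$-graph is a graph with a bijection between $n$ and its set of ports. For a graphical species $F$ let $\overline F[\mathsf I]:=F[\mathsf I]$ and let $\overline F[\mathsf n]$ be the set of isomorphism classes (isomorphisms respecting the port labelling and the decoration) of effective $\mathsf n$-graphs equipped with an $F$-decoration; this is a graphical species (isomorphisms of corollas relabel ports, and restriction along $\mathsf I\to\mathsf n$ reads off the colour at the corresponding port arc, or its inverse arc). Gluing: given a graph $\mathsf R$ and $\phi:\mathsf R\to\overline F$, for each vertex $x$ of $\mathsf R$ put $n_x=p^{-1}(x)$; the canonical etale map from the corolla $\mathsf n_x$ to $\mathsf R$ at $x$ (sending the port $f\in n_x$ to the arc $i(s(f))$) is sent by $\phi$ to an element represented by an effective $\mathsf n_x$-graph $\mathsf S_x$ with ports $q(f)$, $f\in n_x$, and an $F$-decoration. Let $\mathsf S$ be obtained from the disjoint union of all $\mathsf S_x$ and of one copy of $\mathsf I$ for each isolated edge of $\mathsf R$ by identifying, for each inner edge $\{s(f),s(f')\}$ of $\mathsf R$, the arc $q(f)$ with $i(q(f'))$ and $i(q(f))$ with $q(f')$ (a levelwise coequaliser; it is the colimit over the category of elements of $\mathsf R$). The decorations induce an $F$-decoration $\mathsf S\to F$, and the ports of $\mathsf S$ are canonically in bijection with the ports of $\mathsf R$; the result is well defined up to isomorphism. Applying gluing to effective $\mathsf n$-graphs $\mathsf R$ decorated by $\overline F$ gives the multiplication $\overline{\overline F}\to\overline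 F$; the unit $F\to\overline F$ regards an $F$-decorated corolla as an $F$-decorated $\mathsf n$-graph. This is a monad on the category of graphical species. **Restricted Kleisli category.** $\widetilde{\mathbf{Gr}}$ has as objects the graphs without isolated edges (including the empty graph) and morphisms $\mathsf R\to\mathsf Y$ the natural transformations $\mathsf R\to\overline{\mathsf Y}$, with Kleisli composition; it is a full subcategory of the Kleisli category of the monad. An etale morphism $\mathsf R\to\mathsf Y$ is regarded as a morphism in $\widetilde{\mathbf{Gr}}$ by composing with the unit $\mathsf Y\to\overline{\mathsf Y}$. A morphism $\mathsf R\to\mathsf Y$ of $\widetilde{\mathbf{Gr}}$ is generic (a refinement) if the etale morphism $\mathsf S\to\mathsf Y$ obtained by gluing (with $F=\mathsf Y$) is an isomorphism. **The category $\mathbf{Cosp}$.** Objects: graphs without isolated edges. Morphisms $\mathsf T\to\mathsf R$: isomorphism classes (isomorphisms of the apex compatible with both legs) of cospans $\mathsf T\to\mathsf S\leftarrow\mathsf R$ in $\widetilde{\mathbf{Gr}}$ where $\mathsf T\to\mathsf S$ is a reduced cover and $\mathsf R\to\mathsf S$ is generic. Composition is by pushout in $\widetilde{\mathbf{Gr}}$: pushouts of a reduced cover and a generic morphism with common domain exist in $\widetilde{\mathbf{Gr}}$, and the opposite sides are again a reduced cover and a generic morphism, respectively. *)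

theory Defs
  imports "HOL-Library.FuncSet" "HOL-Library.Infinite_Typeclass"
begin

text \<open>
  Finite sets are finite subsets of one type \<open>'u\<close>, which the final statement takes to be an
  arbitrary infinite type. Maps between sets are extensional functions
  (\<open>A \<rightarrow>\<^sub>E B\<close>), so that equality of maps is equality in HOL.
\<close>


section \<open>Categories, equivalences, pushouts\<close>

text \<open>Hom-sets are indexed by source and target and need not be disjoint; composition is
  \<open>Comp C X Y Z g f\<close> for \<open>f : X \<rightarrow> Y\<close>, \<open>g : Y \<rightarrow> Z\<close>.\<close>

record ('o,'m) cat =
  Ob :: "'o set"
  Hom :: "'o \<Rightarrow> 'o \<Rightarrow> 'm set"
  Ide :: "'o \<Rightarrow> 'm"
  Comp :: "'o \<Rightarrow> 'o \<Rightarrow> 'o \<Rightarrow> 'm \<Rightarrow> 'm \<Rightarrow> 'm"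

definition category :: "('o,'m) cat \<Rightarrow> bool" where
  "category C \<longleftrightarrow>
     (\<forall>X\<in>Ob C. Ide C X \<in> Hom C X X) \<and>
     (\<forall>X\<in>Ob C. \<forall>Y\<in>Ob C. \<forall>Z\<in>Ob C. \<forall>f\<in>Hom C X Y. \<forall>g\<in>Hom C Y Z.
        Comp C X Y Z g f \<in> Hom C X Z) \<and>
     (\<forall>X\<in>Ob C. \<forall>Y\<in>Ob C. \<forall>f\<in>Hom C X Y.
        Comp C X X Y f (Ide C X) = f \<and> Comp C X Y Y (Ide C Y) f = f) \<and>
     (\<forall>W\<in>Ob C. \<forall>X\<in>Ob C. \<forall>Y\<in>Ob C. \<forall>Z\<in>Ob C.
        \<forall>f\<in>Hom C W X. \<forall>g\<in>Hom C X Y. \<forall>h\<in>Hom C Y Z.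
        Comp C W Y Z h (Comp C W X Y g f) = Comp C W X Z (Comp C X Y Z h g) f)"

definition iso_in :: "('o,'m) cat \<Rightarrow> 'o \<Rightarrow> 'o \<Rightarrow> 'm \<Rightarrow> bool" where
  "iso_in C X Y f \<longleftrightarrow> f \<in> Hom C X Y \<and>
     (\<exists>g\<in>Hom C Y X. Comp C X Y X g f = Ide C X \<and> Comp C Y X Y f g = Ide C Y)"

definition is_functor ::
  "('o,'m) cat \<Rightarrow> ('p,'n) cat \<Rightarrow> ('o \<Rightarrow> 'p) \<Rightarrow> ('o \<Rightarrow> 'o \<Rightarrow> 'm \<Rightarrow> 'n) \<Rightarrow> bool" where
  "is_functor C D Fo Fm \<longleftrightarrow>
     (\<forall>X\<in>Ob C. Fo X \<in> Ob D) \<and>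
     (\<forall>X\<in>Ob C. \<forall>Y\<in>Ob C. \<forall>f\<in>Hom C X Y. Fm X Y f \<in> Hom D (Fo X) (Fo Y)) \<and>
     (\<forall>X\<in>Ob C. Fm X X (Ide C X) = Ide D (Fo X)) \<and>
     (\<forall>X\<in>Ob C. \<forall>Y\<in>Ob C. \<forall>Z\<in>Ob C. \<forall>f\<in>Hom C X Y. \<forall>g\<in>Hom C Y Z.
        Fm X Z (Comp C X Y Z g f) = Comp D (Fo X) (Fo Y) (Fo Z) (Fm Y Z g) (Fm X Y f))"

definition naturally_isomorphic ::
  "('o,'m) cat \<Rightarrow> ('p,'n) cat \<Rightarrow> ('o \<Rightarrow> 'p) \<Rightarrow> ('o \<Rightarrow> 'o \<Rightarrow> 'm \<Rightarrow> 'n) \<Rightarrow>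
     ('o \<Rightarrow> 'p) \<Rightarrow> ('o \<Rightarrow> 'o \<Rightarrow> 'm \<Rightarrow> 'n) \<Rightarrow> bool" where
  "naturally_isomorphic C D Fo Fm Go Gm \<longleftrightarrow>
     (\<exists>\<eta>. (\<forall>X\<in>Ob C. iso_in D (Fo X) (Go X) (\<eta> X)) \<and>
        (\<forall>X\<in>Ob C. \<forall>Y\<in>Ob C. \<forall>f\<in>Hom C X Y.
           Comp D (Fo X) (Fo Y) (Go Y) (\<eta> Y) (Fm X Y f) =
           Comp D (Fo X) (Go X) (Go Y) (Gm X Y f) (\<eta> X)))"

definition equivalent_categories :: "('o,'m) cat \<Rightarrow> ('p,'n) cat \<Rightarrow> bool" where
  "equivalent_categories C D \<longleftrightarrow> category C \<and> category D \<and>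
     (\<exists>Fo Fm Go Gm. is_functor C D Fo Fm \<and> is_functor D C Go Gm \<and>
        naturally_isomorphic C C (Go \<circ> Fo) (\<lambda>X Y f. Gm (Fo X) (Fo Y) (Fm X Y f))
          (\<lambda>X. X) (\<lambda>X Y f. f) \<and>
        naturally_isomorphic D D (Fo \<circ> Go) (\<lambda>X Y f. Fm (Go X) (Go Y) (Gm X Y f))
          (\<lambda>X. X) (\<lambda>X Y f. f))"

definition is_pushout ::
  "('o,'m) cat \<Rightarrow> 'o \<Rightarrow> 'o \<Rightarrow> 'o \<Rightarrow> 'm \<Rightarrow> 'm \<Rightarrow> 'o \<Rightarrow> 'm \<Rightarrow> 'm \<Rightarrow> bool" where
  "is_pushout C R A B a b P u v \<longleftrightarrow>
     R \<in> Ob C \<and> A \<in> Ob C \<and> B \<in> Ob C \<and> P \<in> Ob C \<and>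
     a \<in> Hom C R A \<and> b \<in> Hom C R B \<and> u \<in> Hom C A P \<and> v \<in> Hom C B P \<and>
     Comp C R A P u a = Comp C R B P v b \<and>
     (\<forall>Z\<in>Ob C. \<forall>u'\<in>Hom C A Z. \<forall>v'\<in>Hom C B Z.
        Comp C R A Z u' a = Comp C R B Z v' b \<longrightarrow>
        (\<exists>!w. w \<in> Hom C P Z \<and> Comp C A P Z w u = u' \<and> Comp C B P Z w v = v'))"


section \<open>The Borisov--Manin category\<close>

record 'u bm_graph =
  bV :: "'u set"
  bF :: "'u set"
  bd :: "'u \<Rightarrow> 'u"
  bj :: "'u \<Rightarrow> 'u"

definition bm_graph :: "'u bm_graph \<Rightarrow> bool" where
  "bm_graph \<tau> \<longleftrightarrow> finite (bV \<tau>) \<and> finite (bF \<tau>) \<and>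
     bd \<tau> \<in> bF \<tau> \<rightarrow>\<^sub>E bV \<tau> \<and> bj \<tau> \<in> bF \<tau> \<rightarrow>\<^sub>E bF \<tau> \<and> (\<forall>f\<in>bF \<tau>. bj \<tau> (bj \<tau> f) = f)"

definition bm_edges :: "'u bm_graph \<Rightarrow> 'u set set" where
  "bm_edges \<tau> = {{f, bj \<tau> f} | f. f \<in> bF \<tau> \<and> bj \<tau> f \<noteq> f}"

record 'u bm_mor =
  hF :: "'u \<Rightarrow> 'u"
  hV :: "'u \<Rightarrow> 'u"
  hj :: "'u \<Rightarrow> 'u"

definition bm_hom :: "'u bm_graph \<Rightarrow> 'u bm_graph \<Rightarrow> 'u bm_mor set" where
  "bm_hom \<tau> \<sigma> = {h. let K = hF h ` bF \<sigma>; D = bF \<tau> - K in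
     hF h \<in> bF \<sigma> \<rightarrow>\<^sub>E bF \<tau> \<and> hV h \<in> bV \<tau> \<rightarrow>\<^sub>E bV \<sigma> \<and>
     hj h \<in> D \<rightarrow>\<^sub>E D \<and> (\<forall>f\<in>D. hj h (hj h f) = f) \<and>
     inj_on (hF h) (bF \<sigma>) \<and> hV h ` bV \<tau> = bV \<sigma> \<and>
     bj \<tau> ` K \<subseteq> K \<and> bj \<tau> ` D \<subseteq> D \<and>
     (\<forall>f\<in>D. hj h f \<noteq> f) \<and> (\<forall>f\<in>D. f \<in> \<Union> (bm_edges \<tau>) \<longrightarrow> hj h f = bj \<tau> f) \<and>
     (\<forall>f\<in>bF \<sigma>. hV h (bd \<tau> (hF h f)) = bd \<sigma> f) \<and>
     (\<forall>f\<in>D. hV h (bd \<tau> f) = hV h (bd \<tau> (hj h f))) \<and>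
     (\<forall>e\<in>bm_edges \<tau>. e \<subseteq> K \<longrightarrow> inv_into (bF \<sigma>) (hF h) ` e \<in> bm_edges \<sigma>)}"

definition bm_id :: "'u bm_graph \<Rightarrow> 'u bm_mor" where
  "bm_id \<tau> = \<lparr>hF = (\<lambda>f\<in>bF \<tau>. f), hV = (\<lambda>x\<in>bV \<tau>. x), hj = (\<lambda>_. undefined)\<rparr>"

definition bm_comp ::
  "'u bm_graph \<Rightarrow> 'u bm_graph \<Rightarrow> 'u bm_graph \<Rightarrow> 'u bm_mor \<Rightarrow> 'u bm_mor \<Rightarrow> 'u bm_mor" where
  "bm_comp \<tau> \<sigma> \<rho> c g =
     (let k = compose (bF \<rho>) (hF g) (hF c) in
     \<lparr>hF = k,
      hV = compose (bV \<tau>) (hV c) (hV g),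
      hj = (\<lambda>f\<in>bF \<tau> - k ` bF \<rho>.
              if f \<in> hF g ` bF \<sigma> then hF g (hj c (inv_into (bF \<sigma>) (hF g) f)) else hj g f)\<rparr>)"

definition BM :: "('u bm_graph, 'u bm_mor) cat" where
  "BM = \<lparr>Ob = {\<tau>. bm_graph \<tau>}, Hom = bm_hom, Ide = bm_id, Comp = bm_comp\<rparr>"


section \<open>JK graphs and etale morphisms\<close>

text \<open>The types of arcs, half-edges and vertices are independent, so that etale morphisms may
  relate graphs over different types.\<close>

record ('a,'h,'v) graph =
  Arcs :: "'a set"
  Halves :: "'h set"
  Verts :: "'v set"
  gs :: "'h \<Rightarrow> 'a"
  gp :: "'h \<Rightarrow> 'v"
  gi :: "'a \<Rightarrow> 'a"

definition jk_graph :: "('a,'h,'v) graph \<Rightarrow> bool" where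
  "jk_graph G \<longleftrightarrow> finite (Arcs G) \<and> finite (Halves G) \<and> finite (Verts G) \<and>
     gs G \<in> Halves G \<rightarrow>\<^sub>E Arcs G \<and> inj_on (gs G) (Halves G) \<and>
     gp G \<in> Halves G \<rightarrow>\<^sub>E Verts G \<and>
     gi G \<in> Arcs G \<rightarrow>\<^sub>E Arcs G \<and> (\<forall>a\<in>Arcs G. gi G (gi G a) = a \<and> gi G a \<noteq> a)"

definition ports :: "('a,'h,'v) graph \<Rightarrow> 'a set" where
  "ports G = Arcs G - gs G ` Halves G"

definition isolated_arcs :: "('a,'h,'v) graph \<Rightarrow> 'a set" where
  "isolated_arcs G = {a \<in> Arcs G. a \<in> ports G \<and> gi G a \<in> ports G}"

definition effective :: "('a,'h,'v) graph \<Rightarrow> bool" where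
  "effective G \<longleftrightarrow> (Arcs G \<noteq> {} \<or> Halves G \<noteq> {} \<or> Verts G \<noteq> {}) \<and> isolated_arcs G = {}"

definition flags_at :: "('a,'h,'v) graph \<Rightarrow> 'v \<Rightarrow> 'h set" where
  "flags_at G x = {f \<in> Halves G. gp G f = x}"

record ('a,'h,'v,'b,'k,'w) gmor =
  mA :: "'a \<Rightarrow> 'b"
  mH :: "'h \<Rightarrow> 'k"
  mV :: "'v \<Rightarrow> 'w"

text \<open>The last clause is the pullback condition: the canonical map from \<open>Halves G\<close> to the
  fibre product of \<open>Verts G\<close> and \<open>Halves K\<close> over \<open>Verts K\<close> is a bijection.\<close>

definition etale ::
  "('a,'h,'v) graph \<Rightarrow> ('b,'k,'w) graph \<Rightarrow> ('a,'h,'v,'b,'k,'w) gmor \<Rightarrow> bool" where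
  "etale G K f \<longleftrightarrow>
     mA f \<in> Arcs G \<rightarrow>\<^sub>E Arcs K \<and> mH f \<in> Halves G \<rightarrow>\<^sub>E Halves K \<and> mV f \<in> Verts G \<rightarrow>\<^sub>E Verts K \<and>
     (\<forall>a\<in>Arcs G. mA f (gi G a) = gi K (mA f a)) \<and>
     (\<forall>h\<in>Halves G. mA f (gs G h) = gs K (mH f h)) \<and>
     (\<forall>h\<in>Halves G. mV f (gp G h) = gp K (mH f h)) \<and>
     bij_betw (\<lambda>h. (gp G h, mH f h)) (Halves G)
       {(x, k). x \<in> Verts G \<and> k \<in> Halves K \<and> mV f x = gp K k}"

definition gid :: "('a,'h,'v) graph \<Rightarrow> ('a,'h,'v,'a,'h,'v) gmor" where
  "gid G = \<lparr>mA = (\<lambda>a\<in>Arcs G. a), mH = (\<lambda>h\<in>Halves G. h), mV = (\<lambda>x\<in>Verts G. x)\<rparr>"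

definition gcomp ::
  "('a,'h,'v) graph \<Rightarrow> ('b,'k,'w,'c,'l,'z) gmor \<Rightarrow> ('a,'h,'v,'b,'k,'w) gmor
    \<Rightarrow> ('a,'h,'v,'c,'l,'z) gmor" where
  "gcomp G g f = \<lparr>mA = compose (Arcs G) (mA g) (mA f), mH = compose (Halves G) (mH g) (mH f),
     mV = compose (Verts G) (mV g) (mV f)\<rparr>"

definition graph_iso ::
  "('a,'h,'v) graph \<Rightarrow> ('b,'k,'w) graph \<Rightarrow> ('a,'h,'v,'b,'k,'w) gmor \<Rightarrow> bool" where
  "graph_iso G K f \<longleftrightarrow> etale G K f \<and>
     (\<exists>g. etale K G g \<and> gcomp G g f = gid G \<and> gcomp K f g = gid K)"

definition reduced_cover ::
  "('a,'h,'v) graph \<Rightarrow> ('b,'k,'w) graph \<Rightarrow> ('a,'h,'v,'b,'k,'w) gmor \<Rightarrow> bool" where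
  "reduced_cover G K f \<longleftrightarrow> etale G K f \<and> bij_betw (mV f) (Verts G) (Verts K)"


section \<open>Elementary graphs and graphical species\<close>

text \<open>In the corolla of \<open>n\<close>, the arc \<open>FlagArc k\<close> is the image under \<open>gs\<close> of the half-edge \<open>k\<close>,
  and \<open>PortArc k\<close> is the opposite arc, i.e. the port \<open>k\<close>.\<close>

datatype 'u elarc = UnitArc bool | PortArc 'u | FlagArc 'u

datatype 'u elobj = Unit | Cor "'u set"

definition elObs :: "'u elobj set" where
  "elObs = {Unit} \<union> {Cor n | n. finite n}"

definition unit_graph :: "('u elarc, 'u, unit) graph" where
  "unit_graph = \<lparr>Arcs = range UnitArc, Halves = {}, Verts = {},
     gs = (\<lambda>_. undefined), gp = (\<lambda>_. undefined),
     gi = (\<lambda>a\<in>range UnitArc. case a of UnitArc b \<Rightarrow> UnitArc (\<not> b))\<rparr>"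

definition corolla :: "'u set \<Rightarrow> ('u elarc, 'u, unit) graph" where
  "corolla n = \<lparr>Arcs = PortArc ` n \<union> FlagArc ` n, Halves = n, Verts = {()},
     gs = (\<lambda>k\<in>n. FlagArc k), gp = (\<lambda>k\<in>n. ()),
     gi = (\<lambda>a\<in>PortArc ` n \<union> FlagArc ` n.
             case a of PortArc k \<Rightarrow> FlagArc k | FlagArc k \<Rightarrow> PortArc k)\<rparr>"

fun el_graph :: "'u elobj \<Rightarrow> ('u elarc, 'u, unit) graph" where
  "el_graph Unit = unit_graph"
| "el_graph (Cor n) = corolla n"

type_synonym ('u,'a,'h,'v) elmap = "('u elarc, 'u, unit, 'a, 'h, 'v) gmor"
type_synonym 'u elmor = "('u, 'u elarc, 'u, unit) elmap"

definition el_hom :: "'u elobj \<Rightarrow> 'u elobj \<Rightarrow> 'u elmor set" where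
  "el_hom X Y = {f. etale (el_graph X) (el_graph Y) f}"

text \<open>\<open>res F X Y f : val F Y \<rightarrow> val F X\<close> is restriction along \<open>f : X \<rightarrow> Y\<close>.\<close>

record ('u,'x) species =
  val :: "'u elobj \<Rightarrow> 'x set"
  res :: "'u elobj \<Rightarrow> 'u elobj \<Rightarrow> 'u elmor \<Rightarrow> 'x \<Rightarrow> 'x"

definition graphical_species :: "('u,'x) species \<Rightarrow> bool" where
  "graphical_species F \<longleftrightarrow>
     (\<forall>X\<in>elObs. \<forall>Y\<in>elObs. \<forall>f\<in>el_hom X Y. res F X Y f \<in> val F Y \<rightarrow> val F X) \<and>
     (\<forall>X\<in>elObs. \<forall>c\<in>val F X. res F X X (gid (el_graph X)) c = c) \<and>
     (\<forall>X\<in>elObs. \<forall>Y\<in>elObs. \<forall>Z\<in>elObs. \<forall>f\<in>el_hom X Y. \<forall>g\<in>el_hom Y Z. \<forall>c\<in>val F Z.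
        res F X Z (gcomp (el_graph X) g f) c = res F X Y f (res F Y Z g c))"

type_synonym ('u,'x,'y) nt = "'u elobj \<Rightarrow> 'x \<Rightarrow> 'y"

definition nt_hom :: "('u,'x) species \<Rightarrow> ('u,'y) species \<Rightarrow> ('u,'x,'y) nt set" where
  "nt_hom F G = {\<alpha> \<in> (\<Pi>\<^sub>E X\<in>elObs. val F X \<rightarrow>\<^sub>E val G X).
     \<forall>X\<in>elObs. \<forall>Y\<in>elObs. \<forall>f\<in>el_hom X Y. \<forall>c\<in>val F Y.
       \<alpha> X (res F X Y f c) = res G X Y f (\<alpha> Y c)}"

definition nt_comp ::
  "('u,'x) species \<Rightarrow> ('u,'y,'z) nt \<Rightarrow> ('u,'x,'y) nt \<Rightarrow> ('u,'x,'z) nt" where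
  "nt_comp F \<beta> \<alpha> = (\<lambda>X\<in>elObs. compose (val F X) (\<beta> X) (\<alpha> X))"

definition yon :: "('a,'h,'v) graph \<Rightarrow> ('u, ('u,'a,'h,'v) elmap) species" where
  "yon G = \<lparr>val = (\<lambda>X. {e. etale (el_graph X) G e}),
            res = (\<lambda>X Y f e. gcomp (el_graph X) e f)\<rparr>"

definition yon_map ::
  "('a,'h,'v) graph \<Rightarrow> ('a,'h,'v,'b,'k,'w) gmor
     \<Rightarrow> ('u, ('u,'a,'h,'v) elmap, ('u,'b,'k,'w) elmap) nt" where
  "yon_map G h = (\<lambda>X\<in>elObs. \<lambda>e\<in>val (yon G) X. gcomp (el_graph X) h e)"


section \<open>The functor underlying the monad\<close>

text \<open>A decorated \<open>n\<close>-graph \<open>(G, l, d)\<close>: the bijection \<open>l\<close> labels the ports of \<open>G\<close> by \<open>n\<close>,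
  and \<open>d\<close> is a decoration.\<close>

type_synonym 'u gr = "('u,'u,'u) graph"
type_synonym ('u,'x) decor = "('u, ('u,'u,'u,'u) elmap, 'x) nt"
type_synonym ('u,'x) dgraph = "'u gr \<times> ('u \<Rightarrow> 'u) \<times> ('u,'x) decor"

definition dgraphs :: "('u,'x) species \<Rightarrow> 'u set \<Rightarrow> ('u,'x) dgraph set" where
  "dgraphs F n = {(G, l, d). jk_graph G \<and> effective G \<and>
     l \<in> n \<rightarrow>\<^sub>E ports G \<and> bij_betw l n (ports G) \<and> d \<in> nt_hom (yon G) F}"

definition dgraph_iso :: "'u set \<Rightarrow> ('u,'x) dgraph \<Rightarrow> ('u,'x) dgraph \<Rightarrow> bool" where
  "dgraph_iso n = (\<lambda>(G, l, d) (G', l', d').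
     \<exists>f. graph_iso G G' f \<and> (\<forall>k\<in>n. mA f (l k) = l' k) \<and> d = nt_comp (yon G) d' (yon_map G f))"

datatype ('u,'x) barel = Colour (colour: 'x) | Cls (cls: "('u,'x) dgraph set")

definition bar_val :: "('u,'x) species \<Rightarrow> 'u elobj \<Rightarrow> ('u,'x) barel set" where
  "bar_val F X = (case X of
      Unit \<Rightarrow> Colour ` val F Unit
    | Cor n \<Rightarrow> Cls ` (dgraphs F n //
        {(S, T). S \<in> dgraphs F n \<and> T \<in> dgraphs F n \<and> dgraph_iso n S T}))"

text \<open>The arc of \<open>G\<close> named by an arc of the corolla, given the labelling \<open>l\<close> of the ports.\<close>

definition port_arc :: "('a,'h,'v) graph \<Rightarrow> ('u \<Rightarrow> 'a) \<Rightarrow> 'u elarc \<Rightarrow> 'a" where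
  "port_arc G l a = (case a of PortArc k \<Rightarrow> l k | FlagArc k \<Rightarrow> gi G (l k) | UnitArc _ \<Rightarrow> undefined)"

definition unit_map :: "(bool \<Rightarrow> 'a) \<Rightarrow> ('u,'a,'h,'v) elmap" where
  "unit_map c = \<lparr>mA = (\<lambda>a\<in>range UnitArc. case a of UnitArc b \<Rightarrow> c b),
     mH = (\<lambda>_. undefined), mV = (\<lambda>_. undefined)\<rparr>"

text \<open>There are no morphisms from a corolla to the unit graph. The restriction of a class
  along \<open>Unit \<rightarrow> Cor n\<close> is computed on all its members at once (the result is a singleton),
  and relabelling all members of an isomorphism class gives an isomorphism class.\<close>

definition bar_res ::
  "('u,'x) species \<Rightarrow> 'u elobj \<Rightarrow> 'u elobj \<Rightarrow> 'u elmor \<Rightarrow> ('u,'x) barel \<Rightarrow> ('u,'x) barel" where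
  "bar_res F X Y f b = (case Y of
      Unit \<Rightarrow> Colour (res F X Y f (colour b))
    | Cor n \<Rightarrow> (case X of
         Unit \<Rightarrow> Colour (the_elem
           ((\<lambda>(G, l, d). d Unit (unit_map (\<lambda>t. port_arc G l (mA f (UnitArc t))))) ` cls b))
       | Cor m \<Rightarrow> Cls ((\<lambda>(G, l, d). (G, compose m l (mH f), d)) ` cls b)))"

definition bar :: "('u,'x) species \<Rightarrow> ('u, ('u,'x) barel) species" where
  "bar F = \<lparr>val = bar_val F, res = bar_res F\<rparr>"

definition bar_map ::
  "('u,'x) species \<Rightarrow> ('u,'x,'y) nt \<Rightarrow> ('u, ('u,'x) barel, ('u,'y) barel) nt" where
  "bar_map F \<alpha> = (\<lambda>X\<in>elObs. \<lambda>b\<in>bar_val F X. case X of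
      Unit \<Rightarrow> Colour (\<alpha> Unit (colour b))
    | Cor n \<Rightarrow> Cls ((\<lambda>(G, l, d). (G, l, nt_comp (yon G) \<alpha> d)) ` cls b))"


section \<open>Gluing\<close>

definition star :: "('a,'u,'v) graph \<Rightarrow> 'v \<Rightarrow> ('u,'a,'u,'v) elmap" where
  "star R x = (let n = flags_at R x in
     \<lparr>mA = (\<lambda>a\<in>Arcs (corolla n). case a of FlagArc f \<Rightarrow> gs R f | PortArc f \<Rightarrow> gi R (gs R f)),
      mH = (\<lambda>f\<in>n. f), mV = (\<lambda>_\<in>{()}. x)\<rparr>)"

definition representatives ::
  "'u gr \<Rightarrow> ('u, ('u,'x) barel) decor \<Rightarrow> ('u \<Rightarrow> ('u,'x) dgraph) \<Rightarrow> bool" where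
  "representatives R \<phi> T \<longleftrightarrow>
     (\<forall>x\<in>Verts R. T x \<in> cls (\<phi> (Cor (flags_at R x)) (star R x)))"

abbreviation piece :: "('u \<Rightarrow> ('u,'x) dgraph) \<Rightarrow> 'u \<Rightarrow> 'u gr" where
  "piece T x \<equiv> fst (T x)"

abbreviation piece_dec :: "('u \<Rightarrow> ('u,'x) dgraph) \<Rightarrow> 'u \<Rightarrow> ('u,'x) decor" where
  "piece_dec T x \<equiv> snd (snd (T x))"

text \<open>The disjoint union, before identifications: \<open>Inl (x, a)\<close> is the arc \<open>a\<close> of the graph
  at the vertex \<open>x\<close>; an isolated edge of \<open>R\<close>, with its two arcs \<open>Inr a\<close>, serves as its own copy
  of the unit graph. \<open>port_of R T f\<close> is the arc written \<open>q(f)\<close>.\<close>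

type_synonym 'u prearc = "'u \<times> 'u + 'u"

definition pre_arcs :: "'u gr \<Rightarrow> ('u \<Rightarrow> ('u,'x) dgraph) \<Rightarrow> 'u prearc set" where
  "pre_arcs R T = Inl ` (SIGMA x:Verts R. Arcs (piece T x)) \<union> Inr ` isolated_arcs R"

definition pre_flip :: "'u gr \<Rightarrow> ('u \<Rightarrow> ('u,'x) dgraph) \<Rightarrow> 'u prearc \<Rightarrow> 'u prearc" where
  "pre_flip R T c = (case c of Inl (x, a) \<Rightarrow> Inl (x, gi (piece T x) a) | Inr a \<Rightarrow> Inr (gi R a))"

definition port_of :: "'u gr \<Rightarrow> ('u \<Rightarrow> ('u,'x) dgraph) \<Rightarrow> 'u \<Rightarrow> 'u prearc" where
  "port_of R T f = Inl (gp R f, fst (snd (T (gp R f))) f)"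

definition pre_rel :: "'u gr \<Rightarrow> ('u \<Rightarrow> ('u,'x) dgraph) \<Rightarrow> 'u prearc rel" where
  "pre_rel R T =
     {(port_of R T f, pre_flip R T (port_of R T f')) | f f'.
        f \<in> Halves R \<and> f' \<in> Halves R \<and> gi R (gs R f) = gs R f'} \<union>
     {(pre_flip R T (port_of R T f), port_of R T f') | f f'.
        f \<in> Halves R \<and> f' \<in> Halves R \<and> gi R (gs R f) = gs R f'}"

definition glue_rel :: "'u gr \<Rightarrow> ('u \<Rightarrow> ('u,'x) dgraph) \<Rightarrow> 'u prearc rel" where
  "glue_rel R T = {(c, c'). c \<in> pre_arcs R T \<and> c' \<in> pre_arcs R T \<and>
     (c, c') \<in> (pre_rel R T \<union> (pre_rel R T)\<inverse>)\<^sup>*}"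

abbreviation glue_class :: "'u gr \<Rightarrow> ('u \<Rightarrow> ('u,'x) dgraph) \<Rightarrow> 'u prearc \<Rightarrow> 'u prearc set" where
  "glue_class R T c \<equiv> glue_rel R T `` {c}"

definition glue ::
  "'u gr \<Rightarrow> ('u \<Rightarrow> ('u,'x) dgraph) \<Rightarrow> ('u prearc set, 'u \<times> 'u, 'u \<times> 'u) graph" where
  "glue R T =
     (let As = pre_arcs R T // glue_rel R T;
          Hs = (SIGMA x:Verts R. Halves (piece T x));
          Vs = (SIGMA x:Verts R. Verts (piece T x)) in
     \<lparr>Arcs = As, Halves = Hs, Verts = Vs,
      gs = (\<lambda>(x, h)\<in>Hs. glue_class R T (Inl (x, gs (piece T x) h))),
      gp = (\<lambda>(x, h)\<in>Hs. (x, gp (piece T x) h)),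
      gi = (\<lambda>c\<in>As. pre_flip R T ` c)\<rparr>)"

definition glue_in ::
  "'u gr \<Rightarrow> ('u \<Rightarrow> ('u,'x) dgraph) \<Rightarrow> 'u
     \<Rightarrow> ('u, 'u, 'u, 'u prearc set, 'u \<times> 'u, 'u \<times> 'u) gmor" where
  "glue_in R T x =
     \<lparr>mA = (\<lambda>a\<in>Arcs (piece T x). glue_class R T (Inl (x, a))),
      mH = (\<lambda>h\<in>Halves (piece T x). (x, h)),
      mV = (\<lambda>y\<in>Verts (piece T x). (x, y))\<rparr>"

text \<open>The arc of the glued graph corresponding to the port \<open>a\<close> of \<open>R\<close>.\<close>

definition glue_port :: "'u gr \<Rightarrow> ('u \<Rightarrow> ('u,'x) dgraph) \<Rightarrow> 'u \<Rightarrow> 'u prearc set" where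
  "glue_port R T a =
     (if a \<in> isolated_arcs R then glue_class R T (Inr a)
      else glue_class R T (port_of R T (THE f. f \<in> Halves R \<and> a = gi R (gs R f))))"

text \<open>
  \<open>is_gluing F R \<phi> S \<pi> d\<close>: up to isomorphism, \<open>S\<close> is the graph glued from \<open>\<phi>\<close>, with induced
  bijection \<open>\<pi>\<close> from the ports of \<open>R\<close> to those of \<open>S\<close> and induced decoration \<open>d\<close>. The last two
  conditions say that \<open>d\<close> restricts to the decorations of the pieces (the graphs at the vertices,
  and the copies of the unit graph); this determines \<open>d\<close>.
\<close>

definition is_gluing ::
  "('u,'x) species \<Rightarrow> 'u gr \<Rightarrow> ('u, ('u,'x) barel) decor \<Rightarrow>
     'u gr \<Rightarrow> ('u \<Rightarrow> 'u) \<Rightarrow> ('u,'x) decor \<Rightarrow> bool" where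
  "is_gluing F R \<phi> S \<pi> d \<longleftrightarrow> jk_graph S \<and> d \<in> nt_hom (yon S) F \<and>
     (\<exists>T g. representatives R \<phi> T \<and> graph_iso (glue R T) S g \<and>
        \<pi> = (\<lambda>a\<in>ports R. mA g (glue_port R T a)) \<and>
        (\<forall>x\<in>Verts R. \<forall>X\<in>elObs. \<forall>e\<in>val (yon (piece T x)) X.
           d X (gcomp (el_graph X) g (gcomp (el_graph X) (glue_in R T x) e)) = piece_dec T x X e) \<and>
        (\<forall>e\<in>val (yon R) Unit. mA e ` range UnitArc \<subseteq> isolated_arcs R \<longrightarrow>
           Colour (d Unit (unit_map (\<lambda>t. mA g (glue_class R T (Inr (mA e (UnitArc t)))))))
             = \<phi> Unit e))"


section \<open>Unit and multiplication, Kleisli composition\<close>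

definition mult ::
  "('u,'x) species \<Rightarrow> ('u, ('u, ('u,'x) barel) barel, ('u,'x) barel) nt" where
  "mult F = (\<lambda>X\<in>elObs. \<lambda>b\<in>bar_val (bar F) X. case X of
      Unit \<Rightarrow> colour b
    | Cor n \<Rightarrow> Cls {(S, l', d) \<in> dgraphs F n.
        \<exists>(R, l, \<phi>)\<in>cls b. \<exists>\<pi>. is_gluing F R \<phi> S \<pi> d \<and> l' = compose n \<pi> l})"

text \<open>By the Yoneda lemma the element \<open>c\<close> of \<open>F\<close> at the corolla is an \<open>F\<close>-decoration of the
  corolla; \<open>f\<close> below is an isomorphism from the corolla, under which \<open>d\<close> corresponds to \<open>c\<close>.\<close>

definition unit_nt :: "('u,'x) species \<Rightarrow> ('u, 'x, ('u,'x) barel) nt" where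
  "unit_nt F = (\<lambda>X\<in>elObs. \<lambda>c\<in>val F X. case X of
      Unit \<Rightarrow> Colour c
    | Cor n \<Rightarrow> Cls {(G, l, d) \<in> dgraphs F n.
        \<exists>f. graph_iso (corolla n) G f \<and> (\<forall>k\<in>n. l k = mA f (PortArc k)) \<and> d (Cor n) f = c})"

type_synonym 'u kl = "('u, ('u, ('u,'u,'u,'u) elmap) barel) decor"

definition GrT :: "('u gr, 'u kl) cat" where
  "GrT = \<lparr>Ob = {G. jk_graph G \<and> isolated_arcs G = {}},
     Hom = (\<lambda>R Y. nt_hom (yon R) (bar (yon Y))),
     Ide = (\<lambda>R. unit_nt (yon R)),
     Comp = (\<lambda>R Y Z g f.
       nt_comp (yon R) (mult (yon Z)) (nt_comp (yon R) (bar_map (yon Y) g) f))\<rparr>"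

definition kl_of_etale :: "'u gr \<Rightarrow> 'u gr \<Rightarrow> ('u,'u,'u,'u,'u,'u) gmor \<Rightarrow> 'u kl" where
  "kl_of_etale R Y f = nt_comp (yon R) (unit_nt (yon Y)) (yon_map R f)"

definition generic :: "'u gr \<Rightarrow> 'u gr \<Rightarrow> 'u kl \<Rightarrow> bool" where
  "generic R Y \<phi> \<longleftrightarrow> \<phi> \<in> Hom GrT R Y \<and>
     (\<exists>S \<pi> h. is_gluing (yon Y) R \<phi> S \<pi> (yon_map S h) \<and> graph_iso S Y h)"


section \<open>The category of cospans\<close>

type_synonym 'u cospan = "'u kl \<times> 'u gr \<times> 'u kl"

definition cospans :: "'u gr \<Rightarrow> 'u gr \<Rightarrow> 'u cospan set" where
  "cospans T R = {(a, S, b). S \<in> Ob GrT \<and>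
     (\<exists>f. reduced_cover T S f \<and> a = kl_of_etale T S f) \<and> generic R S b}"

definition cospan_iso :: "'u gr \<Rightarrow> 'u gr \<Rightarrow> 'u cospan \<Rightarrow> 'u cospan \<Rightarrow> bool" where
  "cospan_iso T R = (\<lambda>(a, S, b) (a', S', b').
     \<exists>\<theta>. iso_in GrT S S' \<theta> \<and> Comp GrT T S S' \<theta> a = a' \<and> Comp GrT R S S' \<theta> b = b')"

definition cospan_class :: "'u gr \<Rightarrow> 'u gr \<Rightarrow> 'u cospan \<Rightarrow> 'u cospan set" where
  "cospan_class T R c = {c' \<in> cospans T R. cospan_iso T R c c'}"

text \<open>The composite of two classes consists of all cospans obtained from some members of them
  and some pushout.\<close>

definition Cosp :: "('u gr, 'u cospan set) cat" where
  "Cosp = \<lparr>Ob = Ob GrT,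
     Hom = (\<lambda>T R. cospan_class T R ` cospans T R),
     Ide = (\<lambda>T. cospan_class T T (Ide GrT T, T, Ide GrT T)),
     Comp = (\<lambda>T R Q d c.
       {(Comp GrT T S P u a, P, Comp GrT Q S' P v b') | a S b a' S' b' P u v.
          (a, S, b) \<in> c \<and> (a', S', b') \<in> d \<and> is_pushout GrT R S S' b a' P u v})\<rparr>"

end

theory Submission
  imports Defs
begin

text \<open>
  A graph without isolated edges is the same thing as a Borisov--Manin graph: \<open>H\<close> and \<open>V\<close> with the
  projection \<open>p\<close>, and the involution of \<open>H\<close> that exchanges the two half-edges of an inner edge and
  fixes the half-edges at the ports. In these terms a reduced cover \<open>f : T \<rightarrow> S\<close> is bijective on
  half-edges and vertices, and \<open>S\<close> arises from \<open>T\<close> by joining pairs of tails. A generic morphism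
  \<open>R \<rightarrow> S\<close> amounts to a surjection \<open>r : V(S) \<rightarrow> V(R)\<close> and an injection \<open>k : H(R) \<rightarrow> H(S)\<close> that commute
  with the structure maps and whose omitted half-edges lie on inner edges inside the fibres of \<open>r\<close>.
  So a cospan \<open>T \<rightarrow> S \<leftarrow> R\<close> is the Borisov--Manin morphism with \<open>h\<^sup>F = f\<^sup>-\<^sup>1 k\<close>, \<open>h\<^sub>V = r f\<close> and \<open>j\<^sub>h\<close> the
  involution of \<open>S\<close> on the omitted half-edges; conversely \<open>S\<close> is recovered from \<open>T\<close> by joining the
  tails as prescribed by \<open>j\<^sub>h\<close> and by the involution of \<open>R\<close>. The pushout of \<open>b : R \<rightarrow> S\<close> along
  a reduced cover \<open>R \<rightarrow> S'\<close> joins, in \<open>S\<close>, the images of the tails of \<open>R\<close> that become inner in \<open>S'\<close>,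
  which matches the composition of the involutions.
\<close>

section \<open>Graphs without isolated edges\<close>

text \<open>\<open>Cosp\<close> composes classes through every pushout of every pair of members, so
  pushouts must be controlled up to isomorphism in \<open>GrT\<close>, and such isomorphisms must be
  shown to come from graph isomorphisms. Associativity of Kleisli composition is established for
  triples with at least one etale factor. This suffices because reduced covers are epimorphisms: an
  equation between Kleisli morphisms may be tested after precomposition with one. The category laws
  of \<open>Cosp\<close> are pulled back from \<open>BM\<close>, since the assignment of a
  Borisov--Manin morphism to a class is bijective on hom-sets and compatible with composites. What
  makes the calculations manageable is that arcs and their quotients are eliminated early: without
  isolated edges, etale maps, isomorphisms, port labellings and gluings are all determined on
  half-edges and vertices. The infinite type provides room: gluing produces graphs on pairs and on
  sets of pairs, and these finite graphs have to be copied back to \<open>'u\<close>.\<close>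

definition full :: "('a,'h,'v) graph \<Rightarrow> bool" where
  "full G \<longleftrightarrow> jk_graph G \<and> isolated_arcs G = {}"

definition hinv :: "('a,'h,'v) graph \<Rightarrow> 'h \<Rightarrow> 'h" where
  "hinv G = (\<lambda>h\<in>Halves G. if gi G (gs G h) \<in> gs G ` Halves G
      then inv_into (Halves G) (gs G) (gi G (gs G h)) else h)"

lemma full_jk [simp]: "full G \<Longrightarrow> jk_graph G"
  by (simp add: full_def)

lemma jk_finite: "jk_graph G \<Longrightarrow> finite (Halves G)" "jk_graph G \<Longrightarrow> finite (Verts G)"
  "jk_graph G \<Longrightarrow> finite (Arcs G)"
  by (auto simp: jk_graph_def)

lemma jk_gs [simp]: "jk_graph G \<Longrightarrow> h \<in> Halves G \<Longrightarrow> gs G h \<in> Arcs G"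
  by (auto simp: jk_graph_def)

lemma jk_gp [simp]: "jk_graph G \<Longrightarrow> h \<in> Halves G \<Longrightarrow> gp G h \<in> Verts G"
  by (auto simp: jk_graph_def)

lemma jk_gi [simp]: "jk_graph G \<Longrightarrow> a \<in> Arcs G \<Longrightarrow> gi G a \<in> Arcs G"
  by (auto simp: jk_graph_def)

lemma jk_gi_gi [simp]: "jk_graph G \<Longrightarrow> a \<in> Arcs G \<Longrightarrow> gi G (gi G a) = a"
  by (auto simp: jk_graph_def)

lemma jk_gi_neq [simp]: "jk_graph G \<Longrightarrow> a \<in> Arcs G \<Longrightarrow> gi G a \<noteq> a"
  by (auto simp: jk_graph_def)

lemma jk_gs_eq [simp]:
  "jk_graph G \<Longrightarrow> h \<in> Halves G \<Longrightarrow> h' \<in> Halves G \<Longrightarrow> gs G h = gs G h' \<longleftrightarrow> h = h'"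
  by (metis jk_graph_def inj_on_eq_iff)

lemma jk_gi_eq [simp]:
  "jk_graph G \<Longrightarrow> a \<in> Arcs G \<Longrightarrow> b \<in> Arcs G \<Longrightarrow> gi G a = gi G b \<longleftrightarrow> a = b"
  by (metis jk_gi_gi)

lemma jk_inj: "jk_graph G \<Longrightarrow> inj_on (gs G) (Halves G)"
  by (simp add: inj_on_def)

lemma hinv_eqI:
  assumes "jk_graph G" "h \<in> Halves G" "h' \<in> Halves G" "gi G (gs G h) = gs G h'"
  shows "hinv G h = h'"
proof -
  have "inj_on (gs G) (Halves G)" using assms(1) by (rule jk_inj)
  then show ?thesis using assms by (auto simp: hinv_def)
qed

lemma hinv_cases:
  assumes "jk_graph G" "h \<in> Halves G"
  obtains (inner) "hinv G h \<noteq> h" "hinv G h \<in> Halves G" "gi G (gs G h) = gs G (hinv G h)"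
    | (tail) "hinv G h = h" "gi G (gs G h) \<notin> gs G ` Halves G"
proof (cases "gi G (gs G h) \<in> gs G ` Halves G")
  case True
  then obtain h' where h': "h' \<in> Halves G" "gi G (gs G h) = gs G h'" by auto
  then have "hinv G h = h'" by (intro hinv_eqI assms)
  moreover have "h' \<noteq> h" using assms h' jk_gi_neq[OF assms(1) jk_gs[OF assms]] by auto
  ultimately show ?thesis using h' inner by blast
next
  case False
  then show ?thesis using assms tail by (auto simp: hinv_def)
qed

lemma hinv_in [simp]: "jk_graph G \<Longrightarrow> h \<in> Halves G \<Longrightarrow> hinv G h \<in> Halves G"
  by (erule (1) hinv_cases) auto

lemma gi_gs: "jk_graph G \<Longrightarrow> h \<in> Halves G \<Longrightarrow> hinv G h \<noteq> h \<Longrightarrow> gi G (gs G h) = gs G (hinv G h)"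
  by (erule (1) hinv_cases) auto

lemma hinv_hinv [simp]:
  assumes "jk_graph G" "h \<in> Halves G" shows "hinv G (hinv G h) = h"
  using assms
proof (cases rule: hinv_cases)
  case inner
  then show ?thesis using assms by (intro hinv_eqI) (auto dest: sym)
qed simp

lemma hinv_funcset: "jk_graph G \<Longrightarrow> hinv G \<in> Halves G \<rightarrow>\<^sub>E Halves G"
  using hinv_in[of G] by (auto simp: hinv_def)

lemma tail_port: "jk_graph G \<Longrightarrow> h \<in> Halves G \<Longrightarrow> hinv G h = h \<Longrightarrow> gi G (gs G h) \<in> ports G"
  by (frule (1) hinv_cases) (auto simp: ports_def)

text \<open>An arc outside the image of \<open>gs\<close> is a port; as its edge is not isolated,
  the flipped arc is attached to some half-edge, which is then a tail. This case split is what
  reduces statements about arcs to half-edges.\<close>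

lemma full_arc_cases:
  assumes "full G" "a \<in> Arcs G"
  obtains (half) h where "h \<in> Halves G" "a = gs G h"
    | (port) h where "h \<in> Halves G" "hinv G h = h" "a = gi G (gs G h)"
proof (cases "a \<in> gs G ` Halves G")
  case True
  then show ?thesis using half by auto
next
  case False
  then have "a \<in> ports G" using assms by (auto simp: ports_def)
  then have "gi G a \<notin> ports G" using assms unfolding full_def isolated_arcs_def by blast
  then obtain h where h: "h \<in> Halves G" "gi G a = gs G h" using assms by (auto simp: ports_def)
  then have a: "a = gi G (gs G h)" using assms by (metis full_jk jk_gi_gi)
  then have "hinv G h = h" using False h assms by (metis full_jk hinv_cases image_eqI)
  then show ?thesis using port h a by blast
qed

lemma full_ports: "full G \<Longrightarrow> ports G = (\<lambda>h. gi G (gs G h)) ` {h \<in> Halves G. hinv G h = h}"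
proof (intro set_eqI iffI)
  fix a assume G: "full G" and a: "a \<in> ports G"
  then have "a \<in> Arcs G" "a \<notin> gs G ` Halves G" by (auto simp: ports_def)
  with G show "a \<in> (\<lambda>h. gi G (gs G h)) ` {h \<in> Halves G. hinv G h = h}"
    by (cases rule: full_arc_cases) auto
qed (auto intro: tail_port)

lemma fullI:
  assumes "jk_graph G" and "\<And>a. a \<in> Arcs G \<Longrightarrow> a \<in> gs G ` Halves G \<or> gi G a \<in> gs G ` Halves G"
  shows "full G"
  using assms unfolding full_def isolated_arcs_def ports_def by blast

section \<open>Etale morphisms\<close>

lemma etale_mA [simp]: "etale G K f \<Longrightarrow> a \<in> Arcs G \<Longrightarrow> mA f a \<in> Arcs K"
  by (auto simp: etale_def)
lemma etale_mH [simp]: "etale G K f \<Longrightarrow> h \<in> Halves G \<Longrightarrow> mH f h \<in> Halves K"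
  by (auto simp: etale_def)
lemma etale_mV [simp]: "etale G K f \<Longrightarrow> x \<in> Verts G \<Longrightarrow> mV f x \<in> Verts K"
  by (auto simp: etale_def)
lemma etale_gi: "etale G K f \<Longrightarrow> a \<in> Arcs G \<Longrightarrow> mA f (gi G a) = gi K (mA f a)"
  by (auto simp: etale_def)
lemma etale_gs: "etale G K f \<Longrightarrow> h \<in> Halves G \<Longrightarrow> mA f (gs G h) = gs K (mH f h)"
  by (auto simp: etale_def)
lemma etale_gp: "etale G K f \<Longrightarrow> h \<in> Halves G \<Longrightarrow> mV f (gp G h) = gp K (mH f h)"
  by (auto simp: etale_def)
lemma etale_ext: "etale G K f \<Longrightarrow> mA f \<in> Arcs G \<rightarrow>\<^sub>E Arcs K"
    "etale G K f \<Longrightarrow> mH f \<in> Halves G \<rightarrow>\<^sub>E Halves K"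
    "etale G K f \<Longrightarrow> mV f \<in> Verts G \<rightarrow>\<^sub>E Verts K"
  by (auto simp: etale_def)

lemma flags_at_iff: "h \<in> flags_at G x \<longleftrightarrow> h \<in> Halves G \<and> gp G h = x"
  by (auto simp: flags_at_def)

text \<open>The fibre of the pullback square over a single vertex; the etale condition is mostly
  used in this local form.\<close>

lemma etale_star:
  assumes "etale G K f" "x \<in> Verts G"
  shows "bij_betw (mH f) (flags_at G x) (flags_at K (mV f x))"
proof -
  have b: "bij_betw (\<lambda>h. (gp G h, mH f h)) (Halves G)
       {(x, k). x \<in> Verts G \<and> k \<in> Halves K \<and> mV f x = gp K k}"
    using assms(1) by (simp add: etale_def)
  show ?thesis
  proof (rule bij_betwI')
    fix h h' assume "h \<in> flags_at G x" "h' \<in> flags_at G x"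
    then show "mH f h = mH f h' \<longleftrightarrow> h = h'"
      using b by (auto simp: flags_at_iff bij_betw_def inj_on_def)
  next
    fix h assume "h \<in> flags_at G x"
    then show "mH f h \<in> flags_at K (mV f x)"
      using assms etale_gp[OF assms(1)] by (auto simp: flags_at_iff)
  next
    fix k assume "k \<in> flags_at K (mV f x)"
    then have "(x, k) \<in> (\<lambda>h. (gp G h, mH f h)) ` Halves G"
      using b assms by (auto simp: flags_at_iff bij_betw_def)
    then show "\<exists>h\<in>flags_at G x. k = mH f h" by (auto simp: flags_at_iff)
  qed
qed

text \<open>The local bijections recombine to the pullback condition because a half-edge is
  recovered from its vertex together with its image.\<close>

lemma etaleI:
  assumes "jk_graph G"
    and "mA f \<in> Arcs G \<rightarrow>\<^sub>E Arcs K" "mH f \<in> Halves G \<rightarrow>\<^sub>E Halves K" "mV f \<in> Verts G \<rightarrow>\<^sub>E Verts K"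
    and "\<And>a. a \<in> Arcs G \<Longrightarrow> mA f (gi G a) = gi K (mA f a)"
    and "\<And>h. h \<in> Halves G \<Longrightarrow> mA f (gs G h) = gs K (mH f h)"
    and p: "\<And>h. h \<in> Halves G \<Longrightarrow> mV f (gp G h) = gp K (mH f h)"
    and b: "\<And>x. x \<in> Verts G \<Longrightarrow> bij_betw (mH f) (flags_at G x) (flags_at K (mV f x))"
  shows "etale G K f"
proof -
  have "bij_betw (\<lambda>h. (gp G h, mH f h)) (Halves G)
       {(x, k). x \<in> Verts G \<and> k \<in> Halves K \<and> mV f x = gp K k}"
  proof (rule bij_betwI')
    fix h h' assume "h \<in> Halves G" "h' \<in> Halves G"
    then show "((gp G h, mH f h) = (gp G h', mH f h')) \<longleftrightarrow> h = h'"
      using b[of "gp G h"] assms(1) by (auto simp: flags_at_iff bij_betw_def inj_on_def)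
  next
    fix h assume "h \<in> Halves G"
    then show "(gp G h, mH f h) \<in> {(x, k). x \<in> Verts G \<and> k \<in> Halves K \<and> mV f x = gp K k}"
      using assms(1,3) p by auto
  next
    fix y assume "y \<in> {(x, k). x \<in> Verts G \<and> k \<in> Halves K \<and> mV f x = gp K k}"
    then obtain x k where y: "y = (x, k)" "x \<in> Verts G" "k \<in> flags_at K (mV f x)"
      by (auto simp: flags_at_iff)
    then have "k \<in> mH f ` flags_at G x" using b[of x] by (auto simp: bij_betw_def)
    then show "\<exists>h\<in>Halves G. y = (gp G h, mH f h)" using y by (auto simp: flags_at_iff)
  qed
  then show ?thesis using assms by (simp add: etale_def)
qed

lemma gmor_eqI:
  assumes "mA f \<in> extensional A" "mA g \<in> extensional A" "\<And>a. a \<in> A \<Longrightarrow> mA f a = mA g a"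
    and "mH f \<in> extensional H" "mH g \<in> extensional H" "\<And>a. a \<in> H \<Longrightarrow> mH f a = mH g a"
    and "mV f \<in> extensional V" "mV g \<in> extensional V" "\<And>a. a \<in> V \<Longrightarrow> mV f a = mV g a"
  shows "(f :: ('a,'h,'v,'b,'k,'w) gmor) = g"
proof -
  have "mA f = mA g" "mH f = mH g" "mV f = mV g"
    by (auto intro: extensionalityI[OF assms(1,2)] extensionalityI[OF assms(4,5)]
      extensionalityI[OF assms(7,8)] assms)
  then show ?thesis by (cases f, cases g) simp
qed

lemma etale_eqI:
  assumes "etale G K f" "etale G K' g"
    and "\<And>a. a \<in> Arcs G \<Longrightarrow> mA f a = mA g a"
    and "\<And>a. a \<in> Halves G \<Longrightarrow> mH f a = mH g a"
    and "\<And>a. a \<in> Verts G \<Longrightarrow> mV f a = mV g a"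
  shows "f = g"
  by (rule gmor_eqI[where A = "Arcs G" and H = "Halves G" and V = "Verts G"])
    (use assms etale_ext[OF assms(1)] etale_ext[OF assms(2)] in \<open>auto simp: PiE_def\<close>)

lemma gcomp_simps [simp]:
  "a \<in> Arcs G \<Longrightarrow> mA (gcomp G g f) a = mA g (mA f a)"
  "h \<in> Halves G \<Longrightarrow> mH (gcomp G g f) h = mH g (mH f h)"
  "x \<in> Verts G \<Longrightarrow> mV (gcomp G g f) x = mV g (mV f x)"
  by (auto simp: gcomp_def compose_def)

lemma gid_simps [simp]:
  "a \<in> Arcs G \<Longrightarrow> mA (gid G) a = a"
  "h \<in> Halves G \<Longrightarrow> mH (gid G) h = h"
  "x \<in> Verts G \<Longrightarrow> mV (gid G) x = x"
  by (auto simp: gid_def)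

lemma etale_gid [simp]: "jk_graph G \<Longrightarrow> etale G G (gid G)"
  by (rule etaleI) (auto simp: gid_def bij_betw_def inj_on_def flags_at_iff)

lemma etale_gcomp [simp]:
  assumes "jk_graph G" "etale G K f" "etale K L g"
  shows "etale G L (gcomp G g f)"
proof (rule etaleI)
  fix x assume x: "x \<in> Verts G"
  have "bij_betw (mH g \<circ> mH f) (flags_at G x) (flags_at L (mV g (mV f x)))"
    using etale_star[OF assms(2) x] etale_star[OF assms(3)] etale_mV[OF assms(2) x]
    by (metis bij_betw_trans)
  then show "bij_betw (mH (gcomp G g f)) (flags_at G x) (flags_at L (mV (gcomp G g f) x))"
    using x by (subst bij_betw_cong[where g = "mH g \<circ> mH f"]) (auto simp: flags_at_iff)
next
  show "mA (gcomp G g f) \<in> Arcs G \<rightarrow>\<^sub>E Arcs L" "mH (gcomp G g f) \<in> Halves G \<rightarrow>\<^sub>E Halves L"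
    "mV (gcomp G g f) \<in> Verts G \<rightarrow>\<^sub>E Verts L"
    using assms by (auto simp: gcomp_def compose_def)
qed (use assms in \<open>auto simp: etale_gi[OF assms(2)] etale_gi[OF assms(3)] etale_gs[OF assms(2)]
   etale_gs[OF assms(3)] etale_gp[OF assms(2)] etale_gp[OF assms(3)]\<close>)

lemma gcomp_assoc:
  assumes "etale G K f"
  shows "gcomp G (gcomp K h g) f = gcomp G h (gcomp G g f)"
  by (rule gmor_eqI[where A = "Arcs G" and H = "Halves G" and V = "Verts G"])
    (use assms in \<open>auto simp: gcomp_def compose_def\<close>)

lemma gcomp_gid_left [simp]:
  assumes "etale G K f" shows "gcomp G (gid K) f = f"
  by (rule gmor_eqI[where A = "Arcs G" and H = "Halves G" and V = "Verts G"])
    (use assms etale_ext[OF assms] in \<open>auto simp: gcomp_def compose_def gid_def PiE_def\<close>)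

lemma gcomp_gid_right [simp]:
  assumes "etale G K f" shows "gcomp G f (gid G) = f"
  by (rule gmor_eqI[where A = "Arcs G" and H = "Halves G" and V = "Verts G"])
    (use assms etale_ext[OF assms] in \<open>auto simp: gcomp_def compose_def gid_def PiE_def\<close>)

text \<open>An edge maps to an edge because \<open>mA f\<close> commutes with \<open>gi\<close> and
  \<open>gs\<close>. A tail may well be joined to another half-edge by an etale map, which is what
  reduced covers do; hence the hypothesis \<open>hinv G h \<noteq> h\<close>.\<close>

lemma etale_hinv:
  assumes "etale G K f" "jk_graph G" "jk_graph K" "h \<in> Halves G" "hinv G h \<noteq> h"
  shows "hinv K (mH f h) = mH f (hinv G h)" "mH f (hinv G h) \<noteq> mH f h"
    "gi K (gs K (mH f h)) = gs K (mH f (hinv G h))"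
proof -
  have "gi K (gs K (mH f h)) = mA f (gi G (gs G h))"
    using assms by (simp add: etale_gs[OF assms(1)] etale_gi[OF assms(1)])
  also have "\<dots> = gs K (mH f (hinv G h))"
    using assms by (simp add: gi_gs etale_gs[OF assms(1)])
  finally show *: "gi K (gs K (mH f h)) = gs K (mH f (hinv G h))" .
  then show "hinv K (mH f h) = mH f (hinv G h)"
    using assms by (intro hinv_eqI) auto
  show "mH f (hinv G h) \<noteq> mH f h" using * assms by (metis etale_mH jk_gi_neq jk_gs)
qed

lemma etale_arc_tail:
  assumes "etale G K f" "jk_graph G" "h \<in> Halves G"
  shows "mA f (gi G (gs G h)) = gi K (gs K (mH f h))"
  using assms by (simp add: etale_gs[OF assms(1)] etale_gi[OF assms(1)])

lemma etale_eq_fullI: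
  assumes "full G" "etale G K f" "etale G K g"
    and h: "\<And>a. a \<in> Halves G \<Longrightarrow> mH f a = mH g a"
    and "\<And>a. a \<in> Verts G \<Longrightarrow> mV f a = mV g a"
  shows "f = g"
proof (rule etale_eqI[OF assms(2,3)])
  fix a assume "a \<in> Arcs G"
  with assms(1) show "mA f a = mA g a"
    by (cases rule: full_arc_cases)
      (auto simp: etale_gs[OF assms(2)] etale_gs[OF assms(3)] h assms(1)
        etale_arc_tail[OF assms(2)] etale_arc_tail[OF assms(3)])
qed (use assms in auto)

text \<open>An etale morphism out of a graph without isolated edges is determined by its effect on
  half-edges and vertices.\<close>

definition hv_mor :: "('a,'h,'v) graph \<Rightarrow> ('b,'k,'w) graph \<Rightarrow> ('h \<Rightarrow> 'k) \<Rightarrow> ('v \<Rightarrow> 'w)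
    \<Rightarrow> ('a,'h,'v,'b,'k,'w) gmor" where
  "hv_mor G K \<eta> \<nu> = \<lparr>
     mA = (\<lambda>a\<in>Arcs G. if a \<in> gs G ` Halves G then gs K (\<eta> (inv_into (Halves G) (gs G) a))
            else gi K (gs K (\<eta> (inv_into (Halves G) (gs G) (gi G a))))),
     mH = (\<lambda>h\<in>Halves G. \<eta> h), mV = (\<lambda>x\<in>Verts G. \<nu> x)\<rparr>"

lemma hv_mor_H [simp]: "h \<in> Halves G \<Longrightarrow> mH (hv_mor G K \<eta> \<nu>) h = \<eta> h"
  by (simp add: hv_mor_def)
lemma hv_mor_V [simp]: "x \<in> Verts G \<Longrightarrow> mV (hv_mor G K \<eta> \<nu>) x = \<nu> x"
  by (simp add: hv_mor_def)

lemma hv_mor_gs: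
  assumes "jk_graph G" "h \<in> Halves G"
  shows "mA (hv_mor G K \<eta> \<nu>) (gs G h) = gs K (\<eta> h)"
proof -
  have "inj_on (gs G) (Halves G)" using assms(1) by (rule jk_inj)
  then show ?thesis using assms by (simp add: hv_mor_def)
qed

text \<open>At a port the flip is respected by the very definition of \<open>hv_mor\<close>; only
  inner edges impose a condition, namely \<open>edge\<close>.\<close>

lemma hv_mor_gi:
  assumes "full G" "jk_graph K" "\<eta> ` Halves G \<subseteq> Halves K" "a \<in> Arcs G"
    and edge: "\<And>h. h \<in> Halves G \<Longrightarrow> hinv G h \<noteq> h \<Longrightarrow> gi K (gs K (\<eta> h)) = gs K (\<eta> (hinv G h))"
  shows "mA (hv_mor G K \<eta> \<nu>) (gi G a) = gi K (mA (hv_mor G K \<eta> \<nu>) a)"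
    and "mA (hv_mor G K \<eta> \<nu>) a \<in> Arcs K"
proof -
  have G: "jk_graph G" using assms(1) by simp
  have inj: "inj_on (gs G) (Halves G)" using G by (rule jk_inj)
  have \<eta>: "h \<in> Halves G \<Longrightarrow> \<eta> h \<in> Halves K" for h using assms(3) by auto
  have t: "mA (hv_mor G K \<eta> \<nu>) (gi G (gs G h)) = gi K (gs K (\<eta> h))" if h: "h \<in> Halves G" for h
    using G h
  proof (cases rule: hinv_cases)
    case inner
    then show ?thesis using h G edge by (simp add: hv_mor_gs)
  next
    case tail
    then show ?thesis using h G inj by (simp add: hv_mor_def)
  qed
  have "mA (hv_mor G K \<eta> \<nu>) (gi G a) = gi K (mA (hv_mor G K \<eta> \<nu>) a) \<and>
    mA (hv_mor G K \<eta> \<nu>) a \<in> Arcs K"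
    using assms(1,4)
  proof (cases rule: full_arc_cases)
    case (half h)
    then show ?thesis using G \<eta> assms(2) by (simp add: hv_mor_gs t)
  next
    case (port h)
    then show ?thesis using G \<eta> assms(2) by (simp add: hv_mor_gs t)
  qed
  then show "mA (hv_mor G K \<eta> \<nu>) (gi G a) = gi K (mA (hv_mor G K \<eta> \<nu>) a)"
    "mA (hv_mor G K \<eta> \<nu>) a \<in> Arcs K" by auto
qed

lemma hv_etale:
  assumes G: "full G" and K: "jk_graph K" and "\<eta> ` Halves G \<subseteq> Halves K" "\<nu> ` Verts G \<subseteq> Verts K"
    and p: "\<And>h. h \<in> Halves G \<Longrightarrow> gp K (\<eta> h) = \<nu> (gp G h)"
    and b: "\<And>x. x \<in> Verts G \<Longrightarrow> bij_betw \<eta> (flags_at G x) (flags_at K (\<nu> x))"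
    and edge: "\<And>h. h \<in> Halves G \<Longrightarrow> hinv G h \<noteq> h \<Longrightarrow> gi K (gs K (\<eta> h)) = gs K (\<eta> (hinv G h))"
  shows "etale G K (hv_mor G K \<eta> \<nu>)"
proof (rule etaleI)
  show "jk_graph G" using G by simp
  show "mA (hv_mor G K \<eta> \<nu>) \<in> Arcs G \<rightarrow>\<^sub>E Arcs K"
    using hv_mor_gi(2)[OF G K assms(3) _ edge] by (auto simp: hv_mor_def)
  show "mH (hv_mor G K \<eta> \<nu>) \<in> Halves G \<rightarrow>\<^sub>E Halves K" "mV (hv_mor G K \<eta> \<nu>) \<in> Verts G \<rightarrow>\<^sub>E Verts K"
    using assms by (auto simp: hv_mor_def)
  show "mA (hv_mor G K \<eta> \<nu>) (gi G a) = gi K (mA (hv_mor G K \<eta> \<nu>) a)" if "a \<in> Arcs G" for a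
    using hv_mor_gi(1)[OF G K assms(3) that edge] by auto
  show "mA (hv_mor G K \<eta> \<nu>) (gs G h) = gs K (mH (hv_mor G K \<eta> \<nu>) h)" if "h \<in> Halves G" for h
    using that G by (simp add: hv_mor_gs)
  show "mV (hv_mor G K \<eta> \<nu>) (gp G h) = gp K (mH (hv_mor G K \<eta> \<nu>) h)" if "h \<in> Halves G" for h
    using that G p by simp
  show "bij_betw (mH (hv_mor G K \<eta> \<nu>)) (flags_at G x) (flags_at K (mV (hv_mor G K \<eta> \<nu>) x))"
    if "x \<in> Verts G" for x
    using b[OF that] that by (subst bij_betw_cong[where g = \<eta>]) (auto simp: flags_at_iff)
qed

section \<open>Isomorphisms\<close>

lemma graph_isoD:
  assumes "graph_iso G K f" "jk_graph G" "jk_graph K"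
  shows "etale G K f" "bij_betw (mA f) (Arcs G) (Arcs K)" "bij_betw (mH f) (Halves G) (Halves K)"
    "bij_betw (mV f) (Verts G) (Verts K)"
proof -
  obtain g where f: "etale G K f" and g: "etale K G g" and gf: "gcomp G g f = gid G"
    and fg: "gcomp K f g = gid K"
    using assms(1) by (auto simp: graph_iso_def)
  show "etale G K f" by fact
  have 1: "mA g (mA f a) = a" if "a \<in> Arcs G" for a
    using arg_cong[OF gf, of "\<lambda>m. mA m a"] that by simp
  have 2: "mA f (mA g a) = a" if "a \<in> Arcs K" for a
    using arg_cong[OF fg, of "\<lambda>m. mA m a"] that by simp
  have 3: "mH g (mH f a) = a" if "a \<in> Halves G" for a
    using arg_cong[OF gf, of "\<lambda>m. mH m a"] that by simp
  have 4: "mH f (mH g a) = a" if "a \<in> Halves K" for a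
    using arg_cong[OF fg, of "\<lambda>m. mH m a"] that by simp
  have 5: "mV g (mV f a) = a" if "a \<in> Verts G" for a
    using arg_cong[OF gf, of "\<lambda>m. mV m a"] that by simp
  have 6: "mV f (mV g a) = a" if "a \<in> Verts K" for a
    using arg_cong[OF fg, of "\<lambda>m. mV m a"] that by simp
  show "bij_betw (mA f) (Arcs G) (Arcs K)"
    by (rule bij_betw_byWitness[where f' = "mA g"]) (use 1 2 f g in auto)
  show "bij_betw (mH f) (Halves G) (Halves K)"
    by (rule bij_betw_byWitness[where f' = "mH g"]) (use 3 4 f g in auto)
  show "bij_betw (mV f) (Verts G) (Verts K)"
    by (rule bij_betw_byWitness[where f' = "mV g"]) (use 5 6 f g in auto)
qed

definition ginv :: "('a,'h,'v) graph \<Rightarrow> ('b,'k,'w) graph \<Rightarrow> ('a,'h,'v,'b,'k,'w) gmor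
    \<Rightarrow> ('b,'k,'w,'a,'h,'v) gmor" where
  "ginv G K f = \<lparr>mA = (\<lambda>a\<in>Arcs K. inv_into (Arcs G) (mA f) a),
     mH = (\<lambda>a\<in>Halves K. inv_into (Halves G) (mH f) a),
     mV = (\<lambda>a\<in>Verts K. inv_into (Verts G) (mV f) a)\<rparr>"

lemma ginv_etale:
  assumes G: "jk_graph G" and K: "jk_graph K" and f: "etale G K f"
    and A: "bij_betw (mA f) (Arcs G) (Arcs K)" and H: "bij_betw (mH f) (Halves G) (Halves K)"
    and V: "bij_betw (mV f) (Verts G) (Verts K)"
  shows "etale K G (ginv G K f)" "gcomp G (ginv G K f) f = gid G" "gcomp K f (ginv G K f) = gid K"
proof -
  let ?g = "ginv G K f"
  have gA: "mA ?g (mA f a) = a" if "a \<in> Arcs G" for a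
    using that A f by (simp add: ginv_def etale_mA[OF f] bij_betw_inv_into_left)
  have gH: "mH ?g (mH f a) = a" if "a \<in> Halves G" for a
    using that H f by (simp add: ginv_def etale_mH[OF f] bij_betw_inv_into_left)
  have gV: "mV ?g (mV f a) = a" if "a \<in> Verts G" for a
    using that V f by (simp add: ginv_def etale_mV[OF f] bij_betw_inv_into_left)
  have fA: "mA f (mA ?g a) = a" "mA ?g a \<in> Arcs G" if "a \<in> Arcs K" for a
    using that A by (auto simp: ginv_def bij_betw_inv_into_right bij_betw_def inv_into_into)
  have fH: "mH f (mH ?g a) = a" "mH ?g a \<in> Halves G" if "a \<in> Halves K" for a
    using that H by (auto simp: ginv_def bij_betw_inv_into_right bij_betw_def inv_into_into)
  have fV: "mV f (mV ?g a) = a" "mV ?g a \<in> Verts G" if "a \<in> Verts K" for a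
    using that V by (auto simp: ginv_def bij_betw_inv_into_right bij_betw_def inv_into_into)
  show e: "etale K G ?g"
  proof (rule etaleI[OF K])
    show "mA ?g \<in> Arcs K \<rightarrow>\<^sub>E Arcs G" using fA(2) by (auto simp: ginv_def)
    show "mH ?g \<in> Halves K \<rightarrow>\<^sub>E Halves G" using fH(2) by (auto simp: ginv_def)
    show "mV ?g \<in> Verts K \<rightarrow>\<^sub>E Verts G" using fV(2) by (auto simp: ginv_def)
    fix a assume a: "a \<in> Arcs K"
    show "mA ?g (gi K a) = gi G (mA ?g a)"
      using gA[of "gi G (mA ?g a)"] fA[OF a] G by (simp add: etale_gi[OF f])
  next
    fix h assume h: "h \<in> Halves K"
    show "mA ?g (gs K h) = gs G (mH ?g h)"
      using gA[of "gs G (mH ?g h)"] fH[OF h] G by (simp add: etale_gs[OF f])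
    show "mV ?g (gp K h) = gp G (mH ?g h)"
      using gV[of "gp G (mH ?g h)"] fH[OF h] G by (simp add: etale_gp[OF f])
  next
    fix x assume x: "x \<in> Verts K"
    have "bij_betw (mH f) (flags_at G (mV ?g x)) (flags_at K x)"
      using etale_star[OF f fV(2)[OF x]] fV[OF x] by simp
    then have "flags_at K x = mH f ` flags_at G (mV ?g x)" by (simp add: bij_betw_def)
    then have "mH ?g ` flags_at K x = flags_at G (mV ?g x)"
      using gH by (force simp: flags_at_iff image_image)
    moreover have "inj_on (mH ?g) (flags_at K x)"
      using fH by (metis (no_types, lifting) flags_at_iff inj_onI)
    ultimately show "bij_betw (mH ?g) (flags_at K x) (flags_at G (mV ?g x))"
      by (simp add: bij_betw_def)
  qed
  show "gcomp G ?g f = gid G"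
    by (rule etale_eqI[where G = G and K = G and K' = G]) (use e f G gA gH gV in auto)
  show "gcomp K f ?g = gid K"
    by (rule etale_eqI[where G = K and K = K and K' = K]) (use e f K fA fH fV in auto)
qed

lemma graph_isoI:
  assumes "jk_graph G" "jk_graph K" "etale G K f"
    and "bij_betw (mA f) (Arcs G) (Arcs K)" "bij_betw (mH f) (Halves G) (Halves K)"
    and "bij_betw (mV f) (Verts G) (Verts K)"
  shows "graph_iso G K f"
  using ginv_etale[OF assms] assms(3) by (auto simp: graph_iso_def)

lemma graph_iso_inverse:
  assumes "graph_iso G K f"
  obtains g where "graph_iso K G g" "gcomp G g f = gid G" "gcomp K f g = gid K"
  using assms unfolding graph_iso_def by blast

lemma graph_iso_etale: "graph_iso G K f \<Longrightarrow> etale G K f"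
  by (simp add: graph_iso_def)

lemma graph_iso_gid: "jk_graph G \<Longrightarrow> graph_iso G G (gid G)"
  unfolding graph_iso_def using etale_gid gcomp_gid_left by blast

lemma graph_iso_gcomp:
  assumes "jk_graph G" "jk_graph K" "jk_graph L" "graph_iso G K f" "graph_iso K L g"
  shows "graph_iso G L (gcomp G g f)"
proof -
  obtain f' where f': "graph_iso K G f'" "gcomp G f' f = gid G" "gcomp K f f' = gid K"
    using graph_iso_inverse[OF assms(4)] .
  obtain g' where g': "graph_iso L K g'" "gcomp K g' g = gid K" "gcomp L g g' = gid L"
    using graph_iso_inverse[OF assms(5)] .
  note e = assms(4,5)[THEN graph_iso_etale] f'(1)[THEN graph_iso_etale] g'(1)[THEN graph_iso_etale]
  have "gcomp G (gcomp L f' g') (gcomp G g f) = gcomp G f' (gcomp G (gcomp K g' g) f)"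
    using e assms by (simp add: gcomp_assoc[where K = L] gcomp_assoc[where K = K])
  moreover have "gcomp L (gcomp G g f) (gcomp L f' g') = gcomp L g (gcomp L (gcomp K f f') g')"
    using e assms by (simp add: gcomp_assoc[where K = G] gcomp_assoc[where K = K])
  ultimately have "gcomp G (gcomp L f' g') (gcomp G g f) = gid G"
    "gcomp L (gcomp G g f) (gcomp L f' g') = gid L"
    using e f' g' by simp_all
  moreover have "etale G L (gcomp G g f)" "etale L G (gcomp L f' g')"
    using e assms by simp_all
  ultimately show ?thesis unfolding graph_iso_def by blast
qed

text \<open>Hypothesis \<open>j\<close> separates isomorphisms from reduced covers, which are also
  bijective on half-edges and vertices. It keeps ports away from attached arcs, and this gives
  injectivity on arcs.\<close>

lemma hv_iso:
  assumes G: "full G" and K: "full K" and e: "etale G K f"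
    and H: "bij_betw (mH f) (Halves G) (Halves K)"
    and V: "bij_betw (mV f) (Verts G) (Verts K)"
    and j: "\<And>h. h \<in> Halves G \<Longrightarrow> hinv G h = h \<Longrightarrow> hinv K (mH f h) = mH f h"
  shows "graph_iso G K f"
proof (rule graph_isoI[OF full_jk[OF G] full_jk[OF K] e _ H V])
  have H': "h \<in> Halves K \<Longrightarrow> \<exists>h'\<in>Halves G. h = mH f h'" for h
    using H by (auto simp: bij_betw_def)
  have inj: "mH f h = mH f h' \<longleftrightarrow> h = h'" if "h \<in> Halves G" "h' \<in> Halves G" for h h'
    using H that by (auto simp: bij_betw_def inj_on_def)
  have GK: "jk_graph G" "jk_graph K" using G K by auto
  have tl: "gi K (gs K (mH f h)) \<notin> gs K ` Halves K" if "h \<in> Halves G" "hinv G h = h" for h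
    using j[OF that] GK that e by (metis etale_mH hinv_cases)
  show "bij_betw (mA f) (Arcs G) (Arcs K)"
    unfolding bij_betw_def
  proof (intro conjI inj_onI set_eqI iffI)
    fix a b assume a: "a \<in> Arcs G" and b: "b \<in> Arcs G" and ab: "mA f a = mA f b"
    from G a show "a = b"
    proof (cases rule: full_arc_cases)
      case h: (half h)
      from G b show ?thesis
      proof (cases rule: full_arc_cases)
        case (half h')
        then show ?thesis using h ab GK e inj by (simp add: etale_gs[OF e])
      next
        case (port h')
        then show ?thesis using h ab GK e tl[of h']
            by (metis etale_arc_tail[OF e] etale_gs[OF e] etale_mH image_eqI)
      qed
    next
      case h: (port h)
      from G b show ?thesis
      proof (cases rule: full_arc_cases)
        case (half h')
        then show ?thesis using h ab GK e tl[of h]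
            by (metis etale_arc_tail[OF e] etale_gs[OF e] etale_mH image_eqI)
      next
        case (port h')
        then show ?thesis using h ab GK e inj by (simp add: etale_gs[OF e] etale_arc_tail[OF e])
      qed
    qed
  next
    fix a assume "a \<in> mA f ` Arcs G" then show "a \<in> Arcs K" using e by auto
  next
    fix a assume a: "a \<in> Arcs K"
    from K a show "a \<in> mA f ` Arcs G"
    proof (cases rule: full_arc_cases)
      case (half h)
      then obtain h' where "h' \<in> Halves G" "h = mH f h'" using H' by blast
      then show ?thesis using half GK by (intro image_eqI[of _ _ "gs G h'"]) (auto simp: etale_gs[OF e])
    next
      case (port h)
      then obtain h' where "h' \<in> Halves G" "h = mH f h'" using H' by blast
      then show ?thesis using port GK
        by (intro image_eqI[of _ _ "gi G (gs G h')"]) (auto simp: etale_arc_tail[OF e])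
    qed
  qed
qed

text \<open>Tails need injectivity on arcs: if the image of a tail \<open>h\<close> were inner, the
  port opposite \<open>h\<close> and an attached arc \<open>gs G h'\<close> would have the same
  image.\<close>

lemma graph_iso_hinv:
  assumes "full G" "full K" "graph_iso G K f" "h \<in> Halves G"
  shows "hinv K (mH f h) = mH f (hinv G h)"
proof (cases "hinv G h = h")
  case False
  then show ?thesis using assms etale_hinv graph_iso_etale full_jk by metis
next
  case True
  have GK: "jk_graph G" "jk_graph K" using assms by auto
  note f = graph_isoD[OF assms(3) GK]
  have "hinv K (mH f h) = mH f h"
  proof (rule ccontr)
    assume "hinv K (mH f h) \<noteq> mH f h"
    then have "gi K (gs K (mH f h)) = gs K (hinv K (mH f h))" "hinv K (mH f h) \<in> Halves K"
      using GK assms f by (simp_all add: gi_gs)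
    then obtain h' where h': "h' \<in> Halves G" "hinv K (mH f h) = mH f h'"
      using f(3) by (auto simp: bij_betw_def)
    then have "mA f (gi G (gs G h)) = mA f (gs G h')"
      using GK f assms \<open>gi K (gs K (mH f h)) = gs K (hinv K (mH f h))\<close>
      by (simp add: etale_arc_tail[OF f(1)] etale_gs[OF f(1)])
    then have "gi G (gs G h) = gs G h'"
      using f(2) GK assms h' by (auto simp: bij_betw_def inj_on_def)
    then show False using True GK assms h' by (metis hinv_eqI jk_gi_neq jk_gs)
  qed
  then show ?thesis using True by simp
qed

section \<open>Elements of a graph\<close>

lemma unit_graph_simps [simp]:
  "Arcs unit_graph = range UnitArc" "Halves unit_graph = {}" "Verts unit_graph = {}"
  "gi unit_graph (UnitArc b) = UnitArc (\<not> b)"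
  by (auto simp: unit_graph_def)

lemma UnitArc_range [simp]: "UnitArc b \<in> range UnitArc"
  by simp

lemma jk_unit_graph [simp]: "jk_graph unit_graph"
proof -
  have "range UnitArc = {UnitArc True, UnitArc False}" by (auto simp: UNIV_bool)
  then have "finite (range UnitArc)" by simp
  then show ?thesis unfolding jk_graph_def by (auto simp: unit_graph_def)
qed

lemma corolla_simps [simp]:
  "Arcs (corolla n) = PortArc ` n \<union> FlagArc ` n" "Halves (corolla n) = n" "Verts (corolla n) = {()}"
  "k \<in> n \<Longrightarrow> gs (corolla n) k = FlagArc k" "k \<in> n \<Longrightarrow> gp (corolla n) k = ()"
  "k \<in> n \<Longrightarrow> gi (corolla n) (FlagArc k) = PortArc k" "k \<in> n \<Longrightarrow> gi (corolla n) (PortArc k) = FlagArc k"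
  "flags_at (corolla n) x = n"
  by (auto simp: corolla_def flags_at_def)

lemma jk_corolla [simp]: "finite n \<Longrightarrow> jk_graph (corolla n)"
  unfolding jk_graph_def by (auto simp: corolla_def inj_on_def)

lemma full_corolla [simp]: "finite n \<Longrightarrow> full (corolla n)"
  by (rule fullI) auto

lemma hinv_corolla [simp]: "k \<in> n \<Longrightarrow> hinv (corolla n) k = k"
  by (auto simp: hinv_def)

lemma elObs_simps [simp]: "Unit \<in> elObs" "Cor n \<in> elObs \<longleftrightarrow> finite n"
  by (auto simp: elObs_def)

lemma elObs_cases:
  assumes "X \<in> elObs" obtains "X = Unit" | n where "X = Cor n" "finite n"
  using assms by (auto simp: elObs_def)

lemma jk_el_graph [simp]: "X \<in> elObs \<Longrightarrow> jk_graph (el_graph X)"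
  by (erule elObs_cases) auto

text \<open>By the Yoneda lemma an arc is a map from the unit graph: \<open>UnitArc True\<close>
  goes to \<open>a\<close>, and the other arc is then forced to go to the flip of
  \<open>a\<close>.\<close>

definition uat :: "('a,'h,'v) graph \<Rightarrow> 'a \<Rightarrow> ('u,'a,'h,'v) elmap" where
  "uat G a = unit_map (\<lambda>b. if b then a else gi G a)"

lemma unit_map_mA [simp]: "mA (unit_map c) (UnitArc b) = c b"
  by (simp add: unit_map_def)

lemma uat_mA [simp]: "mA (uat G a) (UnitArc b) = (if b then a else gi G a)"
  by (simp add: uat_def)

lemma etale_uat [simp]: "jk_graph G \<Longrightarrow> a \<in> Arcs G \<Longrightarrow> etale unit_graph G (uat G a)"
  by (rule etaleI) (auto simp: uat_def unit_map_def)

lemma etale_unitD: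
  fixes e :: "('u,'a,'h,'v) elmap"
  assumes "jk_graph G" "etale unit_graph G e"
  shows "mA e (UnitArc True) \<in> Arcs G" "e = uat G (mA e (UnitArc True))"
proof -
  show a: "mA e (UnitArc True) \<in> Arcs G" using assms(2) by simp
  have "mA e (UnitArc b) = (if b then mA e (UnitArc True) else gi G (mA e (UnitArc True)))" for b
    using etale_gi[OF assms(2), of "UnitArc True"] by simp
  then have *: "mA e (UnitArc b) = mA (uat G (mA e (UnitArc True))) (UnitArc b)" for b
    unfolding uat_mA .
  show "e = uat G (mA e (UnitArc True))"
  proof (rule etale_eqI[OF assms(2) etale_uat[OF assms(1) a]])
    fix b :: "'u elarc" assume "b \<in> Arcs unit_graph"
    then obtain t where b: "b = UnitArc t" by auto
    show "mA e b = mA (uat G (mA e (UnitArc True))) b" unfolding b by (rule *)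
  qed auto
qed

lemma gcomp_uat:
  assumes "etale G K f" "a \<in> Arcs G" "jk_graph G" "jk_graph K"
  shows "gcomp unit_graph f (uat G a) = uat K (mA f a)"
proof (rule etale_eqI[where G = unit_graph and K = K and K' = K])
  show "etale unit_graph K (gcomp unit_graph f (uat G a))"
    using assms by (intro etale_gcomp[where K = G]) auto
qed (use assms etale_gi[OF assms(1)] in auto)

lemma unit_map_port_arc:
  "unit_map (\<lambda>t. port_arc G l (mA (uat (corolla n) a) (UnitArc t))) =
    uat G (port_arc G l a)" if "jk_graph G" "a \<in> PortArc ` n \<union> FlagArc ` n" "l \<in> n \<rightarrow> Arcs G"
proof -
  have "gi G (gi G (l k)) = l k" if "k \<in> n" for k
    using \<open>jk_graph G\<close> \<open>l \<in> n \<rightarrow> Arcs G\<close> that by (metis funcset_mem jk_gi_gi)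
  then show ?thesis
    unfolding uat_def using that by (intro arg_cong[where f = unit_map] ext) (auto simp: port_arc_def)
qed

lemma cor_eqI:
  assumes "finite n" "etale (corolla n) G e" "etale (corolla n) G e'"
    and "\<And>k. k \<in> n \<Longrightarrow> mH e k = mH e' k" "mV e () = mV e' ()"
  shows "e = e'"
  by (rule etale_eq_fullI[OF full_corolla assms(2,3)]) (use assms in auto)

text \<open>A map from a corolla is a vertex together with a naming of its flags: all half-edges of
  a corolla are tails, so there is no edge to respect.\<close>

lemma cor_etale:
  assumes "finite n" "jk_graph G" "x \<in> Verts G" "bij_betw \<sigma> n (flags_at G x)"
  shows "etale (corolla n) G (hv_mor (corolla n) G \<sigma> (\<lambda>_. x))"
  using assms by (intro hv_etale) (auto simp: flags_at_def bij_betw_def)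

lemma cor_bij:
  assumes "etale (corolla n) G e"
  shows "bij_betw (mH e) n (flags_at G (mV e ()))"
  using etale_star[OF assms, of "()"] by simp

lemma cor_flag: "etale (corolla n) G e \<Longrightarrow> k \<in> n \<Longrightarrow> mH e k \<in> flags_at G (mV e ())"
  using cor_bij bij_betw_apply by metis

lemma star_simps [simp]:
  "f \<in> flags_at R x \<Longrightarrow> mA (star R x) (FlagArc f) = gs R f"
  "f \<in> flags_at R x \<Longrightarrow> mA (star R x) (PortArc f) = gi R (gs R f)"
  "f \<in> flags_at R x \<Longrightarrow> mH (star R x) f = f" "mV (star R x) () = x"
  by (auto simp: star_def Let_def)

lemma finite_flags_at [simp]: "jk_graph R \<Longrightarrow> finite (flags_at R x)"
  by (auto simp: flags_at_def jk_finite)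

lemma star_etale [simp]:
  assumes "jk_graph R" "x \<in> Verts R" shows "etale (corolla (flags_at R x)) R (star R x)"
proof (rule etaleI)
  show "jk_graph (corolla (flags_at R x))" using assms by simp
  show "mA (star R x) \<in> Arcs (corolla (flags_at R x)) \<rightarrow>\<^sub>E Arcs R"
    using assms by (auto simp: star_def Let_def flags_at_iff)
  show "mH (star R x) \<in> Halves (corolla (flags_at R x)) \<rightarrow>\<^sub>E Halves R"
    "mV (star R x) \<in> Verts (corolla (flags_at R x)) \<rightarrow>\<^sub>E Verts R"
    using assms by (auto simp: star_def Let_def flags_at_iff)
  show "bij_betw (mH (star R x)) (flags_at (corolla (flags_at R x)) y) (flags_at R (mV (star R x) y))"
    for y by (auto simp: bij_betw_def inj_on_def)
qed (use assms in \<open>auto simp: flags_at_iff\<close>)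

definition crel :: "'u set \<Rightarrow> 'u set \<Rightarrow> ('u \<Rightarrow> 'u) \<Rightarrow> 'u elmor" where
  "crel m n \<sigma> = hv_mor (corolla m) (corolla n) \<sigma> (\<lambda>_. ())"

lemma crel_etale: "finite m \<Longrightarrow> finite n \<Longrightarrow> bij_betw \<sigma> m n \<Longrightarrow> etale (corolla m) (corolla n) (crel m n \<sigma>)"
  unfolding crel_def by (rule cor_etale) auto

lemma crel_H [simp]: "k \<in> m \<Longrightarrow> mH (crel m n \<sigma>) k = \<sigma> k"
  by (simp add: crel_def)

text \<open>Any corolla map is the canonical one at the vertex it hits, precomposed with a
  relabelling. On corollas a natural transformation is therefore determined by its values at the
  stars.\<close>

lemma cor_factor:
  assumes "finite n" "jk_graph G" "etale (corolla n) G e"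
  shows "etale (corolla n) (corolla (flags_at G (mV e ()))) (crel n (flags_at G (mV e ())) (mH e))"
    and "gcomp (corolla n) (star G (mV e ())) (crel n (flags_at G (mV e ())) (mH e)) = e"
proof -
  let ?g = "crel n (flags_at G (mV e ())) (mH e)"
  show g: "etale (corolla n) (corolla (flags_at G (mV e ()))) ?g"
    using assms by (intro crel_etale cor_bij) auto
  have v: "mV e () \<in> Verts G" using assms(3) by simp
  show "gcomp (corolla n) (star G (mV e ())) ?g = e"
    using assms v g cor_flag[OF assms(3)]
    by (intro cor_eqI[OF assms(1)] etale_gcomp[OF _ g]) auto
qed

lemma el_hom_unit_cor: "f \<in> el_hom Unit (Cor n) \<Longrightarrow> finite n \<Longrightarrow>
    \<exists>a \<in> PortArc ` n \<union> FlagArc ` n. f = uat (corolla n) a"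
  using etale_unitD[of "corolla n" f] by (auto simp: el_hom_def)

lemma el_hom_cor_unit: "el_hom (Cor n) Unit = {}"
  using etale_mV[of "corolla n" unit_graph _ "()"] by (auto simp: el_hom_def)

lemma el_hom_cor_bij: "f \<in> el_hom (Cor m) (Cor n) \<Longrightarrow> bij_betw (mH f) m n"
  using cor_bij[of m "corolla n" f] by (simp add: el_hom_def)

section \<open>Natural transformations\<close>

lemma val_yon [simp]: "e \<in> val (yon G) X \<longleftrightarrow> etale (el_graph X) G e"
  by (simp add: yon_def)

lemma res_yon [simp]: "res (yon G) X Y f e = gcomp (el_graph X) e f"
  by (simp add: yon_def)

lemma nt_in: "\<alpha> \<in> nt_hom F G \<Longrightarrow> X \<in> elObs \<Longrightarrow> c \<in> val F X \<Longrightarrow> \<alpha> X c \<in> val G X"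
  by (auto simp: nt_hom_def PiE_iff)

lemma nt_nat: "\<alpha> \<in> nt_hom F G \<Longrightarrow> X \<in> elObs \<Longrightarrow> Y \<in> elObs \<Longrightarrow> f \<in> el_hom X Y \<Longrightarrow> c \<in> val F Y \<Longrightarrow>
    \<alpha> X (res F X Y f c) = res G X Y f (\<alpha> Y c)"
  by (auto simp: nt_hom_def)

lemma nt_eqI:
  assumes "\<alpha> \<in> nt_hom F G" "\<beta> \<in> nt_hom F G'"
    and "\<And>X c. X \<in> elObs \<Longrightarrow> c \<in> val F X \<Longrightarrow> \<alpha> X c = \<beta> X c"
  shows "\<alpha> = \<beta>"
proof
  fix X
  show "\<alpha> X = \<beta> X"
  proof (cases "X \<in> elObs")
    case True
    then have "\<alpha> X \<in> extensional (val F X)" "\<beta> X \<in> extensional (val F X)"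
      using assms(1,2) by (auto simp: nt_hom_def PiE_iff)
    then show ?thesis using assms(3)[OF True] by (auto intro: extensionalityI)
  next
    case False
    then show ?thesis using assms(1,2) by (auto simp: nt_hom_def PiE_iff extensional_def)
  qed
qed

lemma nt_homI:
  assumes "\<alpha> \<in> extensional elObs" "\<And>X. X \<in> elObs \<Longrightarrow> \<alpha> X \<in> extensional (val F X)"
    and "\<And>X c. X \<in> elObs \<Longrightarrow> c \<in> val F X \<Longrightarrow> \<alpha> X c \<in> val G X"
    and "\<And>X Y f c. X \<in> elObs \<Longrightarrow> Y \<in> elObs \<Longrightarrow> f \<in> el_hom X Y \<Longrightarrow> c \<in> val F Y \<Longrightarrow>
      \<alpha> X (res F X Y f c) = res G X Y f (\<alpha> Y c)"
  shows "\<alpha> \<in> nt_hom F G"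
  using assms by (auto simp: nt_hom_def PiE_iff)

lemma nt_comp_app [simp]:
  "X \<in> elObs \<Longrightarrow> c \<in> val F X \<Longrightarrow> nt_comp F \<beta> \<alpha> X c = \<beta> X (\<alpha> X c)"
  by (simp add: nt_comp_def compose_def)

lemma nt_comp_ext: "nt_comp F \<beta> \<alpha> \<in> extensional elObs"
  "X \<in> elObs \<Longrightarrow> nt_comp F \<beta> \<alpha> X \<in> extensional (val F X)"
  by (auto simp: nt_comp_def)

text \<open>Naturality of \<open>nt_comp\<close> at a restricted element presupposes that this
  element lies in the value of the source, where the extensional components are given.\<close>

definition sp_closed :: "('u,'x) species \<Rightarrow> bool" where
  "sp_closed F \<longleftrightarrow> (\<forall>X\<in>elObs. \<forall>Y\<in>elObs. \<forall>f\<in>el_hom X Y. \<forall>c\<in>val F Y. res F X Y f c \<in> val F X)"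

lemma sp_closed_yon [simp]: "jk_graph G \<Longrightarrow> sp_closed (yon G)"
  by (auto simp: sp_closed_def el_hom_def intro: etale_gcomp)

lemma nt_comp_nt:
  assumes "sp_closed F" "\<alpha> \<in> nt_hom F G" "\<beta> \<in> nt_hom G H"
  shows "nt_comp F \<beta> \<alpha> \<in> nt_hom F H"
proof (rule nt_homI)
  fix X Y f c assume *: "X \<in> elObs" "Y \<in> elObs" "f \<in> el_hom X Y" "c \<in> val F Y"
  then have "res F X Y f c \<in> val F X" using assms(1) by (auto simp: sp_closed_def)
  then show "nt_comp F \<beta> \<alpha> X (res F X Y f c) = res H X Y f (nt_comp F \<beta> \<alpha> Y c)"
    using * assms by (simp add: nt_nat[OF assms(2)] nt_nat[OF assms(3)] nt_in)
qed (use assms in \<open>auto simp: nt_comp_ext nt_in\<close>)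

lemma nt_comp_cong: "(\<And>X c. X \<in> elObs \<Longrightarrow> c \<in> val F X \<Longrightarrow> \<beta> X (\<alpha> X c) = \<beta>' X (\<alpha>' X c)) \<Longrightarrow>
    nt_comp F \<beta> \<alpha> = nt_comp F \<beta>' \<alpha>'"
  by (force simp: nt_comp_def compose_def)

lemma nt_comp_assoc:
  assumes "\<alpha> \<in> nt_hom F G"
  shows "nt_comp F (nt_comp G \<gamma> \<beta>) \<alpha> = nt_comp F \<gamma> (nt_comp F \<beta> \<alpha>)"
  by (rule nt_comp_cong) (simp add: nt_in[OF assms])

lemma yon_map_app [simp]:
  "X \<in> elObs \<Longrightarrow> etale (el_graph X) S e \<Longrightarrow> yon_map S h X e = gcomp (el_graph X) h e"
  by (simp add: yon_map_def)

lemma yon_map_nt [simp]: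
  assumes "etale S Y h" "jk_graph S"
  shows "yon_map S h \<in> nt_hom (yon S) (yon Y)"
proof (rule nt_homI)
  fix X Z f c assume *: "X \<in> elObs" "Z \<in> elObs" "f \<in> el_hom X Z" "c \<in> val (yon S) Z"
  then have f: "etale (el_graph X) (el_graph Z) f" by (simp add: el_hom_def)
  then show "yon_map S h X (res (yon S) X Z f c) = res (yon Y) X Z f (yon_map S h Z c)"
    using * assms by (simp add: gcomp_assoc[OF f])
qed (use assms in \<open>auto simp: yon_map_def\<close>)

lemma yon_map_gcomp:
  assumes "etale S S' g" "etale S' Y h" "jk_graph S" "jk_graph S'"
  shows "yon_map S (gcomp S h g) = nt_comp (yon S) (yon_map S' h) (yon_map S g)"
  by (rule nt_eqI[where F = "yon S" and G = "yon Y" and G' = "yon Y"])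
    (use assms in \<open>auto intro!: nt_comp_nt[where G = "yon S'"] simp: gcomp_assoc\<close>)

lemma nt_comp_yon_map_gid:
  assumes "\<alpha> \<in> nt_hom (yon S) F" "jk_graph S"
  shows "nt_comp (yon S) \<alpha> (yon_map S (gid S)) = \<alpha>"
  by (rule nt_eqI[OF nt_comp_nt[OF _ _ assms(1)] assms(1)]) (use assms in auto)

text \<open>The stars generate \<open>yon R\<close>: a corolla map factors through a star, and in a
  graph without isolated edges every arc occurs in the star at the vertex of some half-edge.\<close>

lemma nt_eq_fullI:
  fixes R :: "('a,'u,'v) graph" and F :: "('u,'x) species"
  assumes R: "full R" and \<alpha>: "\<alpha> \<in> nt_hom (yon R) F" and \<beta>: "\<beta> \<in> nt_hom (yon R) F"
    and eq: "\<And>x. x \<in> Verts R \<Longrightarrow> \<alpha> (Cor (flags_at R x)) (star R x) = \<beta> (Cor (flags_at R x)) (star R x)"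
  shows "\<alpha> = \<beta>"
proof (rule nt_eqI[OF \<alpha> \<beta>])
  have J: "jk_graph R" using R by simp
  have e: "\<alpha> X (gcomp (el_graph X) (star R x) g) = \<beta> X (gcomp (el_graph X) (star R x) g)"
    if "X \<in> elObs" "x \<in> Verts R" "g \<in> el_hom X (Cor (flags_at R x))" for X :: "'u elobj" and x g
    using nt_nat[OF \<alpha>, of X "Cor (flags_at R x)" g "star R x"]
      nt_nat[OF \<beta>, of X "Cor (flags_at R x)" g "star R x"] that J eq by simp
  fix X :: "'u elobj" and c assume X: "X \<in> elObs" and c: "c \<in> val (yon R) X"
  from X show "\<alpha> X c = \<beta> X c"
  proof (cases rule: elObs_cases)
    case 1
    then have c': "etale unit_graph R c" using c by simp
    have "mA c (UnitArc True) \<in> Arcs R" using etale_unitD[OF J c'] by simp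
    from R this obtain h a where h: "h \<in> Halves R" "a \<in> PortArc ` flags_at R (gp R h) \<union> FlagArc ` flags_at R (gp R h)"
      "mA c (UnitArc True) = mA (star R (gp R h)) a"
      by (cases rule: full_arc_cases) (force simp: flags_at_iff)+
    then have "gcomp unit_graph (star R (gp R h)) (uat (corolla (flags_at R (gp R h))) a) = c"
      using J etale_unitD[OF J c'] by (simp add: gcomp_uat[OF star_etale])
    then show ?thesis using e[of Unit "gp R h" "uat (corolla (flags_at R (gp R h))) a"] 1 h J
      by (auto simp: el_hom_def)
  next
    case (2 n)
    then have c': "etale (corolla n) R c" using c by simp
    then have "mV c () \<in> Verts R" by simp
    then show ?thesis using e[of X "mV c ()"] cor_factor[OF 2(2) J c'] 2 X
      by (fastforce simp: el_hom_def)
  qed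
qed

lemma yon_map_inj:
  fixes S :: "('a,'u,'v) graph" and Y :: "('b,'k,'w) graph"
  assumes S: "jk_graph S" and h: "etale S Y h" and h': "etale S Y' h'"
    and eq: "(yon_map S h :: ('u,_,_) nt) = yon_map S h'"
  shows "h = h'"
proof -
  have e: "gcomp (el_graph X) h e = gcomp (el_graph X) h' e" if "X \<in> elObs" "etale (el_graph X) S e" for X :: "'u elobj" and e
    using fun_cong[OF fun_cong[OF eq, of X], of e] that by simp
  have st: "gcomp (corolla (flags_at S x)) h (star S x) = gcomp (corolla (flags_at S x)) h' (star S x)"
    if "x \<in> Verts S" for x
    using e[of "Cor (flags_at S x)" "star S x"] S that by simp
  show ?thesis
  proof (rule etale_eqI[OF h h'])
    fix a assume "a \<in> Arcs S"
    then show "mA h a = mA h' a"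
      using arg_cong[OF e[of Unit "uat S a"], of "\<lambda>m. mA m (UnitArc True)"] S by simp
  next
    fix f assume "f \<in> Halves S"
    then show "mH h f = mH h' f"
      using arg_cong[OF st[of "gp S f"], of "\<lambda>m. mH m f"] S by (simp add: flags_at_iff)
  next
    fix x assume "x \<in> Verts S"
    then show "mV h x = mV h' x"
      using arg_cong[OF st[of x], of "\<lambda>m. mV m ()"] S by simp
  qed
qed

text \<open>Fullness of the embedding of graphs into species: arcs are read off from the unit
  elements, half-edges and vertices from the stars, and naturality makes the three components fit
  together.\<close>

lemma yon_full:
  fixes S :: "('a,'u,'v) graph" and Y :: "('b,'k,'w) graph" and d :: "('u,_,_) nt"
  assumes S: "full S" and Y: "jk_graph Y" and d: "d \<in> nt_hom (yon S) (yon Y)"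
  obtains h where "etale S Y h" "d = yon_map S h"
proof -
  have J: "jk_graph S" using S by simp
  define A where "A a = mA (d Unit (uat S a)) (UnitArc True)" for a
  define V where "V x = mV (d (Cor (flags_at S x)) (star S x)) ()" for x
  define H where "H f = mH (d (Cor (flags_at S (gp S f))) (star S (gp S f))) f" for f
  define h where "h = \<lparr>mA = (\<lambda>a\<in>Arcs S. A a), mH = (\<lambda>f\<in>Halves S. H f), mV = (\<lambda>x\<in>Verts S. V x)\<rparr>"
  have du: "etale unit_graph Y (d Unit (uat S a))" if "a \<in> Arcs S" for a
    using nt_in[OF d, of Unit "uat S a"] that J by simp
  have ds: "etale (corolla (flags_at S x)) Y (d (Cor (flags_at S x)) (star S x))" if "x \<in> Verts S" for x
    using nt_in[OF d, of "Cor (flags_at S x)" "star S x"] that J by simp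
  have dua: "d Unit (uat S a) = uat Y (A a)" "A a \<in> Arcs Y" if "a \<in> Arcs S" for a
    unfolding A_def using etale_unitD[OF Y du[OF that]] by simp_all
  \<comment> \<open>Naturality along the maps from the unit graph to the corolla ties the arc
    component to the values at the stars.\<close>
  have st: "A (mA (star S x) a) = mA (d (Cor (flags_at S x)) (star S x)) a"
    if x: "x \<in> Verts S" and a: "a \<in> PortArc ` flags_at S x \<union> FlagArc ` flags_at S x" for x a
  proof -
    have "d Unit (gcomp unit_graph (star S x) (uat (corolla (flags_at S x)) a)) =
        gcomp unit_graph (d (Cor (flags_at S x)) (star S x)) (uat (corolla (flags_at S x)) a)"
      using nt_nat[OF d, of Unit "Cor (flags_at S x)" "uat (corolla (flags_at S x)) a" "star S x"]
        x a J by (auto simp: el_hom_def)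
    then show ?thesis
      using a J Y by (simp add: A_def gcomp_uat[OF star_etale[OF J x]] gcomp_uat[OF ds[OF x]])
  qed
  have e: "etale S Y h"
  proof (rule etaleI[OF J])
    show "mA h \<in> Arcs S \<rightarrow>\<^sub>E Arcs Y" using dua by (auto simp: h_def)
    show "mH h \<in> Halves S \<rightarrow>\<^sub>E Halves Y"
      using cor_flag[OF ds] J by (auto simp: h_def H_def flags_at_iff)
    show "mV h \<in> Verts S \<rightarrow>\<^sub>E Verts Y"
      using etale_mV[OF ds] by (auto simp: h_def V_def)
  next
    fix a assume a: "a \<in> Arcs S"
    \<comment> \<open>The nontrivial automorphism of the unit graph; naturality along it is
      compatibility with \<open>gi\<close>.\<close>
    let ?\<iota> = "uat unit_graph (UnitArc False) :: 'u elmor"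
    have "d Unit (gcomp unit_graph (uat S a) ?\<iota>) = gcomp unit_graph (d Unit (uat S a)) ?\<iota>"
      using nt_nat[OF d, of Unit Unit ?\<iota> "uat S a"] a J by (simp add: el_hom_def)
    then have "d Unit (uat S (gi S a)) = uat Y (mA (d Unit (uat S a)) (UnitArc False))"
      using a J Y by (simp add: gcomp_uat[OF du[OF a]] gcomp_uat[OF etale_uat[OF J a]])
    then show "mA h (gi S a) = gi Y (mA h a)"
      using a J dua by (simp add: h_def) (metis jk_gi uat_mA)
  next
    fix f assume f: "f \<in> Halves S"
    let ?x = "gp S f"
    show "mA h (gs S f) = gs Y (mH h f)"
      using st[of ?x "FlagArc f"] f J etale_gs[OF ds[of ?x], of f]
      by (simp add: h_def H_def flags_at_iff)
    show "mV h (gp S f) = gp Y (mH h f)"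
      using f J etale_gp[OF ds[of ?x], of f] by (simp add: h_def H_def V_def flags_at_iff)
  next
    fix x assume x: "x \<in> Verts S"
    show "bij_betw (mH h) (flags_at S x) (flags_at Y (mV h x))"
      using cor_bij[OF ds[OF x]] x
      by (subst bij_betw_cong[where g = "mH (d (Cor (flags_at S x)) (star S x))"])
        (auto simp: h_def H_def V_def flags_at_iff)
  qed
  moreover have "d = yon_map S h"
  proof (rule nt_eq_fullI[OF S d yon_map_nt[OF e J]])
    fix x assume x: "x \<in> Verts S"
    have g: "etale (corolla (flags_at S x)) Y (gcomp (corolla (flags_at S x)) h (star S x))"
      by (rule etale_gcomp[OF _ star_etale[OF J x] e]) (simp add: J)
    have "d (Cor (flags_at S x)) (star S x) = gcomp (corolla (flags_at S x)) h (star S x)"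
      using x J
      by (intro cor_eqI[OF _ ds[OF x] g]) (auto simp: h_def H_def V_def flags_at_iff)
    then show "d (Cor (flags_at S x)) (star S x) = yon_map S h (Cor (flags_at S x)) (star S x)"
      using x J by simp
  qed
  ultimately show ?thesis using that by blast
qed

section \<open>Decorated graphs and their classes\<close>

text \<open>Without isolated edges every arc lies on an edge with a half-edge, and a half-edge has a
  vertex; so being nonempty means having a vertex.\<close>

lemma effective_iff:
  assumes "jk_graph G" shows "effective G \<longleftrightarrow> full G \<and> Verts G \<noteq> {}"
proof
  assume e: "effective G"
  then have f: "full G" using assms by (simp add: effective_def full_def)
  moreover have "Verts G \<noteq> {}"
  proof -
    consider a where "a \<in> Arcs G" | h where "h \<in> Halves G" | x where "x \<in> Verts G"
      using e unfolding effective_def by blast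
    then show ?thesis
    proof cases
      case (1 a)
      with f show ?thesis by (cases rule: full_arc_cases) (use jk_gp[OF assms] in blast)+
    qed (use jk_gp[OF assms] in blast)+
  qed
  ultimately show "full G \<and> Verts G \<noteq> {}" by simp
qed (simp add: effective_def full_def)

lemma dgraphs_iff: "(G, l, d) \<in> dgraphs F n \<longleftrightarrow> full G \<and> Verts G \<noteq> {} \<and>
    l \<in> n \<rightarrow>\<^sub>E ports G \<and> bij_betw l n (ports G) \<and> d \<in> nt_hom (yon G) F"
  unfolding dgraphs_def using effective_iff[of G] full_jk[of G] by blast

lemma dgraph_iso_refl: "t \<in> dgraphs F n \<Longrightarrow> dgraph_iso n t t"
proof -
  assume t: "t \<in> dgraphs F n"
  obtain G l d where G: "t = (G, l, d)" by (cases t)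
  have "mA (gid G) (l k) = l k" if "k \<in> n" for k
    using t that unfolding G by (auto simp: dgraphs_iff ports_def PiE_iff)
  moreover have "jk_graph G" "d \<in> nt_hom (yon G) F" using t unfolding G by (simp_all add: dgraphs_iff)
  ultimately have "graph_iso G G (gid G) \<and> (\<forall>k\<in>n. mA (gid G) (l k) = l k) \<and>
      d = nt_comp (yon G) d (yon_map G (gid G))"
    by (simp add: graph_iso_gid nt_comp_yon_map_gid)
  then show ?thesis unfolding G dgraph_iso_def by auto
qed

lemma nt_comp_yon_map_assoc:
  assumes "jk_graph G" "jk_graph G'" "etale G G' f" "etale G' G'' g"
  shows "nt_comp (yon G) (nt_comp (yon G') d (yon_map G' g)) (yon_map G f) =
    nt_comp (yon G) d (yon_map G (gcomp G g f))"
  by (rule nt_comp_cong) (use assms in \<open>auto simp: gcomp_assoc\<close>)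

lemma dgraph_iso_sym:
  assumes "t \<in> dgraphs F n" "t' \<in> dgraphs F n" "dgraph_iso n t t'" shows "dgraph_iso n t' t"
proof -
  obtain G l d where t: "t = (G, l, d)" by (cases t)
  obtain G' l' d' where t': "t' = (G', l', d')" by (cases t')
  from assms(3) obtain f where f: "graph_iso G G' f" "\<And>k. k \<in> n \<Longrightarrow> mA f (l k) = l' k"
    "d = nt_comp (yon G) d' (yon_map G f)"
    unfolding dgraph_iso_def t t' by auto
  obtain g where g: "graph_iso G' G g" "gcomp G g f = gid G" "gcomp G' f g = gid G'"
    using graph_iso_inverse[OF f(1)] .
  have J: "jk_graph G" "jk_graph G'" using assms(1,2) unfolding t t' by (simp_all add: dgraphs_iff)
  have e: "etale G G' f" "etale G' G g" using f g by (simp_all add: graph_iso_etale)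
  have "mA g (l' k) = l k" if k: "k \<in> n" for k
  proof -
    have "l k \<in> Arcs G" using assms(1) k unfolding t by (auto simp: dgraphs_iff ports_def PiE_iff)
    then show ?thesis using arg_cong[OF g(2), of "\<lambda>m. mA m (l k)"] f(2)[OF k] by simp
  qed
  moreover have "d' = nt_comp (yon G') d (yon_map G' g)"
    unfolding f(3) nt_comp_yon_map_assoc[OF J(2,1) e(2,1)] g(3)
    by (rule nt_comp_yon_map_gid[symmetric, where F = F, OF _ J(2)]) (use assms(2) in \<open>simp add: t' dgraphs_iff\<close>)
  ultimately show ?thesis using g(1) unfolding t t' dgraph_iso_def by auto
qed

lemma dgraph_iso_trans:
  assumes "t \<in> dgraphs F n" "t' \<in> dgraphs F n" "t'' \<in> dgraphs F n"
    and "dgraph_iso n t t'" "dgraph_iso n t' t''" shows "dgraph_iso n t t''"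
proof -
  obtain G l d where t: "t = (G, l, d)" by (cases t)
  obtain G' l' d' where t': "t' = (G', l', d')" by (cases t')
  obtain G'' l'' d'' where t'': "t'' = (G'', l'', d'')" by (cases t'')
  from assms(4) obtain f where f: "graph_iso G G' f" "\<And>k. k \<in> n \<Longrightarrow> mA f (l k) = l' k"
    "d = nt_comp (yon G) d' (yon_map G f)"
    unfolding dgraph_iso_def t t' by auto
  from assms(5) obtain g where g: "graph_iso G' G'' g" "\<And>k. k \<in> n \<Longrightarrow> mA g (l' k) = l'' k"
    "d' = nt_comp (yon G') d'' (yon_map G' g)"
    unfolding dgraph_iso_def t' t'' by auto
  have J: "jk_graph G" "jk_graph G'" "jk_graph G''"
    using assms(1-3) unfolding t t' t'' by (simp_all add: dgraphs_iff)
  have e: "etale G G' f" "etale G' G'' g" using f g by (simp_all add: graph_iso_etale)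
  have "mA (gcomp G g f) (l k) = l'' k" if k: "k \<in> n" for k
  proof -
    have "l k \<in> Arcs G" using assms(1) k unfolding t by (auto simp: dgraphs_iff ports_def PiE_iff)
    then show ?thesis using f(2)[OF k] g(2)[OF k] by simp
  qed
  moreover have "d = nt_comp (yon G) d'' (yon_map G (gcomp G g f))"
    unfolding f(3) g(3) nt_comp_yon_map_assoc[OF J(1,2) e] ..
  ultimately show ?thesis using graph_iso_gcomp[OF J f(1) g(1)] unfolding t t'' dgraph_iso_def by auto
qed

section \<open>Elements of \<open>bar F\<close> at a corolla as isomorphism classes\<close>

definition dcls :: "('u,'x) species \<Rightarrow> 'u set \<Rightarrow> ('u,'x) dgraph \<Rightarrow> ('u,'x) dgraph set" where
  "dcls F n t = {t' \<in> dgraphs F n. dgraph_iso n t t'}"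

lemma bar_val_Unit [simp]: "bar_val F Unit = Colour ` val F Unit"
  by (simp add: bar_val_def)

lemma bar_val_Cor: "c \<in> bar_val F (Cor n) \<longleftrightarrow> (\<exists>t\<in>dgraphs F n. c = Cls (dcls F n t))"
proof -
  have "{(S, T). S \<in> dgraphs F n \<and> T \<in> dgraphs F n \<and> dgraph_iso n S T} `` {t} = dcls F n t"
    if "t \<in> dgraphs F n" for t
    using that by (auto simp: dcls_def)
  then show ?thesis by (auto simp: bar_val_def quotient_def)
qed

lemma dcls_bar: "t \<in> dgraphs F n \<Longrightarrow> Cls (dcls F n t) \<in> bar_val F (Cor n)"
  by (auto simp: bar_val_Cor)

lemma dcls_self: "t \<in> dgraphs F n \<Longrightarrow> t \<in> dcls F n t"
  by (auto simp: dcls_def dgraph_iso_refl)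

lemma barC_mem:
  assumes "c \<in> bar_val F (Cor n)" "t \<in> cls c"
  shows "t \<in> dgraphs F n" "c = Cls (dcls F n t)"
proof -
  obtain t0 where t0: "t0 \<in> dgraphs F n" "c = Cls (dcls F n t0)" using assms(1) by (auto simp: bar_val_Cor)
  then show t: "t \<in> dgraphs F n" using assms(2) by (auto simp: dcls_def)
  have i: "dgraph_iso n t0 t" using t0 assms(2) by (auto simp: dcls_def)
  have "dcls F n t0 = dcls F n t"
    unfolding dcls_def using t0(1) t i dgraph_iso_sym[OF t0(1) t i]
    by (auto intro: dgraph_iso_trans[of t0 F n t] dgraph_iso_trans[of t F n t0])
  then show "c = Cls (dcls F n t)" using t0 by simp
qed

lemma barC_ne:
  assumes "c \<in> bar_val F (Cor n)"
  obtains G l d where "(G, l, d) \<in> cls c" "(G, l, d) \<in> dgraphs F n"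
proof -
  obtain t where t: "t \<in> dgraphs F n" "c = Cls (dcls F n t)" using assms by (auto simp: bar_val_Cor)
  obtain G l d where "t = (G, l, d)" by (cases t)
  then show ?thesis using that t dcls_self[OF t(1)] by simp
qed

text \<open>The classes partition the decorated graphs, so a common member suffices. Equalities
  between values of \<open>bar\<close> are usually proved in this way, by exhibiting one
  representative on both sides.\<close>

lemma barC_eqI:
  "c \<in> bar_val F (Cor n) \<Longrightarrow> c' \<in> bar_val F (Cor n) \<Longrightarrow> t \<in> cls c \<Longrightarrow> t \<in> cls c' \<Longrightarrow> c = c'"
  by (metis barC_mem(2))

lemma barC_iso:
  assumes "c \<in> bar_val F (Cor n)" "t \<in> cls c" "t' \<in> dgraphs F n"
  shows "t' \<in> cls c \<longleftrightarrow> dgraph_iso n t t'"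
  using barC_mem(2)[OF assms(1,2)] assms(3) by (metis (no_types, lifting) barel.sel(2) dcls_def mem_Collect_eq)

lemma barC_I:
  assumes "C \<subseteq> dgraphs F n" "t \<in> C"
    and "\<And>t'. t' \<in> dgraphs F n \<Longrightarrow> dgraph_iso n t t' \<Longrightarrow> t' \<in> C"
    and "\<And>t'. t' \<in> C \<Longrightarrow> dgraph_iso n t t'"
  shows "Cls C \<in> bar_val F (Cor n)"
proof -
  have "C = dcls F n t" using assms by (auto simp: dcls_def)
  then show ?thesis using assms by (auto simp: bar_val_Cor)
qed

lemma bar_simps [simp]: "val (bar F) X = bar_val F X" "res (bar F) = bar_res F"
  by (simp_all add: bar_def)

lemma bar_res_UU: "bar_res F X Unit f (Colour c) = Colour (res F X Unit f c)"
  by (simp add: bar_res_def)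

lemma bar_res_CC: "bar_res F (Cor m) (Cor n) f c = Cls ((\<lambda>(G, l, d). (G, compose m l (mH f), d)) ` cls c)"
  by (simp add: bar_res_def)

lemma ports_arcs: "l \<in> n \<rightarrow>\<^sub>E ports G \<Longrightarrow> l \<in> n \<rightarrow> Arcs G"
  by (auto simp: ports_def)

lemma port_arc_arcs:
  "jk_graph G \<Longrightarrow> l \<in> n \<rightarrow> Arcs G \<Longrightarrow> a \<in> PortArc ` n \<union> FlagArc ` n \<Longrightarrow> port_arc G l a \<in> Arcs G"
  by (auto simp: port_arc_def Pi_iff)

text \<open>The colour at a labelled port is invariant under isomorphisms that respect labels and
  decorations. So the image taken in \<open>bar_res\<close> is a singleton, and any representative
  computes it.\<close>

lemma bar_res_UC:
  fixes F :: "('u,'x) species"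
  assumes c: "c \<in> bar_val F (Cor n)" and t: "(G, l, d) \<in> cls c" and a: "a \<in> PortArc ` n \<union> FlagArc ` n"
  shows "bar_res F Unit (Cor n) (uat (corolla n) a) c = Colour (d Unit (uat G (port_arc G l a)))"
proof -
  define r :: "('u,'x) dgraph \<Rightarrow> 'x" where "r = (\<lambda>(G, l, d). d Unit (unit_map
    (\<lambda>t. port_arc G l (mA (uat (corolla n) a) (UnitArc t)))))"
  have rr: "r (G', l', d') = d' Unit (uat G' (port_arc G' l' a))" if "(G', l', d') \<in> dgraphs F n" for G' l' d'
    using that a ports_arcs[of l' n G'] by (simp add: r_def unit_map_port_arc dgraphs_iff del: uat_mA)
  have tD: "(G, l, d) \<in> dgraphs F n" using barC_mem[OF c t] by simp
  have "r t' = r (G, l, d)" if t': "t' \<in> cls c" for t'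
  proof -
    obtain G' l' d' where t'': "t' = (G', l', d')" by (cases t')
    have tD': "(G', l', d') \<in> dgraphs F n" using barC_mem[OF c t'] t'' by simp
    obtain f where f: "graph_iso G G' f" "\<And>k. k \<in> n \<Longrightarrow> mA f (l k) = l' k"
      "d = nt_comp (yon G) d' (yon_map G f)"
      using barC_iso[OF c t tD'] t' unfolding t'' dgraph_iso_def by auto
    have e: "etale G G' f" using f by (simp add: graph_iso_etale)
    have J: "jk_graph G" "jk_graph G'" using tD tD' by (simp_all add: dgraphs_iff)
    have l: "l \<in> n \<rightarrow> Arcs G" using tD by (simp add: dgraphs_iff ports_arcs)
    have "mA f (port_arc G l a) = port_arc G' l' a"
      using a f(2) l by (auto simp: port_arc_def etale_gi[OF e] Pi_iff)
    then have "d Unit (uat G (port_arc G l a)) = d' Unit (uat G' (port_arc G' l' a))"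
      unfolding f(3) using J e port_arc_arcs[OF J(1) l a] by (simp add: gcomp_uat[OF e])
    then show ?thesis unfolding t'' rr[OF tD] rr[OF tD'] by simp
  qed
  then have "r ` cls c = {r (G, l, d)}" using t by blast
  then show ?thesis using rr[OF tD] by (simp add: bar_res_def r_def)
qed

lemma relabel_dgraphs:
  assumes "(G, l, d) \<in> dgraphs F n" "bij_betw \<sigma> m n"
  shows "(G, compose m l \<sigma>, d) \<in> dgraphs F m"
  using assms unfolding dgraphs_iff
  by (auto simp: compose_def bij_betw_def inj_on_def image_image)

lemma bar_res_CC_in:
  assumes c: "c \<in> bar_val F (Cor n)" and f: "f \<in> el_hom (Cor m) (Cor n)"
  shows "bar_res F (Cor m) (Cor n) f c \<in> bar_val F (Cor m)"
proof -
  let ?\<sigma> = "mH f"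
  have b: "bij_betw ?\<sigma> m n" using f by (rule el_hom_cor_bij)
  let ?r = "\<lambda>(G, l, d). (G, compose m l ?\<sigma>, d)"
  have rD: "?r t \<in> dgraphs F m" if "t \<in> dgraphs F n" for t
    using that relabel_dgraphs[OF _ b] by (cases t) auto
  obtain G l d where t: "(G, l, d) \<in> cls c" "(G, l, d) \<in> dgraphs F n" using barC_ne[OF c] .
  show ?thesis unfolding bar_res_CC
  proof (rule barC_I[where t = "?r (G, l, d)"])
    show "?r ` cls c \<subseteq> dgraphs F m" using rD barC_mem(1)[OF c] by auto
    show "?r (G, l, d) \<in> ?r ` cls c" using t by blast
  next
    fix t' assume "t' \<in> ?r ` cls c"
    then obtain G' l' d' where t': "(G', l', d') \<in> cls c" "t' = (G', compose m l' ?\<sigma>, d')" by auto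
    have "dgraph_iso n (G, l, d) (G', l', d')" using barC_iso[OF c t(1) barC_mem(1)[OF c t'(1)]] t' by simp
    then show "dgraph_iso m (?r (G, l, d)) t'"
      using b unfolding dgraph_iso_def t' by (auto simp: compose_def bij_betw_def)
  next
    fix t' assume t': "t' \<in> dgraphs F m" "dgraph_iso m (?r (G, l, d)) t'"
    obtain G' l' d' where t'': "t' = (G', l', d')" by (cases t')
    \<comment> \<open>The labelling of the isomorphic copy is moved back along the bijection, which
      gives a member of the original class that relabels to \<open>t'\<close>.\<close>
    define l0 where "l0 = compose n l' (inv_into m ?\<sigma>)"
    have "bij_betw (inv_into m ?\<sigma>) n m" using b by (rule bij_betw_inv_into)
    then have D: "(G', l0, d') \<in> dgraphs F n"
      unfolding l0_def using t'(1) t'' by (blast intro: relabel_dgraphs)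
    have "l' \<in> extensional m" using t'(1) t'' by (auto simp: dgraphs_iff PiE_def)
    then have l0: "compose m l0 ?\<sigma> = l'"
      unfolding l0_def using b
      by (auto simp: compose_def bij_betw_def fun_eq_iff extensional_def)
    have k0: "l' (inv_into m ?\<sigma> k) = l0 k" "?\<sigma> (inv_into m ?\<sigma> k) = k" "inv_into m ?\<sigma> k \<in> m" if "k \<in> n" for k
      using that b unfolding l0_def by (auto simp: compose_def bij_betw_inv_into_right bij_betw_def inv_into_into)
    obtain f where f: "graph_iso G G' f" "\<forall>k\<in>m. mA f (compose m l ?\<sigma> k) = l' k"
      "d = nt_comp (yon G) d' (yon_map G f)"
      using t'(2) unfolding t'' dgraph_iso_def by auto
    have "mA f (l k) = l0 k" if "k \<in> n" for k
      using f(2) k0[OF that] by (force simp: compose_def)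
    then have "dgraph_iso n (G, l, d) (G', l0, d')"
      unfolding dgraph_iso_def using f by auto
    then have "(G', l0, d') \<in> cls c" using barC_iso[OF c t(1) D] by simp
    then show "t' \<in> ?r ` cls c" unfolding t'' by (rule rev_image_eqI) (simp add: l0)
  qed
qed

section \<open>Action of natural transformations on classes\<close>

lemma bar_map_Unit [simp]: "c \<in> val F Unit \<Longrightarrow> bar_map F \<alpha> Unit (Colour c) = Colour (\<alpha> Unit c)"
  by (simp add: bar_map_def)

lemma bar_map_Cor:
  "finite n \<Longrightarrow> c \<in> bar_val F (Cor n) \<Longrightarrow>
    bar_map F \<alpha> (Cor n) c = Cls ((\<lambda>(G, l, d). (G, l, nt_comp (yon G) \<alpha> d)) ` cls c)"
  by (simp add: bar_map_def)

text \<open>A whole class has to be carried onto a whole class. The point is that any isomorphic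
  copy of an image is itself an image.\<close>

lemma bar_map_in:
  assumes \<alpha>: "\<alpha> \<in> nt_hom F G" and X: "X \<in> elObs" and c: "c \<in> bar_val F X"
  shows "bar_map F \<alpha> X c \<in> bar_val G X"
  using X
proof (cases rule: elObs_cases)
  case 1
  then show ?thesis using c nt_in[OF \<alpha>] by auto
next
  case (2 n)
  let ?r = "\<lambda>(G, l, d). (G, l, nt_comp (yon G) \<alpha> d)"
  have rD: "?r t \<in> dgraphs G n" if "t \<in> dgraphs F n" for t
    using that by (cases t) (auto simp: dgraphs_iff intro!: nt_comp_nt[OF _ _ \<alpha>])
  have c: "c \<in> bar_val F (Cor n)" using c 2 by simp
  obtain S l d where t: "(S, l, d) \<in> cls c" "(S, l, d) \<in> dgraphs F n" using barC_ne[OF c] .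
  have d: "d \<in> nt_hom (yon S) F" using t by (simp add: dgraphs_iff)
  show ?thesis unfolding 2 bar_map_Cor[OF 2(2) c]
  proof (rule barC_I[where t = "?r (S, l, d)"])
    show "?r ` cls c \<subseteq> dgraphs G n" using rD barC_mem(1)[OF c] by auto
    show "?r (S, l, d) \<in> ?r ` cls c" using t by blast
  next
    fix t' assume "t' \<in> ?r ` cls c"
    then obtain S' l' d' where t': "(S', l', d') \<in> cls c" "t' = ?r (S', l', d')" by auto
    have "dgraph_iso n (S, l, d) (S', l', d')" using barC_iso[OF c t(1) barC_mem(1)[OF c t'(1)]] t' by simp
    then obtain f where f: "graph_iso S S' f" "\<forall>k\<in>n. mA f (l k) = l' k"
      "d = nt_comp (yon S) d' (yon_map S f)"
      unfolding dgraph_iso_def by auto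
    have "nt_comp (yon S) \<alpha> d = nt_comp (yon S) (nt_comp (yon S') \<alpha> d') (yon_map S f)"
      unfolding f(3) using graph_iso_etale[OF f(1)] t(2)
      by (intro nt_comp_cong) (auto simp: dgraphs_iff)
    then show "dgraph_iso n (?r (S, l, d)) t'"
      using f unfolding dgraph_iso_def t' by auto
  next
    fix t' assume t': "t' \<in> dgraphs G n" "dgraph_iso n (?r (S, l, d)) t'"
    obtain S' l' d' where t'': "t' = (S', l', d')" by (cases t')
    obtain f where f: "graph_iso S S' f" "\<forall>k\<in>n. mA f (l k) = l' k"
      "nt_comp (yon S) \<alpha> d = nt_comp (yon S) d' (yon_map S f)"
      using t'(2) unfolding t'' dgraph_iso_def by auto
    obtain g where g: "graph_iso S' S g" "gcomp S g f = gid S" "gcomp S' f g = gid S'"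
      using graph_iso_inverse[OF f(1)] .
    have e: "etale S S' f" "etale S' S g" using f g by (simp_all add: graph_iso_etale)
    have J: "jk_graph S" "jk_graph S'" using t t' t'' by (simp_all add: dgraphs_iff)
    \<comment> \<open>The decoration over \<open>F\<close> of the copy: \<open>d\<close> pulled back
      along the inverse isomorphism. Composed with \<open>\<alpha>\<close> it gives the prescribed
      \<open>d'\<close>.\<close>
    let ?d = "nt_comp (yon S') d (yon_map S' g)"
    have D: "(S', l', ?d) \<in> dgraphs F n"
      using t'(1) nt_comp_nt[OF _ yon_map_nt[OF e(2)] d] J unfolding t'' by (simp add: dgraphs_iff)
    have "nt_comp (yon S) ?d (yon_map S f) = d"
      unfolding nt_comp_yon_map_assoc[OF J e] g using d J by (simp add: nt_comp_yon_map_gid)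
    then have "dgraph_iso n (S, l, d) (S', l', ?d)"
      unfolding dgraph_iso_def using f by auto
    then have m: "(S', l', ?d) \<in> cls c" using barC_iso[OF c t(1) D] by simp
    have "nt_comp (yon S') \<alpha> ?d = nt_comp (yon S') (nt_comp (yon S) \<alpha> d) (yon_map S' g)"
      using e by (intro nt_comp_cong) auto
    also have "\<dots> = d'"
      unfolding f(3) nt_comp_yon_map_assoc[OF J(2,1) e(2,1)] g
      by (rule nt_comp_yon_map_gid[where F = G, OF _ J(2)])
        (use t'(1) in \<open>simp add: t'' dgraphs_iff\<close>)
    finally show "t' \<in> ?r ` cls c" unfolding t'' by (intro rev_image_eqI[OF m]) simp
  qed
qed

lemma bar_map_mem:
  assumes "finite n" "c \<in> bar_val F (Cor n)" "(G, l, d) \<in> cls c"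
  shows "(G, l, nt_comp (yon G) \<alpha> d) \<in> cls (bar_map F \<alpha> (Cor n) c)"
  using assms by (auto simp: bar_map_Cor intro!: rev_image_eqI)

section \<open>Labelled tails\<close>

text \<open>Passes from labels of ports to labels of tails: this is the half-edge opposite to the
  port named \<open>k\<close>, so that labellings, too, are expressed through half-edges.\<close>

definition tailh :: "('a,'h,'v) graph \<Rightarrow> ('l \<Rightarrow> 'a) \<Rightarrow> 'l \<Rightarrow> 'h" where
  "tailh G l k = inv_into (Halves G) (gs G) (gi G (l k))"

definition tails :: "('a,'h,'v) graph \<Rightarrow> 'h set" where
  "tails G = {h \<in> Halves G. hinv G h = h}"

lemma tails_iff: "h \<in> tails G \<longleftrightarrow> h \<in> Halves G \<and> hinv G h = h"
  by (simp add: tails_def)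

lemma tailh_eqI: "jk_graph G \<Longrightarrow> h \<in> Halves G \<Longrightarrow> l k = gi G (gs G h) \<Longrightarrow> tailh G l k = h"
  using jk_inj[of G] by (simp add: tailh_def)

lemma tailh_port:
  assumes "full G" "l k \<in> ports G"
  shows "tailh G l k \<in> Halves G" "hinv G (tailh G l k) = tailh G l k"
    "l k = gi G (gs G (tailh G l k))" "gs G (tailh G l k) = gi G (l k)"
proof -
  obtain h where h: "h \<in> Halves G" "hinv G h = h" "l k = gi G (gs G h)"
    using assms full_ports by auto
  then have "tailh G l k = h" using assms(1) by (intro tailh_eqI) auto
  then show "tailh G l k \<in> Halves G" "hinv G (tailh G l k) = tailh G l k"
    "l k = gi G (gs G (tailh G l k))" "gs G (tailh G l k) = gi G (l k)"
    using h assms(1) by simp_all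
qed

lemma bij_tail_port: "full G \<Longrightarrow> bij_betw (\<lambda>h. gi G (gs G h)) (tails G) (ports G)"
  by (auto simp: bij_betw_def inj_on_def full_ports tails_def)

lemma tailh_bij:
  assumes G: "full G" and l: "bij_betw l n (ports G)"
  shows "bij_betw (tailh G l) n (tails G)"
proof -
  have p: "l k \<in> ports G" if "k \<in> n" for k using l that by (auto simp: bij_betw_def)
  have "bij_betw (inv_into (tails G) (\<lambda>h. gi G (gs G h)) \<circ> l) n (tails G)"
    using bij_betw_trans[OF l bij_betw_inv_into[OF bij_tail_port[OF G]]] .
  moreover have "(inv_into (tails G) (\<lambda>h. gi G (gs G h)) \<circ> l) k = tailh G l k" if "k \<in> n" for k
  proof -
    have "tailh G l k \<in> tails G" using tailh_port(1,2)[where l = l, OF G p[OF that]] by (simp add: tails_def)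
    then have "inv_into (tails G) (\<lambda>h. gi G (gs G h)) (gi G (gs G (tailh G l k))) = tailh G l k"
      using bij_tail_port[OF G] by (intro inv_into_f_f) (auto simp: bij_betw_def)
    then show ?thesis using tailh_port(3)[where l = l, OF G p[OF that]] by simp
  qed
  ultimately show ?thesis by (simp cong: bij_betw_cong)
qed

definition lab :: "('a,'h,'v) graph \<Rightarrow> 'l set \<Rightarrow> ('l \<Rightarrow> 'h) \<Rightarrow> 'l \<Rightarrow> 'a" where
  "lab G n t = (\<lambda>k\<in>n. gi G (gs G (t k)))"

lemma lab_bij:
  assumes "full G" "bij_betw t n (tails G)"
  shows "bij_betw (lab G n t) n (ports G)" "lab G n t \<in> n \<rightarrow>\<^sub>E ports G"
proof -
  have "bij_betw ((\<lambda>h. gi G (gs G h)) \<circ> t) n (ports G)"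
    by (rule bij_betw_trans[OF assms(2) bij_tail_port[OF assms(1)]])
  then show b: "bij_betw (lab G n t) n (ports G)"
    by (subst bij_betw_cong[where g = "(\<lambda>h. gi G (gs G h)) \<circ> t"]) (auto simp: lab_def)
  then show "lab G n t \<in> n \<rightarrow>\<^sub>E ports G" by (auto simp: lab_def bij_betw_def)
qed

lemma tailh_lab:
  assumes "jk_graph G" "k \<in> n" "t k \<in> Halves G" shows "tailh G (lab G n t) k = t k"
  using assms by (intro tailh_eqI) (auto simp: lab_def)

lemma iso_label:
  assumes "full G" "full G'" "etale G G' f" "l k \<in> ports G" "l' k \<in> ports G'"
  shows "mA f (l k) = l' k \<longleftrightarrow> mH f (tailh G l k) = tailh G' l' k"
proof -
  note a = tailh_port[where l = l, OF assms(1,4)] and b = tailh_port[where l = l', OF assms(2,5)]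
  have J: "jk_graph G" "jk_graph G'" using assms by auto
  have "mA f (l k) = gi G' (gs G' (mH f (tailh G l k)))"
    using arg_cong[OF a(3), of "mA f"] etale_arc_tail[OF assms(3) J(1) a(1)] by simp
  moreover have "mH f (tailh G l k) \<in> Halves G'" using a assms(3) by simp
  ultimately show ?thesis using a(1) b(1,3) J by (metis jk_gi_eq jk_gs jk_gs_eq)
qed

lemma hv_graph_iso:
  assumes G: "full G" and K: "full K" and H: "bij_betw \<eta> (Halves G) (Halves K)"
    and V: "bij_betw \<nu> (Verts G) (Verts K)"
    and p: "\<And>h. h \<in> Halves G \<Longrightarrow> gp K (\<eta> h) = \<nu> (gp G h)"
    and j: "\<And>h. h \<in> Halves G \<Longrightarrow> hinv K (\<eta> h) = \<eta> (hinv G h)"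
  shows "graph_iso G K (hv_mor G K \<eta> \<nu>)"
proof (rule hv_iso[OF G K])
  have J: "jk_graph G" "jk_graph K" using G K by auto
  have inj: "\<eta> h = \<eta> h' \<longleftrightarrow> h = h'" if "h \<in> Halves G" "h' \<in> Halves G" for h h'
    using H that by (auto simp: bij_betw_def inj_on_def)
  have \<nu>inj: "\<nu> h = \<nu> h' \<longleftrightarrow> h = h'" if "h \<in> Verts G" "h' \<in> Verts G" for h h'
    using V that by (auto simp: bij_betw_def inj_on_def)
  show "etale G K (hv_mor G K \<eta> \<nu>)"
  proof (rule hv_etale[OF G J(2)])
    show "\<eta> ` Halves G \<subseteq> Halves K" "\<nu> ` Verts G \<subseteq> Verts K" using H V by (auto simp: bij_betw_def)
    fix x assume x: "x \<in> Verts G"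
    show "bij_betw \<eta> (flags_at G x) (flags_at K (\<nu> x))"
      unfolding bij_betw_def
    proof (intro conjI set_eqI iffI)
      show "inj_on \<eta> (flags_at G x)" using inj by (auto simp: inj_on_def flags_at_iff)
      fix k assume "k \<in> \<eta> ` flags_at G x" then show "k \<in> flags_at K (\<nu> x)"
        using p H by (auto simp: flags_at_iff bij_betw_def)
    next
      fix k assume k: "k \<in> flags_at K (\<nu> x)"
      then obtain h where "h \<in> Halves G" "k = \<eta> h" using H by (auto simp: flags_at_iff bij_betw_def)
      then show "k \<in> \<eta> ` flags_at G x" using k p \<nu>inj x J by (auto simp: flags_at_iff)
    qed
  next
    fix h assume h: "h \<in> Halves G" "hinv G h \<noteq> h"
    have "hinv K (\<eta> h) \<noteq> \<eta> h" "\<eta> h \<in> Halves K" using h J j inj H by (auto simp: bij_betw_def)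
    then show "gi K (gs K (\<eta> h)) = gs K (\<eta> (hinv G h))" using j h J by (simp add: gi_gs)
  qed (use p in auto)
  show "bij_betw (mH (hv_mor G K \<eta> \<nu>)) (Halves G) (Halves K)"
    using H by (simp cong: bij_betw_cong)
  show "bij_betw (mV (hv_mor G K \<eta> \<nu>)) (Verts G) (Verts K)"
    using V by (simp cong: bij_betw_cong)
qed (use j in auto)

section \<open>Decorations with values in a graph\<close>

lemma yon_dgraphs_iff:
  fixes Y :: "('b,'k,'w) graph"
  assumes Y: "jk_graph Y"
  shows "(G, l, d) \<in> dgraphs (yon Y) n \<longleftrightarrow> full G \<and> Verts G \<noteq> {} \<and>
    l \<in> n \<rightarrow>\<^sub>E ports G \<and> bij_betw l n (ports G) \<and> (\<exists>e. etale G Y e \<and> d = yon_map G e)"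
  using yon_full[OF _ Y, of G d] full_jk[of G] by (auto simp: dgraphs_iff)

lemma yon_dgraphsI:
  fixes Y :: "('b,'k,'w) graph"
  assumes "full G" "Verts G \<noteq> {}" "l \<in> n \<rightarrow>\<^sub>E ports G" "bij_betw l n (ports G)" "etale G Y e"
  shows "(G, l, yon_map G e) \<in> dgraphs (yon Y) n"
  using assms by (simp add: dgraphs_iff)

text \<open>Faithfulness of \<open>yon_map\<close> turns the equality of decorations into
  commutativity of a triangle of etale maps over \<open>Y\<close>.\<close>

lemma yon_dgraph_iso:
  fixes Y :: "('b,'k,'w) graph" and G :: "'u gr"
  assumes "jk_graph G" "jk_graph G'" "etale G Y e" "etale G' Y e'"
  shows "dgraph_iso n (G, l, yon_map G e) (G', l', yon_map G' e') \<longleftrightarrow>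
    (\<exists>f. graph_iso G G' f \<and> (\<forall>k\<in>n. mA f (l k) = l' k) \<and> e = gcomp G e' f)"
proof -
  have "((yon_map G e :: ('u,_,_) nt) = nt_comp (yon G) (yon_map G' e') (yon_map G f)) \<longleftrightarrow> e = gcomp G e' f"
    if f: "graph_iso G G' f" for f
  proof -
    have f': "etale G G' f" using f by (rule graph_iso_etale)
    have "etale G Y (gcomp G e' f)" using assms f' by (intro etale_gcomp)
    then show ?thesis
      using assms f' yon_map_inj[OF assms(1,3), of Y "gcomp G e' f"]
      by (auto simp: yon_map_gcomp)
  qed
  then show ?thesis unfolding dgraph_iso_def by auto
qed

text \<open>Arcs, and with them the port labels, follow from the half-edges since there are no
  isolated edges. Glued graphs and cuts are compared in this form below.\<close>

lemma yon_dgraph_isoI: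
  fixes Y :: "('b,'k,'w) graph"
  assumes t: "(G, l, yon_map G e) \<in> dgraphs (yon Y) n" and t': "(G', l', yon_map G' e') \<in> dgraphs (yon Y) n"
    and e: "etale G Y e" "etale G' Y e'"
    and H: "bij_betw \<eta> (Halves G) (Halves G')" and V: "bij_betw \<nu> (Verts G) (Verts G')"
    and p: "\<And>h. h \<in> Halves G \<Longrightarrow> gp G' (\<eta> h) = \<nu> (gp G h)"
    and j: "\<And>h. h \<in> Halves G \<Longrightarrow> hinv G' (\<eta> h) = \<eta> (hinv G h)"
    and l: "\<And>k. k \<in> n \<Longrightarrow> \<eta> (tailh G l k) = tailh G' l' k"
    and eH: "\<And>h. h \<in> Halves G \<Longrightarrow> mH e' (\<eta> h) = mH e h"
    and eV: "\<And>x. x \<in> Verts G \<Longrightarrow> mV e' (\<nu> x) = mV e x"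
  shows "dgraph_iso n (G, l, yon_map G e) (G', l', yon_map G' e')"
proof -
  have G: "full G" "full G'" using t t' by (simp_all add: dgraphs_iff)
  have f: "graph_iso G G' (hv_mor G G' \<eta> \<nu>)" by (rule hv_graph_iso[OF G H V p j])
  note fe = graph_iso_etale[OF f]
  have "e = gcomp G e' (hv_mor G G' \<eta> \<nu>)"
    by (rule etale_eq_fullI[OF G(1) e(1)]) (use G e fe eH eV in \<open>auto intro: etale_gcomp\<close>)
  moreover have "mA (hv_mor G G' \<eta> \<nu>) (l k) = l' k" if k: "k \<in> n" for k
  proof -
    have a: "l k \<in> ports G" "l' k \<in> ports G'" using t t' k by (auto simp: dgraphs_iff)
    then show ?thesis using iso_label[where l = l and l' = l', OF G fe a] l[OF k] tailh_port(1)[where l = l, OF G(1) a(1)] by simp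
  qed
  ultimately show ?thesis using f G e by (subst yon_dgraph_iso) auto
qed

section \<open>The glued graph\<close>

text \<open>The tail, in the piece at the vertex of \<open>f\<close>, whose opposite arc is the port
  \<open>port_of S T f\<close>. Gluing joins these tails in the way \<open>hinv S\<close> joins the
  half-edges of \<open>S\<close>.\<close>

definition ptail :: "'u gr \<Rightarrow> ('u \<Rightarrow> ('u,'x) dgraph) \<Rightarrow> 'u \<Rightarrow> 'u" where
  "ptail S T f = tailh (piece T (gp S f)) (fst (snd (T (gp S f)))) f"

locale gluing =
  fixes S :: "'u gr" and T :: "'u \<Rightarrow> ('u,'x) dgraph" and F :: "('u,'x) species"
  assumes S: "full S" and T: "\<And>y. y \<in> Verts S \<Longrightarrow> T y \<in> dgraphs F (flags_at S y)"
begin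

abbreviation "G y \<equiv> piece T y"
abbreviation "L y \<equiv> fst (snd (T y))"
abbreviation "q \<equiv> port_of S T"
abbreviation "flip \<equiv> pre_flip S T"
abbreviation "cl \<equiv> glue_class S T"

lemma jk_S [simp]: "jk_graph S" using S by simp

lemma G: "y \<in> Verts S \<Longrightarrow> full (G y)" "y \<in> Verts S \<Longrightarrow> jk_graph (G y)"
  "y \<in> Verts S \<Longrightarrow> bij_betw (L y) (flags_at S y) (ports (G y))"
  using T[of y] by (cases "T y"; auto simp: dgraphs_iff)+

lemma L_port: "f \<in> Halves S \<Longrightarrow> L (gp S f) f \<in> ports (G (gp S f))"
  using G(3)[of "gp S f"] by (auto simp: bij_betw_def flags_at_iff)

lemma ptail: assumes "f \<in> Halves S"
  shows "ptail S T f \<in> Halves (G (gp S f))" "hinv (G (gp S f)) (ptail S T f) = ptail S T f"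
   and ptail_L: "L (gp S f) f = gi (G (gp S f)) (gs (G (gp S f)) (ptail S T f))"
proof -
  have "full (G (gp S f))" using assms G by simp
  note * = tailh_port[where l = "L (gp S f)", OF this L_port[OF assms], folded ptail_def]
  show "ptail S T f \<in> Halves (G (gp S f))" "hinv (G (gp S f)) (ptail S T f) = ptail S T f"
   "L (gp S f) f = gi (G (gp S f)) (gs (G (gp S f)) (ptail S T f))" using * by blast+
qed

lemma ptail_surj:
  assumes "y \<in> Verts S" "h \<in> Halves (G y)" "hinv (G y) h = h"
  obtains f where "f \<in> Halves S" "gp S f = y" "h = ptail S T f"
proof -
  have "h \<in> tails (G y)" using assms by (simp add: tails_iff)
  then have "h \<in> tailh (G y) (L y) ` flags_at S y"
    using tailh_bij[OF G(1,3)[OF assms(1)]] by (auto simp: bij_betw_def)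
  then show ?thesis using that by (auto simp: flags_at_iff ptail_def)
qed

lemma q_eq: "q f = Inl (gp S f, L (gp S f) f)" by (simp add: port_of_def)

lemma q_inj: "f \<in> Halves S \<Longrightarrow> f' \<in> Halves S \<Longrightarrow> q f = q f' \<longleftrightarrow> f = f'"
  using G(3)[of "gp S f"] by (auto simp: q_eq bij_betw_def inj_on_def flags_at_iff)

lemma flip_q: "f \<in> Halves S \<Longrightarrow> flip (q f) = Inl (gp S f, gs (G (gp S f)) (ptail S T f))"
  using ptail(1)[of f] G(2)[of "gp S f"] by (simp add: q_eq pre_flip_def ptail_L)

lemma pre_arcs_eq: "pre_arcs S T = Inl ` (SIGMA y:Verts S. Arcs (G y))"
  using S unfolding full_def pre_arcs_def by simp

lemma q_pre: "f \<in> Halves S \<Longrightarrow> q f \<in> pre_arcs S T"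
  using L_port[of f] by (auto simp: q_eq pre_arcs_eq ports_def)

lemma half_pre: "y \<in> Verts S \<Longrightarrow> h \<in> Halves (G y) \<Longrightarrow> Inl (y, gs (G y) h) \<in> pre_arcs S T"
  using G(2) by (auto simp: pre_arcs_eq)

lemma flip_pre [simp]: "c \<in> pre_arcs S T \<Longrightarrow> flip c \<in> pre_arcs S T"
  "c \<in> pre_arcs S T \<Longrightarrow> flip (flip c) = c"
  using G(2) by (auto simp: pre_arcs_eq pre_flip_def)

lemma pre_cases:
  assumes "c \<in> pre_arcs S T"
  obtains (half) y h where "y \<in> Verts S" "h \<in> Halves (G y)" "c = Inl (y, gs (G y) h)"
    | (port) f where "f \<in> Halves S" "c = q f"
proof -
  obtain y a where c: "c = Inl (y, a)" "y \<in> Verts S" "a \<in> Arcs (G y)"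
    using assms by (auto simp: pre_arcs_eq)
  from G(1)[OF c(2)] c(3) show ?thesis
  proof (cases rule: full_arc_cases)
    case (half h) then show ?thesis using c that(1) by blast
  next
    case (port h)
    obtain f where f: "f \<in> Halves S" "gp S f = y" "h = ptail S T f"
      using ptail_surj[OF c(2) port(1,2)] .
    then show ?thesis using c port that(2)[of f] ptail_L[of f] by (simp add: q_eq)
  qed
qed

lemma q_not_half: "f \<in> Halves S \<Longrightarrow> h \<in> Halves (G y) \<Longrightarrow> q f \<noteq> Inl (y, gs (G y) h)"
  using L_port[of f] by (auto simp: q_eq ports_def)

text \<open>Every class of identified arcs has at most two elements; this picks a representative,
  preferring arcs that are attached to a half-edge.\<close>

definition N :: "'u prearc \<Rightarrow> 'u prearc" where
  "N c = (if \<exists>f\<in>Halves S. c = q f \<and> hinv S f \<noteq> f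
     then flip (q (hinv S (THE f. f \<in> Halves S \<and> c = q f))) else c)"

lemma N_q: assumes "f \<in> Halves S"
  shows "N (q f) = (if hinv S f = f then q f else flip (q (hinv S f)))"
proof -
  have "(THE f'. f' \<in> Halves S \<and> q f = q f') = f"
    using assms q_inj by (intro the_equality) auto
  then show ?thesis using assms q_inj by (auto simp: N_def)
qed

lemma N_half: "h \<in> Halves (G y) \<Longrightarrow> N (Inl (y, gs (G y) h)) = Inl (y, gs (G y) h)"
proof -
  assume "h \<in> Halves (G y)"
  then have "\<forall>f\<in>Halves S. Inl (y, gs (G y) h) \<noteq> q f" using q_not_half by metis
  then show ?thesis unfolding N_def by meson
qed

lemma N_flip_q: "f \<in> Halves S \<Longrightarrow> N (flip (q f)) = flip (q f)"
  using ptail(1)[of f] by (simp add: flip_q N_half)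

lemma edge_halves:
  assumes "f \<in> Halves S" "f' \<in> Halves S" "gi S (gs S f) = gs S f'"
  shows "hinv S f = f'" "hinv S f' = f" "f' \<noteq> f"
proof -
  show a: "hinv S f = f'" using assms by (intro hinv_eqI) auto
  then show "hinv S f' = f" using assms hinv_hinv[OF jk_S, of f] by simp
  show "f' \<noteq> f" using assms jk_gi_neq[OF jk_S, of "gs S f"] by auto
qed

lemma pre_rel_N: "(c, c') \<in> pre_rel S T \<Longrightarrow> N c = N c'"
  unfolding pre_rel_def using edge_halves by (fastforce simp: N_q N_flip_q)

lemma rel_N: "(c, c') \<in> (pre_rel S T \<union> (pre_rel S T)\<inverse>)\<^sup>* \<Longrightarrow> N c = N c'"
  by (induction rule: rtrancl_induct) (auto dest: pre_rel_N)

lemma N_rel: "c \<in> pre_arcs S T \<Longrightarrow> (c, N c) \<in> (pre_rel S T)\<^sup>="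
proof (erule pre_cases)
  fix f assume f: "f \<in> Halves S" "c = q f"
  then show ?thesis
    using gi_gs[OF jk_S f(1)] by (auto simp: N_q pre_rel_def)
qed (simp add: N_half)

text \<open>\<open>N\<close> is constant along the generating identifications, and every arc is at
  most one identification away from its value under \<open>N\<close>; so the equivalence closure is
  the kernel of \<open>N\<close>.\<close>

lemma glue_rel_iff:
  "(c, c') \<in> glue_rel S T \<longleftrightarrow> c \<in> pre_arcs S T \<and> c' \<in> pre_arcs S T \<and> N c = N c'"
proof -
  let ?R = "(pre_rel S T \<union> (pre_rel S T)\<inverse>)\<^sup>*"
  have "(c, c') \<in> ?R" if "c \<in> pre_arcs S T" "c' \<in> pre_arcs S T" "N c = N c'"
  proof -
    have "(c, N c) \<in> ?R" "(N c, c') \<in> ?R" using N_rel[OF that(1)] N_rel[OF that(2)] that(3) by auto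
    then show ?thesis by (rule rtrancl_trans)
  qed
  then show ?thesis using rel_N by (auto simp: glue_rel_def)
qed

lemma cl_eq: "c \<in> pre_arcs S T \<Longrightarrow> cl c = {c' \<in> pre_arcs S T. N c' = N c}"
  by (auto simp: glue_rel_iff)

lemma cl_eq_iff: "c \<in> pre_arcs S T \<Longrightarrow> c' \<in> pre_arcs S T \<Longrightarrow> cl c = cl c' \<longleftrightarrow> N c = N c'"
  by (auto simp: cl_eq)

text \<open>Makes the flip well defined on classes: the only identifications are between
  \<open>q f\<close> and the flip of \<open>q (hinv S f)\<close>, and flipping such a pair gives
  another such pair.\<close>

lemma N_flip_N: "c \<in> pre_arcs S T \<Longrightarrow> N (flip (N c)) = N (flip c)"
  by (erule pre_cases) (simp_all add: N_half N_q N_flip_q q_pre)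

lemma N_flip: "c \<in> pre_arcs S T \<Longrightarrow> c' \<in> pre_arcs S T \<Longrightarrow> N c = N c' \<Longrightarrow> N (flip c) = N (flip c')"
  by (metis N_flip_N)

lemma glue_simps [simp]:
  "Halves (glue S T) = (SIGMA y:Verts S. Halves (G y))"
  "Verts (glue S T) = (SIGMA y:Verts S. Verts (G y))"
  by (simp_all add: glue_def Let_def)

lemma glue_arcs: "Arcs (glue S T) = cl ` pre_arcs S T"
  by (auto simp: glue_def Let_def quotient_def)

lemma glue_gs: "y \<in> Verts S \<Longrightarrow> h \<in> Halves (G y) \<Longrightarrow> gs (glue S T) (y, h) = cl (Inl (y, gs (G y) h))"
  by (simp add: glue_def Let_def)

lemma glue_gp: "y \<in> Verts S \<Longrightarrow> h \<in> Halves (G y) \<Longrightarrow> gp (glue S T) (y, h) = (y, gp (G y) h)"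
  by (simp add: glue_def Let_def)

lemma glue_gi: assumes "c \<in> pre_arcs S T" shows "gi (glue S T) (cl c) = cl (flip c)"
proof -
  have "gi (glue S T) (cl c) = flip ` cl c"
    using assms by (simp add: glue_def Let_def quotientI)
  also have "\<dots> = cl (flip c)"
  proof (intro set_eqI iffI)
    fix x assume "x \<in> flip ` cl c"
    then show "x \<in> cl (flip c)" using assms by (auto simp: cl_eq dest: N_flip)
  next
    fix x assume "x \<in> cl (flip c)"
    then have x: "x \<in> pre_arcs S T" "N x = N (flip c)" using assms by (auto simp: cl_eq)
    then have "N (flip x) = N c" using N_flip[OF x(1) _ x(2)] assms by simp
    then show "x \<in> flip ` cl c" using x assms by (intro image_eqI[of _ _ "flip x"]) (auto simp: cl_eq)
  qed
  finally show ?thesis .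
qed

text \<open>The quotient does not identify an arc with its own flip. For the arc attached to the
  tail at \<open>f\<close> the flip is \<open>q f\<close>, whose normal form is \<open>q f\<close>
  itself or, when \<open>hinv S\<close> moves \<open>f\<close>, the arc attached to a different
  tail.\<close>

lemma N_flip_neq: assumes "c \<in> pre_arcs S T" shows "N (flip c) \<noteq> N c"
proof -
  have h: "N (flip (Inl (y, gs (G y) h))) \<noteq> N (Inl (y, gs (G y) h))"
    if y: "y \<in> Verts S" and h: "h \<in> Halves (G y)" for y h
    using G(2)[OF y] h
  proof (cases rule: hinv_cases)
    case inner
    then have "flip (Inl (y, gs (G y) h)) = Inl (y, gs (G y) (hinv (G y) h))" by (simp add: pre_flip_def)
    then show ?thesis using inner h G(2)[OF y] by (simp add: N_half)
  next
    case tail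
    obtain f where f: "f \<in> Halves S" "gp S f = y" "h = ptail S T f" using ptail_surj[OF y h tail(1)] .
    have *: "flip (q f) = Inl (y, gs (G y) h)" using f by (simp add: flip_q)
    then have "flip (Inl (y, gs (G y) h)) = q f" using q_pre[OF f(1)] by (metis flip_pre(2))
    moreover have "flip (q (hinv S f)) \<noteq> flip (q f)" if "hinv S f \<noteq> f"
      using that f q_pre q_inj by (metis flip_pre(2) hinv_in jk_S)
    then have "N (q f) \<noteq> Inl (y, gs (G y) h)"
      using N_q[OF f(1)] q_not_half[OF f(1) h] * by (cases "hinv S f = f") simp_all
    ultimately show ?thesis using N_half[OF h] by simp
  qed
  from assms show ?thesis
  proof (cases rule: pre_cases)
    case (half y h) then show ?thesis using h by simp
  next
    case (port f)
    have "N (flip (flip (q f))) \<noteq> N (flip (q f))"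
      using h[of "gp S f" "ptail S T f"] port ptail(1) by (simp add: flip_q)
    then show ?thesis using port assms by simp
  qed
qed

lemma jk_glue: "jk_graph (glue S T)"
  unfolding jk_graph_def
proof (intro conjI)
  have "finite (pre_arcs S T)"
    unfolding pre_arcs_eq using jk_finite[OF jk_S] jk_finite[OF G(2)] by auto
  then show "finite (Arcs (glue S T))" by (simp add: glue_arcs)
  show "finite (Halves (glue S T))" "finite (Verts (glue S T))"
    using jk_finite[OF jk_S] jk_finite[OF G(2)] by auto
  show "gs (glue S T) \<in> Halves (glue S T) \<rightarrow>\<^sub>E Arcs (glue S T)"
  proof (rule PiE_I)
    fix x assume "x \<in> Halves (glue S T)"
    then show "gs (glue S T) x \<in> Arcs (glue S T)" by (auto simp: glue_gs glue_arcs half_pre)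
  qed (auto simp: glue_def Let_def)
  show "gp (glue S T) \<in> Halves (glue S T) \<rightarrow>\<^sub>E Verts (glue S T)"
  proof (rule PiE_I)
    fix x assume "x \<in> Halves (glue S T)"
    then show "gp (glue S T) x \<in> Verts (glue S T)" using G(2) by (auto simp: glue_gp)
  qed (auto simp: glue_def Let_def)
  show "gi (glue S T) \<in> Arcs (glue S T) \<rightarrow>\<^sub>E Arcs (glue S T)"
  proof (rule PiE_I)
    fix x assume "x \<in> Arcs (glue S T)"
    then show "gi (glue S T) x \<in> Arcs (glue S T)" by (auto simp: glue_arcs glue_gi)
  qed (auto simp: glue_def Let_def)
  show "inj_on (gs (glue S T)) (Halves (glue S T))"
    using G(2) by (auto simp: inj_on_def glue_gs cl_eq_iff half_pre N_half)
  show "\<forall>a\<in>Arcs (glue S T). gi (glue S T) (gi (glue S T) a) = a \<and> gi (glue S T) a \<noteq> a"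
    by (auto simp: glue_arcs glue_gi cl_eq_iff N_flip_neq)
qed

text \<open>Every class contains an attached arc or some \<open>q f\<close>, and the flip of
  \<open>q f\<close> is attached to \<open>ptail S T f\<close>.\<close>

lemma full_glue: "full (glue S T)"
proof (rule fullI[OF jk_glue])
  fix a assume "a \<in> Arcs (glue S T)"
  then obtain c where c: "c \<in> pre_arcs S T" "a = cl c" by (auto simp: glue_arcs)
  have im: "cl (Inl (y, gs (G y) h)) \<in> gs (glue S T) ` Halves (glue S T)"
    if "y \<in> Verts S" "h \<in> Halves (G y)" for y h
    using that by (intro image_eqI[of _ _ "(y, h)"]) (auto simp: glue_gs)
  from c(1) show "a \<in> gs (glue S T) ` Halves (glue S T) \<or>
      gi (glue S T) a \<in> gs (glue S T) ` Halves (glue S T)"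
  proof (cases rule: pre_cases)
    case (half y h) then show ?thesis using im c by simp
  next
    case (port f)
    then have "gi (glue S T) a = cl (Inl (gp S f, gs (G (gp S f)) (ptail S T f)))"
      using c by (simp add: glue_gi flip_q)
    then show ?thesis using im[of "gp S f" "ptail S T f"] port ptail(1) by simp
  qed
qed

lemma glue_gi_gs: "y \<in> Verts S \<Longrightarrow> h \<in> Halves (G y) \<Longrightarrow>
    gi (glue S T) (gs (glue S T) (y, h)) = cl (Inl (y, gi (G y) (gs (G y) h)))"
  by (simp add: glue_gs glue_gi half_pre pre_flip_def)

lemma glue_gi_gs_ptail:
  "f \<in> Halves S \<Longrightarrow> gi (glue S T) (gs (glue S T) (gp S f, ptail S T f)) = cl (q f)"
  using ptail(1)[of f] by (simp add: glue_gi_gs q_eq flip: ptail_L)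

lemma hinv_glue:
  assumes "y \<in> Verts S" "h \<in> Halves (G y)" "hinv (G y) h \<noteq> h"
  shows "hinv (glue S T) (y, h) = (y, hinv (G y) h)"
proof (rule hinv_eqI[OF jk_glue])
  show "gi (glue S T) (gs (glue S T) (y, h)) = gs (glue S T) (y, hinv (G y) h)"
    using assms G(2)[OF assms(1)] by (simp add: glue_gi_gs gi_gs) (simp add: glue_gs)
qed (use assms G(2)[OF assms(1)] in auto)

text \<open>On an inner edge of \<open>S\<close>, \<open>q f\<close> is identified with the arc
  attached to the tail at the other end; for a tail \<open>f\<close> of \<open>S\<close> it is
  identified with no attached arc, so the half-edge stays open. Together with
  \<open>hinv_glue\<close> this computes the involution of the glued graph.\<close>

lemma hinv_glue_ptail:
  assumes "f \<in> Halves S"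
  shows "hinv (glue S T) (gp S f, ptail S T f) = (gp S (hinv S f), ptail S T (hinv S f))"
proof (cases "hinv S f = f")
  case False
  have f': "hinv S f \<in> Halves S" using assms by simp
  then have "cl (q f) = cl (flip (q (hinv S f)))"
    using False assms by (subst cl_eq_iff) (simp_all add: q_pre N_q N_flip_q)
  then have "gi (glue S T) (gs (glue S T) (gp S f, ptail S T f)) =
      gs (glue S T) (gp S (hinv S f), ptail S T (hinv S f))"
    using assms f' ptail(1)[OF f'] by (simp add: glue_gi_gs_ptail flip_q) (simp add: glue_gs)
  then show ?thesis using assms f' ptail(1)[OF assms] ptail(1)[OF f']
    by (intro hinv_eqI[OF jk_glue]) simp_all
next
  case True
  have m: "(gp S f, ptail S T f) \<in> Halves (glue S T)" using assms ptail(1)[OF assms] by simp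
  have "hinv (glue S T) (gp S f, ptail S T f) = (gp S f, ptail S T f)"
    using jk_glue m
  proof (cases rule: hinv_cases)
    case inner
    obtain y h where yh: "hinv (glue S T) (gp S f, ptail S T f) = (y, h)" by fastforce
    then have "y \<in> Verts S" "h \<in> Halves (G y)" using inner(2) by auto
    moreover have "cl (q f) = cl (Inl (y, gs (G y) h))"
      using inner(3) assms calculation by (simp add: glue_gi_gs_ptail yh glue_gs)
    ultimately have "N (q f) = Inl (y, gs (G y) h)" using assms
      by (simp add: cl_eq_iff q_pre half_pre N_half)
    then show ?thesis using True assms q_not_half[OF assms \<open>h \<in> Halves (G y)\<close>] by (simp add: N_q)
  qed
  then show ?thesis using True by simp
qed

lemma glue_in_etale:
  assumes y: "y \<in> Verts S" shows "etale (G y) (glue S T) (glue_in S T y)"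
proof (rule etaleI[OF G(2)[OF y]])
  show "mA (glue_in S T y) \<in> Arcs (G y) \<rightarrow>\<^sub>E Arcs (glue S T)"
    using y by (auto simp: glue_in_def glue_arcs pre_arcs_eq)
  show "mH (glue_in S T y) \<in> Halves (G y) \<rightarrow>\<^sub>E Halves (glue S T)"
    "mV (glue_in S T y) \<in> Verts (G y) \<rightarrow>\<^sub>E Verts (glue S T)"
    using y by (auto simp: glue_in_def)
  show "mA (glue_in S T y) (gi (G y) a) = gi (glue S T) (mA (glue_in S T y) a)" if "a \<in> Arcs (G y)" for a
  proof -
    have "Inl (y, a) \<in> pre_arcs S T" using that y by (auto simp: pre_arcs_eq)
    then show ?thesis using that y G(2)[OF y] by (simp add: glue_in_def glue_gi) (simp add: pre_flip_def)
  qed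
  show "bij_betw (mH (glue_in S T y)) (flags_at (G y) x) (flags_at (glue S T) (mV (glue_in S T y) x))"
    if "x \<in> Verts (G y)" for x
    using that y by (auto simp: bij_betw_def inj_on_def flags_at_iff glue_in_def glue_gp image_iff)
qed (use y G(2)[OF y] in \<open>auto simp: glue_in_def glue_gs glue_gp\<close>)

lemma glue_in_simps [simp]:
  "h \<in> Halves (G y) \<Longrightarrow> mH (glue_in S T y) h = (y, h)"
  "x \<in> Verts (G y) \<Longrightarrow> mV (glue_in S T y) x = (y, x)"
  by (auto simp: glue_in_def)

lemma glue_port_tail:
  assumes "f \<in> Halves S"
  shows "glue_port S T (gi S (gs S f)) = gi (glue S T) (gs (glue S T) (gp S f, ptail S T f))"
proof -
  have "(THE f'. f' \<in> Halves S \<and> gi S (gs S f) = gi S (gs S f')) = f"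
    using assms by (intro the_equality) auto
  then show ?thesis using assms S unfolding full_def by (simp add: glue_port_def glue_gi_gs_ptail)
qed

end

section \<open>Gluing in terms of half-edges and vertices\<close>

text \<open>A presentation of \<open>W\<close> as the glued graph from which arcs and quotients have
  disappeared: edges inside the pieces are kept, and the tails of the pieces are paired, or left
  open, by the involution of \<open>S\<close>.\<close>

definition assembles :: "'u gr \<Rightarrow> ('u \<Rightarrow> ('u,'x) dgraph) \<Rightarrow> 'u gr \<Rightarrow>
    ('u \<times> 'u \<Rightarrow> 'u) \<Rightarrow> ('u \<times> 'u \<Rightarrow> 'u) \<Rightarrow> bool" where
  "assembles S T W \<gamma> \<delta> \<longleftrightarrow>
     bij_betw \<gamma> (SIGMA y:Verts S. Halves (piece T y)) (Halves W) \<and>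
     bij_betw \<delta> (SIGMA y:Verts S. Verts (piece T y)) (Verts W) \<and>
     (\<forall>y\<in>Verts S. \<forall>h\<in>Halves (piece T y). gp W (\<gamma> (y, h)) = \<delta> (y, gp (piece T y) h)) \<and>
     (\<forall>y\<in>Verts S. \<forall>h\<in>Halves (piece T y). hinv (piece T y) h \<noteq> h \<longrightarrow>
        hinv W (\<gamma> (y, h)) = \<gamma> (y, hinv (piece T y) h)) \<and>
     (\<forall>f\<in>Halves S. hinv W (\<gamma> (gp S f, ptail S T f)) = \<gamma> (gp S (hinv S f), ptail S T (hinv S f)))"

lemma (in gluing) iso_assembles:
  assumes W: "full W" and g: "graph_iso (glue S T) W g"
  shows "assembles S T W (mH g) (mV g)"
proof -
  have WJ: "jk_graph W" using W by simp
  note gg = graph_isoD[OF g jk_glue WJ]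
  have j: "hinv W (mH g (y, h)) = mH g (hinv (glue S T) (y, h))"
    if "y \<in> Verts S" "h \<in> Halves (G y)" for y h
    using graph_iso_hinv[OF full_glue W g, of "(y, h)"] that by simp
  show ?thesis unfolding assembles_def
  proof (intro conjI ballI impI)
    show "bij_betw (mH g) (SIGMA y:Verts S. Halves (G y)) (Halves W)"
      "bij_betw (mV g) (SIGMA y:Verts S. Verts (G y)) (Verts W)"
      using gg by simp_all
    fix y h assume "y \<in> Verts S" "h \<in> Halves (G y)"
    then show "gp W (mH g (y, h)) = mV g (y, gp (G y) h)"
      using etale_gp[OF gg(1), of "(y, h)"] by (simp add: glue_gp)
  qed (auto simp: j hinv_glue ptail hinv_glue_ptail)
qed

text \<open>The two clauses on \<open>hinv\<close> in \<open>assembles\<close> cover all half-edges,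
  because every tail of a piece is \<open>ptail\<close> of some half-edge of
  \<open>S\<close>.\<close>

lemma (in gluing) assembles_iso:
  assumes W: "full W" and a: "assembles S T W \<gamma> \<delta>"
  shows "graph_iso (glue S T) W (hv_mor (glue S T) W \<gamma> \<delta>)"
proof (rule hv_graph_iso[OF full_glue W])
  show "bij_betw \<gamma> (Halves (glue S T)) (Halves W)" "bij_betw \<delta> (Verts (glue S T)) (Verts W)"
    using a by (simp_all add: assembles_def)
  fix x assume "x \<in> Halves (glue S T)"
  then obtain y h where x: "x = (y, h)" "y \<in> Verts S" "h \<in> Halves (G y)" by auto
  then show "gp W (\<gamma> x) = \<delta> (gp (glue S T) x)" using a by (auto simp: assembles_def glue_gp)
  show "hinv W (\<gamma> x) = \<gamma> (hinv (glue S T) x)"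
  proof (cases "hinv (G y) h = h")
    case False
    then show ?thesis using a x by (auto simp: assembles_def hinv_glue)
  next
    case True
    obtain f where "f \<in> Halves S" "gp S f = y" "h = ptail S T f" using ptail_surj[OF x(2,3) True] .
    then show ?thesis using a x hinv_glue_ptail[of f] by (auto simp: assembles_def)
  qed
qed

lemma star_cls:
  assumes "full S" "\<psi> \<in> nt_hom (yon S) (bar F)" "y \<in> Verts S"
  shows "\<psi> (Cor (flags_at S y)) (star S y) \<in> bar_val F (Cor (flags_at S y))"
  using nt_in[OF assms(2), of "Cor (flags_at S y)" "star S y"] assms by simp

text \<open>When decorations are etale maps to \<open>Z\<close>, it is enough to have a graph
  \<open>W\<close> over \<open>Z\<close> that is assembled from the pieces compatibly with their
  maps to \<open>Z\<close>.\<close>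

lemma is_gluingI:
  fixes Z :: "'u gr" and \<psi> :: "'u kl"
  assumes S: "full S" and \<psi>: "\<psi> \<in> nt_hom (yon S) (bar (yon Z))"
    and W: "full W" and e': "etale W Z e'"
    and Tm: "\<And>y. y \<in> Verts S \<Longrightarrow> T y \<in> cls (\<psi> (Cor (flags_at S y)) (star S y))"
    and Td: "\<And>y. y \<in> Verts S \<Longrightarrow> piece_dec T y = yon_map (piece T y) (Te y) \<and> etale (piece T y) Z (Te y)"
    and a: "assembles S T W \<gamma> \<delta>"
    and eH: "\<And>y h. y \<in> Verts S \<Longrightarrow> h \<in> Halves (piece T y) \<Longrightarrow> mH e' (\<gamma> (y, h)) = mH (Te y) h"
    and eV: "\<And>y x. y \<in> Verts S \<Longrightarrow> x \<in> Verts (piece T y) \<Longrightarrow> mV e' (\<delta> (y, x)) = mV (Te y) x"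
  obtains \<pi> where "is_gluing (yon Z) S \<psi> W \<pi> (yon_map W e')" "\<pi> \<in> extensional (ports S)"
    "\<And>f. f \<in> tails S \<Longrightarrow> \<pi> (gi S (gs S f)) = gi W (gs W (\<gamma> (gp S f, ptail S T f)))"
proof -
  interpret gluing S T "yon Z"
    by unfold_locales (use S barC_mem(1)[OF star_cls[OF S \<psi>] Tm] in auto)
  let ?g = "hv_mor (glue S T) W \<gamma> \<delta>"
  have g: "graph_iso (glue S T) W ?g" using assembles_iso[OF W a] .
  note ge = graph_iso_etale[OF g]
  let ?\<pi> = "\<lambda>a\<in>ports S. mA ?g (glue_port S T a)"
  have dec: "gcomp (G y) e' (gcomp (G y) ?g (glue_in S T y)) = Te y" if y: "y \<in> Verts S" for y
  proof (rule etale_eq_fullI[OF G(1)[OF y]])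
    have 1: "etale (G y) W (gcomp (G y) ?g (glue_in S T y))"
      by (rule etale_gcomp[OF G(2)[OF y] glue_in_etale[OF y] ge])
    show "etale (G y) Z (gcomp (G y) e' (gcomp (G y) ?g (glue_in S T y)))"
      by (rule etale_gcomp[OF G(2)[OF y] 1 e'])
    show "etale (G y) Z (Te y)" using Td[OF y] by simp
  qed (use y eH eV in simp_all)
  have "is_gluing (yon Z) S \<psi> W ?\<pi> (yon_map W e')"
    unfolding is_gluing_def
  proof (intro conjI exI[of _ T] exI[of _ ?g])
    show "jk_graph W" using W by simp
    then show "yon_map W e' \<in> nt_hom (yon W) (yon Z)" using e' by simp
    show "representatives S \<psi> T" using Tm by (simp add: representatives_def)
    show "graph_iso (glue S T) W ?g" by (fact g)
    show "\<forall>y\<in>Verts S. \<forall>X\<in>elObs. \<forall>e\<in>val (yon (G y)) X. yon_map W e' X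
        (gcomp (el_graph X) ?g (gcomp (el_graph X) (glue_in S T y) e)) = piece_dec T y X e"
    proof (intro ballI)
      fix y and X :: "'u elobj" and e assume y: "y \<in> Verts S" and X: "X \<in> elObs" and "e \<in> val (yon (G y)) X"
      then have e: "etale (el_graph X) (G y) e" by simp
      have 1: "etale (el_graph X) (glue S T) (gcomp (el_graph X) (glue_in S T y) e)"
        by (rule etale_gcomp[OF jk_el_graph[OF X] e glue_in_etale[OF y]])
      have 2: "etale (el_graph X) W (gcomp (el_graph X) ?g (gcomp (el_graph X) (glue_in S T y) e))"
        by (rule etale_gcomp[OF jk_el_graph[OF X] 1 ge])
      have "yon_map W e' X (gcomp (el_graph X) ?g (gcomp (el_graph X) (glue_in S T y) e)) =
          gcomp (el_graph X) (gcomp (G y) e' (gcomp (G y) ?g (glue_in S T y))) e"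
        using X 2 by (simp add: gcomp_assoc[OF e])
      then show "yon_map W e' X (gcomp (el_graph X) ?g (gcomp (el_graph X) (glue_in S T y) e)) =
          piece_dec T y X e"
        using dec[OF y] Td[OF y] X e by simp
    qed
    \<comment> \<open>This clause is vacuous: \<open>S\<close> has no isolated arcs, whereas the
      image of the unit graph is nonempty.\<close>
    show "\<forall>e\<in>val (yon S) Unit. mA e ` range UnitArc \<subseteq> isolated_arcs S \<longrightarrow>
      Colour (yon_map W e' Unit (unit_map (\<lambda>t. mA ?g (cl (Inr (mA e (UnitArc t))))))) = \<psi> Unit e"
      using S unfolding full_def by auto
  qed simp
  moreover have "?\<pi> (gi S (gs S f)) = gi W (gs W (\<gamma> (gp S f, ptail S T f)))" if "f \<in> tails S" for f
  proof -
    have f: "f \<in> Halves S" "gi S (gs S f) \<in> ports S" using that tail_port[OF full_jk[OF S]] by (auto simp: tails_iff)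
    then show ?thesis using etale_arc_tail[OF ge jk_glue, of "(gp S f, ptail S T f)"] ptail(1)[OF f(1)]
      by (simp add: glue_port_tail)
  qed
  moreover have "?\<pi> \<in> extensional (ports S)" by simp
  ultimately show ?thesis using that by blast
qed

text \<open>Converse of \<open>is_gluingI\<close>. The condition on decorations, stated for
  elements, becomes an equality of etale maps from each piece to \<open>Z\<close> because the
  embedding into species is faithful.\<close>

lemma is_gluingD:
  fixes Z :: "'u gr" and \<psi> :: "'u kl"
  assumes S: "full S" and Z: "jk_graph Z" and \<psi>: "\<psi> \<in> nt_hom (yon S) (bar (yon Z))"
    and gl: "is_gluing (yon Z) S \<psi> W \<pi> d"
  obtains T Te \<gamma> \<delta> e' where "full W" "etale W Z e'" "d = yon_map W e'"
    "\<And>y. y \<in> Verts S \<Longrightarrow> T y \<in> cls (\<psi> (Cor (flags_at S y)) (star S y))"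
    "\<And>y. y \<in> Verts S \<Longrightarrow> piece_dec T y = yon_map (piece T y) (Te y) \<and> etale (piece T y) Z (Te y)"
    "assembles S T W \<gamma> \<delta>"
    "\<And>y h. y \<in> Verts S \<Longrightarrow> h \<in> Halves (piece T y) \<Longrightarrow> mH e' (\<gamma> (y, h)) = mH (Te y) h"
    "\<And>y x. y \<in> Verts S \<Longrightarrow> x \<in> Verts (piece T y) \<Longrightarrow> mV e' (\<delta> (y, x)) = mV (Te y) x"
    "\<And>f. f \<in> tails S \<Longrightarrow> \<pi> (gi S (gs S f)) = gi W (gs W (\<gamma> (gp S f, ptail S T f)))"
proof -
  obtain T g where WJ: "jk_graph W" and d: "d \<in> nt_hom (yon W) (yon Z)"
    and rep: "representatives S \<psi> T" and g: "graph_iso (glue S T) W g"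
    and \<pi>: "\<pi> = (\<lambda>a\<in>ports S. mA g (glue_port S T a))"
    and dec: "\<And>y X e. y \<in> Verts S \<Longrightarrow> X \<in> elObs \<Longrightarrow> e \<in> val (yon (piece T y)) X \<Longrightarrow>
      d X (gcomp (el_graph X) g (gcomp (el_graph X) (glue_in S T y) e)) = piece_dec T y X e"
    using gl unfolding is_gluing_def by blast
  have Tm: "T y \<in> cls (\<psi> (Cor (flags_at S y)) (star S y))" if "y \<in> Verts S" for y
    using rep that by (simp add: representatives_def)
  have TD: "T y \<in> dgraphs (yon Z) (flags_at S y)" if "y \<in> Verts S" for y
    using barC_mem(1)[OF star_cls[OF S \<psi> that] Tm[OF that]] .
  interpret gluing S T "yon Z" by unfold_locales (use S TD in auto)
  note gg = graph_isoD[OF g jk_glue WJ]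
  \<comment> \<open>Inherited from the glued graph: \<open>mA g\<close> is surjective on arcs, and
    an etale map sends attached arcs to attached arcs.\<close>
  have W: "full W"
  proof (rule fullI[OF WJ])
    fix a assume "a \<in> Arcs W"
    then obtain b where b: "b \<in> Arcs (glue S T)" "a = mA g b" using gg(2) by (auto simp: bij_betw_def)
    from full_glue b(1) show "a \<in> gs W ` Halves W \<or> gi W a \<in> gs W ` Halves W"
    proof (cases rule: full_arc_cases)
      case (half h)
      then show ?thesis using b gg(1) by (simp add: etale_gs[OF gg(1)] del: glue_simps)
    next
      case (port h)
      then show ?thesis using b gg(1) jk_glue WJ by (simp add: etale_arc_tail[OF gg(1)] del: glue_simps)
    qed
  qed
  obtain e' where e': "etale W Z e'" "d = yon_map W e'" using yon_full[OF W Z d] .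
  have "\<forall>y\<in>Verts S. \<exists>e. piece_dec T y = yon_map (G y) e \<and> etale (G y) Z e"
  proof
    fix y assume y: "y \<in> Verts S"
    obtain G0 l0 d0 where t: "T y = (G0, l0, d0)" by (cases "T y")
    then have "(G0, l0, d0) \<in> dgraphs (yon Z) (flags_at S y)" using TD[OF y] by simp
    then show "\<exists>e. piece_dec T y = yon_map (G y) e \<and> etale (G y) Z e"
      using Z t by (auto simp: yon_dgraphs_iff)
  qed
  then obtain Te where Te: "\<And>y. y \<in> Verts S \<Longrightarrow> piece_dec T y = yon_map (G y) (Te y) \<and> etale (G y) Z (Te y)"
    by metis
  have eq: "gcomp (G y) e' (gcomp (G y) g (glue_in S T y)) = Te y" if y: "y \<in> Verts S" for y
  proof -
    have 1: "etale (G y) W (gcomp (G y) g (glue_in S T y))"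
      by (rule etale_gcomp[OF G(2)[OF y] glue_in_etale[OF y] gg(1)])
    have 2: "etale (G y) Z (gcomp (G y) e' (gcomp (G y) g (glue_in S T y)))"
      by (rule etale_gcomp[OF G(2)[OF y] 1 e'(1)])
    show ?thesis
    proof (rule yon_map_inj[OF G(2)[OF y] 2])
      show 3: "etale (G y) Z (Te y)" using Te[OF y] by simp
      show "(yon_map (G y) (gcomp (G y) e' (gcomp (G y) g (glue_in S T y))) :: ('u,_,_) nt) = yon_map (G y) (Te y)"
      proof (rule nt_eqI[OF yon_map_nt[OF 2 G(2)[OF y]] yon_map_nt[OF 3 G(2)[OF y]]])
        fix X :: "'u elobj" and e assume X: "X \<in> elObs" and ev: "e \<in> val (yon (G y)) X"
        then have e: "etale (el_graph X) (G y) e" by simp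
        have 4: "etale (el_graph X) (glue S T) (gcomp (el_graph X) (glue_in S T y) e)"
          by (rule etale_gcomp[OF jk_el_graph[OF X] e glue_in_etale[OF y]])
        have 5: "etale (el_graph X) W (gcomp (el_graph X) g (gcomp (el_graph X) (glue_in S T y) e))"
          by (rule etale_gcomp[OF jk_el_graph[OF X] 4 gg(1)])
        show "yon_map (G y) (gcomp (G y) e' (gcomp (G y) g (glue_in S T y))) X e = yon_map (G y) (Te y) X e"
          using dec[OF y X ev] Te[OF y] X e 5 e'(2) by (simp add: gcomp_assoc[OF e])
      qed
    qed
  qed
  show ?thesis
  proof (rule that[OF W e' Tm Te iso_assembles[OF W g]])
    fix y h assume y: "y \<in> Verts S" and h: "h \<in> Halves (G y)"
    then show "mH e' (mH g (y, h)) = mH (Te y) h"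
      using arg_cong[OF eq[OF y], of "\<lambda>m. mH m h"] by simp
  next
    fix y x assume y: "y \<in> Verts S" and h: "x \<in> Verts (G y)"
    then show "mV e' (mV g (y, x)) = mV (Te y) x"
      using arg_cong[OF eq[OF y], of "\<lambda>m. mV m x"] by simp
  next
    fix f assume "f \<in> tails S"
    then have f: "f \<in> Halves S" "gi S (gs S f) \<in> ports S" using tail_port[OF full_jk[OF S]] by (auto simp: tails_iff)
    then show "\<pi> (gi S (gs S f)) = gi W (gs W (mH g (gp S f, ptail S T f)))"
      using etale_arc_tail[OF gg(1) jk_glue, of "(gp S f, ptail S T f)"] ptail(1)[OF f(1)]
      by (simp add: glue_port_tail \<pi>)
  qed
qed

section \<open>Graphs from their half-edges and vertices\<close>

text \<open>An infinite cardinal equals its double.\<close>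

lemma ex_inj_sum: "\<exists>f :: 'u::infinite + 'u \<Rightarrow> 'u. inj f"
proof -
  have "(card_of (UNIV :: ('u + 'u) set), card_of (UNIV :: 'u set)) \<in> ordIso"
    using card_of_Plus_infinite1[of "UNIV :: 'u set" "UNIV :: 'u set"] infinite_UNIV
    by (simp add: card_of_refl ordIso_imp_ordLeq)
  then obtain f :: "'u + 'u \<Rightarrow> 'u" where "bij_betw f UNIV UNIV"
    using card_of_ordIso by blast
  then show ?thesis using bij_betw_imp_inj_on by blast
qed

definition LR :: "'u::infinite + 'u \<Rightarrow> 'u" where "LR = (SOME f. inj f)"

lemma inj_LR: "inj LR"
  unfolding LR_def using someI_ex[OF ex_inj_sum] .

lemma LR_eq [simp]: "LR x = LR y \<longleftrightarrow> x = y"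
  by (rule inj_eq[OF inj_LR])

text \<open>\<open>Inl f\<close> stands for the arc attached to the half-edge \<open>f\<close>, and
  \<open>Inr f\<close> for the port opposite to a tail \<open>f\<close>. Both have to be elements of
  \<open>'u\<close>, hence the coding by \<open>LR\<close>.\<close>

definition jkof :: "'u::infinite bm_graph \<Rightarrow> 'u gr" where
  "jkof \<tau> = (let A = LR ` (Inl ` bF \<tau> \<union> Inr ` {f \<in> bF \<tau>. bj \<tau> f = f}) in
     \<lparr>Arcs = A, Halves = bF \<tau>, Verts = bV \<tau>, gs = (\<lambda>f\<in>bF \<tau>. LR (Inl f)), gp = bd \<tau>,
      gi = (\<lambda>a\<in>A. case inv LR a of Inl f \<Rightarrow> if bj \<tau> f = f then LR (Inr f) else LR (Inl (bj \<tau> f))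
                | Inr f \<Rightarrow> LR (Inl f))\<rparr>)"

lemma jkof_simps [simp]: "Halves (jkof \<tau>) = bF \<tau>" "Verts (jkof \<tau>) = bV \<tau>" "gp (jkof \<tau>) = bd \<tau>"
  "f \<in> bF \<tau> \<Longrightarrow> gs (jkof \<tau>) f = LR (Inl f)"
  by (simp_all add: jkof_def Let_def)

lemma jkof_gi:
  "f \<in> bF \<tau> \<Longrightarrow> gi (jkof \<tau>) (LR (Inl f)) = (if bj \<tau> f = f then LR (Inr f) else LR (Inl (bj \<tau> f)))"
  "f \<in> bF \<tau> \<Longrightarrow> bj \<tau> f = f \<Longrightarrow> gi (jkof \<tau>) (LR (Inr f)) = LR (Inl f)"
  by (auto simp: jkof_def Let_def inj_LR)

lemma jkof_arcs: "Arcs (jkof \<tau>) = LR ` (Inl ` bF \<tau> \<union> Inr ` {f \<in> bF \<tau>. bj \<tau> f = f})"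
  by (simp add: jkof_def Let_def)

lemma bm_graphD:
  assumes "bm_graph \<tau>"
  shows "finite (bV \<tau>)" "finite (bF \<tau>)" "f \<in> bF \<tau> \<Longrightarrow> bd \<tau> f \<in> bV \<tau>" "f \<in> bF \<tau> \<Longrightarrow> bj \<tau> f \<in> bF \<tau>"
    "f \<in> bF \<tau> \<Longrightarrow> bj \<tau> (bj \<tau> f) = f" "bd \<tau> \<in> bF \<tau> \<rightarrow>\<^sub>E bV \<tau>" "bj \<tau> \<in> bF \<tau> \<rightarrow>\<^sub>E bF \<tau>"
  using assms by (auto simp: bm_graph_def)

lemma full_jkof:
  assumes \<tau>: "bm_graph \<tau>" shows "full (jkof \<tau>)"
proof (rule fullI)
  note t = bm_graphD[OF \<tau>]
  show "jk_graph (jkof \<tau>)"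
    unfolding jk_graph_def
  proof (intro conjI)
    show "finite (Arcs (jkof \<tau>))" "finite (Halves (jkof \<tau>))" "finite (Verts (jkof \<tau>))"
      using t by (simp_all add: jkof_arcs)
    show "gs (jkof \<tau>) \<in> Halves (jkof \<tau>) \<rightarrow>\<^sub>E Arcs (jkof \<tau>)"
      by (auto simp: jkof_def Let_def)
    show "inj_on (gs (jkof \<tau>)) (Halves (jkof \<tau>))" by (auto simp: inj_on_def)
    show "gp (jkof \<tau>) \<in> Halves (jkof \<tau>) \<rightarrow>\<^sub>E Verts (jkof \<tau>)" using t by simp
    show "gi (jkof \<tau>) \<in> Arcs (jkof \<tau>) \<rightarrow>\<^sub>E Arcs (jkof \<tau>)"
    proof (rule PiE_I)
      fix a assume "a \<in> Arcs (jkof \<tau>)"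
      then show "gi (jkof \<tau>) a \<in> Arcs (jkof \<tau>)"
        using t(4) by (auto simp: jkof_arcs jkof_gi)
    qed (auto simp: jkof_def Let_def)
    show "\<forall>a\<in>Arcs (jkof \<tau>). gi (jkof \<tau>) (gi (jkof \<tau>) a) = a \<and> gi (jkof \<tau>) a \<noteq> a"
      using t(4,5) by (auto simp: jkof_arcs jkof_gi split: if_splits)
  qed
  fix a assume "a \<in> Arcs (jkof \<tau>)"
  then show "a \<in> gs (jkof \<tau>) ` Halves (jkof \<tau>) \<or> gi (jkof \<tau>) a \<in> gs (jkof \<tau>) ` Halves (jkof \<tau>)"
    by (auto simp: jkof_arcs jkof_gi)
qed

lemma hinv_jkof:
  assumes \<tau>: "bm_graph \<tau>" shows "hinv (jkof \<tau>) = bj \<tau>"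
proof
  fix f
  have J: "jk_graph (jkof \<tau>)" using full_jkof[OF \<tau>] by simp
  show "hinv (jkof \<tau>) f = bj \<tau> f"
  proof (cases "f \<in> bF \<tau>")
    case False
    then show ?thesis using bm_graphD(7)[OF \<tau>] by (auto simp: hinv_def PiE_def extensional_def)
  next
    case True
    show ?thesis
    proof (cases "bj \<tau> f = f")
      case f: True
      then have "gi (jkof \<tau>) (gs (jkof \<tau>) f) \<notin> gs (jkof \<tau>) ` Halves (jkof \<tau>)"
        using True by (auto simp: jkof_gi)
      then show ?thesis using True f by (simp add: hinv_def)
    next
      case False
      then show ?thesis using True bm_graphD(4)[OF \<tau>] by (intro hinv_eqI[OF J]) (auto simp: jkof_gi)
    qed
  qed
qed

lemma ex_inj_finite: "finite A \<Longrightarrow> \<exists>f :: 'a \<Rightarrow> 'u::infinite. inj_on f A"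
  by (metis bij_betw_imp_inj_on finite_same_card_bij infinite_UNIV infinite_arbitrarily_large)

text \<open>Glued graphs live on pairs and sets of pairs, and corollas on \<open>elarc\<close>,
  whereas \<open>dgraphs\<close> speaks of graphs on \<open>'u\<close>. Half-edges and vertices are
  injected into \<open>'u\<close>, and the arcs are rebuilt by \<open>jkof\<close>.\<close>

lemma ex_copy:
  assumes G: "full G"
  obtains W :: "'u::infinite gr" and g where "full W" "graph_iso G W g"
proof -
  have J: "jk_graph G" using G by simp
  obtain \<eta> :: "_ \<Rightarrow> 'u" where \<eta>: "inj_on \<eta> (Halves G)" using ex_inj_finite jk_finite(1)[OF J] by metis
  obtain \<nu> :: "_ \<Rightarrow> 'u" where \<nu>: "inj_on \<nu> (Verts G)" using ex_inj_finite jk_finite(2)[OF J] by metis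
  define \<tau> where "\<tau> = \<lparr>bV = \<nu> ` Verts G, bF = \<eta> ` Halves G,
    bd = (\<lambda>h\<in>\<eta> ` Halves G. \<nu> (gp G (inv_into (Halves G) \<eta> h))),
    bj = (\<lambda>h\<in>\<eta> ` Halves G. \<eta> (hinv G (inv_into (Halves G) \<eta> h)))\<rparr>"
  have \<tau>: "bm_graph \<tau>"
    unfolding bm_graph_def \<tau>_def using J \<eta> jk_finite[OF J] by auto
  show ?thesis
  proof (rule that[OF full_jkof[OF \<tau>] hv_graph_iso[OF G full_jkof[OF \<tau>]]])
    show "bij_betw \<eta> (Halves G) (Halves (jkof \<tau>))" "bij_betw \<nu> (Verts G) (Verts (jkof \<tau>))"
      using \<eta> \<nu> by (auto simp: \<tau>_def bij_betw_def)
    show "gp (jkof \<tau>) (\<eta> h) = \<nu> (gp G h)" if "h \<in> Halves G" for h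
      using that \<eta> by (simp add: \<tau>_def)
    show "hinv (jkof \<tau>) (\<eta> h) = \<eta> (hinv G h)" if "h \<in> Halves G" for h
      using that \<eta> unfolding hinv_jkof[OF \<tau>] by (simp add: \<tau>_def)
  qed
qed

section \<open>The unit of the monad\<close>

lemma crel_iso:
  assumes "finite m" "finite n" "f \<in> el_hom (Cor m) (Cor n)"
  shows "graph_iso (corolla m) (corolla n) f"
proof (rule hv_iso)
  show "etale (corolla m) (corolla n) f" using assms by (simp add: el_hom_def)
  then show "bij_betw (mV f) (Verts (corolla m)) (Verts (corolla n))"
    by (auto simp: bij_betw_def)
  show "bij_betw (mH f) (Halves (corolla m)) (Halves (corolla n))"
    using el_hom_cor_bij[OF assms(3)] by simp
qed (use assms el_hom_cor_bij[OF assms(3)] in \<open>auto simp: bij_betw_def\<close>)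

lemma unit_Unit [simp]: "etale unit_graph Y e \<Longrightarrow> unit_nt (yon Y) Unit e = Colour e"
  by (simp add: unit_nt_def)

lemma unit_Cor:
  fixes Y :: "'u gr" and e :: "('u,'u,'u,'u) elmap"
  assumes "finite n" "etale (corolla n) Y e"
  shows "unit_nt (yon Y) (Cor n) e = Cls {(G, l, d) \<in> dgraphs (yon Y) n.
        \<exists>f. graph_iso (corolla n) G f \<and> (\<forall>k\<in>n. l k = mA f (PortArc k)) \<and> d (Cor n) f = e}"
  using assms by (simp add: unit_nt_def)

lemma unitI:
  fixes Y :: "'u gr" and e :: "('u,'u,'u,'u) elmap"
  assumes Y: "jk_graph Y" and "finite n" "etale (corolla n) Y e" and G: "full G" and f: "graph_iso (corolla n) G f"
    and l: "l \<in> extensional n" "\<And>k. k \<in> n \<Longrightarrow> l k = mA f (PortArc k)" and e0: "etale G Y e0"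
    and e: "gcomp (corolla n) e0 f = e"
  shows "(G, l, yon_map G e0) \<in> cls (unit_nt (yon Y) (Cor n) e)"
proof -
  have J: "jk_graph (corolla n)" "jk_graph G" using assms by auto
  note ff = graph_isoD[OF f J]
  have "hinv G h = h" if "h \<in> Halves G" for h
  proof -
    have "h \<in> mH f ` n" using bij_betw_imp_surj_on[OF ff(3)] that by simp
    then obtain k where k: "k \<in> n" "h = mH f k" by (rule imageE) blast
    have "hinv G (mH f k) = mH f (hinv (corolla n) k)"
      by (rule graph_iso_hinv[OF full_corolla[OF assms(2)] G f]) (simp add: k(1))
    then show ?thesis unfolding k(2) hinv_corolla[OF k(1)] .
  qed
  then have "tails G = Halves G" by (auto simp: tails_def)
  then have b: "bij_betw (mH f) n (tails G)" using ff(3) by simp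
  have "l = lab G n (mH f)"
  proof (rule extensionalityI[OF l(1)])
    show "lab G n (mH f) \<in> extensional n" by (simp add: lab_def)
    fix k assume k: "k \<in> n"
    then show "l k = lab G n (mH f) k"
      using l(2)[OF k] etale_arc_tail[OF ff(1) J(1), of k] by (simp add: lab_def)
  qed
  then have "bij_betw l n (ports G)" "l \<in> n \<rightarrow>\<^sub>E ports G" using lab_bij[OF G b] by simp_all
  moreover have "Verts G \<noteq> {}" using etale_mV[OF ff(1), of "()"] by auto
  ultimately have "(G, l, yon_map G e0) \<in> dgraphs (yon Y) n" using G e0 by (simp add: dgraphs_iff)
  moreover have "yon_map G e0 (Cor n) f = e" using e ff(1) assms(2) by simp
  ultimately show ?thesis using f l unfolding unit_Cor[OF assms(2,3)] by auto
qed

lemma unitE: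
  fixes Y :: "'u gr" and e :: "('u,'u,'u,'u) elmap"
  assumes Y: "jk_graph Y" and n: "finite n" "etale (corolla n) Y e"
    and t: "(G, l, d) \<in> cls (unit_nt (yon Y) (Cor n) e)"
  obtains f e0 where "graph_iso (corolla n) G f" "\<And>k. k \<in> n \<Longrightarrow> l k = mA f (PortArc k)"
    "etale G Y e0" "d = yon_map G e0" "gcomp (corolla n) e0 f = e" "full G"
    "\<And>k. k \<in> n \<Longrightarrow> tailh G l k = mH f k" "(G, l, d) \<in> dgraphs (yon Y) n"
proof -
  have D: "(G, l, d) \<in> dgraphs (yon Y) n" using t unfolding unit_Cor[OF n] by auto
  then obtain e0 where e0: "etale G Y e0" "d = yon_map G e0" and G: "full G" using Y by (auto simp: yon_dgraphs_iff)
  obtain f where f: "graph_iso (corolla n) G f" "\<And>k. k \<in> n \<Longrightarrow> l k = mA f (PortArc k)" "d (Cor n) f = e"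
    using t unfolding unit_Cor[OF n] by auto
  have fe: "etale (corolla n) G f" using f by (simp add: graph_iso_etale)
  have "gcomp (corolla n) e0 f = e" using f(3) e0 fe n by simp
  moreover have "tailh G l k = mH f k" if k: "k \<in> n" for k
    using f(2)[OF k] etale_arc_tail[OF fe, of k] k n G fe by (intro tailh_eqI) auto
  ultimately show ?thesis using that f(1,2) e0 G D by blast
qed

text \<open>The corolla is not itself a graph on \<open>'u\<close>, so a copy of it provides a
  member of the class. Any two members are isomorphic because each is identified with the corolla
  compatibly with labels and decoration.\<close>

lemma unit_bar:
  fixes Y :: "'u::infinite gr" and e :: "('u,'u,'u,'u) elmap"
  assumes Y: "jk_graph Y" and n: "finite n" "etale (corolla n) Y e"
  shows "unit_nt (yon Y) (Cor n) e \<in> bar_val (yon Y) (Cor n)"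
proof -
  let ?U = "unit_nt (yon Y) (Cor n) e"
  have J: "jk_graph (corolla n)" using n by simp
  obtain G :: "'u gr" and f where G: "full G" and f: "graph_iso (corolla n) G f"
    using ex_copy[OF full_corolla[OF n(1)]] .
  obtain g where g: "graph_iso G (corolla n) g" "gcomp (corolla n) g f = gid (corolla n)"
    "gcomp G f g = gid G"
    using graph_iso_inverse[OF f] .
  have e: "etale (corolla n) G f" "etale G (corolla n) g" using f g by (simp_all add: graph_iso_etale)
  have JG: "jk_graph G" using G by simp
  define l where "l = (\<lambda>k\<in>n. mA f (PortArc k))"
  have e0: "etale G Y (gcomp G e g)" by (rule etale_gcomp[OF JG e(2) n(2)])
  have m: "(G, l, yon_map G (gcomp G e g)) \<in> cls ?U"
    by (rule unitI[OF Y n G f _ _ e0]) (use e n g in \<open>auto simp: l_def gcomp_assoc[OF e(1)]\<close>)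
  have C: "?U = Cls (cls ?U)" using unit_Cor[OF n] by simp
  have "Cls (cls ?U) \<in> bar_val (yon Y) (Cor n)"
  proof (rule barC_I[OF _ m])
    show "cls ?U \<subseteq> dgraphs (yon Y) n" unfolding unit_Cor[OF n] by auto
  next
    fix t' assume t': "t' \<in> dgraphs (yon Y) n" "dgraph_iso n (G, l, yon_map G (gcomp G e g)) t'"
    obtain G' l' d' where tt: "t' = (G', l', d')" by (cases t')
    obtain e' where e': "etale G' Y e'" "d' = yon_map G' e'" and G': "full G'"
      using t'(1) Y unfolding tt by (auto simp: yon_dgraphs_iff)
    have JG': "jk_graph G'" using G' by simp
    obtain h where h: "graph_iso G G' h" "\<And>k. k \<in> n \<Longrightarrow> mA h (l k) = l' k" "gcomp G e g = gcomp G e' h"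
      using t'(2) unfolding tt e'(2) yon_dgraph_iso[OF JG JG' e0 e'(1)] by auto
    show "t' \<in> cls ?U" unfolding tt e'(2)
    proof (rule unitI[OF Y n G' graph_iso_gcomp[OF J JG JG' f h(1)] _ _ e'(1)])
      show "l' \<in> extensional n" using t'(1) unfolding tt by (auto simp: dgraphs_iff PiE_def)
      show "l' k = mA (gcomp (corolla n) h f) (PortArc k)" if "k \<in> n" for k
        using h(2)[OF that] that by (simp add: l_def)
      have "gcomp (corolla n) e' (gcomp (corolla n) h f) = gcomp (corolla n) (gcomp G e g) f"
        unfolding h(3) by (simp add: gcomp_assoc[OF e(1)])
      then show "gcomp (corolla n) e' (gcomp (corolla n) h f) = e"
        using g n by (simp add: gcomp_assoc[OF e(1)])
    qed
  next
    fix t' assume t': "t' \<in> cls ?U"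
    obtain G' l' d' where tt: "t' = (G', l', d')" by (cases t')
    obtain f' e' where f': "graph_iso (corolla n) G' f'" "\<And>k. k \<in> n \<Longrightarrow> l' k = mA f' (PortArc k)"
      "etale G' Y e'" "d' = yon_map G' e'" "gcomp (corolla n) e' f' = e" "full G'"
      using unitE[OF Y n t'[unfolded tt]] by metis
    have JG': "jk_graph G'" using f' by simp
    have "mA (gcomp G f' g) (l k) = l' k" if "k \<in> n" for k
      using that f'(2)[OF that] e arg_cong[OF g(2), of "\<lambda>m. mA m (PortArc k)"] by (simp add: l_def)
    moreover have "gcomp G e g = gcomp G e' (gcomp G f' g)"
      using f'(5) by (simp add: gcomp_assoc[OF e(2), symmetric])
    ultimately show "dgraph_iso n (G, l, yon_map G (gcomp G e g)) t'"
      unfolding tt f'(4) yon_dgraph_iso[OF JG JG' e0 f'(3)]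
      using graph_iso_gcomp[OF JG J JG' g(1) f'(1)] by blast
  qed
  then show ?thesis using C by simp
qed

lemma unit_nt_nat:
  fixes Y :: "'u::infinite gr"
  assumes Y: "jk_graph Y"
  shows "(unit_nt (yon Y) :: ('u,_,_) nt) \<in> nt_hom (yon Y) (bar (yon Y))"
proof (rule nt_homI)
  show "unit_nt (yon Y) \<in> extensional elObs" by (simp add: unit_nt_def)
  fix X :: "'u elobj" assume X: "X \<in> elObs"
  then show "unit_nt (yon Y) X \<in> extensional (val (yon Y) X)" by (simp add: unit_nt_def)
  fix c assume "c \<in> val (yon Y) X"
  with X show "unit_nt (yon Y) X c \<in> val (bar (yon Y)) X"
    by (cases rule: elObs_cases) (auto simp: unit_bar[OF Y])
next
  fix X Z :: "'u elobj" and f c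
  assume X: "X \<in> elObs" and Z: "Z \<in> elObs" and f: "f \<in> el_hom X Z" and c: "c \<in> val (yon Y) Z"
  have fe: "etale (el_graph X) (el_graph Z) f" using f by (simp add: el_hom_def)
  have ce: "etale (el_graph X) Y (gcomp (el_graph X) c f)"
    using c X by (intro etale_gcomp[OF _ fe]) auto
  from Z show "unit_nt (yon Y) X (res (yon Y) X Z f c) = res (bar (yon Y)) X Z f (unit_nt (yon Y) Z c)"
  proof (cases rule: elObs_cases)
    case 1
    with X f have "X = Unit" using el_hom_cor_unit by (auto elim: elObs_cases)
    then show ?thesis using 1 c ce by (simp add: bar_res_UU)
  next
    case (2 n)
    then have c: "etale (corolla n) Y c" using c by simp
    note cb = unit_bar[OF Y 2(2) c]
    obtain G l d where t: "(G, l, d) \<in> cls (unit_nt (yon Y) (Cor n) c)" using barC_ne[OF cb] .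
    obtain f0 e0 where f0: "graph_iso (corolla n) G f0" "\<And>k. k \<in> n \<Longrightarrow> l k = mA f0 (PortArc k)"
      "etale G Y e0" "d = yon_map G e0" "gcomp (corolla n) e0 f0 = c" "full G"
      and D: "(G, l, d) \<in> dgraphs (yon Y) n"
      using unitE[OF Y 2(2) c t] by metis
    have f0e: "etale (corolla n) G f0" using f0 by (simp add: graph_iso_etale)
    have J: "jk_graph (corolla n)" "jk_graph G" using 2 f0 by auto
    from X show ?thesis
    proof (cases rule: elObs_cases)
      case 1
      obtain a where a: "a \<in> PortArc ` n \<union> FlagArc ` n" "f = uat (corolla n) a"
        using el_hom_unit_cor[of f n] f 1 2 by auto
      have "port_arc G l a = mA f0 a"
        using a(1) f0(2) etale_gi[OF f0e] J by (auto simp: port_arc_def) (metis UnI1 corolla_simps(1,7) image_eqI)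
      then have "d Unit (uat G (port_arc G l a)) = gcomp unit_graph c f"
        unfolding f0(4) f0(5)[symmetric] a(2) using a(1) J f0e f0(3)
        by (simp add: gcomp_assoc[OF etale_uat] gcomp_uat[OF f0e])
      then show ?thesis using 1 2 ce a by (simp add: bar_res_UC[OF cb t])
    next
      case m: (2 m)
      have fe': "etale (corolla m) (corolla n) f" using fe 2 m by simp
      have fi: "graph_iso (corolla m) (corolla n) f" using crel_iso m 2 f by simp
      have ce': "etale (corolla m) Y (gcomp (corolla m) c f)" using ce m by simp
      have rb: "bar_res (yon Y) (Cor m) (Cor n) f (unit_nt (yon Y) (Cor n) c) \<in> bar_val (yon Y) (Cor m)"
        using bar_res_CC_in[OF cb] f m 2 by simp
      have m1: "(G, compose m l (mH f), d) \<in> cls (bar_res (yon Y) (Cor m) (Cor n) f (unit_nt (yon Y) (Cor n) c))"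
        unfolding bar_res_CC using t by force
      have "(G, compose m l (mH f), yon_map G e0) \<in> cls (unit_nt (yon Y) (Cor m) (gcomp (corolla m) c f))"
      proof (rule unitI[OF Y m(2) ce' f0(6) graph_iso_gcomp[OF _ J fi f0(1)] _ _ f0(3)])
        show "compose m l (mH f) k = mA (gcomp (corolla m) f0 f) (PortArc k)" if k: "k \<in> m" for k
        proof -
          have "mH f k \<in> n" using etale_mH[OF fe'] k by simp
          moreover have "mA f (PortArc k) = PortArc (mH f k)"
            using etale_arc_tail[OF fe', of k] k m calculation by simp
          ultimately show ?thesis using k f0(2) by (simp add: compose_def)
        qed
      qed (use m f0 in \<open>auto simp: gcomp_assoc[OF fe', symmetric]\<close>)
      then show ?thesis using barC_eqI[OF unit_bar[OF Y m(2) ce'] rb _ m1] f0(4) m 2 by simp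
    qed
  qed
qed

lemma kl_nt:
  fixes Y :: "'u::infinite gr"
  assumes "jk_graph R" "jk_graph Y" "etale R Y f" shows "kl_of_etale R Y f \<in> nt_hom (yon R) (bar (yon Y))"
  unfolding kl_of_etale_def using assms by (intro nt_comp_nt[OF _ _ unit_nt_nat]) auto

text \<open>A representative comes with an isomorphism from the corolla, and its labels leave only
  one choice for it; composing with the decoration gives \<open>c\<close> back.\<close>

lemma unit_inj:
  fixes Y :: "'u::infinite gr" and c :: "('u,'u,'u,'u) elmap"
  assumes Y: "jk_graph Y" and X: "X \<in> elObs" and c: "etale (el_graph X) Y c" "etale (el_graph X) Y c'"
    and eq: "unit_nt (yon Y) X c = unit_nt (yon Y) X c'"
  shows "c = c'"
  using X
proof (cases rule: elObs_cases)
  case 1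
  then show ?thesis using eq c by simp
next
  case (2 n)
  have c: "etale (corolla n) Y c" "etale (corolla n) Y c'" using c 2 by simp_all
  obtain G l d where t: "(G, l, d) \<in> cls (unit_nt (yon Y) (Cor n) c)"
    using barC_ne[OF unit_bar[OF Y 2(2) c(1)]] .
  obtain f e where f: "graph_iso (corolla n) G f" "\<And>k. k \<in> n \<Longrightarrow> tailh G l k = mH f k"
      "etale G Y e" "d = yon_map G e" "gcomp (corolla n) e f = c" "full G"
    using unitE[OF Y 2(2) c(1) t] by metis
  have t': "(G, l, d) \<in> cls (unit_nt (yon Y) (Cor n) c')" using t eq 2 by simp
  obtain f' e' where f': "graph_iso (corolla n) G f'" "\<And>k. k \<in> n \<Longrightarrow> tailh G l k = mH f' k"
      "etale G Y e'" "d = yon_map G e'" "gcomp (corolla n) e' f' = c'"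
    using unitE[OF Y 2(2) c(2) t'] by metis
  have J: "jk_graph (corolla n)" "jk_graph G" using 2 f by auto
  have e: "e = e'" using yon_map_inj[OF J(2) f(3) f'(3)] f f' by simp
  note b = graph_isoD[OF f(1) J] and b' = graph_isoD[OF f'(1) J]
  have "mV f () = mV f' ()" using b(4) b'(4) by (auto simp: bij_betw_def)
  then have "f = f'" using f(2) f'(2) by (intro cor_eqI[OF 2(2) b(1) b'(1)]) auto
  then show ?thesis using e f f' by simp
qed

section \<open>Kleisli extension\<close>

type_synonym 'u kval = "('u, ('u,'u,'u,'u) elmap) barel"
type_synonym 'u gmap = "('u,'u,'u,'u,'u,'u) gmor"

text \<open>The Kleisli extension of \<open>g\<close> to a map on \<open>bar (yon Y)\<close>;
  composition in \<open>GrT\<close> applies it pointwise.\<close>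

definition kext :: "'u gr \<Rightarrow> 'u gr \<Rightarrow> 'u kl \<Rightarrow> 'u elobj \<Rightarrow> 'u kval \<Rightarrow> 'u kval" where
  "kext Y Z g X c = mult (yon Z) X (bar_map (yon Y) g X c)"

lemma Comp_GrT: "Comp GrT R Y Z g f = nt_comp (yon R) (kext Y Z g) f"
  unfolding GrT_def by (simp, rule nt_comp_cong) (simp add: kext_def)

lemma Hom_GrT [simp]: "Hom GrT R Y = nt_hom (yon R) (bar (yon Y))"
  by (simp add: GrT_def)

lemma Ob_GrT [simp]: "R \<in> Ob GrT \<longleftrightarrow> full R"
  by (simp add: GrT_def full_def)

lemma Ide_GrT [simp]: "Ide GrT R = unit_nt (yon R)"
  by (simp add: GrT_def)

lemma bar_col:
  fixes Z :: "'u gr" and c :: "'u kval"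
  assumes Z: "jk_graph Z" and c: "c \<in> bar_val (yon Z) (Cor n)" and t: "(G, L, yon_map G e) \<in> cls c"
    and e: "etale G Z e" and k: "k \<in> n"
  shows "bar_res (yon Z) Unit (Cor n) (uat (corolla n) (FlagArc k)) c =
      Colour (uat Z (gs Z (mH e (tailh G L k))))"
    "bar_res (yon Z) Unit (Cor n) (uat (corolla n) (PortArc k)) c =
      Colour (uat Z (gi Z (gs Z (mH e (tailh G L k)))))"
proof -
  have D: "(G, L, yon_map G e) \<in> dgraphs (yon Z) n" using barC_mem[OF c t] by simp
  then have G: "full G" and p: "L k \<in> ports G" using k by (auto simp: dgraphs_iff)
  have J: "jk_graph G" using G by simp
  note tp = tailh_port[where l = L, OF G p]
  have a: "port_arc G L (FlagArc k) = gs G (tailh G L k)" using tp(4) by (simp add: port_arc_def)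
  have b: "port_arc G L (PortArc k) = gi G (gs G (tailh G L k))" using tp(3) by (simp add: port_arc_def)
  show "bar_res (yon Z) Unit (Cor n) (uat (corolla n) (FlagArc k)) c =
      Colour (uat Z (gs Z (mH e (tailh G L k))))"
    using k J Z tp(1) by (simp add: bar_res_UC[OF c t] a gcomp_uat[OF e] etale_gs[OF e])
  show "bar_res (yon Z) Unit (Cor n) (uat (corolla n) (PortArc k)) c =
      Colour (uat Z (gi Z (gs Z (mH e (tailh G L k)))))"
    using k J Z tp(1) by (simp add: bar_res_UC[OF c t] b gcomp_uat[OF e] etale_arc_tail[OF e])
qed

text \<open>Naturality along the two arcs of the star at the flag \<open>f\<close>. Comparing these
  colours shows that the pieces at the two ends of an edge fit together.\<close>

lemma star_colour:
  fixes Z :: "'u gr" and \<phi> :: "'u kl"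
  assumes S: "full S" and Z: "jk_graph Z" and \<phi>: "\<phi> \<in> nt_hom (yon S) (bar (yon Z))" and f: "f \<in> Halves S"
    and t: "(G, L, yon_map G e) \<in> cls (\<phi> (Cor (flags_at S (gp S f))) (star S (gp S f)))" and e: "etale G Z e"
  shows "\<phi> Unit (uat S (gs S f)) = Colour (uat Z (gs Z (mH e (tailh G L f))))"
    "\<phi> Unit (uat S (gi S (gs S f))) = Colour (uat Z (gi Z (gs Z (mH e (tailh G L f)))))"
proof -
  let ?y = "gp S f" let ?n = "flags_at S ?y"
  have J: "jk_graph S" and y: "?y \<in> Verts S" and fn: "f \<in> ?n" using S f by (auto simp: flags_at_iff)
  have *: "\<phi> Unit (uat S (mA (star S ?y) a)) =
      bar_res (yon Z) Unit (Cor ?n) (uat (corolla ?n) a) (\<phi> (Cor ?n) (star S ?y))"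
    if a: "a \<in> PortArc ` ?n \<union> FlagArc ` ?n" for a
  proof -
    have "\<phi> Unit (res (yon S) Unit (Cor ?n) (uat (corolla ?n) a) (star S ?y)) =
      res (bar (yon Z)) Unit (Cor ?n) (uat (corolla ?n) a) (\<phi> (Cor ?n) (star S ?y))"
      using a J y by (intro nt_nat[OF \<phi>]) (auto simp: el_hom_def)
    then show ?thesis using a J y by (simp add: gcomp_uat[OF star_etale[OF J y]])
  qed
  note col = bar_col[OF Z star_cls[OF S \<phi> y] t e fn]
  show "\<phi> Unit (uat S (gs S f)) = Colour (uat Z (gs Z (mH e (tailh G L f))))"
    using *[of "FlagArc f"] col(1) fn by simp
  show "\<phi> Unit (uat S (gi S (gs S f))) = Colour (uat Z (gi Z (gs Z (mH e (tailh G L f)))))"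
    using *[of "PortArc f"] col(2) fn by simp
qed

lemma uat_inj: "uat Z a = uat Z b \<Longrightarrow> a = b"
  by (metis (full_types) uat_mA)

text \<open>The graph \<open>W\<close> with etale map \<open>e'\<close> to \<open>Z\<close> is glued, along an etale map \<open>e : S \<rightarrow> Y\<close>, from
  representatives \<open>T y\<close> with etale maps \<open>Te y\<close> of the values of \<open>g\<close>; \<open>\<gamma>\<close> and \<open>\<delta>\<close> are the
  resulting identifications of half-edges and vertices.\<close>

definition composite :: "'u gr \<Rightarrow> 'u gr \<Rightarrow> 'u kl \<Rightarrow> 'u set \<Rightarrow> 'u gr \<Rightarrow> ('u \<Rightarrow> 'u) \<Rightarrow> 'u gmap \<Rightarrow>
    ('u \<Rightarrow> ('u, ('u,'u,'u,'u) elmap) dgraph) \<Rightarrow> ('u \<Rightarrow> 'u gmap) \<Rightarrow> 'u gr \<Rightarrow> ('u \<Rightarrow> 'u) \<Rightarrow> 'u gmap \<Rightarrow>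
    ('u \<times> 'u \<Rightarrow> 'u) \<Rightarrow> ('u \<times> 'u \<Rightarrow> 'u) \<Rightarrow> bool" where
  "composite Y Z g n S l e T Te W l' e' \<gamma> \<delta> \<longleftrightarrow> etale S Y e \<and> etale W Z e' \<and>
     (\<forall>y\<in>Verts S. T y \<in> cls (g (Cor (flags_at S y)) (gcomp (corolla (flags_at S y)) e (star S y)))) \<and>
     (\<forall>y\<in>Verts S. piece_dec T y = yon_map (piece T y) (Te y) \<and> etale (piece T y) Z (Te y)) \<and>
     assembles S T W \<gamma> \<delta> \<and>
     (\<forall>y\<in>Verts S. \<forall>h\<in>Halves (piece T y). mH e' (\<gamma> (y, h)) = mH (Te y) h) \<and>
     (\<forall>y\<in>Verts S. \<forall>x\<in>Verts (piece T y). mV e' (\<delta> (y, x)) = mV (Te y) x) \<and>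
     (\<forall>k\<in>n. tailh W l' k = \<gamma> (gp S (tailh S l k), ptail S T (tailh S l k)))"

section \<open>Members of a Kleisli extension as glued graphs\<close>

lemma kext_Unit:
  fixes Y Z :: "'u gr"
  assumes "jk_graph Y" "jk_graph Z" "g \<in> nt_hom (yon Y) (bar (yon Z))" "etale unit_graph Y c"
  shows "kext Y Z g Unit (Colour c) = g Unit c"
proof -
  have "g Unit c \<in> bar_val (yon Z) Unit" using nt_in[OF assms(3), of Unit c] assms(4) by simp
  then show ?thesis using assms by (simp add: kext_def mult_def)
qed

lemma kext_Cor:
  fixes Y Z :: "'u gr"
  assumes g: "g \<in> nt_hom (yon Y) (bar (yon Z))" and n: "finite n" and c: "c \<in> bar_val (yon Y) (Cor n)"
  shows "kext Y Z g (Cor n) c = Cls {(W, l', d') \<in> dgraphs (yon Z) n.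
    \<exists>S l d \<pi>. (S, l, d) \<in> cls c \<and> is_gluing (yon Z) S (nt_comp (yon S) g d) W \<pi> d' \<and> l' = compose n \<pi> l}"
proof -
  have "bar_map (yon Y) g (Cor n) c \<in> bar_val (bar (yon Z)) (Cor n)"
    using bar_map_in[OF g _ c] n by simp
  then show ?thesis
    unfolding kext_def mult_def using n
    by (auto simp: bar_map_Cor[OF n c] split: prod.splits) blast+
qed

lemma edge_nt:
  fixes Y Z :: "'u gr"
  assumes "g \<in> nt_hom (yon Y) (bar (yon Z))" "etale S Y e" "full S"
  shows "nt_comp (yon S) g (yon_map S e) \<in> nt_hom (yon S) (bar (yon Z))"
    "y \<in> Verts S \<Longrightarrow> nt_comp (yon S) g (yon_map S e) (Cor (flags_at S y)) (star S y) =
       g (Cor (flags_at S y)) (gcomp (corolla (flags_at S y)) e (star S y))"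
  using assms by (auto intro!: nt_comp_nt[OF _ _ assms(1)])

text \<open>Together with \<open>kextE\<close> this replaces the nested quotients in
  \<open>mult\<close> by the explicit data of \<open>composite\<close>.\<close>

lemma kextI:
  fixes Y Z :: "'u gr"
  assumes Y: "jk_graph Y" and Z: "jk_graph Z" and g: "g \<in> nt_hom (yon Y) (bar (yon Z))" and n: "finite n"
    and c: "c \<in> bar_val (yon Y) (Cor n)" and t: "(S, l, yon_map S e) \<in> cls c"
    and D: "(W, l', yon_map W e') \<in> dgraphs (yon Z) n"
    and k: "composite Y Z g n S l e T Te W l' e' \<gamma> \<delta>"
  shows "(W, l', yon_map W e') \<in> cls (kext Y Z g (Cor n) c)"
proof -
  have tD: "(S, l, yon_map S e) \<in> dgraphs (yon Y) n" using barC_mem[OF c t] by simp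
  have S: "full S" and W: "full W" and e: "etale S Y e" "etale W Z e'"
    using tD D k by (auto simp: dgraphs_iff composite_def)
  note en = edge_nt[OF g e(1) S]
  obtain \<pi> where gl: "is_gluing (yon Z) S (nt_comp (yon S) g (yon_map S e)) W \<pi> (yon_map W e')"
    and \<pi>: "\<And>f. f \<in> tails S \<Longrightarrow> \<pi> (gi S (gs S f)) = gi W (gs W (\<gamma> (gp S f, ptail S T f)))"
    by (rule is_gluingI[where T = T and Te = Te, OF S en(1) W e(2)])
      (use k en(2) in \<open>auto simp: composite_def\<close>)
  have "l' = compose n \<pi> l"
  proof (rule extensionalityI[where A = n])
    show "l' \<in> extensional n" using D by (auto simp: dgraphs_iff PiE_def)
    fix i assume i: "i \<in> n"
    have p: "l i \<in> ports S" "l' i \<in> ports W" using i D tD by (auto simp: dgraphs_iff)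
    note a = tailh_port[where l = l, OF S p(1)] and b = tailh_port[where l = l', OF W p(2)]
    have "\<pi> (l i) = gi W (gs W (\<gamma> (gp S (tailh S l i), ptail S T (tailh S l i))))"
      using \<pi>[of "tailh S l i"] a(1,2) a(3)[symmetric] by (simp add: tails_iff)
    also have "\<dots> = l' i" using b(3) k i by (simp add: composite_def)
    finally show "l' i = compose n \<pi> l i" using i by (simp add: compose_def)
  qed (simp add: compose_def)
  then show ?thesis unfolding kext_Cor[OF g n c] using D t gl by auto
qed

lemma kextE:
  fixes Y Z :: "'u gr"
  assumes Y: "jk_graph Y" and Z: "jk_graph Z" and g: "g \<in> nt_hom (yon Y) (bar (yon Z))" and n: "finite n"
    and c: "c \<in> bar_val (yon Y) (Cor n)" and m: "(W, l', d') \<in> cls (kext Y Z g (Cor n) c)"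
  obtains S l e T Te e' \<gamma> \<delta> where "(S, l, yon_map S e) \<in> cls c" "d' = yon_map W e'"
    "(W, l', d') \<in> dgraphs (yon Z) n" "composite Y Z g n S l e T Te W l' e' \<gamma> \<delta>"
proof -
  obtain S l d \<pi> where D: "(W, l', d') \<in> dgraphs (yon Z) n" and t: "(S, l, d) \<in> cls c"
    and gl: "is_gluing (yon Z) S (nt_comp (yon S) g d) W \<pi> d'" and l': "l' = compose n \<pi> l"
    using m unfolding kext_Cor[OF g n c] by auto
  have tD: "(S, l, d) \<in> dgraphs (yon Y) n" using barC_mem[OF c t] by simp
  then obtain e where e: "etale S Y e" "d = yon_map S e" and S: "full S" using Y by (auto simp: yon_dgraphs_iff)
  note en = edge_nt[OF g e(1) S]
  obtain T Te \<gamma> \<delta> e' where W: "full W" and e': "etale W Z e'" "d' = yon_map W e'"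
    and Tm: "\<And>y. y \<in> Verts S \<Longrightarrow> T y \<in> cls (nt_comp (yon S) g (yon_map S e) (Cor (flags_at S y)) (star S y))"
    and Td: "\<And>y. y \<in> Verts S \<Longrightarrow> piece_dec T y = yon_map (piece T y) (Te y) \<and> etale (piece T y) Z (Te y)"
    and a: "assembles S T W \<gamma> \<delta>"
    and eH: "\<And>y h. y \<in> Verts S \<Longrightarrow> h \<in> Halves (piece T y) \<Longrightarrow> mH e' (\<gamma> (y, h)) = mH (Te y) h"
    and eV: "\<And>y x. y \<in> Verts S \<Longrightarrow> x \<in> Verts (piece T y) \<Longrightarrow> mV e' (\<delta> (y, x)) = mV (Te y) x"
    and \<pi>: "\<And>f. f \<in> tails S \<Longrightarrow> \<pi> (gi S (gs S f)) = gi W (gs W (\<gamma> (gp S f, ptail S T f)))"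
    by (rule is_gluingD[OF S Z en(1) gl[unfolded e(2)]], rule that; assumption)
  have TD: "T y \<in> dgraphs (yon Z) (flags_at S y)" if "y \<in> Verts S" for y
    using barC_mem(1)[OF star_cls[OF S en(1) that] Tm[OF that]] .
  interpret gluing S T "yon Z" by unfold_locales (use S TD in auto)
  have "tailh W l' i = \<gamma> (gp S (tailh S l i), ptail S T (tailh S l i))" if i: "i \<in> n" for i
  proof (rule tailh_eqI)
    have p: "l i \<in> ports S" using i tD by (auto simp: dgraphs_iff)
    note b = tailh_port[where l = l, OF S p]
    show "l' i = gi W (gs W (\<gamma> (gp S (tailh S l i), ptail S T (tailh S l i))))"
      using \<pi>[of "tailh S l i"] b(1,2) b(3)[symmetric] i by (simp add: tails_iff l' compose_def)
    show "\<gamma> (gp S (tailh S l i), ptail S T (tailh S l i)) \<in> Halves W"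
      using a ptail(1)[OF b(1)] b(1) by (auto simp: assembles_def bij_betw_def)
  qed (use W in simp)
  then have "composite Y Z g n S l e T Te W l' e' \<gamma> \<delta>"
    using e e' Tm Td a eH eV by (simp add: composite_def en(2))
  then show ?thesis using that t e e' D by blast
qed

section \<open>Uniqueness of the glued graph up to isomorphism\<close>

lemma composite_gluing:
  fixes Y Z :: "'u gr"
  assumes "g \<in> nt_hom (yon Y) (bar (yon Z))" "full S" "composite Y Z g n S l e T Te W l' e' \<gamma> \<delta>"
  shows "gluing S T (yon Z)"
proof (unfold_locales)
  show "full S" by fact
  fix y assume y: "y \<in> Verts S"
  have e: "etale S Y e" using assms(3) by (simp add: composite_def)
  have "T y \<in> cls (nt_comp (yon S) g (yon_map S e) (Cor (flags_at S y)) (star S y))"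
    using assms(3) y edge_nt(2)[OF assms(1) e assms(2) y] by (simp add: composite_def)
  then show "T y \<in> dgraphs (yon Z) (flags_at S y)"
    using barC_mem(1)[OF star_cls[OF assms(2) edge_nt(1)[OF assms(1) e assms(2)] y]] by blast
qed

text \<open>The relabelling is the one that \<open>t\<close> induces on flags. It lets values of a
  natural transformation at a vertex of \<open>S\<close> and at its image in \<open>S'\<close> be
  compared.\<close>

lemma star_iso:
  assumes J: "jk_graph S" "jk_graph S'" and t: "etale S S' t" and y: "y \<in> Verts S"
  shows "crel (flags_at S y) (flags_at S' (mV t y)) (mH t) \<in>
      el_hom (Cor (flags_at S y)) (Cor (flags_at S' (mV t y)))"
    "gcomp (corolla (flags_at S y)) t (star S y) =
      gcomp (corolla (flags_at S y)) (star S' (mV t y)) (crel (flags_at S y) (flags_at S' (mV t y)) (mH t))"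
proof -
  let ?c = "crel (flags_at S y) (flags_at S' (mV t y)) (mH t)"
  have c: "etale (corolla (flags_at S y)) (corolla (flags_at S' (mV t y))) ?c"
    using J etale_star[OF t y] by (intro crel_etale) auto
  then show "?c \<in> el_hom (Cor (flags_at S y)) (Cor (flags_at S' (mV t y)))" by (simp add: el_hom_def)
  have m: "mH t k \<in> flags_at S' (mV t y)" if "k \<in> flags_at S y" for k
    using etale_star[OF t y] that by (auto simp: bij_betw_def)
  have v: "mV t y \<in> Verts S'" using t y by simp
  show "gcomp (corolla (flags_at S y)) t (star S y) = gcomp (corolla (flags_at S y)) (star S' (mV t y)) ?c"
  proof (rule cor_eqI)
    show "etale (corolla (flags_at S y)) S' (gcomp (corolla (flags_at S y)) t (star S y))"
      using J y by (intro etale_gcomp[OF _ star_etale t]) auto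
    show "etale (corolla (flags_at S y)) S' (gcomp (corolla (flags_at S y)) (star S' (mV t y)) ?c)"
      using J v by (intro etale_gcomp[OF _ c star_etale]) auto
    show "mV (gcomp (corolla (flags_at S y)) t (star S y)) () =
        mV (gcomp (corolla (flags_at S y)) (star S' (mV t y)) ?c) ()" using c by simp
  qed (use J m in \<open>auto simp: flags_at_iff\<close>)
qed

lemma compose_tailh: "k \<in> m \<Longrightarrow> tailh G (compose m l \<sigma>) k = tailh G l (\<sigma> k)"
  by (simp add: tailh_def compose_def)

lemma nt_relabel:
  fixes Y Z :: "'u gr"
  assumes g: "g \<in> nt_hom (yon Y) (bar (yon Z))" and mn: "finite m" "finite n"
    and f: "f \<in> el_hom (Cor m) (Cor n)" and e: "etale (corolla n) Y e"
  shows "g (Cor m) (gcomp (corolla m) e f) =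
    Cls ((\<lambda>(G, l, d). (G, compose m l (mH f), d)) ` cls (g (Cor n) e))"
  using nt_nat[OF g, of "Cor m" "Cor n" f e] mn f e by (simp add: bar_res_CC)

text \<open>Well-definedness of the multiplication. Two representatives of \<open>c\<close> are
  isomorphic by some \<open>t\<close>; the pieces inserted at \<open>y\<close> and at
  \<open>mV t y\<close> represent the same value of \<open>g\<close> up to the relabelling induced
  by \<open>t\<close>, so they are isomorphic as well. These isomorphisms assemble to one between
  the glued graphs.\<close>

lemma composite_iso:
  fixes Y Z :: "'u gr"
  assumes Y: "jk_graph Y" and Z: "jk_graph Z" and g: "g \<in> nt_hom (yon Y) (bar (yon Z))" and n: "finite n"
    and c: "c \<in> bar_val (yon Y) (Cor n)"
    and t1: "(S1, l1, yon_map S1 e1) \<in> cls c" and t2: "(S2, l2, yon_map S2 e2) \<in> cls c"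
    and D1: "(W1, m1, yon_map W1 d1) \<in> dgraphs (yon Z) n" and D2: "(W2, m2, yon_map W2 d2) \<in> dgraphs (yon Z) n"
    and k1: "composite Y Z g n S1 l1 e1 T1 E1 W1 m1 d1 \<gamma>1 \<delta>1"
    and k2: "composite Y Z g n S2 l2 e2 T2 E2 W2 m2 d2 \<gamma>2 \<delta>2"
  shows "dgraph_iso n (W1, m1, yon_map W1 d1) (W2, m2, yon_map W2 d2)"
proof -
  have SD: "(S1, l1, yon_map S1 e1) \<in> dgraphs (yon Y) n" "(S2, l2, yon_map S2 e2) \<in> dgraphs (yon Y) n"
    using barC_mem[OF c t1] barC_mem[OF c t2] by simp_all
  have S: "full S1" "full S2" and e: "etale S1 Y e1" "etale S2 Y e2" "etale W1 Z d1" "etale W2 Z d2"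
    using SD k1 k2 D1 D2 by (auto simp: dgraphs_iff composite_def)
  have J: "jk_graph S1" "jk_graph S2" using S by auto
  interpret g1: gluing S1 T1 "yon Z" using composite_gluing[OF g S(1) k1] .
  interpret g2: gluing S2 T2 "yon Z" using composite_gluing[OF g S(2) k2] .
  obtain t where t: "graph_iso S1 S2 t" "\<And>k. k \<in> n \<Longrightarrow> mA t (l1 k) = l2 k" "e1 = gcomp S1 e2 t"
    using barC_iso[OF c t1 SD(2)] t2 unfolding yon_dgraph_iso[OF J e(1,2)] by auto
  note tt = graph_isoD[OF t(1) J]
  have tH: "f \<in> Halves S1 \<Longrightarrow> hinv S2 (mH t f) = mH t (hinv S1 f)" for f
    using graph_iso_hinv[OF S t(1)] by simp
  have tl: "mH t (tailh S1 l1 k) = tailh S2 l2 k" "tailh S1 l1 k \<in> Halves S1" if "k \<in> n" for k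
  proof -
    have p: "l1 k \<in> ports S1" "l2 k \<in> ports S2" using SD that by (auto simp: dgraphs_iff)
    show "mH t (tailh S1 l1 k) = tailh S2 l2 k"
      using iso_label[where l = l1 and l' = l2, OF S tt(1) p] t(2)[OF that] by simp
    show "tailh S1 l1 k \<in> Halves S1" using tailh_port[where l = l1, OF S(1) p(1)] by simp
  qed
  have "\<exists>\<tau>. graph_iso (g1.G y) (g2.G (mV t y)) \<tau> \<and>
      (\<forall>f\<in>flags_at S1 y. mH \<tau> (ptail S1 T1 f) = ptail S2 T2 (mH t f)) \<and>
      E1 y = gcomp (g1.G y) (E2 (mV t y)) \<tau>" if y: "y \<in> Verts S1" for y
  proof -
    let ?y = "mV t y" let ?n1 = "flags_at S1 y" let ?n2 = "flags_at S2 ?y"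
    have y2: "?y \<in> Verts S2" using y tt by simp
    note si = star_iso[OF J tt(1) y]
    let ?f = "crel ?n1 ?n2 (mH t)"
    have fe: "etale (corolla ?n1) (corolla ?n2) ?f" using si(1) by (simp add: el_hom_def)
    have fin: "finite ?n1" "finite ?n2" using J by simp_all
    have st: "etale (corolla ?n1) S1 (star S1 y)" "etale (corolla ?n2) S2 (star S2 ?y)"
      using J y y2 by simp_all
    have est: "etale (corolla ?n2) Y (gcomp (corolla ?n2) e2 (star S2 ?y))"
      using fin by (intro etale_gcomp[OF _ st(2) e(2)]) simp
    have eq: "gcomp (corolla ?n1) e1 (star S1 y) =
        gcomp (corolla ?n1) (gcomp (corolla ?n2) e2 (star S2 ?y)) ?f"
      unfolding t(3) gcomp_assoc[OF st(1)] si(2) gcomp_assoc[OF fe] ..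
    obtain L0 d0 G0 where T1: "T1 y = (G0, compose ?n1 L0 (mH ?f), d0)"
      and m0: "(G0, L0, d0) \<in> cls (g (Cor ?n2) (gcomp (corolla ?n2) e2 (star S2 ?y)))"
    proof -
      have "T1 y \<in> cls (g (Cor ?n1) (gcomp (corolla ?n1) e1 (star S1 y)))"
        using k1 y by (simp add: composite_def)
      then have "T1 y \<in> (\<lambda>(G, l, d). (G, compose ?n1 l (mH ?f), d)) `
          cls (g (Cor ?n2) (gcomp (corolla ?n2) e2 (star S2 ?y)))"
        unfolding eq nt_relabel[OF g fin si(1) est] by simp
      then show ?thesis using that by auto
    qed
    have cb: "g (Cor ?n2) (gcomp (corolla ?n2) e2 (star S2 ?y)) \<in> bar_val (yon Z) (Cor ?n2)"
      using nt_in[OF g, of "Cor ?n2"] est fin by simp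
    obtain G2 L2 d2' where T2: "T2 ?y = (G2, L2, d2')" by (cases "T2 ?y")
    have m2: "(G2, L2, d2') \<in> cls (g (Cor ?n2) (gcomp (corolla ?n2) e2 (star S2 ?y)))"
    proof -
      have "T2 ?y \<in> cls (g (Cor ?n2) (gcomp (corolla ?n2) e2 (star S2 ?y)))"
        using k2 y2 by (simp add: composite_def)
      then show ?thesis using T2 by simp
    qed
    have Ee: "d0 = yon_map G0 (E1 y)" "etale G0 Z (E1 y)" "d2' = yon_map G2 (E2 ?y)" "etale G2 Z (E2 ?y)"
      using k1 k2 y y2 T1 T2 by (auto simp: composite_def)
    have D0: "(G0, L0, d0) \<in> dgraphs (yon Z) ?n2" using barC_mem(1)[OF cb m0] .
    have D2: "(G2, L2, d2') \<in> dgraphs (yon Z) ?n2" using barC_mem(1)[OF cb m2] .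
    have GG: "full G0" "full G2" and GJ: "jk_graph G0" "jk_graph G2" using D0 D2 by (auto simp: dgraphs_iff)
    obtain \<tau> where \<tau>: "graph_iso G0 G2 \<tau>" "\<And>k. k \<in> ?n2 \<Longrightarrow> mA \<tau> (L0 k) = L2 k" "E1 y = gcomp G0 (E2 ?y) \<tau>"
      using barC_iso[OF cb m0 D2] m2 unfolding Ee(1,3) yon_dgraph_iso[OF GJ Ee(2,4)] by auto
    have "mH \<tau> (ptail S1 T1 f) = ptail S2 T2 (mH t f)" if f: "f \<in> ?n1" for f
    proof -
      have f2: "mH t f \<in> ?n2" using etale_star[OF tt(1) y] f by (auto simp: bij_betw_def)
      have gpf: "gp S1 f = y" "gp S2 (mH t f) = ?y" using f f2 by (auto simp: flags_at_iff)
      have "ptail S1 T1 f = tailh G0 L0 (mH t f)"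
        using f by (simp add: ptail_def gpf T1 compose_tailh)
      moreover have "ptail S2 T2 (mH t f) = tailh G2 L2 (mH t f)" by (simp add: ptail_def gpf T2)
      moreover have "L0 (mH t f) \<in> ports G0" "L2 (mH t f) \<in> ports G2" using D0 D2 f2 by (auto simp: dgraphs_iff)
      then have "mH \<tau> (tailh G0 L0 (mH t f)) = tailh G2 L2 (mH t f)"
        using iso_label[where l = L0 and l' = L2, OF GG graph_iso_etale[OF \<tau>(1)]] \<tau>(2)[OF f2] by metis
      ultimately show ?thesis by simp
    qed
    then show ?thesis using \<tau> T1 T2 by auto
  qed
  then obtain \<tau> where \<tau>: "\<And>y. y \<in> Verts S1 \<Longrightarrow> graph_iso (g1.G y) (g2.G (mV t y)) (\<tau> y)"
    "\<And>y f. y \<in> Verts S1 \<Longrightarrow> f \<in> flags_at S1 y \<Longrightarrow> mH (\<tau> y) (ptail S1 T1 f) = ptail S2 T2 (mH t f)"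
    "\<And>y. y \<in> Verts S1 \<Longrightarrow> E1 y = gcomp (g1.G y) (E2 (mV t y)) (\<tau> y)"
    by metis
  have ty: "mV t y \<in> Verts S2" if "y \<in> Verts S1" for y using that tt by simp
  have \<tau>\<tau>: "etale (g1.G y) (g2.G (mV t y)) (\<tau> y)"
    "bij_betw (mH (\<tau> y)) (Halves (g1.G y)) (Halves (g2.G (mV t y)))"
    "bij_betw (mV (\<tau> y)) (Verts (g1.G y)) (Verts (g2.G (mV t y)))" if "y \<in> Verts S1" for y
    using graph_isoD[OF \<tau>(1)[OF that] g1.G(2)[OF that] g2.G(2)[OF ty[OF that]]] by auto
  let ?H1 = "SIGMA y:Verts S1. Halves (g1.G y)" and ?H2 = "SIGMA y:Verts S2. Halves (g2.G y)"
  let ?V1 = "SIGMA y:Verts S1. Verts (g1.G y)" and ?V2 = "SIGMA y:Verts S2. Verts (g2.G y)"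
  have \<gamma>: "bij_betw \<gamma>1 ?H1 (Halves W1)" "bij_betw \<gamma>2 ?H2 (Halves W2)"
    and \<delta>: "bij_betw \<delta>1 ?V1 (Verts W1)" "bij_betw \<delta>2 ?V2 (Verts W2)"
    using k1 k2 by (auto simp: composite_def assembles_def)
  let ?h = "\<lambda>(y, h). (mV t y, mH (\<tau> y) h)" and ?v = "\<lambda>(y, x). (mV t y, mV (\<tau> y) x)"
  have inj: "mV t y = mV t y' \<longleftrightarrow> y = y'" if "y \<in> Verts S1" "y' \<in> Verts S1" for y y'
    using tt(4) that by (auto simp: bij_betw_def inj_on_def)
  have surj: "\<exists>y\<in>Verts S1. y' = mV t y" if "y' \<in> Verts S2" for y'
    using tt(4) that by (auto simp: bij_betw_def)
  have h: "bij_betw ?h ?H1 ?H2" unfolding bij_betw_def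
  proof (intro conjI inj_onI set_eqI iffI)
    fix a b assume "a \<in> ?H1" "b \<in> ?H1" "?h a = ?h b"
    then show "a = b" using inj \<tau>\<tau>(2) by (auto simp: bij_betw_def inj_on_def)
  next
    fix b assume "b \<in> ?h ` ?H1" then show "b \<in> ?H2" using \<tau>\<tau>(2) ty by (auto simp: bij_betw_def)
  next
    fix b assume "b \<in> ?H2"
    then obtain y' k where b': "b = (y', k)" "y' \<in> Verts S2" "k \<in> Halves (g2.G y')" by auto
    from surj[OF b'(2)] obtain y where "y \<in> Verts S1" "y' = mV t y" by blast
    with b' have b: "b = (mV t y, k)" "y \<in> Verts S1" "k \<in> Halves (g2.G (mV t y))" by simp_all
    then have "k \<in> mH (\<tau> y) ` Halves (g1.G y)" using \<tau>\<tau>(2)[of y] by (simp add: bij_betw_def)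
    then show "b \<in> ?h ` ?H1" using b by force
  qed
  have v: "bij_betw ?v ?V1 ?V2" unfolding bij_betw_def
  proof (intro conjI inj_onI set_eqI iffI)
    fix a b assume "a \<in> ?V1" "b \<in> ?V1" "?v a = ?v b"
    then show "a = b" using inj \<tau>\<tau>(3) by (auto simp: bij_betw_def inj_on_def)
  next
    fix b assume "b \<in> ?v ` ?V1" then show "b \<in> ?V2" using \<tau>\<tau>(3) ty by (auto simp: bij_betw_def)
  next
    fix b assume "b \<in> ?V2"
    then obtain y' k where b': "b = (y', k)" "y' \<in> Verts S2" "k \<in> Verts (g2.G y')" by auto
    from surj[OF b'(2)] obtain y where "y \<in> Verts S1" "y' = mV t y" by blast
    with b' have b: "b = (mV t y, k)" "y \<in> Verts S1" "k \<in> Verts (g2.G (mV t y))" by simp_all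
    then have "k \<in> mV (\<tau> y) ` Verts (g1.G y)" using \<tau>\<tau>(3)[of y] by (simp add: bij_betw_def)
    then show "b \<in> ?v ` ?V1" using b by force
  qed
  \<comment> \<open>Decompose \<open>W1\<close> into its pieces, move each piece by its isomorphism,
    and reassemble in \<open>W2\<close>.\<close>
  define \<eta> where "\<eta> = (\<lambda>x. \<gamma>2 (?h (inv_into ?H1 \<gamma>1 x)))"
  define \<nu> where "\<nu> = (\<lambda>x. \<delta>2 (?v (inv_into ?V1 \<delta>1 x)))"
  have \<eta>: "\<eta> (\<gamma>1 (y, x)) = \<gamma>2 (mV t y, mH (\<tau> y) x)" if "y \<in> Verts S1" "x \<in> Halves (g1.G y)" for y x
    using that \<gamma>(1) by (simp add: \<eta>_def bij_betw_inv_into_left)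
  have \<nu>: "\<nu> (\<delta>1 (y, x)) = \<delta>2 (mV t y, mV (\<tau> y) x)" if "y \<in> Verts S1" "x \<in> Verts (g1.G y)" for y x
    using that \<delta>(1) by (simp add: \<nu>_def bij_betw_inv_into_left)
  have W1H: "\<exists>y x. y \<in> Verts S1 \<and> x \<in> Halves (g1.G y) \<and> h = \<gamma>1 (y, x)" if "h \<in> Halves W1" for h
  proof -
    have "h \<in> \<gamma>1 ` ?H1" using \<gamma>(1) that by (simp add: bij_betw_def)
    then show ?thesis by auto
  qed
  have W1V: "\<exists>y x. y \<in> Verts S1 \<and> x \<in> Verts (g1.G y) \<and> h = \<delta>1 (y, x)" if "h \<in> Verts W1" for h
  proof -
    have "h \<in> \<delta>1 ` ?V1" using \<delta>(1) that by (simp add: bij_betw_def)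
    then show ?thesis by auto
  qed
  have mem: "mH (\<tau> y) x \<in> Halves (g2.G (mV t y))" if "y \<in> Verts S1" "x \<in> Halves (g1.G y)" for y x
    using etale_mH[OF \<tau>\<tau>(1)] that by blast
  have memV: "mV (\<tau> y) x \<in> Verts (g2.G (mV t y))" if "y \<in> Verts S1" "x \<in> Verts (g1.G y)" for y x
    using etale_mV[OF \<tau>\<tau>(1)] that by blast
  have a1: "assembles S1 T1 W1 \<gamma>1 \<delta>1" and a2: "assembles S2 T2 W2 \<gamma>2 \<delta>2"
    using k1 k2 by (auto simp: composite_def)
  show ?thesis
  proof (rule yon_dgraph_isoI[OF D1 D2 e(3,4), where \<eta> = \<eta> and \<nu> = \<nu>])
    have "bij_betw (\<gamma>2 \<circ> (?h \<circ> inv_into ?H1 \<gamma>1)) (Halves W1) (Halves W2)"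
      using bij_betw_trans[OF bij_betw_trans[OF bij_betw_inv_into[OF \<gamma>(1)] h] \<gamma>(2)] .
    then show "bij_betw \<eta> (Halves W1) (Halves W2)" by (simp add: \<eta>_def comp_def)
    have "bij_betw (\<delta>2 \<circ> (?v \<circ> inv_into ?V1 \<delta>1)) (Verts W1) (Verts W2)"
      using bij_betw_trans[OF bij_betw_trans[OF bij_betw_inv_into[OF \<delta>(1)] v] \<delta>(2)] .
    then show "bij_betw \<nu> (Verts W1) (Verts W2)" by (simp add: \<nu>_def comp_def)
  next
    fix h assume "h \<in> Halves W1"
    then obtain y x where x: "y \<in> Verts S1" "x \<in> Halves (g1.G y)" "h = \<gamma>1 (y, x)" using W1H by blast
    have xp: "gp (g1.G y) x \<in> Verts (g1.G y)" using x g1.G by simp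
    have "gp W1 h = \<delta>1 (y, gp (g1.G y) x)" using a1 x by (simp add: assembles_def)
    moreover have "gp W2 (\<gamma>2 (mV t y, mH (\<tau> y) x)) = \<delta>2 (mV t y, gp (g2.G (mV t y)) (mH (\<tau> y) x))"
      using a2 mem[OF x(1,2)] ty[OF x(1)] by (simp add: assembles_def)
    ultimately show "gp W2 (\<eta> h) = \<nu> (gp W1 h)"
      using x xp by (simp add: \<eta> \<nu> etale_gp[OF \<tau>\<tau>(1)])
    \<comment> \<open>A half-edge that is inner in its piece keeps its partner there; a tail of the
      piece has its partner governed by \<open>S1\<close>, and there one uses that \<open>t\<close>
      commutes with the involutions.\<close>
    show "hinv W2 (\<eta> h) = \<eta> (hinv W1 h)"
    proof (cases "hinv (g1.G y) x = x")
      case False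
      have "hinv (g2.G (mV t y)) (mH (\<tau> y) x) = mH (\<tau> y) (hinv (g1.G y) x)"
        "mH (\<tau> y) (hinv (g1.G y) x) \<noteq> mH (\<tau> y) x"
        using etale_hinv[OF \<tau>\<tau>(1) g1.G(2) g2.G(2), of y] x False ty by auto
      then show ?thesis using False x a1 a2 mem[OF x(1,2)] ty[OF x(1)] g1.G(2)[OF x(1)]
        by (simp add: assembles_def \<eta>)
    next
      case True
      obtain f where f: "f \<in> Halves S1" "gp S1 f = y" "x = ptail S1 T1 f"
        using g1.ptail_surj[OF x(1,2) True] .
      have tf: "mH t f \<in> Halves S2" "gp S2 (mH t f) = mV t y" using f tt(1) etale_gp[OF tt(1), of f] by auto
      have \<tau>f: "mH (\<tau> y) x = ptail S2 T2 (mH t f)" using \<tau>(2)[of y f] f x by (simp add: flags_at_iff)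
      let ?f = "hinv S1 f" let ?y = "gp S1 ?f"
      have f': "?f \<in> Halves S1" "?y \<in> Verts S1" using f J by simp_all
      have "hinv W1 h = \<gamma>1 (?y, ptail S1 T1 ?f)" using a1 f x by (auto simp: assembles_def)
      then have "\<eta> (hinv W1 h) = \<gamma>2 (mV t ?y, mH (\<tau> ?y) (ptail S1 T1 ?f))"
        using f' g1.ptail(1)[OF f'(1)] by (simp add: \<eta>)
      also have "\<dots> = \<gamma>2 (gp S2 (mH t ?f), ptail S2 T2 (mH t ?f))"
        using \<tau>(2)[of ?y ?f] f' etale_gp[OF tt(1), of ?f] by (simp add: flags_at_iff)
      also have "\<dots> = hinv W2 (\<gamma>2 (gp S2 (mH t f), ptail S2 T2 (mH t f)))"
      proof -
        have "\<forall>f\<in>Halves S2. hinv W2 (\<gamma>2 (gp S2 f, ptail S2 T2 f)) =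
            \<gamma>2 (gp S2 (hinv S2 f), ptail S2 T2 (hinv S2 f))"
          using a2 by (simp add: assembles_def)
        from bspec[OF this tf(1)] show ?thesis unfolding tH[OF f(1)] by (rule sym)
      qed
      also have "\<dots> = hinv W2 (\<eta> h)" using x \<tau>f tf by (simp add: \<eta>)
      finally show ?thesis by simp
    qed
    have "mH d1 h = mH (E1 y) x" using k1 x by (simp add: composite_def)
    also have "\<dots> = mH (E2 (mV t y)) (mH (\<tau> y) x)" using \<tau>(3)[OF x(1)] x by simp
    also have "\<dots> = mH d2 (\<eta> h)" using k2 x mem[OF x(1,2)] ty[OF x(1)] by (simp add: composite_def \<eta>)
    finally show "mH d2 (\<eta> h) = mH d1 h" by simp
  next
    fix h assume "h \<in> Verts W1"
    then obtain y x where x: "y \<in> Verts S1" "x \<in> Verts (g1.G y)" "h = \<delta>1 (y, x)" using W1V by blast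
    have "mV d1 h = mV (E1 y) x" using k1 x by (simp add: composite_def)
    also have "\<dots> = mV (E2 (mV t y)) (mV (\<tau> y) x)" using \<tau>(3)[OF x(1)] x by simp
    also have "\<dots> = mV d2 (\<nu> h)" using k2 x memV[OF x(1,2)] ty[OF x(1)] by (simp add: composite_def \<nu>)
    finally show "mV d2 (\<nu> h) = mV d1 h" by simp
  next
    fix k assume k: "k \<in> n"
    let ?f = "tailh S1 l1 k"
    have f: "?f \<in> Halves S1" "mH t ?f = tailh S2 l2 k" using tl[OF k] by simp_all
    have y: "gp S1 ?f \<in> Verts S1" using f J by simp
    have "tailh W1 m1 k = \<gamma>1 (gp S1 ?f, ptail S1 T1 ?f)" using k1 k by (simp add: composite_def)
    then have "\<eta> (tailh W1 m1 k) = \<gamma>2 (mV t (gp S1 ?f), mH (\<tau> (gp S1 ?f)) (ptail S1 T1 ?f))"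
      using y g1.ptail(1)[OF f(1)] by (simp add: \<eta>)
    also have "\<dots> = \<gamma>2 (gp S2 (tailh S2 l2 k), ptail S2 T2 (tailh S2 l2 k))"
      using \<tau>(2)[OF y, of ?f] f etale_gp[OF tt(1), of ?f] by (simp add: flags_at_iff)
    also have "\<dots> = tailh W2 m2 k" using k2 k by (simp add: composite_def)
    finally show "\<eta> (tailh W1 m1 k) = tailh W2 m2 k" .
  qed
qed

section \<open>Existence of the glued graph with its map to the target\<close>

lemma (in gluing) ptail_inj:
  assumes "f \<in> Halves S" "f' \<in> Halves S" "gp S f = gp S f'" "ptail S T f = ptail S T f'"
  shows "f = f'"
proof -
  have "q f = q f'" using assms ptail_L[OF assms(1)] ptail_L[OF assms(2)] by (simp add: q_eq)
  then show ?thesis using q_inj assms by simp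
qed

text \<open>Along each inner edge of \<open>S\<close> two tails of pieces are joined, so exactly
  those labelled by tails of \<open>S\<close> stay open.\<close>

lemma (in gluing) tails_glue: "bij_betw (\<lambda>f. (gp S f, ptail S T f)) (tails S) (tails (glue S T))"
  unfolding bij_betw_def
proof (intro conjI inj_onI set_eqI iffI)
  fix f f' assume "f \<in> tails S" "f' \<in> tails S" "(gp S f, ptail S T f) = (gp S f', ptail S T f')"
  then show "f = f'" using ptail_inj by (auto simp: tails_iff)
next
  fix x assume "x \<in> (\<lambda>f. (gp S f, ptail S T f)) ` tails S"
  then show "x \<in> tails (glue S T)" using ptail(1) hinv_glue_ptail by (auto simp: tails_iff)
next
  fix x assume "x \<in> tails (glue S T)"
  then obtain y h where x: "x = (y, h)" "y \<in> Verts S" "h \<in> Halves (G y)" "hinv (glue S T) (y, h) = (y, h)"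
    by (cases x) (auto simp: tails_iff)
  then have "hinv (G y) h = h" using hinv_glue[OF x(2,3)] by fastforce
  then obtain f where f: "f \<in> Halves S" "gp S f = y" "h = ptail S T f" using ptail_surj[OF x(2,3)] by blast
  then have "(gp S (hinv S f), ptail S T (hinv S f)) = (gp S f, ptail S T f)"
    using x(4) hinv_glue_ptail[OF f(1)] by simp
  then have "gp S (hinv S f) = gp S f" "ptail S T (hinv S f) = ptail S T f"
    by (simp_all only: prod.inject)
  then have "hinv S f = f" by (rule ptail_inj[OF hinv_in[OF jk_S f(1)] f(1)])
  then show "x \<in> (\<lambda>f. (gp S f, ptail S T f)) ` tails S" using f x by (auto simp: tails_iff)
qed

lemma graph_iso_tails:
  assumes "full G" "full K" "graph_iso G K f" shows "bij_betw (mH f) (tails G) (tails K)"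
proof -
  have J: "jk_graph G" "jk_graph K" using assms by auto
  note b = graph_isoD(3)[OF assms(3) J]
  have "mH f ` tails G = tails K"
  proof (intro set_eqI iffI)
    fix k assume k: "k \<in> tails K"
    then have "k \<in> mH f ` Halves G" using b by (simp add: bij_betw_def tails_iff)
    then obtain h where h: "h \<in> Halves G" "k = mH f h" by blast
    then have "mH f (hinv G h) = mH f h" using graph_iso_hinv[OF assms h(1)] k by (simp add: tails_iff)
    then have "hinv G h = h"
      using inj_onD[OF bij_betw_imp_inj_on[OF b], of "hinv G h" h] h J by simp
    then show "k \<in> mH f ` tails G" using h by (simp add: tails_iff)
  next
    fix k assume "k \<in> mH f ` tails G"
    then show "k \<in> tails K" using graph_iso_hinv[OF assms] graph_iso_etale[OF assms(3)] by (auto simp: tails_iff)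
  qed
  moreover have "inj_on (mH f) (tails G)"
    using b by (auto simp: bij_betw_def tails_iff intro: inj_on_subset)
  ultimately show ?thesis by (simp add: bij_betw_def)
qed

text \<open>The etale maps of the pieces must agree along every edge of \<open>S\<close> before they
  define a map on the glued graph. They do, because both express the colour that \<open>g\<close>
  gives to one arc of \<open>S\<close>.\<close>

lemma composite_ex:
  fixes Y Z :: "'u::infinite gr"
  assumes Y: "jk_graph Y" and Z: "jk_graph Z" and g: "g \<in> nt_hom (yon Y) (bar (yon Z))" and n: "finite n"
    and t: "(S, l, yon_map S e) \<in> dgraphs (yon Y) n" and e: "etale S Y e"
  obtains T Te W l' e' \<gamma> \<delta> where "(W, l', yon_map W e') \<in> dgraphs (yon Z) n"
    "composite Y Z g n S l e T Te W l' e' \<gamma> \<delta>"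
proof -
  have S: "full S" and SV: "Verts S \<noteq> {}" and SJ: "jk_graph S" using t by (auto simp: dgraphs_iff)
  note en = edge_nt[OF g e S]
  let ?\<psi> = "nt_comp (yon S) g (yon_map S e)"
  have "\<exists>t E. t \<in> cls (?\<psi> (Cor (flags_at S y)) (star S y)) \<and> t \<in> dgraphs (yon Z) (flags_at S y) \<and>
      snd (snd t) = yon_map (fst t) E \<and> etale (fst t) Z E" if y: "y \<in> Verts S" for y
  proof -
    obtain G l d where t: "(G, l, d) \<in> cls (?\<psi> (Cor (flags_at S y)) (star S y))"
      "(G, l, d) \<in> dgraphs (yon Z) (flags_at S y)"
      using barC_ne[OF star_cls[OF S en(1) y]] .
    then obtain E where "etale G Z E" "d = yon_map G E" using Z by (auto simp: yon_dgraphs_iff)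
    then show ?thesis using t by (intro exI[of _ "(G, l, d)"] exI[of _ E]) auto
  qed
  then obtain T Te where TT: "\<And>y. y \<in> Verts S \<Longrightarrow> T y \<in> cls (?\<psi> (Cor (flags_at S y)) (star S y))"
    "\<And>y. y \<in> Verts S \<Longrightarrow> T y \<in> dgraphs (yon Z) (flags_at S y)"
    "\<And>y. y \<in> Verts S \<Longrightarrow> piece_dec T y = yon_map (piece T y) (Te y)"
    "\<And>y. y \<in> Verts S \<Longrightarrow> etale (piece T y) Z (Te y)"
    by metis
  interpret gluing S T "yon Z" by unfold_locales (use S TT in auto)
  have Tt: "T y = (G y, L y, yon_map (G y) (Te y))" if "y \<in> Verts S" for y
    using TT(3)[OF that] by (cases "T y") simp
  let ?H = "\<lambda>(y, h). mH (Te y) h" and ?V = "\<lambda>(y, x). mV (Te y) x"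
  let ?E = "hv_mor (glue S T) Z ?H ?V"
  \<comment> \<open>The colours of both arcs at a half-edge of \<open>S\<close>, as seen in the
    piece at its vertex.\<close>
  have col: "?\<psi> Unit (uat S (gs S f)) = Colour (uat Z (gs Z (mH (Te (gp S f)) (ptail S T f))))"
    "?\<psi> Unit (uat S (gi S (gs S f))) = Colour (uat Z (gi Z (gs Z (mH (Te (gp S f)) (ptail S T f)))))"
    if f: "f \<in> Halves S" for f
  proof -
    have y: "gp S f \<in> Verts S" using f SJ by simp
    have m: "(G (gp S f), L (gp S f), yon_map (G (gp S f)) (Te (gp S f))) \<in>
        cls (?\<psi> (Cor (flags_at S (gp S f))) (star S (gp S f)))"
      by (subst Tt[OF y, symmetric]) (rule TT(1)[OF y])
    show "?\<psi> Unit (uat S (gs S f)) = Colour (uat Z (gs Z (mH (Te (gp S f)) (ptail S T f))))"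
      "?\<psi> Unit (uat S (gi S (gs S f))) = Colour (uat Z (gi Z (gs Z (mH (Te (gp S f)) (ptail S T f)))))"
      using star_colour[OF S Z en(1) f m TT(4)[OF y]] unfolding ptail_def by blast+
  qed
  have E: "etale (glue S T) Z ?E"
  proof (rule hv_etale[OF full_glue Z])
    show "?H ` Halves (glue S T) \<subseteq> Halves Z" "?V ` Verts (glue S T) \<subseteq> Verts Z"
      using etale_mH[OF TT(4)] etale_mV[OF TT(4)] by auto
    fix x assume "x \<in> Halves (glue S T)"
    then obtain y h where x: "x = (y, h)" "y \<in> Verts S" "h \<in> Halves (G y)" by auto
    then show "gp Z (?H x) = ?V (gp (glue S T) x)" using etale_gp[OF TT(4)] by (simp add: glue_gp)
    assume ne: "hinv (glue S T) x \<noteq> x"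
    show "gi Z (gs Z (?H x)) = gs Z (?H (hinv (glue S T) x))"
    proof (cases "hinv (G y) h = h")
      case False
      then show ?thesis using x etale_hinv(3)[OF TT(4) G(2) Z] by (simp add: hinv_glue)
    next
      case True
      obtain f where f: "f \<in> Halves S" "gp S f = y" "h = ptail S T f" using ptail_surj[OF x(2,3) True] .
      have f': "hinv S f \<noteq> f" using ne hinv_glue_ptail[OF f(1)] f x by auto
      then have "gi S (gs S f) = gs S (hinv S f)" using f SJ by (simp add: gi_gs)
      \<comment> \<open>The flip of the arc attached to \<open>f\<close> is the arc attached to its
        partner; its colour, seen from the two pieces, gives the required equality of arcs in
        \<open>Z\<close>.\<close>
      then have "?\<psi> Unit (uat S (gi S (gs S f))) = ?\<psi> Unit (uat S (gs S (hinv S f)))" by simp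
      then have "gi Z (gs Z (mH (Te (gp S f)) (ptail S T f))) =
          gs Z (mH (Te (gp S (hinv S f))) (ptail S T (hinv S f)))"
        unfolding col(2)[OF f(1)] col(1)[OF hinv_in[OF SJ f(1)]] barel.inject by (rule uat_inj)
      then show ?thesis using f x hinv_glue_ptail[OF f(1)] by auto
    qed
  next
    fix x assume "x \<in> Verts (glue S T)"
    then obtain y v where x: "x = (y, v)" "y \<in> Verts S" "v \<in> Verts (G y)" by auto
    have "bij_betw (mH (glue_in S T y)) (flags_at (G y) v) (flags_at (glue S T) x)"
      using etale_star[OF glue_in_etale[OF x(2)] x(3)] x by simp
    moreover have "bij_betw (?H \<circ> mH (glue_in S T y)) (flags_at (G y) v) (flags_at Z (?V x))"
      using etale_star[OF TT(4)[OF x(2)] x(3)] x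
      by (subst bij_betw_cong[where g = "mH (Te y)"]) (auto simp: flags_at_iff)
    ultimately show "bij_betw ?H (flags_at (glue S T) x) (flags_at Z (?V x))"
      by (simp add: bij_betw_comp_iff)
  qed
  obtain W :: "'u gr" and w where W: "full W" and w: "graph_iso (glue S T) W w"
    using ex_copy[OF full_glue] .
  obtain w' where w': "graph_iso W (glue S T) w'" "gcomp (glue S T) w' w = gid (glue S T)"
    using graph_iso_inverse[OF w] .
  have WJ: "jk_graph W" using W by simp
  define e' where "e' = gcomp W ?E w'"
  have e'e: "etale W Z e'" unfolding e'_def by (rule etale_gcomp[OF WJ graph_iso_etale[OF w'(1)] E])
  have we: "etale (glue S T) W w" using w by (rule graph_iso_etale)
  define t' where "t' k = mH w (gp S (tailh S l k), ptail S T (tailh S l k))" for k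
  have "bij_betw l n (ports S)" using t by (simp add: dgraphs_iff)
  then have "bij_betw (mH w \<circ> ((\<lambda>f. (gp S f, ptail S T f)) \<circ> tailh S l)) n (tails W)"
    by (rule bij_betw_trans[OF bij_betw_trans[OF tailh_bij[OF S] tails_glue] graph_iso_tails[OF full_glue W w]])
  then have b: "bij_betw t' n (tails W)" by (simp add: t'_def[abs_def] comp_def)
  note lb = lab_bij[OF W b]
  have "Verts W \<noteq> {}"
  proof -
    obtain y where y: "y \<in> Verts S" using SV by blast
    then have "Verts (G y) \<noteq> {}" using TT(2)[OF y] Tt[OF y] by (metis dgraphs_iff)
    then obtain v where "v \<in> Verts (G y)" by blast
    then show ?thesis using etale_mV[OF we, of "(y, v)"] y by auto
  qed
  then have D: "(W, lab W n t', yon_map W e') \<in> dgraphs (yon Z) n"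
    using W lb e'e by (intro yon_dgraphsI) auto
  have "mH e' (mH w x) = ?H x" if "x \<in> Halves (glue S T)" for x
  proof -
    have "mH w x \<in> Halves W" using etale_mH[OF we that] .
    then have "mH e' (mH w x) = mH ?E (mH (gcomp (glue S T) w' w) x)" using that by (simp add: e'_def)
    then show ?thesis unfolding w'(2) using that by (simp del: glue_simps)
  qed
  moreover have "mV e' (mV w x) = ?V x" if "x \<in> Verts (glue S T)" for x
  proof -
    have "mV w x \<in> Verts W" using etale_mV[OF we that] .
    then have "mV e' (mV w x) = mV ?E (mV (gcomp (glue S T) w' w) x)" using that by (simp add: e'_def)
    then show ?thesis unfolding w'(2) using that by (simp del: glue_simps)
  qed
  moreover have "tailh W (lab W n t') k = t' k" if "k \<in> n" for k
    using b that WJ by (intro tailh_lab) (auto simp: bij_betw_def tails_iff)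
  ultimately have "composite Y Z g n S l e T Te W (lab W n t') e' (mH w) (mV w)"
    using e e'e TT en(2) iso_assembles[OF W w] by (simp add: composite_def t'_def)
  then show ?thesis using D that by blast
qed

lemma assembles_trans:
  assumes W: "full W" "full W'" and t: "graph_iso W W' t" and a: "assembles S T W \<gamma> \<delta>"
    and T: "\<And>y. y \<in> Verts S \<Longrightarrow> jk_graph (piece T y)"
    and S: "gluing S T F"
  shows "assembles S T W' (mH t \<circ> \<gamma>) (mV t \<circ> \<delta>)"
proof -
  interpret gluing S T F by fact
  have J: "jk_graph W" "jk_graph W'" using W by auto
  note tt = graph_isoD[OF t J]
  have \<gamma>: "\<gamma> (y, h) \<in> Halves W" if "y \<in> Verts S" "h \<in> Halves (piece T y)" for y h
    using a that by (auto simp: assembles_def bij_betw_def)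
  have j: "hinv W' (mH t h) = mH t (hinv W h)" if "h \<in> Halves W" for h
    using graph_iso_hinv[OF W t that] .
  show ?thesis unfolding assembles_def
  proof (intro conjI ballI impI)
    show "bij_betw (mH t \<circ> \<gamma>) (SIGMA y:Verts S. Halves (piece T y)) (Halves W')"
      "bij_betw (mV t \<circ> \<delta>) (SIGMA y:Verts S. Verts (piece T y)) (Verts W')"
      using a tt by (auto simp: assembles_def intro: bij_betw_trans)
  next
    fix y h assume x: "y \<in> Verts S" "h \<in> Halves (piece T y)"
    have "gp W (\<gamma> (y, h)) = \<delta> (y, gp (piece T y) h)" using a x by (simp add: assembles_def)
    then show "gp W' ((mH t \<circ> \<gamma>) (y, h)) = (mV t \<circ> \<delta>) (y, gp (piece T y) h)"
      using etale_gp[OF tt(1) \<gamma>[OF x]] by simp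
    assume "hinv (piece T y) h \<noteq> h"
    then have "hinv W (\<gamma> (y, h)) = \<gamma> (y, hinv (piece T y) h)" using a x by (simp add: assembles_def)
    then show "hinv W' ((mH t \<circ> \<gamma>) (y, h)) = (mH t \<circ> \<gamma>) (y, hinv (piece T y) h)"
      using j[OF \<gamma>[OF x]] by simp
  next
    fix f assume f: "f \<in> Halves S"
    have "hinv W (\<gamma> (gp S f, ptail S T f)) = \<gamma> (gp S (hinv S f), ptail S T (hinv S f))"
      using a f by (simp add: assembles_def)
    then show "hinv W' ((mH t \<circ> \<gamma>) (gp S f, ptail S T f)) =
        (mH t \<circ> \<gamma>) (gp S (hinv S f), ptail S T (hinv S f))"
      using j[OF \<gamma>[OF _ ptail(1)[OF f]]] f by simp
  qed
qed

text \<open>The set built by \<open>mult\<close> is one isomorphism class: it is nonempty by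
  \<open>composite_ex\<close>, lies in one class by \<open>composite_iso\<close>, and is closed
  because an isomorphism out of a glued graph can be absorbed into \<open>\<gamma>\<close> and
  \<open>\<delta>\<close>.\<close>

lemma kext_bar:
  fixes Y Z :: "'u::infinite gr"
  assumes Y: "jk_graph Y" and Z: "jk_graph Z" and g: "g \<in> nt_hom (yon Y) (bar (yon Z))" and n: "finite n"
    and c: "c \<in> bar_val (yon Y) (Cor n)"
  shows "kext Y Z g (Cor n) c \<in> bar_val (yon Z) (Cor n)"
proof -
  let ?K = "kext Y Z g (Cor n) c"
  obtain S l d where t: "(S, l, d) \<in> cls c" and D: "(S, l, d) \<in> dgraphs (yon Y) n" using barC_ne[OF c] .
  obtain e where e: "etale S Y e" "d = yon_map S e" using D Y by (auto simp: yon_dgraphs_iff)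
  note t = t[unfolded e(2)] and D = D[unfolded e(2)]
  obtain T Te W l' e' \<gamma> \<delta> where W: "(W, l', yon_map W e') \<in> dgraphs (yon Z) n"
    and k: "composite Y Z g n S l e T Te W l' e' \<gamma> \<delta>"
    using composite_ex[OF Y Z g n D e(1)] .
  have m: "(W, l', yon_map W e') \<in> cls ?K" by (rule kextI[OF Y Z g n c t W k])
  have C: "?K = Cls (cls ?K)" unfolding kext_Cor[OF g n c] by simp
  have "Cls (cls ?K) \<in> bar_val (yon Z) (Cor n)"
  proof (rule barC_I[OF _ m])
    show "cls ?K \<subseteq> dgraphs (yon Z) n" unfolding kext_Cor[OF g n c] by auto
  next
    fix t' assume t': "t' \<in> cls ?K"
    obtain W2 l2 d2 where tt: "t' = (W2, l2, d2)" by (cases t')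
    obtain S2 m2 e2 T2 E2 e2' \<gamma>2 \<delta>2 where k2: "(S2, m2, yon_map S2 e2) \<in> cls c" "d2 = yon_map W2 e2'"
      "(W2, l2, d2) \<in> dgraphs (yon Z) n" "composite Y Z g n S2 m2 e2 T2 E2 W2 l2 e2' \<gamma>2 \<delta>2"
      using kextE[OF Y Z g n c t'[unfolded tt]] by metis
    show "dgraph_iso n (W, l', yon_map W e') t'"
      unfolding tt k2(2) using composite_iso[OF Y Z g n c t k2(1) W _ k k2(4)] k2(2,3) by simp
  next
    fix t' assume t': "t' \<in> dgraphs (yon Z) n" "dgraph_iso n (W, l', yon_map W e') t'"
    obtain W2 l2 d2 where tt: "t' = (W2, l2, d2)" by (cases t')
    obtain e2 where e2: "etale W2 Z e2" "d2 = yon_map W2 e2" using t'(1) Z unfolding tt by (auto simp: yon_dgraphs_iff)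
    have fW: "full W" "full W2" using W t'(1) unfolding tt by (auto simp: dgraphs_iff)
    have J: "jk_graph W" "jk_graph W2" using fW by auto
    have e': "etale W Z e'" using k by (simp add: composite_def)
    obtain f where f: "graph_iso W W2 f" "\<And>k. k \<in> n \<Longrightarrow> mA f (l' k) = l2 k" "e' = gcomp W e2 f"
      using t'(2) unfolding tt e2(2) yon_dgraph_iso[OF J e' e2(1)] by auto
    have fe: "etale W W2 f" using f by (simp add: graph_iso_etale)
    interpret gluing S T "yon Z" using composite_gluing[OF g _ k] D by (simp add: dgraphs_iff)
    have a: "assembles S T W \<gamma> \<delta>" using k by (simp add: composite_def)
    have \<gamma>: "\<gamma> (y, h) \<in> Halves W" if "y \<in> Verts S" "h \<in> Halves (piece T y)" for y h
      using a that by (auto simp: assembles_def bij_betw_def)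
    have \<delta>: "\<delta> (y, h) \<in> Verts W" if "y \<in> Verts S" "h \<in> Verts (piece T y)" for y h
      using a that by (auto simp: assembles_def bij_betw_def)
    have "composite Y Z g n S l e T Te W2 l2 e2 (mH f \<circ> \<gamma>) (mV f \<circ> \<delta>)"
      unfolding composite_def
    proof (intro conjI)
      show "assembles S T W2 (mH f \<circ> \<gamma>) (mV f \<circ> \<delta>)"
        by (rule assembles_trans[OF fW f(1) a G(2) gluing_axioms])
      show "\<forall>y\<in>Verts S. \<forall>h\<in>Halves (piece T y). mH e2 ((mH f \<circ> \<gamma>) (y, h)) = mH (Te y) h"
        using k \<gamma> unfolding composite_def f(3) by simp
      show "\<forall>y\<in>Verts S. \<forall>x\<in>Verts (piece T y). mV e2 ((mV f \<circ> \<delta>) (y, x)) = mV (Te y) x"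
        using k \<delta> unfolding composite_def f(3) by simp
      show "\<forall>k\<in>n. tailh W2 l2 k = (mH f \<circ> \<gamma>) (gp S (tailh S l k), ptail S T (tailh S l k))"
      proof
        fix i assume i: "i \<in> n"
        have p: "l' i \<in> ports W" "l2 i \<in> ports W2" using W t'(1) i unfolding tt by (auto simp: dgraphs_iff)
        then have "tailh W2 l2 i = mH f (tailh W l' i)"
          using iso_label[where l = l' and l' = l2, OF fW fe p] f(2)[OF i] by simp
        then show "tailh W2 l2 i = (mH f \<circ> \<gamma>) (gp S (tailh S l i), ptail S T (tailh S l i))"
          using k i by (simp add: composite_def)
      qed
    qed (use k e2 in \<open>simp_all add: composite_def\<close>)
    then show "t' \<in> cls ?K"
      unfolding tt e2(2) using kextI[OF Y Z g n c t] t'(1) unfolding tt e2(2) by blast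
  qed
  then show ?thesis using C by simp
qed

section \<open>Naturality of the Kleisli extension\<close>

lemma kext_in:
  fixes Y Z :: "'u::infinite gr"
  assumes Y: "jk_graph Y" and Z: "jk_graph Z" and g: "g \<in> nt_hom (yon Y) (bar (yon Z))" and X: "X \<in> elObs"
    and c: "c \<in> bar_val (yon Y) X"
  shows "kext Y Z g X c \<in> bar_val (yon Z) X"
  using X
proof (cases rule: elObs_cases)
  case 1
  then show ?thesis using c nt_in[OF g, of Unit] by (auto simp: kext_Unit[OF Y Z g])
qed (use kext_bar[OF Y Z g] c in auto)

text \<open>Relabelling the ports of the outer graph leaves the pieces and the gluing untouched, so
  one composite serves both sides.\<close>

lemma kext_relabel:
  fixes Y Z :: "'u::infinite gr"
  assumes Y: "jk_graph Y" and Z: "jk_graph Z" and g: "g \<in> nt_hom (yon Y) (bar (yon Z))"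
    and mn: "finite m" "finite n" and c: "c \<in> bar_val (yon Y) (Cor n)" and f: "f \<in> el_hom (Cor m) (Cor n)"
  shows "kext Y Z g (Cor m) (bar_res (yon Y) (Cor m) (Cor n) f c) =
    bar_res (yon Z) (Cor m) (Cor n) f (kext Y Z g (Cor n) c)"
proof -
  let ?\<sigma> = "mH f"
  have b: "bij_betw ?\<sigma> m n" using f by (rule el_hom_cor_bij)
  note kb = kext_bar[OF Y Z g mn(2) c]
  note rb = bar_res_CC_in[OF c f]
  obtain W l' d' where m: "(W, l', d') \<in> cls (kext Y Z g (Cor n) c)" using barC_ne[OF kb] .
  obtain S l e T Te e' \<gamma> \<delta> where t: "(S, l, yon_map S e) \<in> cls c" and d': "d' = yon_map W e'"
    and D: "(W, l', d') \<in> dgraphs (yon Z) n" and k: "composite Y Z g n S l e T Te W l' e' \<gamma> \<delta>"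
    using kextE[OF Y Z g mn(2) c m] .
  have "(S, compose m l ?\<sigma>, yon_map S e) \<in> cls (bar_res (yon Y) (Cor m) (Cor n) f c)"
    unfolding bar_res_CC using t by force
  moreover have "(W, compose m l' ?\<sigma>, yon_map W e') \<in> dgraphs (yon Z) m"
    using relabel_dgraphs[OF D b] d' by simp
  moreover have "composite Y Z g m S (compose m l ?\<sigma>) e T Te W (compose m l' ?\<sigma>) e' \<gamma> \<delta>"
    using k b by (simp add: composite_def compose_tailh bij_betw_apply)
  ultimately have 1: "(W, compose m l' ?\<sigma>, yon_map W e') \<in> cls (kext Y Z g (Cor m) (bar_res (yon Y) (Cor m) (Cor n) f c))"
    by (rule kextI[OF Y Z g mn(1) rb])
  have 2: "(W, compose m l' ?\<sigma>, yon_map W e') \<in> cls (bar_res (yon Z) (Cor m) (Cor n) f (kext Y Z g (Cor n) c))"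
    unfolding bar_res_CC using m d' by force
  show ?thesis by (rule barC_eqI[OF kext_bar[OF Y Z g mn(1) rb] bar_res_CC_in[OF kb f] 1 2])
qed

text \<open>The tail of the glued graph at a label is the tail of the piece at the corresponding
  tail of \<open>S\<close>; both sides are the colour read off there.\<close>

lemma kext_colour:
  fixes Y Z :: "'u::infinite gr"
  assumes Y: "jk_graph Y" and Z: "jk_graph Z" and g: "g \<in> nt_hom (yon Y) (bar (yon Z))"
    and n: "finite n" and c: "c \<in> bar_val (yon Y) (Cor n)" and a: "a \<in> PortArc ` n \<union> FlagArc ` n"
  shows "kext Y Z g Unit (bar_res (yon Y) Unit (Cor n) (uat (corolla n) a) c) =
    bar_res (yon Z) Unit (Cor n) (uat (corolla n) a) (kext Y Z g (Cor n) c)"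
proof -
  note kb = kext_bar[OF Y Z g n c]
  obtain W l' d' where m: "(W, l', d') \<in> cls (kext Y Z g (Cor n) c)" using barC_ne[OF kb] .
  obtain S l e T Te e' \<gamma> \<delta> where t: "(S, l, yon_map S e) \<in> cls c" and d': "d' = yon_map W e'"
    and D: "(W, l', d') \<in> dgraphs (yon Z) n" and k: "composite Y Z g n S l e T Te W l' e' \<gamma> \<delta>"
    using kextE[OF Y Z g n c m] .
  have SD: "(S, l, yon_map S e) \<in> dgraphs (yon Y) n" using barC_mem(1)[OF c t] .
  have S: "full S" and e: "etale S Y e" "etale W Z e'" using SD k by (auto simp: dgraphs_iff composite_def)
  have SJ: "jk_graph S" using S by simp
  note en = edge_nt[OF g e(1) S]
  interpret gluing S T "yon Z" using composite_gluing[OF g S k] .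
  obtain i where i: "i \<in> n" "a = PortArc i \<or> a = FlagArc i" using a by auto
  let ?f = "tailh S l i"
  have p: "l i \<in> ports S" using SD i by (auto simp: dgraphs_iff)
  have f: "?f \<in> Halves S" using tailh_port(1)[where l = l, OF S p] .
  have y: "gp S ?f \<in> Verts S" using f by simp
  have Tm: "(G (gp S ?f), L (gp S ?f), yon_map (G (gp S ?f)) (Te (gp S ?f))) \<in>
      cls (nt_comp (yon S) g (yon_map S e) (Cor (flags_at S (gp S ?f))) (star S (gp S ?f)))"
    using k y en(2)[OF y] unfolding composite_def by (metis prod.collapse)
  have Te: "etale (G (gp S ?f)) Z (Te (gp S ?f))" using k y by (simp add: composite_def)
  note col = star_colour[OF S Z en(1) f Tm Te, folded ptail_def]
  have w: "mH e' (tailh W l' i) = mH (Te (gp S ?f)) (ptail S T ?f)"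
    using k i y ptail(1)[OF f] by (simp add: composite_def)
  have cu: "kext Y Z g Unit (Colour (uat Y (mA e x))) = nt_comp (yon S) g (yon_map S e) Unit (uat S x)"
    if "x \<in> Arcs S" for x
    using that e SJ Y by (simp add: kext_Unit[OF Y Z g] gcomp_uat[OF e(1)])
  have c1: "kext Y Z g Unit (Colour (uat Y (gs Y (mH e ?f)))) = Colour (uat Z (gs Z (mH e' (tailh W l' i))))"
    using cu[of "gs S ?f"] f col(1) w by (simp add: etale_gs[OF e(1)])
  have c2: "kext Y Z g Unit (Colour (uat Y (gi Y (gs Y (mH e ?f))))) =
      Colour (uat Z (gi Z (gs Z (mH e' (tailh W l' i)))))"
    using cu[of "gi S (gs S ?f)"] f col(2) w by (simp add: etale_arc_tail[OF e(1)])
  from i(2) show ?thesis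
    using c1 c2 bar_col[OF Y c t e(1) i(1)] bar_col[OF Z kb m[unfolded d'] e(2) i(1)] by (elim disjE) simp_all
qed

lemma kext_nat:
  fixes Y Z :: "'u::infinite gr"
  assumes Y: "jk_graph Y" and Z: "jk_graph Z" and g: "g \<in> nt_hom (yon Y) (bar (yon Z))"
    and X: "X \<in> elObs" and V: "V \<in> elObs" and f: "f \<in> el_hom X V" and c: "c \<in> bar_val (yon Y) V"
  shows "kext Y Z g X (bar_res (yon Y) X V f c) = bar_res (yon Z) X V f (kext Y Z g V c)"
  using V
proof (cases rule: elObs_cases)
  case 1
  with X f have XU: "X = Unit" using el_hom_cor_unit by (auto elim: elObs_cases)
  obtain e where e: "c = Colour e" "etale unit_graph Y e" using c 1 by auto
  have "etale unit_graph Y (gcomp unit_graph e f)"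
    using f e 1 XU by (intro etale_gcomp[OF _ _ e(2)]) (auto simp: el_hom_def)
  then show ?thesis using nt_nat[OF g, of Unit Unit f e] f 1 XU e
    by (simp add: bar_res_UU kext_Unit[OF Y Z g])
next
  case V: (2 n)
  from X show ?thesis
  proof (cases rule: elObs_cases)
    case 1
    then obtain a where "a \<in> PortArc ` n \<union> FlagArc ` n" "f = uat (corolla n) a"
      using el_hom_unit_cor[of f n] f V by auto
    then show ?thesis using 1 V kext_colour[OF Y Z g V(2)] c by simp
  next
    case (2 m)
    then show ?thesis using V kext_relabel[OF Y Z g 2(2) V(2)] c f by simp
  qed
qed

lemma Comp_nt:
  fixes Y Z :: "'u::infinite gr"
  assumes "jk_graph R" and Y: "jk_graph Y" and Z: "jk_graph Z" and f: "f \<in> nt_hom (yon R) (bar (yon Y))"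
    and g: "g \<in> nt_hom (yon Y) (bar (yon Z))"
  shows "Comp GrT R Y Z g f \<in> nt_hom (yon R) (bar (yon Z))"
  unfolding Comp_GrT
proof (rule nt_homI)
  fix X :: "'u elobj" and V h c assume a: "X \<in> elObs" "V \<in> elObs" "h \<in> el_hom X V" "c \<in> val (yon R) V"
  have h: "etale (el_graph X) (el_graph V) h" using a by (simp add: el_hom_def)
  have "etale (el_graph X) R (gcomp (el_graph X) c h)" using a by (intro etale_gcomp[OF _ h]) auto
  moreover have "f V c \<in> bar_val (yon Y) V" using nt_in[OF f] a by simp
  ultimately show "nt_comp (yon R) (kext Y Z g) f X (res (yon R) X V h c) =
      res (bar (yon Z)) X V h (nt_comp (yon R) (kext Y Z g) f V c)"
    using a nt_nat[OF f a] by (simp add: kext_nat[OF Y Z g])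
next
  fix X :: "'u elobj" and c assume a: "X \<in> elObs" "c \<in> val (yon R) X"
  then have "f X c \<in> bar_val (yon Y) X" using nt_in[OF f] by simp
  then show "nt_comp (yon R) (kext Y Z g) f X c \<in> val (bar (yon Z)) X"
    using a by (simp add: kext_in[OF Y Z g])
qed (auto simp: nt_comp_ext)

section \<open>Kleisli composition with etale morphisms\<close>

text \<open>A unit law: a corolla has one vertex and no inner edge, so gluing a single piece into it
  returns that piece.\<close>

lemma kext_unit:
  fixes Y Z :: "'u::infinite gr"
  assumes Y: "jk_graph Y" and Z: "jk_graph Z" and g: "g \<in> nt_hom (yon Y) (bar (yon Z))"
    and X: "X \<in> elObs" and e: "etale (el_graph X) Y e"
  shows "kext Y Z g X (unit_nt (yon Y) X e) = g X e"
  using X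
proof (cases rule: elObs_cases)
  case 1
  then show ?thesis using e by (simp add: kext_Unit[OF Y Z g])
next
  case (2 n)
  then have e: "etale (corolla n) Y e" using e by simp
  note n = 2(2)
  note ub = unit_bar[OF Y n e]
  obtain G l d where t: "(G, l, d) \<in> cls (unit_nt (yon Y) (Cor n) e)" using barC_ne[OF ub] .
  obtain f e0 where f: "graph_iso (corolla n) G f" "etale G Y e0" "d = yon_map G e0"
      "gcomp (corolla n) e0 f = e" "full G" "\<And>k. k \<in> n \<Longrightarrow> tailh G l k = mH f k"
    using unitE[OF Y n e t] by metis
  have J: "jk_graph (corolla n)" "jk_graph G" using n f by auto
  note ff = graph_isoD[OF f(1) J]
  let ?y = "mV f ()"
  have GV: "Verts G = {?y}" using ff(4) by (auto simp: bij_betw_def)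
  then have y: "?y \<in> Verts G" by simp
  have fl: "flags_at G ?y = Halves G" using J GV jk_gp[OF J(2)] by (auto simp: flags_at_iff)
  have hG: "hinv G h = h" if "h \<in> Halves G" for h
  proof -
    have "h \<in> mH f ` n" using bij_betw_imp_surj_on[OF ff(3)] that by simp
    then obtain k where k: "k \<in> n" "h = mH f k" by (rule imageE) blast
    have "hinv G (mH f k) = mH f (hinv (corolla n) k)"
      by (rule graph_iso_hinv[OF full_corolla[OF n] f(5,1)]) (simp add: k(1))
    then show ?thesis unfolding k(2) hinv_corolla[OF k(1)] .
  qed
  let ?m = "flags_at G ?y"
  let ?e = "gcomp (corolla ?m) e0 (star G ?y)"
  have st: "etale (corolla ?m) G (star G ?y)" using J y by simp
  have ee: "etale (corolla ?m) Y ?e" using J by (intro etale_gcomp[OF _ st f(2)]) simp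
  let ?c = "crel n ?m (mH f)"
  note cf = cor_factor[OF n J(2) ff(1)]
  have c: "?c \<in> el_hom (Cor n) (Cor ?m)" using cf(1) by (simp add: el_hom_def)
  have eq: "e = gcomp (corolla n) ?e ?c"
    unfolding f(4)[symmetric] gcomp_assoc[OF cf(1)] cf(2) ..
  have fm: "finite ?m" using J by simp
  have gb: "g (Cor n) e \<in> bar_val (yon Z) (Cor n)" using nt_in[OF g, of "Cor n" e] n e by simp
  obtain W l' d' where m: "(W, l', d') \<in> cls (g (Cor n) e)" and D: "(W, l', d') \<in> dgraphs (yon Z) n"
    using barC_ne[OF gb] .
  obtain e' where e': "etale W Z e'" "d' = yon_map W e'" using D Z by (auto simp: yon_dgraphs_iff)
  have W: "full W" using D by (simp add: dgraphs_iff)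
  \<comment> \<open>The flags at the vertex of \<open>G\<close> are named by \<open>?m\<close>
    rather than by \<open>n\<close>, so the piece has to be relabelled before it can be
    inserted.\<close>
  have "(W, l', d') \<in> (\<lambda>(G, l, d). (G, compose n l (mH ?c), d)) ` cls (g (Cor ?m) ?e)"
    using m nt_relabel[OF g n fm c ee] eq by (metis barel.sel(2))
  then obtain L where L: "(W, L, d') \<in> cls (g (Cor ?m) ?e)" "l' = compose n L (mH ?c)" by auto
  have LD: "(W, L, d') \<in> dgraphs (yon Z) ?m"
    using barC_mem(1)[OF _ L(1)] nt_in[OF g, of "Cor ?m" ?e] ee fm by simp
  let ?T = "\<lambda>_::'u. (W, L, d')"
  have pt: "ptail G ?T h = tailh W L h" for h by (simp add: ptail_def)
  have "composite Y Z g n G l e0 ?T (\<lambda>_. e') W l' e' snd snd"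
    unfolding composite_def assembles_def
  proof (intro conjI)
    show "bij_betw snd (SIGMA y:Verts G. Halves (piece ?T y)) (Halves W)"
      "bij_betw snd (SIGMA y:Verts G. Verts (piece ?T y)) (Verts W)"
      using GV by (auto simp: bij_betw_def inj_on_def)
    show "\<forall>h\<in>Halves G. hinv W (snd (gp G h, ptail G ?T h)) = snd (gp G (hinv G h), ptail G ?T (hinv G h))"
    proof
      fix h assume h: "h \<in> Halves G"
      have "L h \<in> ports W" using LD h fl by (auto simp: dgraphs_iff)
      then have "hinv W (tailh W L h) = tailh W L h" using tailh_port(2)[where l = L, OF W] by simp
      then show "hinv W (snd (gp G h, ptail G ?T h)) = snd (gp G (hinv G h), ptail G ?T (hinv G h))"
        using hG[OF h] by (simp add: pt)
    qed
    show "\<forall>k\<in>n. tailh W l' k = snd (gp G (tailh G l k), ptail G ?T (tailh G l k))"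
      using f(6) by (simp add: pt L(2) compose_tailh)
  qed (use f e' GV L in auto)
  then have "(W, l', yon_map W e') \<in> cls (kext Y Z g (Cor n) (unit_nt (yon Y) (Cor n) e))"
    using kextI[OF Y Z g n ub t[unfolded f(3)]] D e' by simp
  then show ?thesis using barC_eqI[OF kext_bar[OF Y Z g n ub] gb] m e' 2 by simp
qed

lemma kl_app:
  "X \<in> elObs \<Longrightarrow> etale (el_graph X) R e \<Longrightarrow> kl_of_etale R Y f X e = unit_nt (yon Y) X (gcomp (el_graph X) f e)"
  by (simp add: kl_of_etale_def)

text \<open>Along an etale map every inserted piece is a corolla, and inserting corollas at all
  vertices of \<open>S\<close> gives \<open>S\<close> again; only the decoration is changed, by
  composition with \<open>t\<close>.\<close>

lemma kext_kl:
  fixes Y Z :: "'u::infinite gr"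
  assumes Y: "jk_graph Y" and Z: "jk_graph Z" and t: "etale Y Z t"
    and X: "X \<in> elObs" and c: "c \<in> bar_val (yon Y) X"
  shows "kext Y Z (kl_of_etale Y Z t) X c = bar_map (yon Y) (yon_map Y t) X c"
proof -
  let ?g = "kl_of_etale Y Z t"
  note g = kl_nt[OF Y Z t]
  from X show ?thesis
  proof (cases rule: elObs_cases)
    case 1
    then obtain e where e: "c = Colour e" "etale unit_graph Y e" using c by auto
    have "etale unit_graph Z (gcomp unit_graph t e)" by (rule etale_gcomp[OF jk_unit_graph e(2) t])
    then show ?thesis using e 1 by (simp add: kext_Unit[OF Y Z g] kl_app)
  next
    case (2 n)
    then have c: "c \<in> bar_val (yon Y) (Cor n)" using c by simp
    note n = 2(2)
    obtain S l d where m: "(S, l, d) \<in> cls c" and D: "(S, l, d) \<in> dgraphs (yon Y) n" using barC_ne[OF c] .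
    obtain e where e: "etale S Y e" "d = yon_map S e" using D Y by (auto simp: yon_dgraphs_iff)
    have S: "full S" and J: "jk_graph S" using D by (auto simp: dgraphs_iff)
    have te: "etale S Z (gcomp S t e)" by (rule etale_gcomp[OF J e(1) t])
    have bm: "bar_map (yon Y) (yon_map Y t) (Cor n) c \<in> bar_val (yon Z) (Cor n)"
      using bar_map_in[OF yon_map_nt[OF t Y], of "Cor n"] n c by simp
    have "(S, l, nt_comp (yon S) (yon_map Y t) d) \<in> cls (bar_map (yon Y) (yon_map Y t) (Cor n) c)"
      by (rule bar_map_mem[OF n c m])
    then have m2: "(S, l, yon_map S (gcomp S t e)) \<in> cls (bar_map (yon Y) (yon_map Y t) (Cor n) c)"
      unfolding e(2) yon_map_gcomp[OF e(1) t J Y] .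
    note D2 = barC_mem(1)[OF bm m2]
    let ?n = "\<lambda>y. flags_at S y"
    let ?e = "\<lambda>y. gcomp (corolla (?n y)) (gcomp S t e) (star S y)"
    have st: "etale (corolla (?n y)) S (star S y)" if "y \<in> Verts S" for y using that J by simp
    have ee: "etale (corolla (?n y)) Z (?e y)" if "y \<in> Verts S" for y
      using J by (intro etale_gcomp[OF _ st[OF that] te]) simp
    let ?P = "\<lambda>y t f E. t \<in> cls (unit_nt (yon Z) (Cor (?n y)) (?e y)) \<and> graph_iso (corolla (?n y)) (fst t) f \<and>
        snd (snd t) = yon_map (fst t) E \<and> etale (fst t) Z E \<and> gcomp (corolla (?n y)) E f = ?e y \<and>
        full (fst t) \<and> (\<forall>k\<in>?n y. tailh (fst t) (fst (snd t)) k = mH f k)"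
    have "\<forall>y\<in>Verts S. \<exists>t f E. ?P y t f E"
    proof
      fix y assume y: "y \<in> Verts S"
      have fin: "finite (?n y)" using J by simp
      obtain G l d where t: "(G, l, d) \<in> cls (unit_nt (yon Z) (Cor (?n y)) (?e y))"
        using barC_ne[OF unit_bar[OF Z fin ee[OF y]]] .
      obtain f E where "graph_iso (corolla (?n y)) G f" "etale G Z E" "d = yon_map G E"
        "gcomp (corolla (?n y)) E f = ?e y" "full G" "\<And>k. k \<in> ?n y \<Longrightarrow> tailh G l k = mH f k"
        using unitE[OF Z fin ee[OF y] t] by metis
      then show "\<exists>t f E. ?P y t f E" using t by (intro exI[of _ "(G, l, d)"] exI[of _ f] exI[of _ E]) auto
    qed
    then have "\<exists>T f E. \<forall>y\<in>Verts S. ?P y (T y) (f y) (E y)" unfolding bchoice_iff .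
    then obtain T f E where TT0: "\<forall>y\<in>Verts S. ?P y (T y) (f y) (E y)" by (elim exE)
    then have TT: "\<And>y. y \<in> Verts S \<Longrightarrow> T y \<in> cls (unit_nt (yon Z) (Cor (?n y)) (?e y))"
      "\<And>y. y \<in> Verts S \<Longrightarrow> graph_iso (corolla (?n y)) (piece T y) (f y)"
      "\<And>y. y \<in> Verts S \<Longrightarrow> piece_dec T y = yon_map (piece T y) (E y)"
      "\<And>y. y \<in> Verts S \<Longrightarrow> etale (piece T y) Z (E y)"
      "\<And>y. y \<in> Verts S \<Longrightarrow> gcomp (corolla (?n y)) (E y) (f y) = ?e y"
      "\<And>y. y \<in> Verts S \<Longrightarrow> full (piece T y)"
      "\<And>y k. y \<in> Verts S \<Longrightarrow> k \<in> ?n y \<Longrightarrow> tailh (piece T y) (fst (snd (T y))) k = mH (f y) k"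
      by (blast dest: bspec)+
    have ff: "etale (corolla (?n y)) (piece T y) (f y)" "bij_betw (mH (f y)) (?n y) (Halves (piece T y))"
      "bij_betw (mV (f y)) {()} (Verts (piece T y))" if y: "y \<in> Verts S" for y
      using graph_isoD[OF TT(2)[OF y]] TT(6)[OF y] J by simp_all
    have VT: "Verts (piece T y) = {mV (f y) ()}" if y: "y \<in> Verts S" for y
      using ff(3)[OF y] by (auto simp: bij_betw_def)
    have hT: "hinv (piece T y) h = h" if y: "y \<in> Verts S" and h: "h \<in> Halves (piece T y)" for y h
    proof -
      have "h \<in> mH (f y) ` ?n y" using bij_betw_imp_surj_on[OF ff(2)[OF y]] h by simp
      then obtain k where k: "k \<in> ?n y" "h = mH (f y) k" by (rule imageE) blast
      have "hinv (piece T y) (mH (f y) k) = mH (f y) (hinv (corolla (?n y)) k)"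
        using J by (intro graph_iso_hinv[OF full_corolla TT(6,2)]) (simp_all add: k(1) y)
      then show ?thesis unfolding k(2) hinv_corolla[OF k(1)] .
    qed
    \<comment> \<open>A half-edge of the corolla at \<open>y\<close> is renamed to the flag of
      \<open>S\<close> that labels it.\<close>
    define \<gamma> where "\<gamma> = (\<lambda>(y, h). inv_into (?n y) (mH (f y)) h)"
    have \<gamma>: "\<gamma> (y, mH (f y) k) = k" if "y \<in> Verts S" "k \<in> ?n y" for y k
      using bij_betw_inv_into_left[OF ff(2)[OF that(1)] that(2)] by (simp add: \<gamma>_def)
    have HT: "\<exists>k. k \<in> ?n y \<and> h = mH (f y) k" if "y \<in> Verts S" "h \<in> Halves (piece T y)" for y h
      using that bij_betw_imp_surj_on[OF ff(2)] by blast
    have pt: "ptail S T k = mH (f (gp S k)) k" if "k \<in> Halves S" for k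
      using that TT(7)[of "gp S k" k] J by (simp add: ptail_def flags_at_iff)
    have mT: "mH (f (gp S k)) k \<in> Halves (piece T (gp S k))" if "k \<in> Halves S" for k
      using that ff(2)[of "gp S k"] J by (auto simp: flags_at_iff bij_betw_def)
    have EH: "mH (E y) (mH (f y) k) = mH t (mH e k)" if y: "y \<in> Verts S" and k: "k \<in> ?n y" for y k
    proof -
      have "mH (gcomp (corolla (?n y)) (E y) (f y)) k = mH (?e y) k" using TT(5)[OF y] by simp
      then show ?thesis using k by (simp add: flags_at_iff)
    qed
    have EV: "mV (E y) (mV (f y) ()) = mV t (mV e y)" if y: "y \<in> Verts S" for y
      using arg_cong[OF TT(5)[OF y], of "\<lambda>m. mV m ()"] y by simp
    have k: "composite Y Z ?g n S l e T E S l (gcomp S t e) \<gamma> fst"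
      unfolding composite_def assembles_def
    proof (intro conjI)
      show "\<forall>y\<in>Verts S. T y \<in> cls (?g (Cor (?n y)) (gcomp (corolla (?n y)) e (star S y)))"
      proof
        fix y assume y: "y \<in> Verts S"
        have "etale (corolla (?n y)) Y (gcomp (corolla (?n y)) e (star S y))"
          using J by (intro etale_gcomp[OF _ st[OF y] e(1)]) simp
        then show "T y \<in> cls (?g (Cor (?n y)) (gcomp (corolla (?n y)) e (star S y)))"
          using TT(1)[OF y] J by (simp add: kl_app gcomp_assoc[OF st[OF y]])
      qed
      show "bij_betw \<gamma> (SIGMA y:Verts S. Halves (piece T y)) (Halves S)"
      proof (rule bij_betw_byWitness[where f' = "\<lambda>k. (gp S k, mH (f (gp S k)) k)"])
        show "\<forall>a\<in>(SIGMA y:Verts S. Halves (piece T y)). (gp S (\<gamma> a), mH (f (gp S (\<gamma> a))) (\<gamma> a)) = a"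
          using HT \<gamma> by (fastforce simp: flags_at_iff)
        show "\<forall>k\<in>Halves S. \<gamma> (gp S k, mH (f (gp S k)) k) = k" using \<gamma> J by (simp add: flags_at_iff)
        show "\<gamma> ` (SIGMA y:Verts S. Halves (piece T y)) \<subseteq> Halves S"
          using HT \<gamma> by (fastforce simp: flags_at_iff)
        show "(\<lambda>k. (gp S k, mH (f (gp S k)) k)) ` Halves S \<subseteq> (SIGMA y:Verts S. Halves (piece T y))"
          using mT J by auto
      qed
      show "bij_betw fst (SIGMA y:Verts S. Verts (piece T y)) (Verts S)"
        using VT by (auto simp: bij_betw_def inj_on_def image_iff)
      show "\<forall>y\<in>Verts S. \<forall>h\<in>Halves (piece T y). gp S (\<gamma> (y, h)) = fst (y, gp (piece T y) h)"
        using HT \<gamma> by (fastforce simp: flags_at_iff)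
      show "\<forall>k\<in>Halves S. hinv S (\<gamma> (gp S k, ptail S T k)) = \<gamma> (gp S (hinv S k), ptail S T (hinv S k))"
        using J by (simp add: pt \<gamma> flags_at_iff)
      show "\<forall>y\<in>Verts S. \<forall>h\<in>Halves (piece T y). mH (gcomp S t e) (\<gamma> (y, h)) = mH (E y) h"
      proof (intro ballI)
        fix y h assume y: "y \<in> Verts S" and "h \<in> Halves (piece T y)"
        then obtain k where k: "k \<in> ?n y" "h = mH (f y) k" using HT by blast
        then show "mH (gcomp S t e) (\<gamma> (y, h)) = mH (E y) h"
          using y by (simp add: \<gamma> EH flags_at_iff)
      qed
      show "\<forall>y\<in>Verts S. \<forall>x\<in>Verts (piece T y). mV (gcomp S t e) (fst (y, x)) = mV (E y) x"
        using VT EV by simp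
      show "\<forall>k\<in>n. tailh S l k = \<gamma> (gp S (tailh S l k), ptail S T (tailh S l k))"
      proof
        fix i assume "i \<in> n"
        then have "l i \<in> ports S" using D by (auto simp: dgraphs_iff)
        then have "tailh S l i \<in> Halves S" using tailh_port(1)[where l = l, OF S] by simp
        then show "tailh S l i = \<gamma> (gp S (tailh S l i), ptail S T (tailh S l i))"
          using J by (simp add: pt \<gamma> flags_at_iff)
      qed
    qed (use e te TT hT in auto)
    have m1: "(S, l, yon_map S (gcomp S t e)) \<in> cls (kext Y Z ?g (Cor n) c)"
      by (rule kextI[OF Y Z g n c m[unfolded e(2)] D2 k])
    show ?thesis using barC_eqI[OF kext_bar[OF Y Z g n c] bm m1 m2] 2 by simp
  qed
qed

lemma bar_map_comp:
  fixes Y0 Y :: "'u gr"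
  assumes Y0: "jk_graph Y0" and Y: "jk_graph Y" and t: "etale Y0 Y t"
    and X: "X \<in> elObs" and c: "c \<in> bar_val (yon Y0) X"
  shows "bar_map (yon Y) w X (bar_map (yon Y0) (yon_map Y0 t) X c) =
    bar_map (yon Y0) (nt_comp (yon Y0) w (yon_map Y0 t)) X c"
  using X
proof (cases rule: elObs_cases)
  case 1
  then obtain e where e: "c = Colour e" "etale unit_graph Y0 e" using c by auto
  have "etale unit_graph Y (gcomp unit_graph t e)" by (rule etale_gcomp[OF jk_unit_graph e(2) t])
  then show ?thesis using 1 e by simp
next
  case (2 n)
  then have c: "c \<in> bar_val (yon Y0) (Cor n)" using c by simp
  have cm: "bar_map (yon Y0) (yon_map Y0 t) (Cor n) c \<in> bar_val (yon Y) (Cor n)"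
    using bar_map_in[OF yon_map_nt[OF t Y0], of "Cor n" c] 2 c by simp
  have "nt_comp (yon G) w (nt_comp (yon G) (yon_map Y0 t) d) = nt_comp (yon G) (nt_comp (yon Y0) w (yon_map Y0 t)) d"
    if "(G, l, d) \<in> cls c" for G l d
    using barC_mem(1)[OF c that] by (intro nt_comp_assoc[symmetric]) (simp add: dgraphs_iff)
  then have "(\<lambda>(G, l, d). (G, l, nt_comp (yon G) w d)) ` (\<lambda>(G, l, d). (G, l, nt_comp (yon G) (yon_map Y0 t) d)) ` cls c
      = (\<lambda>(G, l, d). (G, l, nt_comp (yon G) (nt_comp (yon Y0) w (yon_map Y0 t)) d)) ` cls c"
    unfolding image_image by (intro image_cong) auto
  moreover have "bar_map (yon Y) w (Cor n) (bar_map (yon Y0) (yon_map Y0 t) (Cor n) c) =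
      Cls ((\<lambda>(G, l, d). (G, l, nt_comp (yon G) w d)) `
        (\<lambda>(G, l, d). (G, l, nt_comp (yon G) (yon_map Y0 t) d)) ` cls c)"
    unfolding bar_map_Cor[OF 2(2) cm] by (simp add: bar_map_Cor[OF 2(2) c])
  ultimately show ?thesis using 2 by (simp add: bar_map_Cor[OF 2(2) c])
qed

text \<open>An etale map applied after gluing acts on decorations only: the graph, its labels and
  the identifications \<open>\<gamma>\<close>, \<open>\<delta>\<close> are kept, and each piece is
  decorated through \<open>t\<close>.\<close>

lemma kext_bar_map:
  fixes Y Z Z' :: "'u::infinite gr"
  assumes Y: "jk_graph Y" and Z: "jk_graph Z" and Z': "jk_graph Z'"
    and g: "g \<in> nt_hom (yon Y) (bar (yon Z))" and t: "etale Z Z' t"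
    and X: "X \<in> elObs" and c: "c \<in> bar_val (yon Y) X"
  shows "bar_map (yon Z) (yon_map Z t) X (kext Y Z g X c) =
    kext Y Z' (nt_comp (yon Y) (bar_map (yon Z) (yon_map Z t)) g) X c"
proof -
  let ?g = "nt_comp (yon Y) (bar_map (yon Z) (yon_map Z t)) g"
  have gX: "g X e \<in> bar_val (yon Z) X" if "X \<in> elObs" "etale (el_graph X) Y e" for X e
    using nt_in[OF g, of X e] that by simp
  have "?g = nt_comp (yon Y) (kext Z Z' (kl_of_etale Z Z' t)) g"
    by (rule nt_comp_cong) (simp add: kext_kl[OF Z Z' t] gX)
  then have g': "?g \<in> nt_hom (yon Y) (bar (yon Z'))"
    using Comp_nt[OF Y Z Z' g kl_nt[OF Z Z' t]] by (simp add: Comp_GrT)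
  from X show ?thesis
  proof (cases rule: elObs_cases)
    case 1
    then obtain e where e: "c = Colour e" "etale unit_graph Y e" using c by auto
    then show ?thesis using 1 by (simp add: kext_Unit[OF Y Z g] kext_Unit[OF Y Z' g'])
  next
    case (2 n)
    then have c: "c \<in> bar_val (yon Y) (Cor n)" using c by simp
    note n = 2(2)
    note kb = kext_bar[OF Y Z g n c]
    have bm: "bar_map (yon Z) (yon_map Z t) (Cor n) (kext Y Z g (Cor n) c) \<in> bar_val (yon Z') (Cor n)"
      using bar_map_in[OF yon_map_nt[OF t Z], of "Cor n"] n kb by simp
    obtain W l' d' where m: "(W, l', d') \<in> cls (kext Y Z g (Cor n) c)" using barC_ne[OF kb] .
    obtain S l e T E e' \<gamma> \<delta> where k: "(S, l, yon_map S e) \<in> cls c" "d' = yon_map W e'"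
      "(W, l', d') \<in> dgraphs (yon Z) n" "composite Y Z g n S l e T E W l' e' \<gamma> \<delta>"
      using kextE[OF Y Z g n c m] .
    have SD: "(S, l, yon_map S e) \<in> dgraphs (yon Y) n" using barC_mem(1)[OF c k(1)] .
    have W: "jk_graph W" and e': "etale W Z e'" and S: "full S" and SJ: "jk_graph S" and e: "etale S Y e"
      using k SD by (auto simp: composite_def dgraphs_iff)
    have "(W, l', nt_comp (yon W) (yon_map Z t) d') \<in> cls (bar_map (yon Z) (yon_map Z t) (Cor n) (kext Y Z g (Cor n) c))"
      by (rule bar_map_mem[OF n kb m])
    then have m2: "(W, l', yon_map W (gcomp W t e')) \<in> cls (bar_map (yon Z) (yon_map Z t) (Cor n) (kext Y Z g (Cor n) c))"
      unfolding k(2) yon_map_gcomp[OF e' t W Z] .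
    note D2 = barC_mem(1)[OF bm m2]
    interpret gluing S T "yon Z" using composite_gluing[OF g S k(4)] .
    let ?T = "\<lambda>y. (G y, L y, yon_map (G y) (gcomp (G y) t (E y)))"
    let ?n = "\<lambda>y. flags_at S y"
    let ?e = "\<lambda>y. gcomp (corolla (?n y)) e (star S y)"
    have a: "assembles S T W \<gamma> \<delta>" using k(4) by (simp add: composite_def)
    have \<gamma>: "\<gamma> (y, h) \<in> Halves W" if "y \<in> Verts S" "h \<in> Halves (G y)" for y h
      using a that by (auto simp: assembles_def bij_betw_def)
    have \<delta>: "\<delta> (y, h) \<in> Verts W" if "y \<in> Verts S" "h \<in> Verts (G y)" for y h
      using a that by (auto simp: assembles_def bij_betw_def)
    have E: "etale (G y) Z (E y)" "piece_dec T y = yon_map (G y) (E y)" if "y \<in> Verts S" for y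
      using k(4) that by (simp_all add: composite_def)
    have "composite Y Z' ?g n S l e ?T (\<lambda>y. gcomp (G y) t (E y)) W l' (gcomp W t e') \<gamma> \<delta>"
      unfolding composite_def
    proof (intro conjI)
      show "assembles S ?T W \<gamma> \<delta>" using a by (simp add: assembles_def ptail_def)
      show "etale W Z' (gcomp W t e')" by (rule etale_gcomp[OF W e' t])
      show "\<forall>y\<in>Verts S. ?T y \<in> cls (?g (Cor (?n y)) (?e y))"
      proof
        fix y assume y: "y \<in> Verts S"
        have st: "etale (corolla (?n y)) S (star S y)" using SJ y by simp
        have ee: "etale (corolla (?n y)) Y (?e y)" using SJ by (intro etale_gcomp[OF _ st e]) simp
        have fin: "finite (?n y)" using SJ by simp
        have "T y \<in> cls (g (Cor (?n y)) (?e y))" using k(4) y by (simp add: composite_def)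
        then have "(G y, L y, yon_map (G y) (E y)) \<in> cls (g (Cor (?n y)) (?e y))"
          unfolding E(2)[OF y, symmetric] by simp
        moreover have "g (Cor (?n y)) (?e y) \<in> bar_val (yon Z) (Cor (?n y))"
          using gX[of "Cor (?n y)" "?e y"] fin ee by simp
        ultimately have "(G y, L y, nt_comp (yon (G y)) (yon_map Z t) (yon_map (G y) (E y))) \<in>
            cls (bar_map (yon Z) (yon_map Z t) (Cor (?n y)) (g (Cor (?n y)) (?e y)))"
          using bar_map_mem[OF fin] by blast
        then
        show "?T y \<in> cls (?g (Cor (?n y)) (?e y))"
          using fin ee by (simp add: yon_map_gcomp[OF E(1)[OF y] t G(2)[OF y] Z])
      qed
      show "\<forall>y\<in>Verts S. piece_dec ?T y = yon_map (piece ?T y) (gcomp (G y) t (E y)) \<and>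
          etale (piece ?T y) Z' (gcomp (G y) t (E y))"
        using E(1) G(2) t by (auto intro: etale_gcomp)
      show "\<forall>y\<in>Verts S. \<forall>h\<in>Halves (piece ?T y). mH (gcomp W t e') (\<gamma> (y, h)) = mH (gcomp (G y) t (E y)) h"
        using k(4) \<gamma> by (simp add: composite_def)
      show "\<forall>y\<in>Verts S. \<forall>x\<in>Verts (piece ?T y). mV (gcomp W t e') (\<delta> (y, x)) = mV (gcomp (G y) t (E y)) x"
        using k(4) \<delta> by (simp add: composite_def)
      show "\<forall>k\<in>n. tailh W l' k = \<gamma> (gp S (tailh S l k), ptail S ?T (tailh S l k))"
        using k(4) by (simp add: composite_def ptail_def)
    qed (use e in auto)
    then have m1: "(W, l', yon_map W (gcomp W t e')) \<in> cls (kext Y Z' ?g (Cor n) c)"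
      by (rule kextI[OF Y Z' g' n c k(1) D2])
    show ?thesis using barC_eqI[OF bm kext_bar[OF Y Z' g' n c] m2 m1] 2 by simp
  qed
qed

section \<open>Composition and associativity with an etale factor\<close>

lemma Comp_kl:
  fixes Y Z :: "'u::infinite gr"
  assumes R: "jk_graph R" and Y: "jk_graph Y" and Z: "jk_graph Z" and f: "etale R Y f"
    and g: "g \<in> nt_hom (yon Y) (bar (yon Z))"
  shows "Comp GrT R Y Z g (kl_of_etale R Y f) = nt_comp (yon R) g (yon_map R f)"
  unfolding Comp_GrT
proof (rule nt_comp_cong)
  fix X :: "'u elobj" and c assume X: "X \<in> elObs" and "c \<in> val (yon R) X"
  then have c: "etale (el_graph X) R c" by simp
  have "etale (el_graph X) Y (gcomp (el_graph X) f c)" by (rule etale_gcomp[OF jk_el_graph[OF X] c f])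
  then show "kext Y Z g X (kl_of_etale R Y f X c) = g X (yon_map R f X c)"
    using X c by (simp add: kl_app kext_unit[OF Y Z g X])
qed

lemma kl_Comp:
  fixes Y Z :: "'u::infinite gr"
  assumes R: "jk_graph R" and Y: "jk_graph Y" and Z: "jk_graph Z" and t: "etale Y Z t"
    and \<phi>: "\<phi> \<in> nt_hom (yon R) (bar (yon Y))"
  shows "Comp GrT R Y Z (kl_of_etale Y Z t) \<phi> = nt_comp (yon R) (bar_map (yon Y) (yon_map Y t)) \<phi>"
  unfolding Comp_GrT
  by (rule nt_comp_cong) (use nt_in[OF \<phi>] in \<open>simp add: kext_kl[OF Y Z t]\<close>)

text \<open>The pushout arguments use associativity with an etale factor in each of the three
  positions: in the middle here, outermost in \<open>Comp_kl_assoc2\<close>, innermost in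
  \<open>Comp_Comp_kl\<close>.\<close>

lemma Comp_kl_assoc1:
  fixes Y Z :: "'u::infinite gr"
  assumes J: "jk_graph R" "jk_graph Y0" "jk_graph Y" "jk_graph Z" and t: "etale Y0 Y t"
    and \<phi>: "\<phi> \<in> nt_hom (yon R) (bar (yon Y0))" and w: "w \<in> nt_hom (yon Y) (bar (yon Z))"
  shows "Comp GrT R Y Z w (Comp GrT R Y0 Y (kl_of_etale Y0 Y t) \<phi>) =
    Comp GrT R Y0 Z (nt_comp (yon Y0) w (yon_map Y0 t)) \<phi>"
  unfolding kl_Comp[OF J(1,2,3) t \<phi>] unfolding Comp_GrT
  by (rule nt_comp_cong) (use nt_in[OF \<phi>] in \<open>simp add: kext_def bar_map_comp[OF J(2,3) t]\<close>)

lemma Comp_kl_assoc2: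
  fixes Y Z Z' :: "'u::infinite gr"
  assumes J: "jk_graph R" "jk_graph Y" "jk_graph Z" "jk_graph Z'" and t: "etale Z Z' t"
    and \<phi>: "\<phi> \<in> nt_hom (yon R) (bar (yon Y))" and g: "g \<in> nt_hom (yon Y) (bar (yon Z))"
  shows "Comp GrT R Z Z' (kl_of_etale Z Z' t) (Comp GrT R Y Z g \<phi>) =
    Comp GrT R Y Z' (Comp GrT Y Z Z' (kl_of_etale Z Z' t) g) \<phi>"
  unfolding kl_Comp[OF J(2,3,4) t g] kl_Comp[OF J(1,3,4) t Comp_nt[OF J(1,2,3) \<phi> g]]
  unfolding Comp_GrT
  by (rule nt_comp_cong) (use nt_in[OF \<phi>] in \<open>simp add: kext_bar_map[OF J(2,3,4) g t]\<close>)

lemma kl_gid: "jk_graph R \<Longrightarrow> kl_of_etale R R (gid R) = unit_nt (yon R)" for R :: "'u::infinite gr"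
  unfolding kl_of_etale_def by (rule nt_comp_yon_map_gid[OF unit_nt_nat])

lemma kl_gcomp:
  fixes Y Z :: "'u::infinite gr"
  assumes J: "jk_graph R" "jk_graph Y" "jk_graph Z" and f: "etale R Y f" and t: "etale Y Z t"
  shows "Comp GrT R Y Z (kl_of_etale Y Z t) (kl_of_etale R Y f) = kl_of_etale R Z (gcomp R t f)"
  unfolding Comp_kl[OF J f kl_nt[OF J(2,3) t]] unfolding kl_of_etale_def yon_map_gcomp[OF f t J(1,2)]
  by (rule nt_comp_assoc[OF yon_map_nt[OF f J(1)]])

text \<open>The unit is the Kleisli morphism of \<open>gid Y\<close>, so composing with it only
  postcomposes decorations with an identity.\<close>

lemma Comp_Ide_left:
  fixes Y :: "'u::infinite gr"
  assumes J: "jk_graph R" "jk_graph Y" and \<phi>: "\<phi> \<in> nt_hom (yon R) (bar (yon Y))"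
  shows "Comp GrT R Y Y (unit_nt (yon Y)) \<phi> = \<phi>"
proof -
  have "bar_map (yon Y) (yon_map Y (gid Y)) X c = c" if X: "X \<in> elObs" and c: "c \<in> bar_val (yon Y) X" for X :: "'u elobj" and c
    using X
  proof (cases rule: elObs_cases)
    case 1
    then show ?thesis using c by auto
  next
    case (2 n)
    then have c: "c \<in> bar_val (yon Y) (Cor n)" using c by simp
    have "nt_comp (yon G) (yon_map Y (gid Y)) d = d" if "(G, l, d) \<in> cls c" for G l d
    proof -
      have D: "(G, l, d) \<in> dgraphs (yon Y) n" using barC_mem(1)[OF c that] .
      then obtain e where e: "etale G Y e" "d = yon_map G e" using J by (auto simp: yon_dgraphs_iff)
      have "jk_graph G" using D by (simp add: dgraphs_iff)
      then show ?thesis using e yon_map_gcomp[OF e(1) etale_gid[OF J(2)] _ J(2), symmetric] by simp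
    qed
    then have "(\<lambda>(G, l, d). (G, l, nt_comp (yon G) (yon_map Y (gid Y)) d)) ` cls c = (\<lambda>x. x) ` cls c"
      by (intro image_cong) auto
    moreover obtain t where "c = Cls t" using c by (auto simp: bar_val_Cor)
    ultimately show ?thesis using 2 bar_map_Cor[OF 2(2) c, of "yon_map Y (gid Y)"] by simp
  qed
  then have "nt_comp (yon R) (bar_map (yon Y) (yon_map Y (gid Y))) \<phi> = nt_comp (yon R) (\<lambda>X c. c) \<phi>"
    by (intro nt_comp_cong) (use nt_in[OF \<phi>] in simp)
  also have "\<dots> = \<phi>"
    by (rule nt_eqI[where F = "yon R" and G = "bar (yon Y)" and G' = "bar (yon Y)"])
      (use \<phi> nt_nat[OF \<phi>] nt_in[OF \<phi>] in \<open>auto intro!: nt_homI nt_comp_ext simp: el_hom_def\<close>)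
  finally show ?thesis
    using kl_Comp[OF J J(2) etale_gid[OF J(2)] \<phi>] kl_gid[OF J(2)] by simp
qed

section \<open>Refinements\<close>

text \<open>The data of a generic morphism \<open>R \<rightarrow> Y\<close>, where \<open>r\<close> runs backwards, from \<open>Verts Y\<close> to \<open>Verts R\<close>.\<close>

definition refn :: "'u gr \<Rightarrow> 'u gr \<Rightarrow> ('u \<Rightarrow> 'u) \<Rightarrow> ('u \<Rightarrow> 'u) \<Rightarrow> bool" where
  "refn R Y r k \<longleftrightarrow> k ` Halves R \<subseteq> Halves Y \<and> inj_on k (Halves R) \<and> r ` Verts Y = Verts R \<and>
     (\<forall>f\<in>Halves R. r (gp Y (k f)) = gp R f \<and> hinv Y (k f) = k (hinv R f)) \<and>
     (\<forall>h\<in>Halves Y - k ` Halves R. hinv Y h \<noteq> h \<and> r (gp Y (hinv Y h)) = r (gp Y h))"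

text \<open>The involution stays inside the fibre because, by \<open>refn\<close>, a half-edge
  omitted by \<open>k\<close> has its partner over the same vertex of \<open>R\<close>.\<close>

definition cutbm :: "'u gr \<Rightarrow> 'u gr \<Rightarrow> ('u \<Rightarrow> 'u) \<Rightarrow> ('u \<Rightarrow> 'u) \<Rightarrow> 'u \<Rightarrow> 'u bm_graph" where
  "cutbm R Y r k x = \<lparr>bV = {y \<in> Verts Y. r y = x}, bF = {h \<in> Halves Y. r (gp Y h) = x},
     bd = (\<lambda>h\<in>{h \<in> Halves Y. r (gp Y h) = x}. gp Y h),
     bj = (\<lambda>h\<in>{h \<in> Halves Y. r (gp Y h) = x}. if h \<in> k ` Halves R then h else hinv Y h)\<rparr>"

text \<open>The part of \<open>Y\<close> lying over the vertex \<open>x\<close>, with the edges in the image of \<open>k\<close> cut open.\<close>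

definition cut :: "'u::infinite gr \<Rightarrow> 'u gr \<Rightarrow> ('u \<Rightarrow> 'u) \<Rightarrow> ('u \<Rightarrow> 'u) \<Rightarrow> 'u \<Rightarrow> 'u gr" where
  "cut R Y r k x = jkof (cutbm R Y r k x)"

definition cutl :: "'u::infinite gr \<Rightarrow> 'u gr \<Rightarrow> ('u \<Rightarrow> 'u) \<Rightarrow> ('u \<Rightarrow> 'u) \<Rightarrow> 'u \<Rightarrow> 'u \<Rightarrow> 'u" where
  "cutl R Y r k x = lab (cut R Y r k x) (flags_at R x) k"

definition cute :: "'u::infinite gr \<Rightarrow> 'u gr \<Rightarrow> ('u \<Rightarrow> 'u) \<Rightarrow> ('u \<Rightarrow> 'u) \<Rightarrow> 'u \<Rightarrow> 'u gmap" where
  "cute R Y r k x = hv_mor (cut R Y r k x) Y (\<lambda>h. h) (\<lambda>y. y)"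

definition cutd :: "'u::infinite gr \<Rightarrow> 'u gr \<Rightarrow> ('u \<Rightarrow> 'u) \<Rightarrow> ('u \<Rightarrow> 'u) \<Rightarrow> 'u \<Rightarrow>
    ('u, ('u,'u,'u,'u) elmap) dgraph" where
  "cutd R Y r k x = (cut R Y r k x, cutl R Y r k x, yon_map (cut R Y r k x) (cute R Y r k x))"

locale refinement =
  fixes R Y :: "'u::infinite gr" and r k :: "'u \<Rightarrow> 'u"
  assumes R: "full R" and Y: "full Y" and refn: "refn R Y r k"
begin

lemma jk [simp]: "jk_graph R" "jk_graph Y" using R Y by auto

lemma kD: "f \<in> Halves R \<Longrightarrow> k f \<in> Halves Y" "f \<in> Halves R \<Longrightarrow> r (gp Y (k f)) = gp R f"
  "f \<in> Halves R \<Longrightarrow> hinv Y (k f) = k (hinv R f)"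
  "f \<in> Halves R \<Longrightarrow> f' \<in> Halves R \<Longrightarrow> k f = k f' \<longleftrightarrow> f = f'"
  using refn by (auto simp: refn_def inj_on_def)

text \<open>For the third claim: the image of \<open>k\<close> is closed under the involution of
  \<open>Y\<close>, hence so is its complement.\<close>

lemma inner: "h \<in> Halves Y \<Longrightarrow> h \<notin> k ` Halves R \<Longrightarrow> hinv Y h \<noteq> h"
  "h \<in> Halves Y \<Longrightarrow> h \<notin> k ` Halves R \<Longrightarrow> r (gp Y (hinv Y h)) = r (gp Y h)"
  "h \<in> Halves Y \<Longrightarrow> h \<notin> k ` Halves R \<Longrightarrow> hinv Y h \<notin> k ` Halves R"
proof -
  assume h: "h \<in> Halves Y" "h \<notin> k ` Halves R"
  then show "hinv Y h \<noteq> h" "r (gp Y (hinv Y h)) = r (gp Y h)" using refn by (auto simp: refn_def)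
  show "hinv Y h \<notin> k ` Halves R"
  proof
    assume "hinv Y h \<in> k ` Halves R"
    then obtain f where f: "f \<in> Halves R" "hinv Y h = k f" by auto
    then have "h = k (hinv R f)" using kD(3)[OF f(1)] h(1) by (metis hinv_hinv jk(2))
    then show False using h f by simp
  qed
qed

lemma r_surj: "r ` Verts Y = Verts R" using refn by (simp add: refn_def)

lemma r_in: "y \<in> Verts Y \<Longrightarrow> r y \<in> Verts R" using r_surj by auto

lemma cutbm: "bm_graph (cutbm R Y r k x)"
  unfolding bm_graph_def cutbm_def
  using jk_finite[OF jk(2)] inner by auto

lemma cut_simps [simp]:
  "Halves (cut R Y r k x) = {h \<in> Halves Y. r (gp Y h) = x}"
  "Verts (cut R Y r k x) = {y \<in> Verts Y. r y = x}"
  "h \<in> Halves Y \<Longrightarrow> r (gp Y h) = x \<Longrightarrow> gp (cut R Y r k x) h = gp Y h"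
  by (simp_all add: cut_def) (simp_all add: cutbm_def)

lemma hinv_cut: "h \<in> Halves Y \<Longrightarrow> r (gp Y h) = x \<Longrightarrow>
    hinv (cut R Y r k x) h = (if h \<in> k ` Halves R then h else hinv Y h)"
  unfolding cut_def hinv_jkof[OF cutbm] by (simp add: cutbm_def)

lemma full_cut: "full (cut R Y r k x)"
  unfolding cut_def by (rule full_jkof[OF cutbm])

text \<open>A half-edge omitted by \<open>k\<close> keeps its partner inside the fibre, so tails
  arise at the cuts only. This provides the port labelling of the cut by the flags at
  \<open>x\<close>.\<close>

lemma tails_cut: "bij_betw k (flags_at R x) (tails (cut R Y r k x))"
  unfolding bij_betw_def
proof (intro conjI set_eqI iffI inj_onI)
  fix h assume "h \<in> k ` flags_at R x"
  then show "h \<in> tails (cut R Y r k x)" using kD by (auto simp: tails_iff flags_at_iff hinv_cut)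
next
  fix h assume "h \<in> tails (cut R Y r k x)"
  then show "h \<in> k ` flags_at R x"
    using kD inner by (auto simp: tails_iff flags_at_iff hinv_cut split: if_splits)
qed (use kD in \<open>auto simp: flags_at_iff\<close>)

lemma flags_cut: "r y = x \<Longrightarrow> flags_at (cut R Y r k x) y = flags_at Y y"
  by (auto simp: flags_at_iff)

lemma cute: "etale (cut R Y r k x) Y (cute R Y r k x)"
  unfolding cute_def
proof (rule hv_etale[OF full_cut jk(2)])
  show "bij_betw (\<lambda>h. h) (flags_at (cut R Y r k x) y) (flags_at Y y)" if "y \<in> Verts (cut R Y r k x)" for y
    using that by (simp add: flags_cut bij_betw_def)
  show "gi Y (gs Y h) = gs Y (hinv (cut R Y r k x) h)"
    if "h \<in> Halves (cut R Y r k x)" "hinv (cut R Y r k x) h \<noteq> h" for h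
    using that by (simp add: hinv_cut gi_gs split: if_splits)
qed auto

lemma cute_simps [simp]:
  "h \<in> Halves Y \<Longrightarrow> r (gp Y h) = x \<Longrightarrow> mH (cute R Y r k x) h = h"
  "y \<in> Verts Y \<Longrightarrow> r y = x \<Longrightarrow> mV (cute R Y r k x) y = y"
  by (simp_all add: cute_def)

lemma tailh_cut: "f \<in> flags_at R x \<Longrightarrow> tailh (cut R Y r k x) (cutl R Y r k x) f = k f"
  unfolding cutl_def using full_cut kD by (intro tailh_lab) (auto simp: flags_at_iff)

lemma cutd: "x \<in> Verts R \<Longrightarrow> cutd R Y r k x \<in> dgraphs (yon Y) (flags_at R x)"
  unfolding cutd_def
proof (rule yon_dgraphsI[OF full_cut _ _ _ cute])
  assume "x \<in> Verts R"
  then have "x \<in> r ` Verts Y" using r_surj by simp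
  then show "Verts (cut R Y r k x) \<noteq> {}" by auto
qed (use lab_bij[OF full_cut tails_cut] in \<open>auto simp: cutl_def\<close>)

end

text \<open>Values at stars are enough to pin the morphism down: the data \<open>r\<close>,
  \<open>k\<close> determine it by \<open>refines_unique\<close>, and by
  \<open>refines_unique_data\<close> it determines them where they matter.\<close>

definition refines :: "'u::infinite gr \<Rightarrow> 'u gr \<Rightarrow> 'u kl \<Rightarrow> ('u \<Rightarrow> 'u) \<Rightarrow> ('u \<Rightarrow> 'u) \<Rightarrow> bool" where
  "refines R Y \<phi> r k \<longleftrightarrow> \<phi> \<in> nt_hom (yon R) (bar (yon Y)) \<and> refn R Y r k \<and>
     (\<forall>x\<in>Verts R. cutd R Y r k x \<in> cls (\<phi> (Cor (flags_at R x)) (star R x)))"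

lemma refines_unique:
  assumes R: "full R" and Y: "full Y" and "refines R Y \<phi> r k" "refines R Y \<phi>' r k"
  shows "\<phi> = \<phi>'"
proof (rule nt_eq_fullI[OF R])
  show p: "\<phi> \<in> nt_hom (yon R) (bar (yon Y))" "\<phi>' \<in> nt_hom (yon R) (bar (yon Y))"
    using assms by (auto simp: refines_def)
  fix x assume x: "x \<in> Verts R"
  show "\<phi> (Cor (flags_at R x)) (star R x) = \<phi>' (Cor (flags_at R x)) (star R x)"
    by (rule barC_eqI[OF star_cls[OF R p(1) x] star_cls[OF R p(2) x], of "cutd R Y r k x"])
      (use assms(3,4) x in \<open>auto simp: refines_def\<close>)
qed

text \<open>\<open>r\<close> and \<open>k\<close> are total functions without an extensionality
  condition, so changes outside \<open>Verts Y\<close> and \<open>Halves R\<close> have to be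
  allowed for explicitly, here and in \<open>refines_cong\<close>.\<close>

lemma refn_cong:
  fixes R Y :: "'u::infinite gr"
  assumes "refn R Y r k" "full R" "full Y"
    and r: "\<And>y. y \<in> Verts Y \<Longrightarrow> r y = r' y" and k: "\<And>f. f \<in> Halves R \<Longrightarrow> k f = k' f"
  shows "refn R Y r' k'"
proof -
  interpret refinement R Y r k using assms by unfold_locales
  have 1: "k' ` Halves R = k ` Halves R" using k by (intro image_cong) auto
  have 2: "inj_on k' (Halves R)" using kD k by (auto simp: inj_on_def)
  have 3: "r' ` Verts Y = Verts R" using r r_surj by (metis image_cong)
  show ?thesis unfolding refn_def 1
  proof (intro conjI ballI 2 3)
    show "k ` Halves R \<subseteq> Halves Y" using kD(1) by blast
    fix f assume f: "f \<in> Halves R"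
    show "r' (gp Y (k' f)) = gp R f"
      using kD(1,2)[OF f] r[of "gp Y (k f)"] k[OF f] by simp
    show "hinv Y (k' f) = k' (hinv R f)"
      using kD(3)[OF f] k[OF f] k[of "hinv R f"] f by simp
  next
    fix h assume h: "h \<in> Halves Y - k ` Halves R"
    then show "hinv Y h \<noteq> h" using inner(1) by blast
    show "r' (gp Y (hinv Y h)) = r' (gp Y h)"
      using h inner(2)[of h] r[of "gp Y h"] r[of "gp Y (hinv Y h)"] by simp
  qed
qed

lemma refines_cong:
  assumes "refines R Y \<phi> r k" "full R" "full Y"
    and r: "\<And>y. y \<in> Verts Y \<Longrightarrow> r y = r' y" and k: "\<And>f. f \<in> Halves R \<Longrightarrow> k f = k' f"
  shows "refines R Y \<phi> r' k'"
proof -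
  interpret refinement R Y r k using assms by unfold_locales (auto simp: refines_def)
  have 1: "k' ` Halves R = k ` Halves R" using k by (intro image_cong) auto
  have s: "{h \<in> Halves Y. r' (gp Y h) = x} = {h \<in> Halves Y. r (gp Y h) = x}"
    "{y \<in> Verts Y. r' y = x} = {y \<in> Verts Y. r y = x}" for x
    using r by auto
  have c: "cut R Y r' k' x = cut R Y r k x" for x
    unfolding cut_def cutbm_def s 1 ..
  have "cutd R Y r' k' x = cutd R Y r k x" for x
    unfolding cutd_def cute_def cutl_def c using k by (auto simp: lab_def flags_at_iff fun_eq_iff)
  then show ?thesis using assms(1) refn_cong[OF refn R Y r k] by (simp add: refines_def)
qed

lemma refines_arc:
  assumes R: "full R" and Y: "full Y" and \<phi>: "refines R Y \<phi> r k" and f: "f \<in> Halves R"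
  shows "\<phi> Unit (uat R (gs R f)) = Colour (uat Y (gs Y (k f)))"
proof -
  interpret refinement R Y r k using R Y \<phi> by unfold_locales (auto simp: refines_def)
  have x: "gp R f \<in> Verts R" using f by simp
  have "\<phi> Unit (uat R (gs R f)) = Colour (uat Y (gs Y (mH (cute R Y r k (gp R f))
      (tailh (cut R Y r k (gp R f)) (cutl R Y r k (gp R f)) f))))"
    by (rule star_colour(1)[OF R jk(2) _ f _ cute]) (use \<phi> x in \<open>auto simp: refines_def cutd_def\<close>)
  then show ?thesis using f kD by (simp add: tailh_cut flags_at_iff)
qed

text \<open>\<open>k\<close> is visible in the colours of arcs. For \<open>r\<close>, the two cuts
  over \<open>r y\<close> represent the same element, hence are isomorphic over \<open>Y\<close>;
  both map to \<open>Y\<close> by the identity on vertices, so \<open>y\<close> itself lies in the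
  second cut.\<close>

lemma refines_unique_data:
  assumes R: "full R" and Y: "full Y" and \<phi>: "refines R Y \<phi> r k" and \<phi>': "refines R Y \<phi> r' k'"
  shows "f \<in> Halves R \<Longrightarrow> k f = k' f" "y \<in> Verts Y \<Longrightarrow> r y = r' y"
proof -
  interpret a: refinement R Y r k using R Y \<phi> by unfold_locales (auto simp: refines_def)
  interpret b: refinement R Y r' k' using R Y \<phi>' by unfold_locales (auto simp: refines_def)
  show "k f = k' f" if f: "f \<in> Halves R"
  proof -
    have "gs Y (k f) = gs Y (k' f)"
      using refines_arc[OF R Y \<phi> f] unfolding refines_arc[OF R Y \<phi>' f] barel.inject
      by (rule uat_inj[OF sym])
    then show ?thesis using a.kD(1)[OF f] b.kD(1)[OF f] by simp
  qed
  assume y: "y \<in> Verts Y"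
  let ?x = "r y"
  have x: "?x \<in> Verts R" using a.r_in y by simp
  have m: "cutd R Y r k ?x \<in> cls (\<phi> (Cor (flags_at R ?x)) (star R ?x))"
    "cutd R Y r' k' ?x \<in> cls (\<phi> (Cor (flags_at R ?x)) (star R ?x))"
    using \<phi> \<phi>' x by (auto simp: refines_def)
  have "dgraph_iso (flags_at R ?x) (cutd R Y r k ?x) (cutd R Y r' k' ?x)"
    using barC_iso[OF star_cls[where \<psi> = \<phi> and F = "yon Y", OF R _ x] m(1) b.cutd[OF x]] m(2) \<phi>
    by (simp add: refines_def)
  then obtain f where f: "graph_iso (cut R Y r k ?x) (cut R Y r' k' ?x) f"
    "cute R Y r k ?x = gcomp (cut R Y r k ?x) (cute R Y r' k' ?x) f"
    unfolding cutd_def yon_dgraph_iso[OF full_jk[OF a.full_cut] full_jk[OF b.full_cut] a.cute b.cute] by auto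
  have "mV f y \<in> Verts (cut R Y r' k' ?x)" using etale_mV[OF graph_iso_etale[OF f(1)]] y by simp
  then have v: "mV f y \<in> Verts Y" "r' (mV f y) = ?x" by simp_all
  have "y = mV (cute R Y r' k' ?x) (mV f y)" using arg_cong[OF f(2), of "\<lambda>m. mV m y"] y by simp
  then show "r y = r' y" using v by simp
qed

section \<open>Generic morphisms and refinement data\<close>

lemma assembles_cong:
  assumes T: "gluing S T F" and a: "assembles S T W \<gamma> \<delta>"
    and "\<And>y h. y \<in> Verts S \<Longrightarrow> h \<in> Halves (piece T y) \<Longrightarrow> \<gamma> (y, h) = \<gamma>' (y, h)"
    and "\<And>y h. y \<in> Verts S \<Longrightarrow> h \<in> Verts (piece T y) \<Longrightarrow> \<delta> (y, h) = \<delta>' (y, h)"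
  shows "assembles S T W \<gamma>' \<delta>'"
proof -
  interpret gluing S T F by fact
  have e1: "bij_betw \<gamma> (SIGMA y:Verts S. Halves (piece T y)) (Halves W) \<longleftrightarrow>
      bij_betw \<gamma>' (SIGMA y:Verts S. Halves (piece T y)) (Halves W)"
    using assms(3) by (intro bij_betw_cong) auto
  have e2: "bij_betw \<delta> (SIGMA y:Verts S. Verts (piece T y)) (Verts W) \<longleftrightarrow>
      bij_betw \<delta>' (SIGMA y:Verts S. Verts (piece T y)) (Verts W)"
    using assms(4) by (intro bij_betw_cong) auto
  have p: "\<gamma> (gp S f, ptail S T f) = \<gamma>' (gp S f, ptail S T f)" if "f \<in> Halves S" for f
    using that ptail(1) assms(3) by simp
  show ?thesis using a unfolding assembles_def e1 e2
    by (auto simp flip: assms(3,4) p simp: G(2))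
qed

text \<open>Composing the gluing with the isomorphism from \<open>S\<close> shows that
  \<open>Y\<close> itself is assembled by the etale maps of the pieces. Then \<open>r\<close> sends
  a vertex to the index of the piece it comes from, and \<open>k\<close> sends a half-edge to the
  image of the tail that it labels.\<close>

lemma generic_refines:
  fixes R Y :: "'u::infinite gr"
  assumes R: "full R" and Y: "full Y" and gen: "generic R Y \<phi>"
  obtains r k where "refines R Y \<phi> r k"
proof -
  have J: "jk_graph R" "jk_graph Y" using R Y by auto
  obtain S \<pi> h where \<phi>: "\<phi> \<in> nt_hom (yon R) (bar (yon Y))"
    and gl: "is_gluing (yon Y) R \<phi> S \<pi> (yon_map S h)" and h: "graph_iso S Y h"
    using gen by (auto simp: generic_def)
  obtain T Te \<gamma> \<delta> e' where SS: "full S" and e': "etale S Y e'" "yon_map S h = (yon_map S e' :: ('u,_,_) nt)"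
    and Tm: "\<And>y. y \<in> Verts R \<Longrightarrow> T y \<in> cls (\<phi> (Cor (flags_at R y)) (star R y))"
    and Td: "\<And>y. y \<in> Verts R \<Longrightarrow> piece_dec T y = yon_map (piece T y) (Te y) \<and> etale (piece T y) Y (Te y)"
    and a: "assembles R T S \<gamma> \<delta>"
    and eH: "\<And>y h. y \<in> Verts R \<Longrightarrow> h \<in> Halves (piece T y) \<Longrightarrow> mH e' (\<gamma> (y, h)) = mH (Te y) h"
    and eV: "\<And>y x. y \<in> Verts R \<Longrightarrow> x \<in> Verts (piece T y) \<Longrightarrow> mV e' (\<delta> (y, x)) = mV (Te y) x"
    by (rule is_gluingD[OF R J(2) \<phi> gl]) (rule that; assumption)
  have he: "h = e'" using yon_map_inj[OF _ graph_iso_etale[OF h] e'(1) e'(2)] SS by simp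
  interpret gluing R T "yon Y"
    by unfold_locales (use R barC_mem(1)[OF star_cls[OF R \<phi>] Tm] in auto)
  let ?\<gamma> = "\<lambda>(x, h). mH (Te x) h" and ?\<delta> = "\<lambda>(x, v). mV (Te x) v"
  have A: "assembles R T Y ?\<gamma> ?\<delta>"
    by (rule assembles_cong[OF gluing_axioms assembles_trans[OF SS Y h a G(2) gluing_axioms]])
      (use he eH eV in auto)
  let ?SH = "SIGMA y:Verts R. Halves (G y)" and ?SV = "SIGMA y:Verts R. Verts (G y)"
  have bH: "bij_betw ?\<gamma> ?SH (Halves Y)" and bV: "bij_betw ?\<delta> ?SV (Verts Y)"
    using A by (auto simp: assembles_def)
  have injH: "x = x' \<and> h = h'" if "mH (Te x) h = mH (Te x') h'" "x \<in> Verts R" "x' \<in> Verts R"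
    "h \<in> Halves (G x)" "h' \<in> Halves (G x')" for x x' h h'
    using inj_onD[OF bij_betw_imp_inj_on[OF bH], of "(x, h)" "(x', h')"] that by simp
  have injV: "x = x' \<and> h = h'" if "mV (Te x) h = mV (Te x') h'" "x \<in> Verts R" "x' \<in> Verts R"
    "h \<in> Verts (G x)" "h' \<in> Verts (G x')" for x x' h h'
    using inj_onD[OF bij_betw_imp_inj_on[OF bV], of "(x, h)" "(x', h')"] that by simp
  have surjH: "\<exists>x h. x \<in> Verts R \<and> h \<in> Halves (G x) \<and> y = mH (Te x) h" if "y \<in> Halves Y" for y
  proof -
    have "y \<in> ?\<gamma> ` ?SH" using bij_betw_imp_surj_on[OF bH] that by simp
    then show ?thesis by auto
  qed
  have surjV: "\<exists>x h. x \<in> Verts R \<and> h \<in> Verts (G x) \<and> y = mV (Te x) h" if "y \<in> Verts Y" for y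
  proof -
    have "y \<in> ?\<delta> ` ?SV" using bij_betw_imp_surj_on[OF bV] that by simp
    then show ?thesis by auto
  qed
  have Te: "etale (G x) Y (Te x)" if "x \<in> Verts R" for x using Td[OF that] by simp
  define k where "k f = mH (Te (gp R f)) (ptail R T f)" for f
  define r where "r y = fst (inv_into ?SV ?\<delta> y)" for y
  have r: "r (mV (Te x) v) = x" if "x \<in> Verts R" "v \<in> Verts (G x)" for x v
    using bij_betw_inv_into_left[OF bV, of "(x, v)"] that by (simp add: r_def)
  have rp: "r (gp Y (mH (Te x) h)) = x" if "x \<in> Verts R" "h \<in> Halves (G x)" for x h
    using etale_gp[OF Te[OF that(1)] that(2)] r[OF that(1), of "gp (G x) h"] G(2)[OF that(1)] that(2) by simp
  have ktail: "mH (Te (gp R f)) (ptail R T f) \<in> Halves Y" if "f \<in> Halves R" for f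
    using etale_mH[OF Te ptail(1)[OF that]] that by simp
  have hk: "hinv Y (k f) = k (hinv R f)" if "f \<in> Halves R" for f
    using A that by (simp add: assembles_def k_def)
  have notk: "mH (Te x) h \<notin> k ` Halves R" if "x \<in> Verts R" "h \<in> Halves (G x)" "hinv (G x) h \<noteq> h" for x h
  proof
    assume "mH (Te x) h \<in> k ` Halves R"
    then obtain f where f: "f \<in> Halves R" "mH (Te x) h = mH (Te (gp R f)) (ptail R T f)" by (auto simp: k_def)
    then have "x = gp R f \<and> h = ptail R T f" using injH[OF f(2)] that ptail(1)[OF f(1)] by simp
    then show False using that ptail(2)[OF f(1)] by simp
  qed
  have rf: "refn R Y r k"
    unfolding refn_def
  proof (intro conjI ballI)
    show "k ` Halves R \<subseteq> Halves Y" using ktail by (auto simp: k_def)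
    show "inj_on k (Halves R)"
    proof (rule inj_onI)
      fix f f' assume f: "f \<in> Halves R" "f' \<in> Halves R" "k f = k f'"
      then have "gp R f = gp R f' \<and> ptail R T f = ptail R T f'"
        unfolding k_def using ptail(1) by (intro injH) auto
      then show "f = f'" using f(1,2) by (elim conjE) (rule ptail_inj)
    qed
    show "r ` Verts Y = Verts R"
    proof (intro set_eqI iffI)
      fix x assume "x \<in> r ` Verts Y" then show "x \<in> Verts R" using surjV r by force
    next
      fix x assume x: "x \<in> Verts R"
      then have "Verts (G x) \<noteq> {}" using T[OF x] by (cases "T x") (simp add: dgraphs_iff)
      then obtain v where "v \<in> Verts (G x)" by blast
      then show "x \<in> r ` Verts Y" using r[OF x] etale_mV[OF Te[OF x]] by (metis image_eqI)
    qed
    fix f assume f: "f \<in> Halves R"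
    then show "r (gp Y (k f)) = gp R f" using rp[of "gp R f"] ptail(1)[OF f] by (simp add: k_def)
    show "hinv Y (k f) = k (hinv R f)" by (rule hk[OF f])
  next
    fix h assume h: "h \<in> Halves Y - k ` Halves R"
    then obtain x h0 where x: "x \<in> Verts R" "h0 \<in> Halves (G x)" "h = mH (Te x) h0" using surjH by blast
    have "hinv (G x) h0 \<noteq> h0"
    proof
      assume "hinv (G x) h0 = h0"
      then obtain f where "f \<in> Halves R" "gp R f = x" "h0 = ptail R T f" using ptail_surj[OF x(1,2)] by blast
      then show False using h x by (auto simp: k_def)
    qed
    then have eh: "hinv Y h = mH (Te x) (hinv (G x) h0)" "hinv Y h \<noteq> h"
      using etale_hinv[OF Te[OF x(1)] G(2)[OF x(1)] J(2) x(2)] x(3) by simp_all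
    then show "hinv Y h \<noteq> h" by simp
    show "r (gp Y (hinv Y h)) = r (gp Y h)" unfolding eh(1) unfolding x(3) using rp x(1,2) G(2)[OF x(1)] by simp
  qed
  interpret rr: refinement R Y r k using R Y rf by unfold_locales
  have "cutd R Y r k x \<in> cls (\<phi> (Cor (flags_at R x)) (star R x))" if x: "x \<in> Verts R" for x
  proof -
    have Tt: "T x = (G x, L x, yon_map (G x) (Te x))" using Td[OF x] by (cases "T x") simp
    have D: "(G x, L x, yon_map (G x) (Te x)) \<in> dgraphs (yon Y) (flags_at R x)"
      by (subst Tt[symmetric]) (rule T[OF x])
    \<comment> \<open>The piece at \<open>x\<close> is identified with the cut over \<open>x\<close>
      by its own etale map, whose image is the fibre over \<open>x\<close>.\<close>
    have "dgraph_iso (flags_at R x) (G x, L x, yon_map (G x) (Te x)) (cutd R Y r k x)"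
      unfolding cutd_def
    proof (rule yon_dgraph_isoI[OF D rr.cutd[OF x, unfolded cutd_def] Te[OF x] rr.cute])
      have "mH (Te x) ` Halves (G x) = {h \<in> Halves Y. r (gp Y h) = x}"
      proof (intro set_eqI iffI)
        fix h assume "h \<in> {h \<in> Halves Y. r (gp Y h) = x}"
        moreover then obtain x' h0 where "x' \<in> Verts R" "h0 \<in> Halves (G x')" "h = mH (Te x') h0" using surjH by blast
        ultimately show "h \<in> mH (Te x) ` Halves (G x)" using rp by auto
      qed (use rp x etale_mH[OF Te[OF x]] in auto)
      then show "bij_betw (mH (Te x)) (Halves (G x)) (Halves (cut R Y r k x))"
        using inj_onI[of "Halves (G x)" "mH (Te x)"] injH[OF _ x x] by (simp add: bij_betw_def)
      have "mV (Te x) ` Verts (G x) = {y \<in> Verts Y. r y = x}"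
      proof (intro set_eqI iffI)
        fix h assume "h \<in> {y \<in> Verts Y. r y = x}"
        moreover then obtain x' h0 where "x' \<in> Verts R" "h0 \<in> Verts (G x')" "h = mV (Te x') h0" using surjV by blast
        ultimately show "h \<in> mV (Te x) ` Verts (G x)" using r by auto
      qed (use r x etale_mV[OF Te[OF x]] in auto)
      then show "bij_betw (mV (Te x)) (Verts (G x)) (Verts (cut R Y r k x))"
        using inj_onI[of "Verts (G x)" "mV (Te x)"] injV[OF _ x x] by (simp add: bij_betw_def)
    next
      fix h assume h: "h \<in> Halves (G x)"
      have hY: "mH (Te x) h \<in> Halves Y" using etale_mH[OF Te[OF x] h] .
      show "gp (cut R Y r k x) (mH (Te x) h) = mV (Te x) (gp (G x) h)"
        using rp[OF x h] etale_gp[OF Te[OF x] h] hY by simp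
      show "hinv (cut R Y r k x) (mH (Te x) h) = mH (Te x) (hinv (G x) h)"
      proof (cases "hinv (G x) h = h")
        case True
        then obtain f where "f \<in> Halves R" "gp R f = x" "h = ptail R T f" using ptail_surj[OF x h] by blast
        then have "mH (Te x) h \<in> k ` Halves R" by (auto simp: k_def)
        then show ?thesis using rr.hinv_cut[OF hY rp[OF x h]] True by simp
      next
        case False
        then show ?thesis using rr.hinv_cut[OF hY rp[OF x h]] notk[OF x h False]
          etale_hinv[OF Te[OF x] G(2)[OF x] J(2) h False] by simp
      qed
      show "mH (cute R Y r k x) (mH (Te x) h) = mH (Te x) h" using hY rp[OF x h] by simp
    next
      fix v assume v: "v \<in> Verts (G x)"
      show "mV (cute R Y r k x) (mV (Te x) v) = mV (Te x) v" using etale_mV[OF Te[OF x] v] r[OF x v] by simp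
    next
      fix f assume f: "f \<in> flags_at R x"
      then show "mH (Te x) (tailh (G x) (L x) f) = tailh (cut R Y r k x) (cutl R Y r k x) f"
        by (simp add: rr.tailh_cut k_def ptail_def flags_at_iff)
    qed
    then have "dgraph_iso (flags_at R x) (T x) (cutd R Y r k x)" by (subst Tt)
    then show ?thesis using barC_iso[OF star_cls[OF R \<phi> x] Tm[OF x] rr.cutd[OF x]] by simp
  qed
  then have "refines R Y \<phi> r k" using \<phi> rf by (simp add: refines_def)
  then show ?thesis using that by blast
qed

text \<open>The cuts over the vertices of \<open>R\<close> partition \<open>Y\<close>, and rejoining
  them along the image of \<open>k\<close> gives back \<open>Y\<close>; so the glued etale map can
  be taken to be the identity.\<close>

lemma refines_generic:
  fixes R Y :: "'u::infinite gr"
  assumes R: "full R" and Y: "full Y" and ref: "refines R Y \<phi> r k"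
  shows "generic R Y \<phi>"
proof -
  interpret refinement R Y r k using R Y ref by unfold_locales (auto simp: refines_def)
  have \<phi>: "\<phi> \<in> nt_hom (yon R) (bar (yon Y))" using ref by (simp add: refines_def)
  let ?T = "cutd R Y r k"
  have pt: "ptail R ?T f = k f" if "f \<in> Halves R" for f
    using that by (simp add: ptail_def cutd_def tailh_cut flags_at_iff)
  have a: "assembles R ?T Y snd snd"
    unfolding assembles_def
  proof (intro conjI)
    show "bij_betw snd (SIGMA x:Verts R. Halves (piece ?T x)) (Halves Y)"
      using r_in by (auto simp: bij_betw_def inj_on_def cutd_def image_iff)
    show "bij_betw snd (SIGMA x:Verts R. Verts (piece ?T x)) (Verts Y)"
      using r_in by (auto simp: bij_betw_def inj_on_def cutd_def image_iff)
    show "\<forall>x\<in>Verts R. \<forall>h\<in>Halves (piece ?T x). hinv (piece ?T x) h \<noteq> h \<longrightarrow>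
        hinv Y (snd (x, h)) = snd (x, hinv (piece ?T x) h)"
      by (auto simp: cutd_def hinv_cut split: if_splits)
    show "\<forall>f\<in>Halves R. hinv Y (snd (gp R f, ptail R ?T f)) = snd (gp R (hinv R f), ptail R ?T (hinv R f))"
      using kD by (simp add: pt)
  qed (auto simp: cutd_def)
  obtain \<pi> where "is_gluing (yon Y) R \<phi> Y \<pi> (yon_map Y (gid Y))"
    by (rule is_gluingI[where T = ?T and Te = "cute R Y r k", OF R \<phi> Y etale_gid[OF jk(2)] _ _ a])
      (use ref cute in \<open>auto simp: refines_def cutd_def\<close>)
  then show ?thesis using \<phi> graph_iso_gid[OF jk(2)] unfolding generic_def by auto
qed

section \<open>Existence of a morphism with given refinement data\<close>

lemma bar_res_member:
  assumes "(G, l, d) \<in> cls c"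
  shows "(G, compose m l (mH f), d) \<in> cls (bar_res F (Cor m) (Cor n) f c)"
  using assms unfolding bar_res_CC by force

context refinement begin

lemma refines_ex: "\<exists>\<phi>. refines R Y \<phi> r k"
proof -
  \<comment> \<open>\<open>k\<close> need not come from an etale map, but it has a well-defined
    effect on arcs; \<open>hv_mor\<close> is used for its arc component, and the vertex component is
    a dummy.\<close>
  define kA where "kA = mA (hv_mor R Y k (\<lambda>_. undefined :: 'u))"
  have ke: "gi Y (gs Y (k h)) = gs Y (k (hinv R h))" if "h \<in> Halves R" "hinv R h \<noteq> h" for h
    using that kD(1,3,4) gi_gs[of Y "k h"] by simp
  have kim: "k ` Halves R \<subseteq> Halves Y" using kD by auto
  have kgs: "kA (gs R h) = gs Y (k h)" if "h \<in> Halves R" for h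
    unfolding kA_def by (rule hv_mor_gs[OF jk(1) that])
  have kgi: "kA (gi R a) = gi Y (kA a)" "kA a \<in> Arcs Y" if "a \<in> Arcs R" for a
    unfolding kA_def using hv_mor_gi[OF R jk(2) kim that ke] by auto
  \<comment> \<open>Naturality forces this value: a corolla map is a relabelled star, so it must go
    to the cut over its vertex with ports relabelled in the same way.\<close>
  define t where "t n e = (cut R Y r k (mV e ()), compose n (cutl R Y r k (mV e ())) (mH e),
    yon_map (cut R Y r k (mV e ())) (cute R Y r k (mV e ())) :: ('u, ('u,'u,'u,'u) elmap) decor)"
    for n and e :: "('u,'u,'u,'u) elmap"
  define \<phi> :: "'u kl" where "\<phi> = (\<lambda>X\<in>elObs. \<lambda>e\<in>val (yon R) X. case X of
    Unit \<Rightarrow> Colour (uat Y (kA (mA e (UnitArc True)))) | Cor n \<Rightarrow> Cls (dcls (yon Y) n (t n e)))"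
  have \<phi>U: "\<phi> Unit e = Colour (uat Y (kA (mA e (UnitArc True))))" if "etale unit_graph R e" for e
    using that by (simp add: \<phi>_def)
  have \<phi>C: "\<phi> (Cor n) e = Cls (dcls (yon Y) n (t n e))" if "finite n" "etale (corolla n) R e" for n e
    using that by (simp add: \<phi>_def)
  have tD: "t n e \<in> dgraphs (yon Y) n" if "finite n" "etale (corolla n) R e" for n e
    unfolding t_def
  proof (rule relabel_dgraphs[OF cutd[unfolded cutd_def]])
    show "mV e () \<in> Verts R" using etale_mV[OF that(2)] by simp
    show "bij_betw (mH e) n (flags_at R (mV e ()))" by (rule cor_bij[OF that(2)])
  qed
  have \<phi>b: "\<phi> (Cor n) e \<in> bar_val (yon Y) (Cor n)" "t n e \<in> cls (\<phi> (Cor n) e)"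
    if "finite n" "etale (corolla n) R e" for n e
    using dcls_bar[OF tD[OF that]] dcls_self[OF tD[OF that]] by (simp_all add: \<phi>C[OF that])
  have "\<phi> \<in> nt_hom (yon R) (bar (yon Y))"
  proof (rule nt_homI)
    show "\<phi> \<in> extensional elObs" by (simp add: \<phi>_def)
    fix X :: "'u elobj" assume X: "X \<in> elObs"
    then show "\<phi> X \<in> extensional (val (yon R) X)" by (simp add: \<phi>_def)
    fix c assume "c \<in> val (yon R) X"
    with X show "\<phi> X c \<in> val (bar (yon Y)) X"
      by (cases rule: elObs_cases) (auto simp: \<phi>U kgi \<phi>b)
  next
    fix X V :: "'u elobj" and f c
    assume X: "X \<in> elObs" and V: "V \<in> elObs" and f: "f \<in> el_hom X V" and c: "c \<in> val (yon R) V"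
    have fe: "etale (el_graph X) (el_graph V) f" using f by (simp add: el_hom_def)
    have ce: "etale (el_graph X) R (gcomp (el_graph X) c f)"
      using c X by (intro etale_gcomp[OF _ fe]) auto
    from V show "\<phi> X (res (yon R) X V f c) = res (bar (yon Y)) X V f (\<phi> V c)"
    proof (cases rule: elObs_cases)
      case 1
      with X f have XU: "X = Unit" using el_hom_cor_unit by (auto elim: elObs_cases)
      have c': "etale unit_graph R c" using c 1 by simp
      let ?a = "mA c (UnitArc True)"
      have a: "?a \<in> Arcs R" "c = uat R ?a" using etale_unitD[OF jk(1) c'] by simp_all
      have fu: "etale unit_graph unit_graph f" using fe 1 XU by simp
      obtain b where b: "mA f (UnitArc True) = UnitArc b" using etale_unitD(1)[OF jk_unit_graph fu] by auto
      have "mA (gcomp unit_graph c f) (UnitArc True) = (if b then ?a else gi R ?a)"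
        using b by (subst a(2)) simp
      moreover have "gcomp unit_graph (uat Y (kA ?a)) f = uat Y (if b then kA ?a else gi Y (kA ?a))"
        using etale_unitD(2)[OF jk_unit_graph fu] b gcomp_uat[OF etale_uat[OF jk(2) kgi(2)[OF a(1)]], of "UnitArc b"]
        by simp
      ultimately show ?thesis using 1 XU c' ce a by (simp add: \<phi>U bar_res_UU kgi)
    next
      case n: (2 n)
      then have c: "etale (corolla n) R c" using c by simp
      let ?x = "mV c ()"
      have tm: "(cut R Y r k ?x, compose n (cutl R Y r k ?x) (mH c), yon_map (cut R Y r k ?x) (cute R Y r k ?x))
          \<in> cls (\<phi> (Cor n) c)"
        using \<phi>b(2)[OF n(2) c] by (simp add: t_def)
      from X show ?thesis
      proof (cases rule: elObs_cases)
        case 1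
        obtain a where a: "a \<in> PortArc ` n \<union> FlagArc ` n" "f = uat (corolla n) a"
          using el_hom_unit_cor[of f n] f 1 n by auto
        obtain i where i: "i \<in> n" "a = PortArc i \<or> a = FlagArc i" using a(1) by auto
        have fl: "mH c i \<in> flags_at R ?x" using cor_flag[OF c i(1)] .
        then have h: "mH c i \<in> Halves R" by (simp add: flags_at_iff)
        have w: "mH (cute R Y r k ?x) (tailh (cut R Y r k ?x) (compose n (cutl R Y r k ?x) (mH c)) i) = k (mH c i)"
          using fl i kD by (simp add: compose_tailh tailh_cut flags_at_iff)
        have m: "mA (gcomp unit_graph c f) (UnitArc True) = mA c a" using a by simp
        have "mA c (FlagArc i) = gs R (mH c i)" "mA c (PortArc i) = gi R (gs R (mH c i))"
          using etale_gs[OF c, of i] etale_arc_tail[OF c, of i] i n by simp_all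
        then show ?thesis using 1 n ce m a(2) i(2) h
          bar_col[OF jk(2) \<phi>b(1)[OF n(2) c] tm cute i(1)] by (auto simp: \<phi>U kgs kgi w)
      next
        case m: (2 m)
        have fm: "f \<in> el_hom (Cor m) (Cor n)" and fe: "etale (corolla m) (corolla n) f"
          using f fe m n by simp_all
        have ce: "etale (corolla m) R (gcomp (corolla m) c f)" using ce m by simp
        have "compose m (compose n (cutl R Y r k ?x) (mH c)) (mH f) =
            compose m (cutl R Y r k ?x) (mH (gcomp (corolla m) c f))"
          using etale_mH[OF fe] by (auto simp: compose_def fun_eq_iff)
        moreover have "mV (gcomp (corolla m) c f) () = ?x" using fe by simp
        ultimately have "t m (gcomp (corolla m) c f) \<in> cls (bar_res (yon Y) (Cor m) (Cor n) f (\<phi> (Cor n) c))"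
          using bar_res_member[OF tm, of m f] by (simp add: t_def)
        then show ?thesis
          using barC_eqI[OF \<phi>b(1)[OF m(2) ce] bar_res_CC_in[OF \<phi>b(1)[OF n(2) c] fm] \<phi>b(2)[OF m(2) ce]] m n by simp
      qed
    qed
  qed
  moreover have "cutd R Y r k x \<in> cls (\<phi> (Cor (flags_at R x)) (star R x))" if x: "x \<in> Verts R" for x
  proof -
    have "compose (flags_at R x) (cutl R Y r k x) (mH (star R x)) = cutl R Y r k x"
      by (auto simp: cutl_def lab_def compose_def fun_eq_iff)
    then have "t (flags_at R x) (star R x) = cutd R Y r k x" by (simp add: t_def cutd_def)
    then show ?thesis using \<phi>b(2)[of "flags_at R x" "star R x"] x by simp
  qed
  ultimately show ?thesis using refn by (auto simp: refines_def)
qed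

end

section \<open>Composites and isomorphisms as refinements\<close>

lemma refn_comp:
  fixes Q S P :: "'u::infinite gr"
  assumes Q: "full Q" and S: "full S" and P: "full P" and a: "refn Q S r1 k1" and b: "refn S P r k"
  shows "refn Q P (r1 \<circ> r) (k \<circ> k1)"
proof -
  interpret a: refinement Q S r1 k1 using assms by unfold_locales
  interpret b: refinement S P r k using assms by unfold_locales
  show ?thesis unfolding refn_def
  proof (intro conjI ballI)
    show "(k \<circ> k1) ` Halves Q \<subseteq> Halves P" using a.kD b.kD by auto
    show "inj_on (k \<circ> k1) (Halves Q)" using a.kD b.kD by (auto simp: inj_on_def)
    show "(r1 \<circ> r) ` Verts P = Verts Q" using a.r_surj b.r_surj by (metis image_comp)
    fix f assume f: "f \<in> Halves Q"
    then show "(r1 \<circ> r) (gp P ((k \<circ> k1) f)) = gp Q f" using a.kD b.kD by simp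
    show "hinv P ((k \<circ> k1) f) = (k \<circ> k1) (hinv Q f)" using f a.kD b.kD by simp
  next
    fix h assume h: "h \<in> Halves P - (k \<circ> k1) ` Halves Q"
    have "hinv P h \<noteq> h \<and> (r1 \<circ> r) (gp P (hinv P h)) = (r1 \<circ> r) (gp P h)"
    proof (cases "h \<in> k ` Halves S")
      case True
      then obtain f where f: "f \<in> Halves S" "h = k f" by auto
      then have "f \<notin> k1 ` Halves Q" using h by auto
      then show ?thesis using f a.inner[of f] b.kD by simp
    next
      case False
      then show ?thesis using h b.inner[of h] by simp
    qed
    then show "hinv P h \<noteq> h" "(r1 \<circ> r) (gp P (hinv P h)) = (r1 \<circ> r) (gp P h)" by auto
  qed
qed

text \<open>The part of \<open>P\<close> over \<open>x\<close> along the composite arises by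
  inserting, into the part of \<open>S\<close> over \<open>x\<close>, the parts of \<open>P\<close>
  over its vertices. The pieces and the result share the half-edges and vertices of
  \<open>P\<close>, so the assembly is the projection \<open>snd\<close>.\<close>

lemma refines_comp:
  fixes Q S P :: "'u::infinite gr"
  assumes Q: "full Q" and S: "full S" and P: "full P"
    and b: "refines Q S b r1 k1" and v: "refines S P v r k"
  shows "refines Q P (Comp GrT Q S P v b) (r1 \<circ> r) (k \<circ> k1)"
proof -
  interpret b: refinement Q S r1 k1 using Q S b by unfold_locales (auto simp: refines_def)
  interpret v: refinement S P r k using S P v by unfold_locales (auto simp: refines_def)
  have rc: "refn Q P (r1 \<circ> r) (k \<circ> k1)" using refn_comp[OF Q S P b.refn v.refn] .
  interpret c: refinement Q P "r1 \<circ> r" "k \<circ> k1" using Q P rc by unfold_locales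
  have bn: "b \<in> nt_hom (yon Q) (bar (yon S))" and vn: "v \<in> nt_hom (yon S) (bar (yon P))"
    using b v by (auto simp: refines_def)
  note J = b.jk v.jk
  have "cutd Q P (r1 \<circ> r) (k \<circ> k1) x \<in> cls (Comp GrT Q S P v b (Cor (flags_at Q x)) (star Q x))"
    if x: "x \<in> Verts Q" for x
  proof -
    let ?n = "flags_at Q x"
    let ?S = "cut Q S r1 k1 x" and ?l = "cutl Q S r1 k1 x" and ?e = "cute Q S r1 k1 x"
    let ?W = "cut Q P (r1 \<circ> r) (k \<circ> k1) x"
    let ?T = "cutd S P r k"
    have fin: "finite ?n" using J by simp
    have c: "b (Cor ?n) (star Q x) \<in> bar_val (yon S) (Cor ?n)" by (rule star_cls[OF Q bn x])
    have t: "(?S, ?l, yon_map ?S ?e) \<in> cls (b (Cor ?n) (star Q x))" using b x by (simp add: refines_def cutd_def)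
    have SJ: "jk_graph ?S" using b.full_cut by simp
    have st: "gcomp (corolla (flags_at ?S y)) ?e (star ?S y) = star S y" if y: "y \<in> Verts ?S" for y
    proof (rule cor_eqI)
      have fy: "flags_at ?S y = flags_at S y" using y by (intro b.flags_cut) simp
      show "finite (flags_at ?S y)" using SJ by simp
      then show "etale (corolla (flags_at ?S y)) S (gcomp (corolla (flags_at ?S y)) ?e (star ?S y))"
        by (intro etale_gcomp[OF _ star_etale[OF SJ y] b.cute]) simp
      show "etale (corolla (flags_at ?S y)) S (star S y)" unfolding fy using J y by simp
      show "mV (gcomp (corolla (flags_at ?S y)) ?e (star ?S y)) () = mV (star S y) ()" using y by simp
      show "mH (gcomp (corolla (flags_at ?S y)) ?e (star ?S y)) h = mH (star S y) h"
        if "h \<in> flags_at ?S y" for h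
        using that y fy by (auto simp: flags_at_iff)
    qed
    have pt: "ptail ?S ?T f = k f" if "f \<in> Halves ?S" for f
      using that by (simp add: ptail_def cutd_def v.tailh_cut flags_at_iff)
    have W: "hinv ?W h = (if h \<in> (k \<circ> k1) ` Halves Q then h else hinv P h)"
      if "h \<in> Halves P" "r1 (r (gp P h)) = x" for h
      using c.hinv_cut[of h x] that by simp
    have "composite S P v ?n ?S ?l ?e ?T (cute S P r k) ?W (cutl Q P (r1 \<circ> r) (k \<circ> k1) x)
        (cute Q P (r1 \<circ> r) (k \<circ> k1) x) snd snd"
      unfolding composite_def assembles_def
    proof (intro conjI)
      show "\<forall>y\<in>Verts ?S. ?T y \<in> cls (v (Cor (flags_at ?S y)) (gcomp (corolla (flags_at ?S y)) ?e (star ?S y)))"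
      proof
        fix y assume y: "y \<in> Verts ?S"
        have fy: "flags_at ?S y = flags_at S y" using y by (intro b.flags_cut) simp
        show "?T y \<in> cls (v (Cor (flags_at ?S y)) (gcomp (corolla (flags_at ?S y)) ?e (star ?S y)))"
          unfolding fy st[OF y, unfolded fy] using v y by (simp add: refines_def)
      qed
      show "bij_betw snd (SIGMA y:Verts ?S. Halves (piece ?T y)) (Halves ?W)"
        using v.r_in by (auto simp: bij_betw_def inj_on_def cutd_def image_iff)
      show "bij_betw snd (SIGMA y:Verts ?S. Verts (piece ?T y)) (Verts ?W)"
        using v.r_in by (auto simp: bij_betw_def inj_on_def cutd_def image_iff)
      show "\<forall>y\<in>Verts ?S. \<forall>h\<in>Halves (piece ?T y). hinv (piece ?T y) h \<noteq> h \<longrightarrow>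
          hinv ?W (snd (y, h)) = snd (y, hinv (piece ?T y) h)"
        using b.kD(1) by (auto simp: cutd_def v.hinv_cut W split: if_splits)
      show "\<forall>f\<in>Halves ?S. hinv ?W (snd (gp ?S f, ptail ?S ?T f)) =
          snd (gp ?S (hinv ?S f), ptail ?S ?T (hinv ?S f))"
      proof
        fix f assume f: "f \<in> Halves ?S"
        then have f': "f \<in> Halves S" "r1 (gp S f) = x" by simp_all
        \<comment> \<open>By injectivity of \<open>k\<close>, a half-edge of \<open>S\<close> is cut
          over \<open>x\<close> exactly when its image in \<open>P\<close> is cut by the composite
          data.\<close>
        have i: "k f \<in> (k \<circ> k1) ` Halves Q \<longleftrightarrow> f \<in> k1 ` Halves Q"
          using v.kD(4) f' b.kD(1) by (auto simp: image_iff)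
        have "hinv ?W (k f) = k (hinv ?S f)"
          using W[of "k f"] v.kD(1-3)[OF f'(1)] f' i b.hinv_cut[OF f'] by simp
        then show "hinv ?W (snd (gp ?S f, ptail ?S ?T f)) = snd (gp ?S (hinv ?S f), ptail ?S ?T (hinv ?S f))"
          using pt[OF f] pt[OF hinv_in[OF SJ f]] by simp
      qed
      show "\<forall>i\<in>?n. tailh ?W (cutl Q P (r1 \<circ> r) (k \<circ> k1) x) i =
          snd (gp ?S (tailh ?S ?l i), ptail ?S ?T (tailh ?S ?l i))"
        using b.kD(1,2) by (simp add: c.tailh_cut b.tailh_cut pt flags_at_iff)
    qed (use b.cute v.cute c.cute v.r_in in \<open>auto simp: cutd_def\<close>)
    then have "cutd Q P (r1 \<circ> r) (k \<circ> k1) x \<in> cls (kext S P v (Cor ?n) (b (Cor ?n) (star Q x)))"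
      unfolding cutd_def
      by (rule kextI[OF J(2) J(4) vn fin c t c.cutd[OF x, unfolded cutd_def]])
    then show ?thesis unfolding Comp_GrT using fin x J by simp
  qed
  then show ?thesis using rc Comp_nt[OF J(1,2,4) bn vn] by (simp add: refines_def)
qed

lemma refn_iso:
  assumes Y: "full Y" and Y': "full Y'" and t: "graph_iso Y Y' t"
  shows "refn Y Y' (inv_into (Verts Y) (mV t)) (mH t)"
proof -
  have J: "jk_graph Y" "jk_graph Y'" using Y Y' by auto
  note tt = graph_isoD[OF t J]
  have H: "mH t ` Halves Y = Halves Y'" using tt(3) by (simp add: bij_betw_def)
  show ?thesis unfolding refn_def H
    using bij_betw_imp_surj_on[OF bij_betw_inv_into[OF tt(4)]] bij_betw_imp_inj_on[OF tt(3)]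
      graph_iso_hinv[OF Y Y' t] J
    by (auto simp flip: etale_gp[OF tt(1)] simp: bij_betw_inv_into_left[OF tt(4)])
qed

text \<open>The vertex map is inverted because \<open>r\<close> runs from target to source. Over one
  vertex of \<open>Y\<close> lies a single vertex of \<open>Y'\<close>, and every half-edge of
  \<open>Y'\<close> is in the image of \<open>mH t\<close>, so each cut is a corolla and represents
  a value of the unit.\<close>

lemma refines_iso:
  fixes Y Y' :: "'u::infinite gr"
  assumes Y: "full Y" and Y': "full Y'" and t: "graph_iso Y Y' t"
  shows "refines Y Y' (kl_of_etale Y Y' t) (inv_into (Verts Y) (mV t)) (mH t)"
proof -
  have J: "jk_graph Y" "jk_graph Y'" using Y Y' by auto
  note tt = graph_isoD[OF t J]
  let ?r = "inv_into (Verts Y) (mV t)"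
  have rf: "refn Y Y' ?r (mH t)" by (rule refn_iso[OF Y Y' t])
  interpret refinement Y Y' ?r "mH t" using Y Y' rf by unfold_locales
  have "cutd Y Y' ?r (mH t) x \<in> cls (kl_of_etale Y Y' t (Cor (flags_at Y x)) (star Y x))"
    if x: "x \<in> Verts Y" for x
  proof -
    let ?n = "flags_at Y x" and ?C = "cut Y Y' ?r (mH t) x"
    have tx: "mV t x \<in> Verts Y'" "?r (mV t x) = x" using x tt(1) bij_betw_inv_into_left[OF tt(4) x] by simp_all
    have rv: "y = mV t x" if "y \<in> Verts Y'" "?r y = x" for y
      using bij_betw_inv_into_right[OF tt(4) that(1)] that(2) by simp
    have VC: "Verts ?C = {mV t x}"
    proof (intro set_eqI iffI)
      fix y assume "y \<in> Verts ?C"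
      then have "y = mV t x" by (intro rv) simp_all
      then show "y \<in> {mV t x}" by simp
    qed (use tx in simp)
    have gpC: "gp ?C h = mV t x" if "h \<in> Halves ?C" for h
      using rv[of "gp Y' h"] that by simp
    with gpC have HC: "flags_at ?C (mV t x) = Halves ?C" by (auto simp only: flags_at_iff)
    have C: "full ?C" by (rule full_cut)
    have bt: "bij_betw (mH t) ?n (tails ?C)" by (rule tails_cut)
    have "hinv ?C h = h" if "h \<in> Halves ?C" for h
    proof -
      have "h \<in> mH t ` Halves Y" using that unfolding bij_betw_imp_surj_on[OF tt(3)] by simp
      then show ?thesis using that hinv_cut[of h x] by simp
    qed
    then have tH: "tails ?C = Halves ?C" by (auto simp only: tails_iff)
    have st: "etale (corolla ?n) Y (star Y x)" using x J by simp
    have te: "etale (corolla ?n) Y' (gcomp (corolla ?n) t (star Y x))"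
      using J by (intro etale_gcomp[OF _ st tt(1)]) simp
    let ?f = "hv_mor (corolla ?n) ?C (mH t) (\<lambda>_. mV t x)"
    have f: "graph_iso (corolla ?n) ?C ?f"
    proof (rule hv_graph_iso)
      fix h assume h: "h \<in> Halves (corolla ?n)"
      then have "mH t h \<in> tails ?C" using bt by (auto simp: bij_betw_def)
      then have m: "mH t h \<in> Halves ?C" "hinv ?C (mH t h) = mH t h" by (simp_all add: tails_iff)
      then show "gp ?C (mH t h) = mV t x" by (intro gpC)
      show "hinv ?C (mH t h) = mH t (hinv (corolla ?n) h)" using m h by simp
    qed (use J C bt tH VC in \<open>auto simp: bij_betw_def\<close>)
    note fe = graph_iso_etale[OF f]
    have "(?C, cutl Y Y' ?r (mH t) x, yon_map ?C (cute Y Y' ?r (mH t) x))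
        \<in> cls (unit_nt (yon Y') (Cor ?n) (gcomp (corolla ?n) t (star Y x)))"
    proof (rule unitI[OF J(2) _ te C f _ _ cute])
      show "finite ?n" using J by simp
      show "cutl Y Y' ?r (mH t) x \<in> extensional ?n" by (simp add: cutl_def lab_def)
      show "cutl Y Y' ?r (mH t) x i = mA ?f (PortArc i)" if "i \<in> ?n" for i
        using that etale_arc_tail[OF fe, of i] J by (simp add: cutl_def lab_def)
      show "gcomp (corolla ?n) (cute Y Y' ?r (mH t) x) ?f = gcomp (corolla ?n) t (star Y x)"
      proof (rule cor_eqI[OF _ _ te])
        show "etale (corolla ?n) Y' (gcomp (corolla ?n) (cute Y Y' ?r (mH t) x) ?f)"
          using J by (intro etale_gcomp[OF _ fe cute]) simp
        fix i assume i: "i \<in> ?n"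
        then have "mH t i \<in> Halves ?C" using bt tH by (auto simp: bij_betw_def)
        then show "mH (gcomp (corolla ?n) (cute Y Y' ?r (mH t) x) ?f) i = mH (gcomp (corolla ?n) t (star Y x)) i"
          using i by simp
      qed (use J tx in auto)
    qed
    then show ?thesis using J st by (simp add: kl_app cutd_def)
  qed
  then show ?thesis using rf kl_nt[OF J tt(1)] by (simp add: refines_def)
qed

lemma refines_Ide:
  fixes Y :: "'u::infinite gr"
  assumes Y: "full Y" shows "refines Y Y (unit_nt (yon Y)) (\<lambda>y. y) (\<lambda>h. h)"
proof -
  have J: "jk_graph Y" using Y by simp
  have i: "inv_into (Verts Y) (mV (gid Y)) y = y" if "y \<in> Verts Y" for y
    using bij_betw_inv_into_left[OF graph_isoD(4)[OF graph_iso_gid[OF J] J J] that] that by simp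
  show ?thesis
    by (rule refines_cong[OF refines_iso[OF Y Y graph_iso_gid[OF J], unfolded kl_gid[OF J]] Y Y])
      (use i in auto)
qed

section \<open>Isomorphisms of the Kleisli category\<close>

text \<open>If gluing pieces into \<open>G\<close> gives a corolla, then \<open>G\<close> has only
  one vertex, since every piece has a vertex, and no inner edge, since such an edge would survive in
  the glued graph. The equation for \<open>\<psi>\<close> after \<open>\<theta>\<close> puts a
  representative of \<open>\<theta> X e\<close> in this position.\<close>

lemma split_mono_unit:
  fixes S P :: "'u::infinite gr"
  assumes S: "full S" and P: "full P" and \<theta>: "\<theta> \<in> nt_hom (yon S) (bar (yon P))"
    and \<psi>: "\<psi> \<in> nt_hom (yon P) (bar (yon S))" and id: "Comp GrT S P S \<psi> \<theta> = unit_nt (yon S)"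
    and X: "X \<in> elObs" and e: "etale (el_graph X) S e"
  shows "\<exists>d. etale (el_graph X) P d \<and> \<theta> X e = unit_nt (yon P) X d"
  using X
proof (cases rule: elObs_cases)
  case 1
  then show ?thesis using nt_in[OF \<theta>, of Unit e] e by auto
next
  case (2 n)
  then have e: "etale (corolla n) S e" using e by simp
  have J: "jk_graph S" "jk_graph P" using S P by auto
  have c: "\<theta> (Cor n) e \<in> bar_val (yon P) (Cor n)" using nt_in[OF \<theta>, of "Cor n" e] 2 e by simp
  have eq: "kext P S \<psi> (Cor n) (\<theta> (Cor n) e) = unit_nt (yon S) (Cor n) e"
    using fun_cong[OF fun_cong[OF id[unfolded Comp_GrT], of "Cor n"], of e] 2 e by simp
  obtain W l' d' where m: "(W, l', d') \<in> cls (unit_nt (yon S) (Cor n) e)"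
    using barC_ne[OF unit_bar[OF J(1) 2(2) e]] .
  obtain f where f: "graph_iso (corolla n) W f" "full W"
    using unitE[OF J(1) 2(2) e m] by metis
  obtain G l e0 T Te e' \<gamma> \<delta> where t: "(G, l, yon_map G e0) \<in> cls (\<theta> (Cor n) e)"
    and k: "composite P S \<psi> n G l e0 T Te W l' e' \<gamma> \<delta>"
    using kextE[OF J(2,1) \<psi> 2(2) c m[folded eq]] by metis
  have D: "(G, l, yon_map G e0) \<in> dgraphs (yon P) n" using barC_mem(1)[OF c t] .
  have fG: "full G" and GV: "Verts G \<noteq> {}" and e0: "etale G P e0"
    using D k by (auto simp: dgraphs_iff composite_def)
  have JG: "jk_graph G" using fG by simp
  interpret gluing G T "yon S" using composite_gluing[OF \<psi> fG k] .
  note ff = graph_isoD[OF f(1) jk_corolla[OF 2(2)] full_jk[OF f(2)]]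
  have a: "assembles G T W \<gamma> \<delta>" using k by (simp add: composite_def)
  have VW: "Verts W = {mV f ()}" using ff(4) by (auto simp: bij_betw_def)
  have hW: "hinv W h = h" if "h \<in> Halves W" for h
  proof -
    have "h \<in> mH f ` n" using bij_betw_imp_surj_on[OF ff(3)] that by simp
    then obtain i where i: "i \<in> n" "h = mH f i" by (rule imageE) blast
    have "hinv W (mH f i) = mH f (hinv (corolla n) i)"
      by (rule graph_iso_hinv[OF full_corolla[OF 2(2)] f(2,1)]) (simp add: i(1))
    then show ?thesis unfolding i(2) hinv_corolla[OF i(1)] .
  qed
  obtain y0 where y0: "y0 \<in> Verts G" using GV by blast
  have "y = y0" if y: "y \<in> Verts G" for y
  proof -
    have ne: "\<exists>v. v \<in> Verts (piece T y)" if "y \<in> Verts G" for y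
      using T[OF that] by (cases "T y") (auto simp: dgraphs_iff)
    obtain v w where v: "v \<in> Verts (piece T y)" "w \<in> Verts (piece T y0)" using ne y y0 by blast
    have b: "bij_betw \<delta> (SIGMA y:Verts G. Verts (piece T y)) (Verts W)" using a by (simp add: assembles_def)
    have "\<delta> (y, v) \<in> Verts W" "\<delta> (y0, w) \<in> Verts W" using b v y y0 by (auto simp: bij_betw_def)
    then have "\<delta> (y, v) = \<delta> (y0, w)" using VW by simp
    then show ?thesis using inj_onD[OF bij_betw_imp_inj_on[OF b], of "(y, v)" "(y0, w)"] v y y0 by simp
  qed
  then have VG: "Verts G = {y0}" using y0 by blast
  have hG: "hinv G h = h" if h: "h \<in> Halves G" for h
  proof -
    have b: "bij_betw \<gamma> (SIGMA y:Verts G. Halves (piece T y)) (Halves W)" using a by (simp add: assembles_def)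
    have h': "hinv G h \<in> Halves G" using h JG by simp
    have m: "(gp G h, ptail G T h) \<in> (SIGMA y:Verts G. Halves (piece T y))"
      "(gp G (hinv G h), ptail G T (hinv G h)) \<in> (SIGMA y:Verts G. Halves (piece T y))"
      using h h' ptail(1) JG by auto
    have "\<gamma> (gp G (hinv G h), ptail G T (hinv G h)) = hinv W (\<gamma> (gp G h, ptail G T h))"
      using a h by (simp add: assembles_def)
    also have "\<dots> = \<gamma> (gp G h, ptail G T h)" using bij_betw_apply[OF b m(1)] by (rule hW)
    finally have "(gp G (hinv G h), ptail G T (hinv G h)) = (gp G h, ptail G T h)"
      by (rule inj_onD[OF bij_betw_imp_inj_on[OF b] _ m(2,1)])
    then show ?thesis using ptail_inj[OF h' h] by blast
  qed
  have tG: "tails G = Halves G" using hG by (auto simp only: tails_iff)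
  have lb: "bij_betw l n (ports G)" "l \<in> n \<rightarrow>\<^sub>E ports G" using D by (auto simp: dgraphs_iff)
  have bt: "bij_betw (tailh G l) n (Halves G)" using tailh_bij[OF fG lb(1)] tG by simp
  let ?f = "hv_mor (corolla n) G (tailh G l) (\<lambda>_. y0)"
  have gf: "graph_iso (corolla n) G ?f"
  proof (rule hv_graph_iso[OF full_corolla[OF 2(2)] fG])
    fix h assume "h \<in> Halves (corolla n)"
    then have h: "h \<in> n" "tailh G l h \<in> Halves G" using bt by (auto simp: bij_betw_def)
    then show "gp G (tailh G l h) = y0" using jk_gp[OF JG h(2)] VG by simp
    show "hinv G (tailh G l h) = tailh G l (hinv (corolla n) h)" using hG[OF h(2)] h(1) by simp
  qed (use bt VG in \<open>auto simp: bij_betw_def\<close>)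
  have ge: "etale (corolla n) G ?f" using gf by (rule graph_iso_etale)
  have d: "etale (corolla n) P (gcomp (corolla n) e0 ?f)"
    using 2 by (intro etale_gcomp[OF _ ge e0]) simp
  have "(G, l, yon_map G e0) \<in> cls (unit_nt (yon P) (Cor n) (gcomp (corolla n) e0 ?f))"
  proof (rule unitI[OF J(2) 2(2) d fG gf _ _ e0])
    show "l \<in> extensional n" using lb by (simp add: PiE_def)
    fix i assume i: "i \<in> n"
    have p: "l i \<in> ports G" using lb i by auto
    have "mA ?f (PortArc i) = gi G (gs G (tailh G l i))" using etale_arc_tail[OF ge, of i] i 2 by simp
    then show "l i = mA ?f (PortArc i)" using tailh_port(3)[where l = l, OF fG p] by simp
  qed simp
  then have "\<theta> (Cor n) e = unit_nt (yon P) (Cor n) (gcomp (corolla n) e0 ?f)"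
    by (rule barC_eqI[OF c unit_bar[OF J(2) 2(2) d] t])
  then show ?thesis using 2 d by auto
qed

text \<open>The pointwise choice of preimages under the unit is natural because the unit is
  injective, and a natural transformation between graphs is etale by fullness.\<close>

lemma split_mono_etale:
  fixes S P :: "'u::infinite gr"
  assumes S: "full S" and P: "full P" and \<theta>: "\<theta> \<in> nt_hom (yon S) (bar (yon P))"
    and \<psi>: "\<psi> \<in> nt_hom (yon P) (bar (yon S))" and id: "Comp GrT S P S \<psi> \<theta> = unit_nt (yon S)"
  obtains t where "etale S P t" "\<theta> = kl_of_etale S P t"
proof -
  have J: "jk_graph S" "jk_graph P" using S P by auto
  define D :: "('u, ('u,'u,'u,'u) elmap, ('u,'u,'u,'u) elmap) nt" where "D = (\<lambda>X\<in>elObs. \<lambda>e\<in>val (yon S) X.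
      SOME d. etale (el_graph X) P d \<and> \<theta> X e = unit_nt (yon P) X d)"
  have D: "etale (el_graph X) P (D X e)" "\<theta> X e = unit_nt (yon P) X (D X e)"
    if "X \<in> elObs" "etale (el_graph X) S e" for X e
    using someI_ex[OF split_mono_unit[OF S P \<theta> \<psi> id that]] that by (simp_all add: D_def)
  have "D \<in> nt_hom (yon S) (yon P)"
  proof (rule nt_homI)
    show "D \<in> extensional elObs" "\<And>X. X \<in> elObs \<Longrightarrow> D X \<in> extensional (val (yon S) X)" by (auto simp: D_def)
    show "D X c \<in> val (yon P) X" if "X \<in> elObs" "c \<in> val (yon S) X" for X c using D that by simp
    fix X V :: "'u elobj" and f c
    assume a: "X \<in> elObs" "V \<in> elObs" "f \<in> el_hom X V" "c \<in> val (yon S) V"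
    have f: "etale (el_graph X) (el_graph V) f" using a by (simp add: el_hom_def)
    have ce: "etale (el_graph X) S (gcomp (el_graph X) c f)" using a by (intro etale_gcomp[OF _ f]) auto
    have De: "etale (el_graph X) P (gcomp (el_graph X) (D V c) f)" using a D by (intro etale_gcomp[OF _ f]) auto
    have "unit_nt (yon P) X (D X (gcomp (el_graph X) c f)) = \<theta> X (gcomp (el_graph X) c f)"
      using D(2)[OF a(1) ce] by simp
    also have "\<dots> = bar_res (yon P) X V f (\<theta> V c)" using nt_nat[OF \<theta> a] by simp
    also have "\<dots> = bar_res (yon P) X V f (unit_nt (yon P) V (D V c))" using D(2) a by simp
    also have "\<dots> = unit_nt (yon P) X (gcomp (el_graph X) (D V c) f)"
      using nt_nat[OF unit_nt_nat[OF J(2)] a(1-3), of "D V c"] D a by simp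
    finally show "D X (res (yon S) X V f c) = res (yon P) X V f (D V c)"
      using unit_inj[OF J(2) a(1) D(1)[OF a(1) ce] De] by simp
  qed
  then obtain t where t: "etale S P t" "D = yon_map S t" using yon_full[OF S J(2)] by metis
  have "\<theta> = kl_of_etale S P t"
  proof (rule nt_eqI[OF \<theta> kl_nt[OF J t(1)]])
    fix X :: "'u elobj" and c assume a: "X \<in> elObs" "c \<in> val (yon S) X"
    then show "\<theta> X c = kl_of_etale S P t X c" using D(2)[of X c] t(2) by (simp add: kl_app)
  qed
  then show ?thesis using that t by blast
qed

lemma kl_inj:
  fixes R Y :: "'u::infinite gr"
  assumes J: "jk_graph R" "jk_graph Y" and f: "etale R Y f" "etale R Y f'"
    and eq: "kl_of_etale R Y f = kl_of_etale R Y f'"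
  shows "f = f'"
proof (rule yon_map_inj[OF J(1) f])
  show "(yon_map R f :: ('u,_,_) nt) = yon_map R f'"
  proof (rule nt_eqI[OF yon_map_nt[OF f(1) J(1)] yon_map_nt[OF f(2) J(1)]])
    fix X :: "'u elobj" and c assume X: "X \<in> elObs" and "c \<in> val (yon R) X"
    then have c: "etale (el_graph X) R c" by simp
    have "unit_nt (yon Y) X (gcomp (el_graph X) f c) = unit_nt (yon Y) X (gcomp (el_graph X) f' c)"
      using fun_cong[OF fun_cong[OF eq, of X], of c] X c by (simp add: kl_app)
    then show "yon_map R f X c = yon_map R f' X c"
      using unit_inj[OF J(2) X etale_gcomp[OF jk_el_graph[OF X] c f(1)] etale_gcomp[OF jk_el_graph[OF X] c f(2)]] X c
      by simp
  qed
qed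

lemma iso_GrT:
  fixes S P :: "'u::infinite gr"
  assumes S: "full S" and P: "full P" and \<theta>: "iso_in GrT S P \<theta>"
  obtains t where "graph_iso S P t" "\<theta> = kl_of_etale S P t"
proof -
  have J: "jk_graph S" "jk_graph P" using S P by auto
  obtain \<psi> where h: "\<theta> \<in> nt_hom (yon S) (bar (yon P))" "\<psi> \<in> nt_hom (yon P) (bar (yon S))"
    and id: "Comp GrT S P S \<psi> \<theta> = unit_nt (yon S)" "Comp GrT P S P \<theta> \<psi> = unit_nt (yon P)"
    using \<theta> by (auto simp: iso_in_def)
  obtain t where t: "etale S P t" "\<theta> = kl_of_etale S P t" using split_mono_etale[OF S P h id(1)] .
  obtain s where s: "etale P S s" "\<psi> = kl_of_etale P S s" using split_mono_etale[OF P S h(2,1) id(2)] .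
  have st: "etale S S (gcomp S s t)" "etale P P (gcomp P t s)" using t s J by (auto intro: etale_gcomp)
  have "gcomp S s t = gid S"
    using id(1) unfolding t(2) s(2) kl_gcomp[OF J(1,2,1) t(1) s(1)] kl_gid[OF J(1), symmetric]
    by (rule kl_inj[OF J(1,1) st(1) etale_gid[OF J(1)]])
  moreover have "gcomp P t s = gid P"
    using id(2) unfolding t(2) s(2) kl_gcomp[OF J(2,1,2) s(1) t(1)] kl_gid[OF J(2), symmetric]
    by (rule kl_inj[OF J(2,2) st(2) etale_gid[OF J(2)]])
  ultimately have "graph_iso S P t" using t s unfolding graph_iso_def by blast
  then show ?thesis using that t by blast
qed

lemma kl_iso:
  fixes S P :: "'u::infinite gr"
  assumes S: "jk_graph S" and P: "jk_graph P" and t: "graph_iso S P t"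
  shows "iso_in GrT S P (kl_of_etale S P t)"
proof -
  obtain s where s: "graph_iso P S s" "gcomp S s t = gid S" "gcomp P t s = gid P"
    using graph_iso_inverse[OF t] .
  note e = graph_iso_etale[OF t] graph_iso_etale[OF s(1)]
  show ?thesis unfolding iso_in_def
    using kl_nt[OF S P e(1)] kl_nt[OF P S e(2)] kl_gcomp[OF S P S e] kl_gcomp[OF P S P e(2,1)] s
      kl_gid[OF S] kl_gid[OF P] by auto
qed

section \<open>Reduced covers\<close>

locale cover =
  fixes S P :: "'u::infinite gr" and u :: "'u gmap"
  assumes S: "full S" and P: "full P" and rc: "reduced_cover S P u"
begin

lemma jkc [simp]: "jk_graph S" "jk_graph P" using S P by auto

lemma u: "etale S P u" and bV: "bij_betw (mV u) (Verts S) (Verts P)"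
  using rc by (auto simp: reduced_cover_def)

text \<open>Combines the bijection on vertices with the bijections on the flags at each
  vertex.\<close>

lemma bH: "bij_betw (mH u) (Halves S) (Halves P)"
  unfolding bij_betw_def
proof (intro conjI inj_onI set_eqI iffI)
  fix h h' assume h: "h \<in> Halves S" "h' \<in> Halves S" "mH u h = mH u h'"
  then have "mV u (gp S h) = mV u (gp S h')" by (simp add: etale_gp[OF u])
  then have "gp S h = gp S h'" using inj_onD[OF bij_betw_imp_inj_on[OF bV]] h by simp
  then show "h = h'" using inj_onD[OF bij_betw_imp_inj_on[OF etale_star[OF u, of "gp S h"]] h(3)] h
    by (simp add: flags_at_iff)
next
  fix k assume k: "k \<in> Halves P"
  then have "gp P k \<in> mV u ` Verts S" using bij_betw_imp_surj_on[OF bV] by simp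
  then obtain x where x: "x \<in> Verts S" "gp P k = mV u x" by blast
  then have "k \<in> mH u ` flags_at S x" using bij_betw_imp_surj_on[OF etale_star[OF u x(1)]] k
    by (simp add: flags_at_iff)
  then show "k \<in> mH u ` Halves S" by (auto simp: flags_at_iff)
qed (use u in auto)

lemma H_eq: "h \<in> Halves S \<Longrightarrow> h' \<in> Halves S \<Longrightarrow> mH u h = mH u h' \<longleftrightarrow> h = h'"
  using bH by (auto simp: bij_betw_def inj_on_def)

lemma V_eq: "h \<in> Verts S \<Longrightarrow> h' \<in> Verts S \<Longrightarrow> mV u h = mV u h' \<longleftrightarrow> h = h'"
  using bV by (auto simp: bij_betw_def inj_on_def)

text \<open>Elements lift because \<open>u\<close> is bijective on half-edges and vertices. An arc
  on an edge that \<open>u\<close> creates has two lifts, an attached arc and a port.\<close>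

lemma lift:
  assumes X: "X \<in> elObs" and e: "etale (el_graph X) P e"
  obtains e' where "etale (el_graph X) S e'" "gcomp (el_graph X) u e' = e"
  using X
proof (cases rule: elObs_cases)
  case 1
  then have e: "etale unit_graph P e" using e by simp
  note ee = etale_unitD[OF jkc(2) e]
  from P ee(1) obtain a where a: "a \<in> Arcs S" "mA e (UnitArc True) = mA u a"
  proof (cases rule: full_arc_cases)
    case (half k)
    then have "k \<in> mH u ` Halves S" using bij_betw_imp_surj_on[OF bH] by simp
    then obtain h where "h \<in> Halves S" "k = mH u h" by blast
    then show ?thesis using that[of "gs S h"] half by (simp add: etale_gs[OF u])
  next
    case (port k)
    then have "k \<in> mH u ` Halves S" using bij_betw_imp_surj_on[OF bH] by simp
    then obtain h where "h \<in> Halves S" "k = mH u h" by blast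
    then show ?thesis using that[of "gi S (gs S h)"] port by (simp add: etale_arc_tail[OF u])
  qed
  have "gcomp unit_graph u (uat S a) = uat P (mA u a)" by (rule gcomp_uat[OF u a(1)]) simp_all
  also have "\<dots> = e" unfolding a(2)[symmetric] by (rule ee(2)[symmetric])
  finally show ?thesis using that[of "uat S a"] a(1) 1 by simp
next
  case (2 n)
  then have e: "etale (corolla n) P e" using e by simp
  have "mV e () \<in> mV u ` Verts S" using bij_betw_imp_surj_on[OF bV] etale_mV[OF e, of "()"] by simp
  then obtain x where x: "x \<in> Verts S" "mV e () = mV u x" by blast
  note st = etale_star[OF u x(1)]
  let ?\<sigma> = "inv_into (flags_at S x) (mH u) \<circ> mH e"
  have b: "bij_betw ?\<sigma> n (flags_at S x)"
    using bij_betw_trans[OF cor_bij[OF e] bij_betw_inv_into[OF st, folded x(2)]] .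
  let ?e = "hv_mor (corolla n) S ?\<sigma> (\<lambda>_. x)"
  have e': "etale (corolla n) S ?e" by (rule cor_etale[OF 2(2) jkc(1) x(1) b])
  have "gcomp (corolla n) u ?e = e"
  proof (rule cor_eqI[OF 2(2) _ e])
    show "etale (corolla n) P (gcomp (corolla n) u ?e)" using 2 by (intro etale_gcomp[OF _ e' u]) simp
    fix k assume k: "k \<in> n"
    then have "mH e k \<in> flags_at P (mV u x)" using cor_flag[OF e k] x by simp
    then have "mH u (inv_into (flags_at S x) (mH u) (mH e k)) = mH e k"
      by (rule bij_betw_inv_into_right[OF st])
    then show "mH (gcomp (corolla n) u ?e) k = mH e k" using k by simp
  qed (use x in simp)
  then show ?thesis using that e' 2 by simp
qed

lemma epi:
  fixes F :: "('u,'x) species"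
  assumes "w \<in> nt_hom (yon P) F" "w' \<in> nt_hom (yon P) F" "nt_comp (yon S) w (yon_map S u) = nt_comp (yon S) w' (yon_map S u)"
  shows "w = w'"
proof (rule nt_eqI[OF assms(1,2)])
  fix X :: "'u elobj" and c assume X: "X \<in> elObs" and "c \<in> val (yon P) X"
  then obtain e where e: "etale (el_graph X) S e" "gcomp (el_graph X) u e = c" using lift[OF X, of c] by auto
  show "w X c = w' X c"
    using fun_cong[OF fun_cong[OF assms(3), of X], of e] X e by simp
qed

text \<open>Lifts of corolla maps are unique and only arcs can have several, so compatibility is a
  condition at the unit graph alone.\<close>

lemma descent:
  fixes F :: "('u,'x) species"
  assumes \<alpha>: "\<alpha> \<in> nt_hom (yon S) F"
    and compat: "\<And>a a'. a \<in> Arcs S \<Longrightarrow> a' \<in> Arcs S \<Longrightarrow> mA u a = mA u a' \<Longrightarrow> \<alpha> Unit (uat S a) = \<alpha> Unit (uat S a')"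
  obtains w where "w \<in> nt_hom (yon P) F" "nt_comp (yon S) w (yon_map S u) = \<alpha>"
proof -
  have wd: "\<alpha> X e = \<alpha> X e'" if X: "X \<in> elObs" and e: "etale (el_graph X) S e" "etale (el_graph X) S e'"
    and eq: "gcomp (el_graph X) u e = gcomp (el_graph X) u e'" for X :: "'u elobj" and e e'
    using X
  proof (cases rule: elObs_cases)
    case 1
    then have e: "etale unit_graph S e" "etale unit_graph S e'" using e by simp_all
    note a = etale_unitD[OF jkc(1) e(1)] and b = etale_unitD[OF jkc(1) e(2)]
    have "mA u (mA e (UnitArc True)) = mA u (mA e' (UnitArc True))"
      using arg_cong[OF eq, of "\<lambda>m. mA m (UnitArc True)"] 1 by simp
    from compat[OF a(1) b(1) this] show ?thesis unfolding 1 a(2)[symmetric] b(2)[symmetric] .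
  next
    case (2 n)
    then have e: "etale (corolla n) S e" "etale (corolla n) S e'" using e by simp_all
    have h: "mH u (mH e k) = mH u (mH e' k)" if "k \<in> n" for k
      using arg_cong[OF eq, of "\<lambda>m. mH m k"] 2 that by simp
    have v: "mV u (mV e ()) = mV u (mV e' ())"
      using arg_cong[OF eq, of "\<lambda>m. mV m ()"] 2 by simp
    have "e = e'"
    proof (rule cor_eqI[OF 2(2) e])
      show "mH e k = mH e' k" if "k \<in> n" for k
        using h[OF that] H_eq[of "mH e k" "mH e' k"] etale_mH[OF e(1)] etale_mH[OF e(2)] that by simp
      show "mV e () = mV e' ()" using v V_eq[of "mV e ()" "mV e' ()"] etale_mV[OF e(1)] etale_mV[OF e(2)] by simp
    qed
    then show ?thesis by simp
  qed
  define L where "L X e = (SOME e'. etale (el_graph X) S e' \<and> gcomp (el_graph X) u e' = e)"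
    for X :: "'u elobj" and e
  have L: "etale (el_graph X) S (L X e)" "gcomp (el_graph X) u (L X e) = e"
    if X: "X \<in> elObs" and e: "etale (el_graph X) P e" for X e
  proof -
    have "\<exists>e'. etale (el_graph X) S e' \<and> gcomp (el_graph X) u e' = e" using lift[OF X e] by blast
    from someI_ex[OF this] show "etale (el_graph X) S (L X e)" "gcomp (el_graph X) u (L X e) = e"
      unfolding L_def by auto
  qed
  define w where "w = (\<lambda>X\<in>elObs. \<lambda>e\<in>val (yon P) X. \<alpha> X (L X e))"
  have wn: "w \<in> nt_hom (yon P) F"
  proof (rule nt_homI)
    show "w \<in> extensional elObs" "\<And>X. X \<in> elObs \<Longrightarrow> w X \<in> extensional (val (yon P) X)" by (auto simp: w_def)
    show "w X c \<in> val F X" if "X \<in> elObs" "c \<in> val (yon P) X" for X c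
      using that L nt_in[OF \<alpha>, of X "L X c"] by (simp add: w_def)
    fix X V :: "'u elobj" and f c
    assume a: "X \<in> elObs" "V \<in> elObs" "f \<in> el_hom X V" "c \<in> val (yon P) V"
    have f: "etale (el_graph X) (el_graph V) f" using a by (simp add: el_hom_def)
    have ce: "etale (el_graph X) P (gcomp (el_graph X) c f)" using a by (intro etale_gcomp[OF _ f]) auto
    have c: "etale (el_graph V) P c" using a by simp
    have le: "etale (el_graph X) S (gcomp (el_graph X) (L V c) f)"
      using a L(1)[OF a(2) c] by (intro etale_gcomp[OF _ f]) auto
    have "\<alpha> X (L X (gcomp (el_graph X) c f)) = \<alpha> X (gcomp (el_graph X) (L V c) f)"
    proof (rule wd[OF a(1) L(1)[OF a(1) ce] le])
      show "gcomp (el_graph X) u (L X (gcomp (el_graph X) c f)) = gcomp (el_graph X) u (gcomp (el_graph X) (L V c) f)"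
        unfolding L(2)[OF a(1) ce] gcomp_assoc[OF f, symmetric] L(2)[OF a(2) c] ..
    qed
    then show "w X (res (yon P) X V f c) = res F X V f (w V c)"
      using a c ce nt_nat[OF \<alpha> a(1-3), of "L V c"] L(1)[OF a(2) c] by (simp add: w_def)
  qed
  moreover have "nt_comp (yon S) w (yon_map S u) = \<alpha>"
  proof (rule nt_eqI[OF nt_comp_nt[OF _ yon_map_nt[OF u] wn] \<alpha>])
    fix X :: "'u elobj" and c assume X: "X \<in> elObs" and "c \<in> val (yon S) X"
    then have c: "etale (el_graph X) S c" by simp
    have uc: "etale (el_graph X) P (gcomp (el_graph X) u c)" by (rule etale_gcomp[OF jk_el_graph[OF X] c u])
    show "nt_comp (yon S) w (yon_map S u) X c = \<alpha> X c"
      using X c uc wd[OF X L(1)[OF X uc] c L(2)[OF X uc]] by (simp add: w_def)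
  qed simp_all
  ultimately show ?thesis using that by blast
qed

end

section \<open>Pushouts\<close>

text \<open>\<open>edge\<close> says that the edges of \<open>P\<close> which are new over
  \<open>S\<close> come from edges of \<open>S'\<close> through \<open>R\<close>. It makes any
  cocone \<open>u'\<close>, \<open>v'\<close> compatible along these edges, so \<open>u'\<close>
  descends along the reduced cover \<open>u\<close>. That the descended map restricts to
  \<open>v'\<close> is tested after precomposition with \<open>f\<close>, since reduced covers are
  epimorphisms; the same property of \<open>u\<close> gives uniqueness.\<close>

lemma pushoutI:
  fixes R S S' P :: "'u::infinite gr"
  assumes full: "full R" "full S" "full S'" "full P"
    and b: "refines R S b r k" and f: "reduced_cover R S' f"
    and u: "reduced_cover S P u" and v: "v \<in> nt_hom (yon S') (bar (yon P))"
    and comm: "nt_comp (yon R) v (yon_map R f) = Comp GrT R S P (kl_of_etale S P u) b"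
    and edge: "\<And>h. h \<in> Halves S \<Longrightarrow> hinv P (mH u h) \<noteq> mH u h \<Longrightarrow> hinv S h = h \<Longrightarrow>
      \<exists>f1\<in>Halves R. \<exists>f2\<in>Halves R. h = k f1 \<and> hinv P (mH u h) = mH u (k f2) \<and>
        hinv S' (mH f f1) = mH f f2 \<and> mH f f1 \<noteq> mH f f2"
  shows "is_pushout GrT R S S' b (kl_of_etale R S' f) P (kl_of_etale S P u) v"
proof -
  interpret f: cover R S' f using full f by unfold_locales
  interpret u: cover S P u using full u by unfold_locales
  interpret b: refinement R S r k using full b by unfold_locales (auto simp: refines_def)
  note J = b.jk f.jkc(2) u.jkc(2)
  have bn: "b \<in> nt_hom (yon R) (bar (yon S))" using b by (simp add: refines_def)
  have fn: "kl_of_etale R S' f \<in> nt_hom (yon R) (bar (yon S'))" using kl_nt[OF J(1,3) f.u] .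
  have un: "kl_of_etale S P u \<in> nt_hom (yon S) (bar (yon P))" using kl_nt[OF J(2,4) u.u] .
  have wu: "Comp GrT S P Z w (kl_of_etale S P u) = nt_comp (yon S) w (yon_map S u)"
    if "full Z" "w \<in> nt_hom (yon P) (bar (yon Z))" for Z w
    using Comp_kl[OF J(2,4) _ u.u that(2)] that(1) by simp
  show ?thesis
    unfolding is_pushout_def
  proof (intro conjI ballI impI)
    show "R \<in> Ob GrT" "S \<in> Ob GrT" "S' \<in> Ob GrT" "P \<in> Ob GrT" using full by simp_all
    show "b \<in> Hom GrT R S" "kl_of_etale R S' f \<in> Hom GrT R S'" "kl_of_etale S P u \<in> Hom GrT S P"
      "v \<in> Hom GrT S' P" using bn fn un v by simp_all
    show "Comp GrT R S P (kl_of_etale S P u) b = Comp GrT R S' P v (kl_of_etale R S' f)"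
      unfolding Comp_kl[OF J(1,3,4) f.u v] comm ..
    fix Z :: "'u gr" and u' v'
    assume "Z \<in> Ob GrT" and "u' \<in> Hom GrT S Z" and "v' \<in> Hom GrT S' Z"
      and "Comp GrT R S Z u' b = Comp GrT R S' Z v' (kl_of_etale R S' f)"
    then have Z: "full Z" and u': "u' \<in> nt_hom (yon S) (bar (yon Z))" and v': "v' \<in> nt_hom (yon S') (bar (yon Z))"
      and eq: "Comp GrT R S Z u' b = nt_comp (yon R) v' (yon_map R f)"
      using Comp_kl[OF J(1,3) _ f.u, of Z v'] by auto
    have JZ: "jk_graph Z" using Z by simp
    \<comment> \<open>The cocone condition on arcs of \<open>R\<close>: colours under
      \<open>u'\<close> at the image of \<open>k\<close> are colours under \<open>v'\<close> in
      \<open>S'\<close>.\<close>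
    have col: "u' Unit (uat S (gs S (k h))) = v' Unit (uat S' (gs S' (mH f h)))" if h: "h \<in> Halves R" for h
    proof -
      have "Comp GrT R S Z u' b Unit (uat R (gs R h)) = u' Unit (uat S (gs S (k h)))"
        unfolding Comp_GrT using h J b.kD(1)[OF h]
        by (simp add: refines_arc[OF full(1,2) b h] kext_Unit[OF J(2) JZ u'])
      moreover have "nt_comp (yon R) v' (yon_map R f) Unit (uat R (gs R h)) = v' Unit (uat S' (gs S' (mH f h)))"
        using h J by (simp add: gcomp_uat[OF f.u] etale_gs[OF f.u])
      ultimately show ?thesis using eq by simp
    qed
    \<comment> \<open>Naturality along the nontrivial automorphism of the unit graph.\<close>
    have flip: "\<alpha> Unit (uat Y (gi Y a)) = bar_res (yon Z) Unit Unit (uat unit_graph (UnitArc False)) (\<alpha> Unit (uat Y a))"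
      if "\<alpha> \<in> nt_hom (yon Y) (bar (yon Z))" "jk_graph Y" "a \<in> Arcs Y" for \<alpha> :: "'u kl" and Y :: "'u gr" and a
      using nt_nat[OF that(1), of Unit Unit "uat unit_graph (UnitArc False)" "uat Y a"] that
      by (simp add: el_hom_def gcomp_uat[OF etale_uat[OF that(2,3)]])
    \<comment> \<open>Here \<open>u\<close> joins \<open>h'\<close> to \<open>h\<close>. Through
      \<open>edge\<close> both come from half-edges of \<open>R\<close> whose images form an edge of
      \<open>S'\<close>, where \<open>v'\<close> is already compatible.\<close>
    have compat0: "u' Unit (uat S (gs S h)) = u' Unit (uat S (gi S (gs S h')))"
      if h: "h \<in> Halves S" "h' \<in> Halves S" "hinv S h' = h'" and eqa: "gs P (mH u h) = gi P (gs P (mH u h'))" for h h'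
    proof -
      have hi: "hinv P (mH u h') = mH u h"
        using hinv_eqI[OF J(4), of "mH u h'" "mH u h"] h u.u eqa by simp
      have ne: "mH u h \<noteq> mH u h'" 
      proof
        assume "mH u h = mH u h'"
        then show False using eqa jk_gi_neq[OF J(4) jk_gs[OF J(4) etale_mH[OF u.u h(2)]]] by simp
      qed
      obtain f1 f2 where ff: "f1 \<in> Halves R" "f2 \<in> Halves R" "h' = k f1" "hinv P (mH u h') = mH u (k f2)"
        "hinv S' (mH f f1) = mH f f2" "mH f f1 \<noteq> mH f f2"
        using edge[OF h(2) _ h(3)] hi ne by auto
      then have hk: "h = k f2" using hi u.H_eq[OF h(1) b.kD(1)[OF ff(2)]] by metis
      have fH: "mH f f1 \<in> Halves S'" "mH f f2 \<in> Halves S'" using ff f.u by simp_all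
      have "gi S' (gs S' (mH f f1)) = gs S' (mH f f2)" using gi_gs[OF J(3) fH(1)] ff by simp
      then have "v' Unit (uat S' (gs S' (mH f f2))) =
          bar_res (yon Z) Unit Unit (uat unit_graph (UnitArc False)) (v' Unit (uat S' (gs S' (mH f f1))))"
        using flip[OF v' J(3), of "gs S' (mH f f1)"] fH J by simp
      then show ?thesis using flip[OF u' J(2), of "gs S h'"] h J
        by (simp add: hk ff(3) col[OF ff(1)] col[OF ff(2)])
    qed
    obtain w where w: "w \<in> nt_hom (yon P) (bar (yon Z))" "nt_comp (yon S) w (yon_map S u) = u'"
    proof (rule u.descent[OF u'])
      fix a a' assume a: "a \<in> Arcs S" and a': "a' \<in> Arcs S" and eqa: "mA u a = mA u a'"
      from full(2) a show "u' Unit (uat S a) = u' Unit (uat S a')"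
      proof (cases rule: full_arc_cases)
        case h: (half h)
        from full(2) a' show ?thesis
        proof (cases rule: full_arc_cases)
          case (half h')
          then show ?thesis using h eqa u.H_eq J u.u by (simp add: etale_gs[OF u.u])
        next
          case (port h')
          then show ?thesis using h eqa J compat0[of h h'] by (simp add: etale_gs[OF u.u] etale_arc_tail[OF u.u])
        qed
      next
        case h: (port h)
        from full(2) a' show ?thesis
        proof (cases rule: full_arc_cases)
          case (half h')
          then show ?thesis using h eqa J compat0[of h' h] by (simp add: etale_gs[OF u.u] etale_arc_tail[OF u.u])
        next
          case (port h')
          then show ?thesis using h eqa u.H_eq J u.u by (simp add: etale_arc_tail[OF u.u])
        qed
      qed
    qed
    have wv: "Comp GrT S' P Z w v = v'"
    proof (rule f.epi[OF Comp_nt[OF J(3,4) JZ v w(1)] v'])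
      have "nt_comp (yon R) (Comp GrT S' P Z w v) (yon_map R f) =
          nt_comp (yon R) (kext P Z w) (nt_comp (yon R) v (yon_map R f))"
        unfolding Comp_GrT by (rule nt_comp_assoc[OF yon_map_nt[OF f.u J(1)]])
      also have "\<dots> = Comp GrT R P Z w (Comp GrT R S P (kl_of_etale S P u) b)"
        unfolding comm by (simp add: Comp_GrT)
      also have "\<dots> = Comp GrT R S Z u' b"
        unfolding Comp_kl_assoc1[OF J(1,2,4) JZ u.u bn w(1)] w(2) ..
      finally show "nt_comp (yon R) (Comp GrT S' P Z w v) (yon_map R f) = nt_comp (yon R) v' (yon_map R f)"
        using eq by simp
    qed
    show "\<exists>!w. w \<in> Hom GrT P Z \<and> Comp GrT S P Z w (kl_of_etale S P u) = u' \<and> Comp GrT S' P Z w v = v'"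
    proof (rule ex1I[of _ w])
      show "w \<in> Hom GrT P Z \<and> Comp GrT S P Z w (kl_of_etale S P u) = u' \<and> Comp GrT S' P Z w v = v'"
        using w wv wu[OF Z w(1)] by simp
      fix w2 assume "w2 \<in> Hom GrT P Z \<and> Comp GrT S P Z w2 (kl_of_etale S P u) = u' \<and> Comp GrT S' P Z w2 v = v'"
      then have w2: "w2 \<in> nt_hom (yon P) (bar (yon Z))" "nt_comp (yon S) w2 (yon_map S u) = u'"
        using wu[OF Z, of w2] by simp_all
      show "w2 = w" by (rule u.epi[OF w2(1) w(1)]) (simp add: w2 w)
    qed
  qed
qed

lemma pushout_ex:
  fixes R S S' :: "'u::infinite gr"
  assumes full: "full R" "full S" "full S'"
    and b: "refines R S b r k" and f: "reduced_cover R S' f"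
  obtains P u v rv kv where "full P" "reduced_cover S P u" "refines S' P v rv kv"
    "nt_comp (yon R) v (yon_map R f) = Comp GrT R S P (kl_of_etale S P u) b"
    "\<And>h. h \<in> Halves S \<Longrightarrow> hinv P (mH u h) \<noteq> mH u h \<Longrightarrow> hinv S h = h \<Longrightarrow>
      \<exists>f1\<in>Halves R. \<exists>f2\<in>Halves R. h = k f1 \<and> hinv P (mH u h) = mH u (k f2) \<and>
        hinv S' (mH f f1) = mH f f2 \<and> mH f f1 \<noteq> mH f f2"
    "\<And>y. y \<in> Verts S \<Longrightarrow> rv (mV u y) = mV f (r y)"
    "\<And>h. h \<in> Halves R \<Longrightarrow> kv (mH f h) = mH u (k h)"
    "\<And>h. h \<in> Halves S \<Longrightarrow> h \<notin> k ` Halves R \<Longrightarrow> hinv P (mH u h) = mH u (hinv S h)"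
proof -
  interpret f: cover R S' f using full f by unfold_locales
  interpret b: refinement R S r k using full b by unfold_locales (auto simp: refines_def)
  note J = b.jk f.jkc(2)
  let ?fi = "inv_into (Halves R) (mH f)" and ?ki = "inv_into (Halves R) k"
  have fi: "?fi (mH f h) = h" if "h \<in> Halves R" for h using bij_betw_inv_into_left[OF f.bH that] .
  have fi': "mH f (?fi h) = h" "?fi h \<in> Halves R" if "h \<in> Halves S'" for h
    using bij_betw_inv_into_right[OF f.bH that] bij_betw_apply[OF bij_betw_inv_into[OF f.bH] that] .
  have inj: "inj_on k (Halves R)" using b.kD(4) by (auto simp: inj_on_def)
  have ki: "?ki (k h) = h" if "h \<in> Halves R" for h using inv_into_f_f[OF inj that] .
  have fH: "mH f h \<in> Halves S'" if "h \<in> Halves R" for h using f.u that by simp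
  \<comment> \<open>On the image of \<open>k\<close> the involution is that of \<open>S'\<close>,
    carried over through \<open>R\<close>, whose half-edges \<open>f\<close> identifies with those
    of \<open>S'\<close>; elsewhere it is that of \<open>S\<close>.\<close>
  define P0 where "P0 = \<lparr>bV = Verts S, bF = Halves S, bd = gp S,
    bj = (\<lambda>h\<in>Halves S. if h \<in> k ` Halves R then k (?fi (hinv S' (mH f (?ki h)))) else hinv S h)\<rparr>"
  have bjk: "bj P0 (k h) = k (?fi (hinv S' (mH f h)))" if "h \<in> Halves R" for h
    using that b.kD(1)[OF that] by (simp add: P0_def ki)
  have bjn: "bj P0 h = hinv S h" if "h \<in> Halves S" "h \<notin> k ` Halves R" for h
    using that by (simp add: P0_def)
  have P0: "bm_graph P0"
    unfolding bm_graph_def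
  proof (intro conjI ballI)
    show "finite (bV P0)" "finite (bF P0)" using jk_finite[OF J(2)] by (simp_all add: P0_def)
    show "bd P0 \<in> bF P0 \<rightarrow>\<^sub>E bV P0" 
    proof -
      have "gp S \<in> Halves S \<rightarrow>\<^sub>E Verts S" using J(2) unfolding jk_graph_def by blast
      then show ?thesis by (simp add: P0_def)
    qed
    have bF: "bF P0 = Halves S" by (simp add: P0_def)
    have bjb: "bj P0 h \<in> Halves S \<and> bj P0 (bj P0 h) = h" if "h \<in> Halves S" for h
    proof (cases "h \<in> k ` Halves R")
      case True
      then obtain g where g: "g \<in> Halves R" "h = k g" by auto
      have g': "?fi (hinv S' (mH f g)) \<in> Halves R" using fi'(2)[of "hinv S' (mH f g)"] fH[OF g(1)] J by simp
      show ?thesis unfolding g(2) bjk[OF g(1)] bjk[OF g'] using g g' fH[OF g(1)] fi fi' b.kD(1) J by simp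
    next
      case False
      then show ?thesis using that bjn b.inner(3)[OF that False] J by simp
    qed
    then show "bj P0 (bj P0 h) = h" if "h \<in> bF P0" for h using that unfolding bF by blast
    show "bj P0 \<in> bF P0 \<rightarrow>\<^sub>E bF P0" unfolding bF
    proof (rule PiE_I)
      show "bj P0 h = undefined" if "h \<notin> Halves S" for h using that by (simp add: P0_def)
    qed (use bjb in blast)
  qed
  define P where "P = jkof P0"
  have P: "full P" unfolding P_def by (rule full_jkof[OF P0])
  have JP: "jk_graph P" using P by simp
  have Ps: "Halves P = Halves S" "Verts P = Verts S" "gp P = gp S" by (simp_all add: P_def) (simp_all add: P0_def)
  have hPk: "hinv P (k h) = k (?fi (hinv S' (mH f h)))" if "h \<in> Halves R" for h
    unfolding P_def hinv_jkof[OF P0] by (rule bjk[OF that])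
  have hPn: "hinv P h = hinv S h" if "h \<in> Halves S" "h \<notin> k ` Halves R" for h
    unfolding P_def hinv_jkof[OF P0] by (rule bjn[OF that])
  define u where "u = hv_mor S P (\<lambda>h. h) (\<lambda>y. y)"
  have uH: "mH u h = h" if "h \<in> Halves S" for h using that by (simp add: u_def)
  have uV: "mV u y = y" if "y \<in> Verts S" for y using that by (simp add: u_def)
  have u: "etale S P u" unfolding u_def
  proof (rule hv_etale[OF full(2) JP])
    show "(\<lambda>h. h) ` Halves S \<subseteq> Halves P" "(\<lambda>y. y) ` Verts S \<subseteq> Verts P" by (simp_all add: Ps)
    show "gp P h = gp S h" for h by (simp add: Ps)
    show "bij_betw (\<lambda>h. h) (flags_at S x) (flags_at P x)" for x by (simp add: flags_at_def Ps bij_betw_def)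
    fix h assume h: "h \<in> Halves S" "hinv S h \<noteq> h"
    \<comment> \<open>No edge of \<open>S\<close> is lost: one through \<open>k g\<close> comes from
      an edge of \<open>R\<close>, and the etale map \<open>f\<close> carries that to an edge of
      \<open>S'\<close>.\<close>
    have "hinv P h = hinv S h"
    proof (cases "h \<in> k ` Halves R")
      case True
      then obtain g where g: "g \<in> Halves R" "h = k g" by auto
      then have "hinv R g \<noteq> g" using h b.kD by auto
      then have "hinv S' (mH f g) = mH f (hinv R g)" using etale_hinv(1)[OF f.u J(1,3) g(1)] by simp
      then show ?thesis using hPk[OF g(1)] g J fi b.kD(3) by simp
    next
      case False
      then show ?thesis using hPn h by simp
    qed
    then show "gi P (gs P h) = gs P (hinv S h)" using gi_gs[OF JP, of h] h by (simp add: Ps)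
  qed
  have ur: "reduced_cover S P u"
    unfolding reduced_cover_def
  proof (intro conjI u)
    show "bij_betw (mV u) (Verts S) (Verts P)"
      using uV by (subst bij_betw_cong[where g = "\<lambda>y. y"]) (simp_all add: Ps bij_betw_def)
  qed
  define rv where "rv y = mV f (r y)" for y
  define kv where "kv h = k (?fi h)" for h
  have kvf: "kv (mH f h) = k h" if "h \<in> Halves R" for h using that fi by (simp add: kv_def)
  have kvi: "kv ` Halves S' = k ` Halves R"
  proof -
    have "?fi ` Halves S' = Halves R" using bij_betw_imp_surj_on[OF bij_betw_inv_into[OF f.bH]] .
    then have "k ` ?fi ` Halves S' = k ` Halves R" by simp
    then show ?thesis by (simp add: kv_def image_image)
  qed
  have rfv: "refn S' P rv kv"
    unfolding refn_def kvi
  proof (intro conjI ballI)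
    show "k ` Halves R \<subseteq> Halves P" using b.kD(1) by (auto simp: Ps)
    show "inj_on kv (Halves S')"
    proof (rule inj_onI)
      fix h h' assume h: "h \<in> Halves S'" "h' \<in> Halves S'" "kv h = kv h'"
      then have "?fi h = ?fi h'" using b.kD(4)[OF fi'(2)[OF h(1)] fi'(2)[OF h(2)]] by (simp add: kv_def)
      then have "mH f (?fi h) = mH f (?fi h')" by (rule arg_cong)
      then show "h = h'" unfolding fi'(1)[OF h(1)] fi'(1)[OF h(2)] .
    qed
    show "rv ` Verts P = Verts S'"
    proof -
      have "mV f ` r ` Verts S = Verts S'" unfolding b.r_surj by (rule bij_betw_imp_surj_on[OF f.bV])
      then show ?thesis by (simp add: rv_def Ps image_image)
    qed
    fix h assume "h \<in> Halves S'"
    then obtain g where g: "g \<in> Halves R" "h = mH f g" using fi' by metis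
    show "rv (gp P (kv h)) = gp S' h"
      unfolding g(2) kvf[OF g(1)] using b.kD(2)[OF g(1)] etale_gp[OF f.u g(1)] by (simp add: rv_def Ps)
    show "hinv P (kv h) = kv (hinv S' h)"
      unfolding g(2) kvf[OF g(1)] hPk[OF g(1)] by (simp add: kv_def)
  next
    fix h assume h: "h \<in> Halves P - k ` Halves R"
    then have h': "h \<in> Halves S" "h \<notin> k ` Halves R" by (simp_all add: Ps)
    show "hinv P h \<noteq> h" "rv (gp P (hinv P h)) = rv (gp P h)"
      using b.inner[OF h'] hPn[OF h'] by (simp_all add: Ps rv_def)
  qed
  interpret v: refinement S' P rv kv using full(3) P rfv by unfold_locales
  obtain v where v: "refines S' P v rv kv" using v.refines_ex by blast
  have vn: "v \<in> nt_hom (yon S') (bar (yon P))" and bn: "b \<in> nt_hom (yon R) (bar (yon S))"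
    using v b by (auto simp: refines_def)
  \<comment> \<open>\<open>S\<close> and \<open>P\<close> can differ only in the partners of
    half-edges in the image of \<open>k\<close>, and these are cut open in both. So the cuts are
    equal, not merely isomorphic, and serve as common representatives for commutativity of the
    square.\<close>
  have cutbm_eq: "cutbm S' P rv kv (mV f x) = cutbm R S r k x" if x: "x \<in> Verts R" for x
  proof -
    have e: "rv y = mV f x \<longleftrightarrow> r y = x" if "y \<in> Verts S" for y
      using f.V_eq[OF b.r_in[OF that] x] by (simp add: rv_def)
    have 1: "{y \<in> Verts P. rv y = mV f x} = {y \<in> Verts S. r y = x}" using e by (auto simp: Ps)
    have 2: "{h \<in> Halves P. rv (gp P h) = mV f x} = {h \<in> Halves S. r (gp S h) = x}"
      using e[OF jk_gp[OF J(2)]] by (auto simp: Ps)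
    show ?thesis unfolding cutbm_def 1 2 kvi using hPn by (auto simp: Ps(3) fun_eq_iff)
  qed
  have cut_eq: "cut S' P rv kv (mV f x) = cut R S r k x" if x: "x \<in> Verts R" for x
    unfolding cut_def cutbm_eq[OF x] ..
  have comm: "nt_comp (yon R) v (yon_map R f) = Comp GrT R S P (kl_of_etale S P u) b"
  proof (rule nt_eq_fullI[OF full(1) nt_comp_nt[OF _ yon_map_nt[OF f.u J(1)] vn]
        Comp_nt[OF J(1,2) JP bn kl_nt[OF J(2) JP u]]])
    show "sp_closed (yon R)" using J by simp
    fix x assume x: "x \<in> Verts R"
    let ?n = "flags_at R x" and ?m = "flags_at S' (mV f x)"
    have fin: "finite ?n" "finite ?m" using J by simp_all
    have st: "etale (corolla ?n) R (star R x)" using x J by simp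
    have fx: "mV f x \<in> Verts S'" using x f.u by simp
    have st': "etale (corolla ?m) S' (star S' (mV f x))" using fx J by simp
    note si = star_iso[OF J(1,3) f.u x]
    let ?c = "crel ?n ?m (mH f)"
    let ?C = "cut R S r k x"
    have L: "nt_comp (yon R) v (yon_map R f) (Cor ?n) (star R x) =
        bar_res (yon P) (Cor ?n) (Cor ?m) ?c (v (Cor ?m) (star S' (mV f x)))"
      using fin st nt_nat[OF vn _ _ si(1), of "star S' (mV f x)"] st' by (simp add: si(2))
    have Rt: "Comp GrT R S P (kl_of_etale S P u) b (Cor ?n) (star R x) =
        bar_map (yon S) (yon_map S u) (Cor ?n) (b (Cor ?n) (star R x))"
      unfolding kl_Comp[OF J(1,2) JP u bn] using fin st by simp
    have bc: "b (Cor ?n) (star R x) \<in> bar_val (yon S) (Cor ?n)" using star_cls[OF full(1) bn x] .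
    have vc: "v (Cor ?m) (star S' (mV f x)) \<in> bar_val (yon P) (Cor ?m)" using star_cls[OF full(3) vn fx] .
    have "cutd R S r k x \<in> cls (b (Cor ?n) (star R x))" using b x by (simp add: refines_def)
    then have "(?C, cutl R S r k x, nt_comp (yon ?C) (yon_map S u) (yon_map ?C (cute R S r k x))) \<in>
        cls (bar_map (yon S) (yon_map S u) (Cor ?n) (b (Cor ?n) (star R x)))"
      unfolding cutd_def by (rule bar_map_mem[OF fin(1) bc])
    moreover have "(nt_comp (yon ?C) (yon_map S u) (yon_map ?C (cute R S r k x)) :: ('u,_,_) nt) =
        yon_map ?C (gcomp ?C u (cute R S r k x))"
      using b.full_cut by (intro yon_map_gcomp[symmetric, OF b.cute u _ J(2)]) simp
    moreover have "gcomp ?C u (cute R S r k x) = cute S' P rv kv (mV f x)"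
    proof (rule etale_eq_fullI[OF b.full_cut])
      show "etale ?C P (gcomp ?C u (cute R S r k x))"
        using b.full_cut by (intro etale_gcomp[OF _ b.cute u]) simp
      show "etale ?C P (cute S' P rv kv (mV f x))" using v.cute[of "mV f x"] cut_eq[OF x] by simp
      show "mH (gcomp ?C u (cute R S r k x)) h = mH (cute S' P rv kv (mV f x)) h" if "h \<in> Halves ?C" for h
        using that uH by (simp add: rv_def Ps)
      show "mV (gcomp ?C u (cute R S r k x)) h = mV (cute S' P rv kv (mV f x)) h" if "h \<in> Verts ?C" for h
        using that uV by (simp add: rv_def Ps)
    qed
    ultimately have m1: "(?C, cutl R S r k x, yon_map ?C (cute S' P rv kv (mV f x))) \<in>
        cls (Comp GrT R S P (kl_of_etale S P u) b (Cor ?n) (star R x))"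
      unfolding Rt by simp
    have "cutd S' P rv kv (mV f x) \<in> cls (v (Cor ?m) (star S' (mV f x)))" using v fx by (simp add: refines_def)
    then have "(?C, compose ?n (cutl S' P rv kv (mV f x)) (mH ?c), yon_map ?C (cute S' P rv kv (mV f x))) \<in>
        cls (nt_comp (yon R) v (yon_map R f) (Cor ?n) (star R x))"
      unfolding L cutd_def cut_eq[OF x] by (rule bar_res_member)
    moreover have "compose ?n (cutl S' P rv kv (mV f x)) (mH ?c) = cutl R S r k x"
    proof
      fix i
      have "mH f i \<in> ?m" if "i \<in> ?n" using that bij_betw_apply[OF etale_star[OF f.u x]] by simp
      then show "compose ?n (cutl S' P rv kv (mV f x)) (mH ?c) i = cutl R S r k x i"
        using kvf[of i] by (auto simp: compose_def cutl_def lab_def cut_eq[OF x] flags_at_iff)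
    qed
    ultimately have m2: "(?C, cutl R S r k x, yon_map ?C (cute S' P rv kv (mV f x))) \<in>
        cls (nt_comp (yon R) v (yon_map R f) (Cor ?n) (star R x))" by simp
    have c1: "nt_comp (yon R) v (yon_map R f) (Cor ?n) (star R x) \<in> bar_val (yon P) (Cor ?n)"
      unfolding L by (rule bar_res_CC_in[OF vc si(1)])
    have c2: "Comp GrT R S P (kl_of_etale S P u) b (Cor ?n) (star R x) \<in> bar_val (yon P) (Cor ?n)"
      unfolding Rt using bar_map_in[OF yon_map_nt[OF u J(2)], of "Cor ?n"] fin bc by simp
    show "nt_comp (yon R) v (yon_map R f) (Cor ?n) (star R x) =
        Comp GrT R S P (kl_of_etale S P u) b (Cor ?n) (star R x)"
      by (rule barC_eqI[OF c1 c2 m2 m1])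
  qed
  show ?thesis
  proof (rule that[OF P ur v comm])
    fix h assume h: "h \<in> Halves S" "hinv P (mH u h) \<noteq> mH u h" "hinv S h = h"
    then have ne: "hinv P h \<noteq> h" by (simp add: uH)
    then have "h \<in> k ` Halves R" using hPn[OF h(1)] h(3) by metis
    then obtain g where g: "g \<in> Halves R" "h = k g" by auto
    let ?g = "?fi (hinv S' (mH f g))"
    have g': "?g \<in> Halves R" "mH f ?g = hinv S' (mH f g)"
      using fi'[of "hinv S' (mH f g)"] fH[OF g(1)] J by simp_all
    have hg: "hinv P h = k ?g" using hPk[OF g(1)] g by simp
    then have "?g \<noteq> g" using ne g by auto
    then have "mH f g \<noteq> mH f ?g" using f.H_eq g(1) g'(1) by auto
    then show "\<exists>f1\<in>Halves R. \<exists>f2\<in>Halves R. h = k f1 \<and> hinv P (mH u h) = mH u (k f2) \<and>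
        hinv S' (mH f f1) = mH f f2 \<and> mH f f1 \<noteq> mH f f2"
      using g g' hg h(1) b.kD(1)[OF g'(1)] by (intro bexI[of _ g] bexI[of _ ?g]) (simp_all add: uH)
  next
    show "rv (mV u y) = mV f (r y)" if "y \<in> Verts S" for y using that by (simp add: uV rv_def)
    show "kv (mH f h) = mH u (k h)" if "h \<in> Halves R" for h using that kvf b.kD(1) by (simp add: uH)
    show "hinv P (mH u h) = mH u (hinv S h)" if "h \<in> Halves S" "h \<notin> k ` Halves R" for h
      using that hPn J by (simp add: uH)
  qed
qed

section \<open>The Borisov--Manin category\<close>

lemma bm_edges_iff: "bm_graph \<tau> \<Longrightarrow> x \<in> \<Union> (bm_edges \<tau>) \<longleftrightarrow> x \<in> bF \<tau> \<and> bj \<tau> x \<noteq> x"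
proof
  assume t: "bm_graph \<tau>" and "x \<in> \<Union> (bm_edges \<tau>)"
  then obtain f where f: "f \<in> bF \<tau>" "bj \<tau> f \<noteq> f" "x = f \<or> x = bj \<tau> f" by (auto simp: bm_edges_def)
  then show "x \<in> bF \<tau> \<and> bj \<tau> x \<noteq> x" using bm_graphD(4,5)[OF t] by auto
qed (auto simp: bm_edges_def)

lemma bm_edge_pair:
  assumes "bm_graph \<tau>" "{x, y} \<in> bm_edges \<tau>" "x \<noteq> y" shows "bj \<tau> x = y"
proof -
  obtain f where "{x, y} = {f, bj \<tau> f}" "f \<in> bF \<tau>" using assms(2) by (auto simp: bm_edges_def)
  then show ?thesis using assms(3) bm_graphD(5)[OF assms(1)] by (auto simp: doubleton_eq_iff)
qed

definition bmD :: "'u bm_graph \<Rightarrow> 'u bm_graph \<Rightarrow> 'u bm_mor \<Rightarrow> 'u set" where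
  "bmD \<tau> \<sigma> h = bF \<tau> - hF h ` bF \<sigma>"

text \<open>The edge conditions, pointwise; invariance of the image and of its complement is implied.\<close>

lemma bm_hom_iff:
  assumes \<tau>: "bm_graph \<tau>" and \<sigma>: "bm_graph \<sigma>"
  shows "h \<in> bm_hom \<tau> \<sigma> \<longleftrightarrow>
     hF h \<in> bF \<sigma> \<rightarrow>\<^sub>E bF \<tau> \<and> hV h \<in> bV \<tau> \<rightarrow>\<^sub>E bV \<sigma> \<and> hj h \<in> bmD \<tau> \<sigma> h \<rightarrow>\<^sub>E bmD \<tau> \<sigma> h \<and>
     (\<forall>f\<in>bmD \<tau> \<sigma> h. hj h (hj h f) = f) \<and> inj_on (hF h) (bF \<sigma>) \<and> hV h ` bV \<tau> = bV \<sigma> \<and>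
     (\<forall>f\<in>bmD \<tau> \<sigma> h. hj h f \<noteq> f) \<and> (\<forall>f\<in>bmD \<tau> \<sigma> h. bj \<tau> f \<noteq> f \<longrightarrow> hj h f = bj \<tau> f) \<and>
     (\<forall>f\<in>bF \<sigma>. hV h (bd \<tau> (hF h f)) = bd \<sigma> f) \<and>
     (\<forall>f\<in>bmD \<tau> \<sigma> h. hV h (bd \<tau> f) = hV h (bd \<tau> (hj h f))) \<and>
     (\<forall>f\<in>bF \<sigma>. bj \<tau> (hF h f) \<noteq> hF h f \<longrightarrow> bj \<tau> (hF h f) = hF h (bj \<sigma> f))" (is "?L \<longleftrightarrow> ?R")
proof
  assume L: ?L
  note L' = L[unfolded bm_hom_def Let_def mem_Collect_eq bmD_def[symmetric]]
  \<comment> \<open>The edge condition on sets is applied to the edge through \<open>hF h f\<close>;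
    injectivity of \<open>hF h\<close> identifies its preimage as a pair.\<close>
  have "bj \<tau> (hF h f) = hF h (bj \<sigma> f)" if f: "f \<in> bF \<sigma>" and ne: "bj \<tau> (hF h f) \<noteq> hF h f" for f
  proof -
    have inj: "inj_on (hF h) (bF \<sigma>)" using L' by (elim conjE)
    have K: "bj \<tau> ` hF h ` bF \<sigma> \<subseteq> hF h ` bF \<sigma>" using L' by (elim conjE)
    have hF: "hF h \<in> bF \<sigma> \<rightarrow>\<^sub>E bF \<tau>" using L' by (elim conjE)
    have F: "hF h f \<in> bF \<tau>" using hF f by auto
    have "bj \<tau> (hF h f) \<in> hF h ` bF \<sigma>" using K f by blast
    then obtain g where g: "g \<in> bF \<sigma>" "bj \<tau> (hF h f) = hF h g" by blast
    have e: "{hF h f, hF h g} \<in> bm_edges \<tau>" unfolding bm_edges_def using F ne g(2)[symmetric] by auto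
    have E: "\<forall>e\<in>bm_edges \<tau>. e \<subseteq> hF h ` bF \<sigma> \<longrightarrow> inv_into (bF \<sigma>) (hF h) ` e \<in> bm_edges \<sigma>"
      using L' by (elim conjE)
    have "{hF h f, hF h g} \<subseteq> hF h ` bF \<sigma>" using f g(1) by simp
    with bspec[OF E e] have "inv_into (bF \<sigma>) (hF h) ` {hF h f, hF h g} \<in> bm_edges \<sigma>" by (rule mp)
    then have "{f, g} \<in> bm_edges \<sigma>"
      unfolding image_insert image_empty inv_into_f_f[OF inj f] inv_into_f_f[OF inj g(1)] .
    then have "bj \<sigma> f = g" using ne g(2) by (intro bm_edge_pair[OF \<sigma>]) auto
    then show ?thesis using g(2) by simp
  qed
  then have B: "\<forall>f\<in>bF \<sigma>. bj \<tau> (hF h f) \<noteq> hF h f \<longrightarrow> bj \<tau> (hF h f) = hF h (bj \<sigma> f)" by simp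
  have E: "\<forall>f\<in>bmD \<tau> \<sigma> h. f \<in> \<Union> (bm_edges \<tau>) \<longrightarrow> hj h f = bj \<tau> f" using L' by (elim conjE)
  have A: "\<forall>f\<in>bmD \<tau> \<sigma> h. bj \<tau> f \<noteq> f \<longrightarrow> hj h f = bj \<tau> f"
  proof (intro ballI impI)
    fix f assume f: "f \<in> bmD \<tau> \<sigma> h" "bj \<tau> f \<noteq> f"
    then have "f \<in> \<Union> (bm_edges \<tau>)" unfolding bm_edges_iff[OF \<tau>] by (simp add: bmD_def)
    with bspec[OF E f(1)] show "hj h f = bj \<tau> f" by (rule mp)
  qed
  show ?R using L' A B by (elim conjE, intro conjI) assumption+
next
  assume R: ?R
  have F: "hF h f \<in> bF \<tau>" if "f \<in> bF \<sigma>" for f using R that by auto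
  have e2: "bj \<tau> (hF h f) = hF h (bj \<sigma> f)" if "f \<in> bF \<sigma>" "bj \<tau> (hF h f) \<noteq> hF h f" for f using R that by blast
  have inj: "inj_on (hF h) (bF \<sigma>)" using R by blast
  have 1: "bj \<tau> ` hF h ` bF \<sigma> \<subseteq> hF h ` bF \<sigma>"
  proof clarify
    fix f assume f: "f \<in> bF \<sigma>"
    show "bj \<tau> (hF h f) \<in> hF h ` bF \<sigma>"
      using f e2[OF f] bm_graphD(4)[OF \<sigma> f] by (cases "bj \<tau> (hF h f) = hF h f") auto
  qed
  have 2: "bj \<tau> ` bmD \<tau> \<sigma> h \<subseteq> bmD \<tau> \<sigma> h"
  proof clarify
    fix f assume f: "f \<in> bmD \<tau> \<sigma> h"
    then have "hj h f \<in> bmD \<tau> \<sigma> h" "bj \<tau> f \<noteq> f \<Longrightarrow> hj h f = bj \<tau> f" using R by auto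
    then show "bj \<tau> f \<in> bmD \<tau> \<sigma> h" using f by (cases "bj \<tau> f = f") auto
  qed
  have 3: "inv_into (bF \<sigma>) (hF h) ` e \<in> bm_edges \<sigma>" if e: "e \<in> bm_edges \<tau>" "e \<subseteq> hF h ` bF \<sigma>" for e
  proof -
    obtain x where x: "e = {x, bj \<tau> x}" "bj \<tau> x \<noteq> x" using e(1) by (auto simp: bm_edges_def)
    then obtain f where f: "f \<in> bF \<sigma>" "x = hF h f" using e(2) by auto
    have b: "bj \<tau> x = hF h (bj \<sigma> f)" "bj \<sigma> f \<in> bF \<sigma>" using e2[OF f(1)] x(2) f bm_graphD(4)[OF \<sigma> f(1)] by auto
    have "e = {hF h f, hF h (bj \<sigma> f)}" unfolding x(1) b(1) unfolding f(2) ..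
    then have "inv_into (bF \<sigma>) (hF h) ` e = {f, bj \<sigma> f}" using inj f(1) b(2) by simp
    moreover have "bj \<sigma> f \<noteq> f" using x(2) b f by auto
    ultimately show ?thesis using f(1) by (auto simp: bm_edges_def)
  qed
  have A: "\<forall>f\<in>bmD \<tau> \<sigma> h. bj \<tau> f \<noteq> f \<longrightarrow> hj h f = bj \<tau> f" using R by (elim conjE)
  have 4: "\<forall>f\<in>bmD \<tau> \<sigma> h. f \<in> bF \<tau> \<and> bj \<tau> f \<noteq> f \<longrightarrow> hj h f = bj \<tau> f" using A by simp
  have 5: "\<forall>e\<in>bm_edges \<tau>. e \<subseteq> hF h ` bF \<sigma> \<longrightarrow> inv_into (bF \<sigma>) (hF h) ` e \<in> bm_edges \<sigma>"
    using 3 by (intro ballI impI)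
  show ?L unfolding bm_hom_def Let_def mem_Collect_eq bmD_def[symmetric]
    unfolding bm_edges_iff[OF \<tau>] using R 1 2 4 5 by (elim conjE, intro conjI) assumption+
qed

locale bm_mor =
  fixes \<tau> \<sigma> :: "'u bm_graph" and h :: "'u bm_mor"
  assumes \<tau>: "bm_graph \<tau>" and \<sigma>: "bm_graph \<sigma>" and h: "h \<in> bm_hom \<tau> \<sigma>"
begin

lemmas h' = h[unfolded bm_hom_iff[OF \<tau> \<sigma>]]

lemma F: "f \<in> bF \<sigma> \<Longrightarrow> hF h f \<in> bF \<tau>" using h' by auto
lemma F_ext: "hF h \<in> extensional (bF \<sigma>)" using h' by (auto simp: PiE_def)
lemma V_ext: "hV h \<in> extensional (bV \<tau>)" using h' by (auto simp: PiE_def)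
lemma j_ext: "hj h \<in> extensional (bmD \<tau> \<sigma> h)" using h' by (auto simp: PiE_def)
lemma V: "x \<in> bV \<tau> \<Longrightarrow> hV h x \<in> bV \<sigma>" using h' by auto
lemma V_surj: "hV h ` bV \<tau> = bV \<sigma>" using h' by auto
lemma F_inj: "inj_on (hF h) (bF \<sigma>)" using h' by auto
lemma F_eq: "f \<in> bF \<sigma> \<Longrightarrow> g \<in> bF \<sigma> \<Longrightarrow> hF h f = hF h g \<longleftrightarrow> f = g" using F_inj by (auto simp: inj_on_def)
lemma F_inv: "f \<in> bF \<sigma> \<Longrightarrow> inv_into (bF \<sigma>) (hF h) (hF h f) = f" using F_inj by simp
lemma F_D: "f \<in> bF \<sigma> \<Longrightarrow> hF h f \<notin> bmD \<tau> \<sigma> h" by (simp add: bmD_def)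
lemma D_F: "f \<in> bmD \<tau> \<sigma> h \<Longrightarrow> f \<in> bF \<tau>" by (simp add: bmD_def)
lemma j: "f \<in> bmD \<tau> \<sigma> h \<Longrightarrow> hj h f \<in> bmD \<tau> \<sigma> h" "f \<in> bmD \<tau> \<sigma> h \<Longrightarrow> hj h (hj h f) = f"
  "f \<in> bmD \<tau> \<sigma> h \<Longrightarrow> hj h f \<noteq> f" "f \<in> bmD \<tau> \<sigma> h \<Longrightarrow> bj \<tau> f \<noteq> f \<Longrightarrow> hj h f = bj \<tau> f"
  "f \<in> bmD \<tau> \<sigma> h \<Longrightarrow> hV h (bd \<tau> (hj h f)) = hV h (bd \<tau> f)"
  using h' by auto
lemma FV: "f \<in> bF \<sigma> \<Longrightarrow> hV h (bd \<tau> (hF h f)) = bd \<sigma> f" using h' by auto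
lemma Fj: "f \<in> bF \<sigma> \<Longrightarrow> bj \<tau> (hF h f) \<noteq> hF h f \<Longrightarrow> bj \<tau> (hF h f) = hF h (bj \<sigma> f)" using h' by blast
lemma cases:
  assumes "f \<in> bF \<tau>" obtains "f \<in> bmD \<tau> \<sigma> h" | g where "g \<in> bF \<sigma>" "f = hF h g"
  using assms by (auto simp: bmD_def)

end

lemma bm_mor_eqI:
  "hF g = hF h \<Longrightarrow> hV g = hV h \<Longrightarrow> hj g = hj h \<Longrightarrow> (g :: 'u bm_mor) = h"
  by (cases g, cases h) simp

locale bm_comp2 = g: bm_mor \<tau> \<sigma> g + c: bm_mor \<sigma> \<rho> c
  for \<tau> \<sigma> \<rho> :: "'u bm_graph" and g c :: "'u bm_mor"
begin

abbreviation "cg \<equiv> bm_comp \<tau> \<sigma> \<rho> c g"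

lemma comp_F [simp]: "f \<in> bF \<rho> \<Longrightarrow> hF cg f = hF g (hF c f)"
  by (simp add: bm_comp_def Let_def compose_def)
lemma comp_V [simp]: "x \<in> bV \<tau> \<Longrightarrow> hV cg x = hV c (hV g x)"
  by (simp add: bm_comp_def Let_def compose_def)
lemma comp_FK: "hF cg ` bF \<rho> = hF g ` hF c ` bF \<rho>"
  by (auto simp: image_image)
text \<open>Follows since \<open>hF\<close> of the composite is \<open>hF g\<close> after
  \<open>hF c\<close>. The two parts are disjoint, and they are the ones on which
  \<open>comp_j1\<close> and \<open>comp_j2\<close> compute \<open>hj\<close>.\<close>

lemma comp_D: "bmD \<tau> \<rho> cg = bmD \<tau> \<sigma> g \<union> hF g ` bmD \<sigma> \<rho> c"
proof (intro set_eqI iffI)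
  fix x assume "x \<in> bmD \<tau> \<rho> cg"
  then have x: "x \<in> bF \<tau>" "x \<notin> hF g ` hF c ` bF \<rho>" unfolding bmD_def comp_FK by auto
  from x(1) show "x \<in> bmD \<tau> \<sigma> g \<union> hF g ` bmD \<sigma> \<rho> c"
    by (cases rule: g.cases) (use x in \<open>auto simp: bmD_def\<close>)
next
  fix x assume "x \<in> bmD \<tau> \<sigma> g \<union> hF g ` bmD \<sigma> \<rho> c"
  then show "x \<in> bmD \<tau> \<rho> cg"
  proof
    assume "x \<in> bmD \<tau> \<sigma> g"
    then show ?thesis unfolding bmD_def comp_FK using c.F by auto
  next
    assume "x \<in> hF g ` bmD \<sigma> \<rho> c"
    then obtain y where y: "y \<in> bmD \<sigma> \<rho> c" "x = hF g y" by auto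
    have "hF g y \<notin> hF g ` hF c ` bF \<rho>"
    proof
      assume "hF g y \<in> hF g ` hF c ` bF \<rho>"
      then obtain z where "z \<in> bF \<rho>" "hF g y = hF g (hF c z)" by auto
      then have "y = hF c z" using g.F_eq[OF c.D_F[OF y(1)] c.F] by simp
      then show False using y \<open>z \<in> bF \<rho>\<close> c.F_D by auto
    qed
    then show ?thesis unfolding bmD_def comp_FK using y g.F c.D_F by auto
  qed
qed

lemma comp_j1: "f \<in> bmD \<tau> \<sigma> g \<Longrightarrow> hj cg f = hj g f"
proof -
  assume f: "f \<in> bmD \<tau> \<sigma> g"
  then have "f \<in> bF \<tau> - hF cg ` bF \<rho>" using comp_D unfolding bmD_def by blast
  moreover have "f \<notin> hF g ` bF \<sigma>" using f by (simp add: bmD_def)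
  ultimately show ?thesis by (simp add: bm_comp_def Let_def)
qed

lemma comp_j2: "f \<in> bmD \<sigma> \<rho> c \<Longrightarrow> hj cg (hF g f) = hF g (hj c f)"
proof -
  assume f: "f \<in> bmD \<sigma> \<rho> c"
  then have "hF g f \<in> bF \<tau> - hF cg ` bF \<rho>" using comp_D unfolding bmD_def by blast
  then show ?thesis using c.D_F[OF f] by (simp add: bm_comp_def Let_def g.F_inv)
qed

lemma comp_ext: "hF cg \<in> extensional (bF \<rho>)" "hV cg \<in> extensional (bV \<tau>)"
    "hj cg \<in> extensional (bmD \<tau> \<rho> cg)"
  by (auto simp: bm_comp_def Let_def bmD_def)

lemma comp_hom: "cg \<in> bm_hom \<tau> \<rho>"
  unfolding bm_hom_iff[OF g.\<tau> c.\<sigma>]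
proof (intro conjI)
  show "hF cg \<in> bF \<rho> \<rightarrow>\<^sub>E bF \<tau>" using comp_ext(1) c.F g.F by (auto simp: PiE_def)
  show "hV cg \<in> bV \<tau> \<rightarrow>\<^sub>E bV \<rho>" using comp_ext(2) c.V g.V by (auto simp: PiE_def)
  have jj: "hj cg f \<in> bmD \<tau> \<rho> cg \<and> hj cg (hj cg f) = f \<and> hj cg f \<noteq> f \<and> (bj \<tau> f \<noteq> f \<longrightarrow> hj cg f = bj \<tau> f) \<and>
      hV cg (bd \<tau> f) = hV cg (bd \<tau> (hj cg f))" if "f \<in> bmD \<tau> \<rho> cg" for f
  proof -
    from that have "f \<in> bmD \<tau> \<sigma> g \<or> f \<in> hF g ` bmD \<sigma> \<rho> c" unfolding comp_D by blast
    then show ?thesis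
    proof
      assume f: "f \<in> bmD \<tau> \<sigma> g"
      have "bd \<tau> f \<in> bV \<tau>" "bd \<tau> (hj g f) \<in> bV \<tau>"
        using g.D_F[OF f] g.D_F[OF g.j(1)[OF f]] bm_graphD(3)[OF g.\<tau>] by auto
      then show ?thesis using f g.j[OF f] by (simp add: comp_j1 comp_D)
    next
      assume "f \<in> hF g ` bmD \<sigma> \<rho> c"
      then obtain y where y: "y \<in> bmD \<sigma> \<rho> c" "f = hF g y" by auto
      note jy = c.j[OF y(1)]
      have yF: "y \<in> bF \<sigma>" "hj c y \<in> bF \<sigma>" using c.D_F y(1) jy(1) by auto
      have "hj cg f \<noteq> f" using jy(3) g.F_eq[OF yF(2,1)] y by (simp add: comp_j2)
      \<comment> \<open>An edge of \<open>\<tau>\<close> through \<open>hF g y\<close> comes from an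
        edge of \<open>\<sigma>\<close> through \<open>y\<close>, and on such an edge
        \<open>hj c\<close> agrees with \<open>bj \<sigma>\<close>.\<close>
      moreover have "hj cg f = bj \<tau> f" if ne: "bj \<tau> f \<noteq> f"
      proof -
        have "bj \<tau> f = hF g (bj \<sigma> y)" using g.Fj[OF yF(1)] ne y by simp
        moreover then have "bj \<sigma> y \<noteq> y" using ne y by auto
        ultimately show ?thesis using jy(4) y by (simp add: comp_j2)
      qed
      moreover have "hV cg (bd \<tau> f) = hV cg (bd \<tau> (hj cg f))"
        using jy(5) y g.FV[OF yF(1)] g.FV[OF yF(2)] bm_graphD(3)[OF g.\<tau> g.F[OF yF(1)]]
          bm_graphD(3)[OF g.\<tau> g.F[OF yF(2)]] by (simp add: comp_j2)
      ultimately show ?thesis using y jy by (auto simp: comp_j2 comp_D)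
    qed
  qed
  then show "hj cg \<in> bmD \<tau> \<rho> cg \<rightarrow>\<^sub>E bmD \<tau> \<rho> cg" using comp_ext(3) by (auto simp: PiE_def)
  show "\<forall>f\<in>bmD \<tau> \<rho> cg. hj cg (hj cg f) = f" "\<forall>f\<in>bmD \<tau> \<rho> cg. hj cg f \<noteq> f"
    "\<forall>f\<in>bmD \<tau> \<rho> cg. bj \<tau> f \<noteq> f \<longrightarrow> hj cg f = bj \<tau> f"
    "\<forall>f\<in>bmD \<tau> \<rho> cg. hV cg (bd \<tau> f) = hV cg (bd \<tau> (hj cg f))" using jj by blast+
  show "inj_on (hF cg) (bF \<rho>)" using c.F by (auto simp: inj_on_def g.F_eq c.F_eq)
  have "hV cg ` bV \<tau> = hV c ` hV g ` bV \<tau>" by (auto simp: image_image)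
  then show "hV cg ` bV \<tau> = bV \<rho>" unfolding g.V_surj c.V_surj .
  show "\<forall>f\<in>bF \<rho>. hV cg (bd \<tau> (hF cg f)) = bd \<rho> f"
    using c.F g.F g.FV c.FV bm_graphD(3)[OF g.\<tau>] by simp
  show "\<forall>f\<in>bF \<rho>. bj \<tau> (hF cg f) \<noteq> hF cg f \<longrightarrow> bj \<tau> (hF cg f) = hF cg (bj \<rho> f)"
  proof (intro ballI impI)
    fix f assume f: "f \<in> bF \<rho>" and ne: "bj \<tau> (hF cg f) \<noteq> hF cg f"
    then have 1: "bj \<tau> (hF g (hF c f)) = hF g (bj \<sigma> (hF c f))" using g.Fj[OF c.F[OF f]] by simp
    moreover then have "bj \<sigma> (hF c f) \<noteq> hF c f" using ne f by auto
    ultimately have "bj \<sigma> (hF c f) = hF c (bj \<rho> f)" using c.Fj[OF f] by simp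
    then show "bj \<tau> (hF cg f) = hF cg (bj \<rho> f)" using 1 f bm_graphD(4)[OF c.\<sigma> f] by simp
  qed
qed

end

lemma bm_id_simps [simp]: "f \<in> bF \<tau> \<Longrightarrow> hF (bm_id \<tau>) f = f" "x \<in> bV \<tau> \<Longrightarrow> hV (bm_id \<tau>) x = x"
  "bmD \<tau> \<tau> (bm_id \<tau>) = {}"
  by (auto simp: bm_id_def bmD_def)

lemma bm_id_hom: assumes \<tau>: "bm_graph \<tau>" shows "bm_id \<tau> \<in> bm_hom \<tau> \<tau>"
  unfolding bm_hom_iff[OF \<tau> \<tau>] using bm_graphD[OF \<tau>] by (auto simp: bm_id_def bmD_def inj_on_def)

lemma bm_hom_eqI:
  assumes "bm_graph \<tau>" "bm_graph \<sigma>" "g \<in> bm_hom \<tau> \<sigma>" "h \<in> bm_hom \<tau> \<sigma>"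
    and F: "\<And>f. f \<in> bF \<sigma> \<Longrightarrow> hF g f = hF h f" and "\<And>x. x \<in> bV \<tau> \<Longrightarrow> hV g x = hV h x"
    and "\<And>f. f \<in> bmD \<tau> \<sigma> g \<Longrightarrow> hj g f = hj h f"
  shows "g = h"
proof -
  interpret g: bm_mor \<tau> \<sigma> g using assms by unfold_locales
  interpret h: bm_mor \<tau> \<sigma> h using assms by unfold_locales
  have "hF g ` bF \<sigma> = hF h ` bF \<sigma>" using F by (intro image_cong) auto
  then have D: "bmD \<tau> \<sigma> h = bmD \<tau> \<sigma> g" by (simp add: bmD_def)
  show ?thesis
    by (intro bm_mor_eqI extensionalityI[OF g.F_ext h.F_ext] extensionalityI[OF g.V_ext h.V_ext]
      extensionalityI[OF g.j_ext h.j_ext[unfolded D]] assms)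
qed

lemma category_BM: "category BM"
  unfolding category_def
proof (intro conjI ballI)
  fix X :: "'u bm_graph" assume "X \<in> Ob BM"
  then show "Ide BM X \<in> Hom BM X X" by (simp add: BM_def bm_id_hom)
next
  fix X Y Z :: "'u bm_graph" and f g
  assume "X \<in> Ob BM" "Y \<in> Ob BM" "Z \<in> Ob BM" "f \<in> Hom BM X Y" "g \<in> Hom BM Y Z"
  then interpret bm_comp2 X Y Z f g by unfold_locales (simp_all add: BM_def)
  show "Comp BM X Y Z g f \<in> Hom BM X Z" using comp_hom by (simp add: BM_def)
next
  fix X Y :: "'u bm_graph" and f
  assume "X \<in> Ob BM" "Y \<in> Ob BM" "f \<in> Hom BM X Y"
  then have X: "bm_graph X" and Y: "bm_graph Y" and f: "f \<in> bm_hom X Y" by (simp_all add: BM_def)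
  interpret f: bm_mor X Y f using X Y f by unfold_locales
  interpret l: bm_comp2 X X Y "bm_id X" f using X Y f bm_id_hom by unfold_locales
  interpret r: bm_comp2 X Y Y f "bm_id Y" using X Y f bm_id_hom by unfold_locales
  have "bm_comp X X Y f (bm_id X) = f"
  proof (rule bm_hom_eqI[OF X Y l.comp_hom f])
    fix x assume "x \<in> bmD X Y (bm_comp X X Y f (bm_id X))"
    then have "x \<in> hF (bm_id X) ` bmD X Y f" unfolding l.comp_D by simp
    then have x: "x \<in> bmD X Y f" using f.D_F by auto
    then show "hj (bm_comp X X Y f (bm_id X)) x = hj f x"
      using l.comp_j2[OF x] f.D_F[OF x] f.D_F[OF f.j(1)[OF x]] by simp
  qed (use f.F in auto)
  then show "Comp BM X X Y f (Ide BM X) = f" by (simp add: BM_def)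
  have "bm_comp X Y Y (bm_id Y) f = f"
  proof (rule bm_hom_eqI[OF X Y r.comp_hom f])
    fix x assume "x \<in> bmD X Y (bm_comp X Y Y (bm_id Y) f)"
    then have x: "x \<in> bmD X Y f" unfolding r.comp_D by simp
    then show "hj (bm_comp X Y Y (bm_id Y) f) x = hj f x" using r.comp_j1[OF x] by simp
  qed (use f.V in auto)
  then show "Comp BM X Y Y (Ide BM Y) f = f" by (simp add: BM_def)
next
  fix W X Y Z :: "'u bm_graph" and f g h
  assume "W \<in> Ob BM" "X \<in> Ob BM" "Y \<in> Ob BM" "Z \<in> Ob BM"
    "f \<in> Hom BM W X" "g \<in> Hom BM X Y" "h \<in> Hom BM Y Z"
  then have b: "bm_graph W" "bm_graph X" "bm_graph Y" "bm_graph Z"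
    "f \<in> bm_hom W X" "g \<in> bm_hom X Y" "h \<in> bm_hom Y Z" by (simp_all add: BM_def)
  interpret gf: bm_comp2 W X Y f g using b by unfold_locales
  interpret hg: bm_comp2 X Y Z g h using b by unfold_locales
  interpret l: bm_comp2 W Y Z "bm_comp W X Y g f" h using b gf.comp_hom by unfold_locales
  interpret r: bm_comp2 W X Z f "bm_comp X Y Z h g" using b hg.comp_hom by unfold_locales
  have "bm_comp W Y Z h (bm_comp W X Y g f) = bm_comp W X Z (bm_comp X Y Z h g) f"
  proof (rule bm_hom_eqI[OF b(1,4) l.comp_hom r.comp_hom])
    show "hF (bm_comp W Y Z h (bm_comp W X Y g f)) x = hF (bm_comp W X Z (bm_comp X Y Z h g) f) x"
      if "x \<in> bF Z" for x using that hg.c.F by simp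
    show "hV (bm_comp W Y Z h (bm_comp W X Y g f)) x = hV (bm_comp W X Z (bm_comp X Y Z h g) f) x"
      if "x \<in> bV W" for x using that gf.g.V by simp
    fix x assume "x \<in> bmD W Z (bm_comp W Y Z h (bm_comp W X Y g f))"
    then consider "x \<in> bmD W X f" | y where "y \<in> bmD X Y g" "x = hF f y"
      | z where "z \<in> bmD Y Z h" "x = hF (bm_comp W X Y g f) z"
      unfolding l.comp_D gf.comp_D by blast
    then show "hj (bm_comp W Y Z h (bm_comp W X Y g f)) x = hj (bm_comp W X Z (bm_comp X Y Z h g) f) x"
    proof cases
      case 1
      then have "x \<in> bmD W Y (bm_comp W X Y g f)" unfolding gf.comp_D by blast
      then show ?thesis using 1 by (simp add: l.comp_j1 gf.comp_j1 r.comp_j1)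
    next
      case (2 y)
      then have "x \<in> bmD W Y (bm_comp W X Y g f)" "y \<in> bmD X Z (bm_comp X Y Z h g)"
        unfolding gf.comp_D hg.comp_D by blast+
      then show ?thesis using 2 by (simp add: l.comp_j1 gf.comp_j2 r.comp_j2 hg.comp_j1)
    next
      case (3 z)
      have z: "z \<in> bF Y" "hj h z \<in> bF Y" using hg.c.D_F[OF 3(1)] hg.c.D_F[OF hg.c.j(1)[OF 3(1)]] by auto
      have "hF g z \<in> bmD X Z (bm_comp X Y Z h g)" unfolding hg.comp_D using 3 by blast
      then show ?thesis using 3 z l.comp_j2[OF 3(1)] r.comp_j2[of "hF g z"] by (simp add: hg.comp_j2)
    qed
  qed
  then show "Comp BM W Y Z h (Comp BM W X Y g f) = Comp BM W X Z (Comp BM X Y Z h g) f"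
    by (simp add: BM_def)
qed

section \<open>Equivalences from fully faithful functors with a section on objects\<close>

text \<open>The laws of \<open>C\<close> are consequences: by injectivity of \<open>Fm\<close> an
  equation in \<open>C\<close> may be checked in \<open>D\<close>. Since
  \<open>Fo (Go Y) = Y\<close> holds strictly, \<open>Go\<close> acts on morphisms by inverting
  \<open>Fm\<close>; one natural isomorphism then has identities as components, and the other has
  preimages of identities.\<close>

lemma equivalent_categoriesI:
  fixes C :: "('o,'m) cat" and D :: "('p,'n) cat"
  assumes D: "category D"
    and Fo: "\<And>X. X \<in> Ob C \<Longrightarrow> Fo X \<in> Ob D"
    and Go: "\<And>Y. Y \<in> Ob D \<Longrightarrow> Go Y \<in> Ob C" "\<And>Y. Y \<in> Ob D \<Longrightarrow> Fo (Go Y) = Y"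
    and bij: "\<And>X Y. X \<in> Ob C \<Longrightarrow> Y \<in> Ob C \<Longrightarrow> bij_betw (Fm X Y) (Hom C X Y) (Hom D (Fo X) (Fo Y))"
    and idC: "\<And>X. X \<in> Ob C \<Longrightarrow> Ide C X \<in> Hom C X X"
    and idF: "\<And>X. X \<in> Ob C \<Longrightarrow> Fm X X (Ide C X) = Ide D (Fo X)"
    and compC: "\<And>X Y Z f g. X \<in> Ob C \<Longrightarrow> Y \<in> Ob C \<Longrightarrow> Z \<in> Ob C \<Longrightarrow> f \<in> Hom C X Y \<Longrightarrow> g \<in> Hom C Y Z \<Longrightarrow>
      Comp C X Y Z g f \<in> Hom C X Z"
    and compF: "\<And>X Y Z f g. X \<in> Ob C \<Longrightarrow> Y \<in> Ob C \<Longrightarrow> Z \<in> Ob C \<Longrightarrow> f \<in> Hom C X Y \<Longrightarrow> g \<in> Hom C Y Z \<Longrightarrow>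
      Fm X Z (Comp C X Y Z g f) = Comp D (Fo X) (Fo Y) (Fo Z) (Fm Y Z g) (Fm X Y f)"
  shows "equivalent_categories C D"
proof -
  have Fin: "Fm X Y f \<in> Hom D (Fo X) (Fo Y)" if "X \<in> Ob C" "Y \<in> Ob C" "f \<in> Hom C X Y" for X Y f
    using bij_betw_apply[OF bij[OF that(1,2)] that(3)] .
  have Finj: "f = g" if "X \<in> Ob C" "Y \<in> Ob C" "f \<in> Hom C X Y" "g \<in> Hom C X Y" "Fm X Y f = Fm X Y g" for X Y f g
    using inj_onD[OF bij_betw_imp_inj_on[OF bij[OF that(1,2)]] that(5,3,4)] .
  have Did: "Ide D X \<in> Hom D X X" if "X \<in> Ob D" for X using D that by (simp add: category_def)
  have Dl: "Comp D X X Y f (Ide D X) = f" "Comp D X Y Y (Ide D Y) f = f"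
    if "X \<in> Ob D" "Y \<in> Ob D" "f \<in> Hom D X Y" for X Y f
    using D that by (simp_all add: category_def)
  have Dc: "Comp D X Y Z g f \<in> Hom D X Z"
    if "X \<in> Ob D" "Y \<in> Ob D" "Z \<in> Ob D" "f \<in> Hom D X Y" "g \<in> Hom D Y Z" for X Y Z f g
    using D that by (simp add: category_def)
  have Da: "Comp D W Y Z h (Comp D W X Y g f) = Comp D W X Z (Comp D X Y Z h g) f"
    if "W \<in> Ob D" "X \<in> Ob D" "Y \<in> Ob D" "Z \<in> Ob D" "f \<in> Hom D W X" "g \<in> Hom D X Y" "h \<in> Hom D Y Z"
    for W X Y Z f g h
    using D that unfolding category_def by blast
  have C: "category C"
    unfolding category_def
  proof (intro conjI ballI)
    fix X Y f assume a: "X \<in> Ob C" "Y \<in> Ob C" "f \<in> Hom C X Y"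
    show "Comp C X X Y f (Ide C X) = f"
      by (rule Finj[OF a(1,2) compC a(3)]) (use a in \<open>simp_all add: idC compF idF Dl Fin Fo\<close>)
    show "Comp C X Y Y (Ide C Y) f = f"
      by (rule Finj[OF a(1,2) compC a(3)]) (use a in \<open>simp_all add: idC compF idF Dl Fin Fo\<close>)
  next
    fix W X Y Z f g h
    assume a: "W \<in> Ob C" "X \<in> Ob C" "Y \<in> Ob C" "Z \<in> Ob C" "f \<in> Hom C W X" "g \<in> Hom C X Y" "h \<in> Hom C Y Z"
    have 1: "Comp C W X Y g f \<in> Hom C W Y" "Comp C X Y Z h g \<in> Hom C X Z"
      using compC[OF a(1,2,3,5,6)] compC[OF a(2,3,4,6,7)] .
    show "Comp C W Y Z h (Comp C W X Y g f) = Comp C W X Z (Comp C X Y Z h g) f"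
    proof (rule Finj[OF a(1,4) compC[OF a(1,3,4) 1(1) a(7)] compC[OF a(1,2,4) a(5) 1(2)]])
      show "Fm W Z (Comp C W Y Z h (Comp C W X Y g f)) = Fm W Z (Comp C W X Z (Comp C X Y Z h g) f)"
        unfolding compF[OF a(1,3,4) 1(1) a(7)] compF[OF a(1,2,3,5,6)]
          compF[OF a(1,2,4) a(5) 1(2)] compF[OF a(2,3,4,6,7)]
        using a by (intro Da) (simp_all add: Fo Fin)
    qed
  qed (use idC compC in auto)
  define Gm where "Gm X Y = inv_into (Hom C (Go X) (Go Y)) (Fm (Go X) (Go Y))" for X Y
  have G: "Gm X Y f \<in> Hom C (Go X) (Go Y)" "Fm (Go X) (Go Y) (Gm X Y f) = f"
    if "X \<in> Ob D" "Y \<in> Ob D" "f \<in> Hom D X Y" for X Y f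
  proof -
    have b: "bij_betw (Fm (Go X) (Go Y)) (Hom C (Go X) (Go Y)) (Hom D X Y)"
      using bij[OF Go(1)[OF that(1)] Go(1)[OF that(2)]] that by (simp add: Go)
    show "Gm X Y f \<in> Hom C (Go X) (Go Y)" unfolding Gm_def using bij_betw_apply[OF bij_betw_inv_into[OF b] that(3)] .
    show "Fm (Go X) (Go Y) (Gm X Y f) = f" unfolding Gm_def using bij_betw_inv_into_right[OF b that(3)] .
  qed
  have fF: "is_functor C D Fo Fm" unfolding is_functor_def using Fo Fin idF compF by simp
  have fG: "is_functor D C Go Gm" unfolding is_functor_def
  proof (intro conjI ballI)
    fix X assume X: "X \<in> Ob D"
    show "Gm X X (Ide D X) = Ide C (Go X)"
      by (rule Finj[OF Go(1)[OF X] Go(1)[OF X]]) (use X in \<open>simp_all add: G Did idC idF Go\<close>)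
  next
    fix X Y Z f g assume a: "X \<in> Ob D" "Y \<in> Ob D" "Z \<in> Ob D" "f \<in> Hom D X Y" "g \<in> Hom D Y Z"
    show "Gm X Z (Comp D X Y Z g f) = Comp C (Go X) (Go Y) (Go Z) (Gm Y Z g) (Gm X Y f)"
    proof (rule Finj[OF Go(1)[OF a(1)] Go(1)[OF a(3)]])
      have c: "Comp D X Y Z g f \<in> Hom D X Z" by (rule Dc[OF a])
      show "Gm X Z (Comp D X Y Z g f) \<in> Hom C (Go X) (Go Z)" using G(1)[OF a(1,3) c] .
      show "Comp C (Go X) (Go Y) (Go Z) (Gm Y Z g) (Gm X Y f) \<in> Hom C (Go X) (Go Z)"
        using a by (intro compC) (simp_all add: G Go)
      show "Fm (Go X) (Go Z) (Gm X Z (Comp D X Y Z g f)) =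
          Fm (Go X) (Go Z) (Comp C (Go X) (Go Y) (Go Z) (Gm Y Z g) (Gm X Y f))"
        using a c by (subst compF) (simp_all add: G Go)
    qed
  qed (use Go G in auto)
  define \<eta> where "\<eta> X = inv_into (Hom C (Go (Fo X)) X) (Fm (Go (Fo X)) X) (Ide D (Fo X))" for X
  define \<epsilon> where "\<epsilon> X = inv_into (Hom C X (Go (Fo X))) (Fm X (Go (Fo X))) (Ide D (Fo X))" for X
  have GF: "Go (Fo X) \<in> Ob C" "Fo (Go (Fo X)) = Fo X" if "X \<in> Ob C" for X using that by (simp_all add: Go Fo)
  have \<eta>: "\<eta> X \<in> Hom C (Go (Fo X)) X" "Fm (Go (Fo X)) X (\<eta> X) = Ide D (Fo X)" if X: "X \<in> Ob C" for X
  proof -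
    have b: "bij_betw (Fm (Go (Fo X)) X) (Hom C (Go (Fo X)) X) (Hom D (Fo X) (Fo X))"
      using bij[OF GF(1)[OF X] X] GF[OF X] by simp
    show "\<eta> X \<in> Hom C (Go (Fo X)) X"
      unfolding \<eta>_def using bij_betw_apply[OF bij_betw_inv_into[OF b] Did[OF Fo[OF X]]] .
    show "Fm (Go (Fo X)) X (\<eta> X) = Ide D (Fo X)"
      unfolding \<eta>_def using bij_betw_inv_into_right[OF b Did[OF Fo[OF X]]] .
  qed
  have \<epsilon>: "\<epsilon> X \<in> Hom C X (Go (Fo X))" "Fm X (Go (Fo X)) (\<epsilon> X) = Ide D (Fo X)" if X: "X \<in> Ob C" for X
  proof -
    have b: "bij_betw (Fm X (Go (Fo X))) (Hom C X (Go (Fo X))) (Hom D (Fo X) (Fo X))"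
      using bij[OF X GF(1)[OF X]] GF[OF X] by simp
    show "\<epsilon> X \<in> Hom C X (Go (Fo X))"
      unfolding \<epsilon>_def using bij_betw_apply[OF bij_betw_inv_into[OF b] Did[OF Fo[OF X]]] .
    show "Fm X (Go (Fo X)) (\<epsilon> X) = Ide D (Fo X)"
      unfolding \<epsilon>_def using bij_betw_inv_into_right[OF b Did[OF Fo[OF X]]] .
  qed
  have n1: "naturally_isomorphic C C (Go \<circ> Fo) (\<lambda>X Y f. Gm (Fo X) (Fo Y) (Fm X Y f)) (\<lambda>X. X) (\<lambda>X Y f. f)"
    unfolding naturally_isomorphic_def
  proof (intro exI[of _ \<eta>] conjI ballI)
    fix X assume X: "X \<in> Ob C"
    have iX: "Comp D (Fo X) (Fo X) (Fo X) (Ide D (Fo X)) (Ide D (Fo X)) = Ide D (Fo X)"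
      using Dl(1)[OF Fo[OF X] Fo[OF X] Did[OF Fo[OF X]]] .
    have a: "Comp C (Go (Fo X)) X (Go (Fo X)) (\<epsilon> X) (\<eta> X) = Ide C (Go (Fo X))"
    proof (rule Finj[OF GF(1)[OF X] GF(1)[OF X] compC[OF GF(1)[OF X] X GF(1)[OF X] \<eta>(1)[OF X] \<epsilon>(1)[OF X]] idC[OF GF(1)[OF X]]])
      show "Fm (Go (Fo X)) (Go (Fo X)) (Comp C (Go (Fo X)) X (Go (Fo X)) (\<epsilon> X) (\<eta> X)) =
          Fm (Go (Fo X)) (Go (Fo X)) (Ide C (Go (Fo X)))"
        unfolding compF[OF GF(1)[OF X] X GF(1)[OF X] \<eta>(1)[OF X] \<epsilon>(1)[OF X]] idF[OF GF(1)[OF X]]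
          GF(2)[OF X] \<eta>(2)[OF X] \<epsilon>(2)[OF X] iX ..
    qed
    have b: "Comp C X (Go (Fo X)) X (\<eta> X) (\<epsilon> X) = Ide C X"
    proof (rule Finj[OF X X compC[OF X GF(1)[OF X] X \<epsilon>(1)[OF X] \<eta>(1)[OF X]] idC[OF X]])
      show "Fm X X (Comp C X (Go (Fo X)) X (\<eta> X) (\<epsilon> X)) = Fm X X (Ide C X)"
        unfolding compF[OF X GF(1)[OF X] X \<epsilon>(1)[OF X] \<eta>(1)[OF X]] idF[OF X]
          GF(2)[OF X] \<eta>(2)[OF X] \<epsilon>(2)[OF X] iX ..
    qed
    show "iso_in C ((Go \<circ> Fo) X) X (\<eta> X)"
      unfolding iso_in_def using \<eta>[OF X] \<epsilon>[OF X] a b by auto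
  next
    fix X Y f assume a: "X \<in> Ob C" "Y \<in> Ob C" "f \<in> Hom C X Y"
    let ?g = "Gm (Fo X) (Fo Y) (Fm X Y f)"
    note g = G[OF Fo[OF a(1)] Fo[OF a(2)] Fin[OF a]]
    note X = GF[OF a(1)] and Y = GF[OF a(2)]
    show "Comp C ((Go \<circ> Fo) X) ((Go \<circ> Fo) Y) Y (\<eta> Y) ?g = Comp C ((Go \<circ> Fo) X) X Y f (\<eta> X)"
      unfolding comp_def
    proof (rule Finj[OF X(1) a(2) compC[OF X(1) Y(1) a(2) g(1) \<eta>(1)[OF a(2)]] compC[OF X(1) a(1,2) \<eta>(1)[OF a(1)] a(3)]])
      show "Fm (Go (Fo X)) Y (Comp C (Go (Fo X)) (Go (Fo Y)) Y (\<eta> Y) ?g) =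
          Fm (Go (Fo X)) Y (Comp C (Go (Fo X)) X Y f (\<eta> X))"
        unfolding compF[OF X(1) Y(1) a(2) g(1) \<eta>(1)[OF a(2)]] compF[OF X(1) a(1,2) \<eta>(1)[OF a(1)] a(3)]
          X(2) Y(2) \<eta>(2)[OF a(1)] \<eta>(2)[OF a(2)] g(2)
        using Dl[OF Fo[OF a(1)] Fo[OF a(2)] Fin[OF a]] by simp
    qed
  qed
  have n2: "naturally_isomorphic D D (Fo \<circ> Go) (\<lambda>X Y f. Fm (Go X) (Go Y) (Gm X Y f)) (\<lambda>X. X) (\<lambda>X Y f. f)"
    unfolding naturally_isomorphic_def
  proof (intro exI[of _ "Ide D"] conjI ballI)
    fix X assume X: "X \<in> Ob D"
    show "iso_in D ((Fo \<circ> Go) X) X (Ide D X)"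
      unfolding iso_in_def using X Did[OF X] Dl[OF X X Did[OF X]] by (auto simp: Go)
  next
    fix X Y f assume a: "X \<in> Ob D" "Y \<in> Ob D" "f \<in> Hom D X Y"
    show "Comp D ((Fo \<circ> Go) X) ((Fo \<circ> Go) Y) Y (Ide D Y) (Fm (Go X) (Go Y) (Gm X Y f)) =
        Comp D ((Fo \<circ> Go) X) X Y f (Ide D X)"
      using Dl[OF a] a by (simp add: Go G)
  qed
  show ?thesis unfolding equivalent_categories_def
    using C D fF fG n1 n2 by blast
qed

section \<open>Cospans and Borisov--Manin morphisms\<close>

definition bmof :: "'u gr \<Rightarrow> 'u bm_graph" where
  "bmof G = \<lparr>bV = Verts G, bF = Halves G, bd = gp G, bj = hinv G\<rparr>"

lemma bmof_simps [simp]: "bV (bmof G) = Verts G" "bF (bmof G) = Halves G" "bd (bmof G) = gp G" "bj (bmof G) = hinv G"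
  by (simp_all add: bmof_def)

lemma bm_graph_bmof: assumes "jk_graph G" shows "bm_graph (bmof G)"
proof -
  have "gp G \<in> Halves G \<rightarrow>\<^sub>E Verts G" using assms unfolding jk_graph_def by blast
  then show ?thesis using assms hinv_funcset[OF assms] by (simp add: bm_graph_def jk_finite)
qed

lemma bmof_jkof: assumes "bm_graph \<tau>" shows "bmof (jkof \<tau>) = \<tau>"
  by (simp add: bmof_def hinv_jkof[OF assms])

definition bmc :: "'u gr \<Rightarrow> 'u gr \<Rightarrow> 'u gr \<Rightarrow> 'u gmap \<Rightarrow> ('u \<Rightarrow> 'u) \<Rightarrow> ('u \<Rightarrow> 'u) \<Rightarrow> 'u bm_mor" where
  "bmc T R S f r k = (let fi = inv_into (Halves T) (mH f) in
     \<lparr>hF = (\<lambda>x\<in>Halves R. fi (k x)), hV = (\<lambda>y\<in>Verts T. r (mV f y)),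
      hj = (\<lambda>x\<in>Halves T - (\<lambda>x. fi (k x)) ` Halves R. fi (hinv S (mH f x)))\<rparr>)"

locale cospan_data = f: cover T S f + b: refinement R S r k
  for T S R :: "'u::infinite gr" and f r k
begin

abbreviation "h \<equiv> bmc T R S f r k"

lemma fi: "x \<in> Halves S \<Longrightarrow> mH f (inv_into (Halves T) (mH f) x) = x"
  "x \<in> Halves S \<Longrightarrow> inv_into (Halves T) (mH f) x \<in> Halves T"
  using bij_betw_inv_into_right[OF f.bH] bij_betw_apply[OF bij_betw_inv_into[OF f.bH]] by auto

lemma hF: "x \<in> Halves R \<Longrightarrow> mH f (hF h x) = k x" "x \<in> Halves R \<Longrightarrow> hF h x \<in> Halves T"
  using fi b.kD(1) by (simp_all add: bmc_def Let_def)

lemma hV: "y \<in> Verts T \<Longrightarrow> hV h y = r (mV f y)"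
  by (simp add: bmc_def Let_def)

lemma hF_eqI: "x \<in> Halves T \<Longrightarrow> g \<in> Halves R \<Longrightarrow> mH f x = k g \<Longrightarrow> x = hF h g"
  using hF f.H_eq by metis

lemma D_iff: "x \<in> bmD (bmof T) (bmof R) h \<longleftrightarrow> x \<in> Halves T \<and> mH f x \<notin> k ` Halves R"
proof -
  have "x \<in> hF h ` Halves R \<longleftrightarrow> mH f x \<in> k ` Halves R" if "x \<in> Halves T"
    using hF(1) hF_eqI[OF that] by auto
  then show ?thesis by (auto simp: bmD_def)
qed

lemma fH: "x \<in> Halves T \<Longrightarrow> mH f x \<in> Halves S" using f.u by simp

lemma hj: assumes "x \<in> bmD (bmof T) (bmof R) h"
  shows "mH f (hj h x) = hinv S (mH f x)" "hj h x \<in> Halves T"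
proof -
  have "x \<in> Halves T - hF h ` Halves R" using assms by (simp add: bmD_def)
  then have "x \<in> Halves T - (\<lambda>x. inv_into (Halves T) (mH f) (k x)) ` Halves R"
    by (simp add: bmc_def Let_def)
  then have "hj h x = inv_into (Halves T) (mH f) (hinv S (mH f x))" by (simp add: bmc_def Let_def)
  moreover have "hinv S (mH f x) \<in> Halves S" using assms fH by (simp add: D_iff)
  ultimately show "mH f (hj h x) = hinv S (mH f x)" "hj h x \<in> Halves T" using fi by simp_all
qed

lemma hom: "h \<in> bm_hom (bmof T) (bmof R)"
  unfolding bm_hom_iff[OF bm_graph_bmof[OF f.jkc(1)] bm_graph_bmof[OF b.jk(1)]] bmof_simps
proof (intro conjI)
  let ?D = "bmD (bmof T) (bmof R) h"
  show "hF h \<in> Halves R \<rightarrow>\<^sub>E Halves T"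
    using hF(2) by (intro PiE_I) (simp_all add: bmc_def Let_def)
  show "hV h \<in> Verts T \<rightarrow>\<^sub>E Verts R"
    using hV b.r_in etale_mV[OF f.u] by (intro PiE_I) (simp_all, simp add: bmc_def Let_def)
  have D: "hj h x \<in> ?D" if x: "x \<in> ?D" for x
    using x hj[OF x] fH b.inner(3)[of "mH f x"] by (simp add: D_iff)
  show "hj h \<in> ?D \<rightarrow>\<^sub>E ?D"
  proof (rule PiE_I)
    fix x assume "x \<notin> ?D"
    then show "hj h x = undefined" by (auto simp: bmD_def bmc_def Let_def)
  qed (rule D)
  show "\<forall>x\<in>?D. hj h (hj h x) = x"
  proof
    fix x assume x: "x \<in> ?D"
    have "mH f (hj h (hj h x)) = mH f x" using hj(1)[OF D[OF x]] hj(1)[OF x] x fH by (simp add: D_iff)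
    then show "hj h (hj h x) = x" using f.H_eq hj(2)[OF D[OF x]] x by (simp add: D_iff)
  qed
  show "inj_on (hF h) (Halves R)"
  proof (rule inj_onI)
    fix x y assume a: "x \<in> Halves R" "y \<in> Halves R" "hF h x = hF h y"
    then have "k x = k y" using hF(1)[OF a(1)] hF(1)[OF a(2)] by simp
    then show "x = y" using b.kD(4) a by simp
  qed
  have "hV h ` Verts T = r ` mV f ` Verts T" using hV by (auto simp: image_image)
  then show "hV h ` Verts T = Verts R" unfolding bij_betw_imp_surj_on[OF f.bV] b.r_surj .
  show "\<forall>x\<in>?D. hj h x \<noteq> x"
    using hj(1) b.inner(1) fH by (metis D_iff)
  show "\<forall>x\<in>?D. hinv T x \<noteq> x \<longrightarrow> hj h x = hinv T x"
  proof (intro ballI impI)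
    fix x assume x: "x \<in> ?D" "hinv T x \<noteq> x"
    then have xT: "x \<in> Halves T" by (simp add: D_iff)
    have "mH f (hj h x) = mH f (hinv T x)" using hj(1)[OF x(1)] etale_hinv(1)[OF f.u f.jkc xT x(2)] by simp
    then show "hj h x = hinv T x" using f.H_eq[OF hj(2)[OF x(1)] hinv_in[OF f.jkc(1) xT]] by simp
  qed
  show "\<forall>x\<in>Halves R. hV h (gp T (hF h x)) = gp R x"
    using hF b.kD(2) by (simp add: hV etale_gp[OF f.u])
  show "\<forall>x\<in>?D. hV h (gp T x) = hV h (gp T (hj h x))"
  proof
    fix x assume x: "x \<in> ?D"
    then have xT: "x \<in> Halves T" "mH f x \<notin> k ` Halves R" by (simp_all add: D_iff)
    show "hV h (gp T x) = hV h (gp T (hj h x))"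
      using b.inner(2)[OF fH[OF xT(1)] xT(2)] hj[OF x] xT by (simp add: hV etale_gp[OF f.u])
  qed
  show "\<forall>g\<in>Halves R. hinv T (hF h g) \<noteq> hF h g \<longrightarrow> hinv T (hF h g) = hF h (hinv R g)"
  proof (intro ballI impI)
    fix g assume g: "g \<in> Halves R" "hinv T (hF h g) \<noteq> hF h g"
    have "mH f (hinv T (hF h g)) = k (hinv R g)"
      using etale_hinv(1)[OF f.u f.jkc hF(2)[OF g(1)] g(2)] hF(1)[OF g(1)] b.kD(3)[OF g(1)] by simp
    then show "hinv T (hF h g) = hF h (hinv R g)" using g hF(2) by (intro hF_eqI) simp_all
  qed
qed

text \<open>Half-edges are compared after the bijection \<open>mH f\<close>, where the formulas for
  \<open>bmc\<close> are free of inverses.\<close>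

lemma bmc_eqI:
  assumes h': "h' \<in> bm_hom (bmof T) (bmof R)"
    and F: "\<And>x. x \<in> Halves R \<Longrightarrow> mH f (hF h' x) = k x"
    and V: "\<And>y. y \<in> Verts T \<Longrightarrow> hV h' y = r (mV f y)"
    and j: "\<And>x. x \<in> bmD (bmof T) (bmof R) h' \<Longrightarrow> mH f (hj h' x) = hinv S (mH f x)"
  shows "h' = h"
proof (rule bm_hom_eqI[OF bm_graph_bmof[OF f.jkc(1)] bm_graph_bmof[OF b.jk(1)] h' hom])
  interpret h': bm_mor "bmof T" "bmof R" h'
    using h' bm_graph_bmof[OF f.jkc(1)] bm_graph_bmof[OF b.jk(1)] by unfold_locales
  have FF: "hF h' x = hF h x" if "x \<in> Halves R" for x
    using h'.F[of x] that F[OF that] by (intro hF_eqI) simp_all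
  show "hF h' x = hF h x" if "x \<in> bF (bmof R)" for x using FF that by simp
  show "hV h' x = hV h x" if "x \<in> bV (bmof T)" for x using V hV that by simp
  fix x assume x: "x \<in> bmD (bmof T) (bmof R) h'"
  have "hF h' ` Halves R = hF h ` Halves R" using FF by (intro image_cong) auto
  then have x': "x \<in> bmD (bmof T) (bmof R) h" using x by (simp add: bmD_def)
  have "hj h' x \<in> Halves T" using h'.D_F[OF h'.j(1)[OF x]] by simp
  moreover have "mH f (hj h' x) = mH f (hj h x)" using j[OF x] hj(1)[OF x'] by simp
  ultimately show "hj h' x = hj h x" using f.H_eq hj(2)[OF x'] by simp
qed

end

section \<open>The Borisov--Manin morphism of a cospan\<close>

definition cdata :: "'u::infinite gr \<Rightarrow> 'u gr \<Rightarrow> 'u cospan \<Rightarrow> 'u gmap \<Rightarrow> ('u \<Rightarrow> 'u) \<Rightarrow> ('u \<Rightarrow> 'u) \<Rightarrow> bool" where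
  "cdata T R c f r k \<longleftrightarrow> full T \<and> full R \<and> full (fst (snd c)) \<and> reduced_cover T (fst (snd c)) f \<and>
     fst c = kl_of_etale T (fst (snd c)) f \<and> refines R (fst (snd c)) (snd (snd c)) r k"

lemma cdata_locale: "cdata T R (a, S, b) f r k \<Longrightarrow> cospan_data T S R f r k"
  by unfold_locales (auto simp: cdata_def refines_def)

lemma cospans_cdata:
  assumes "full T" "full R"
  shows "(a, S, b) \<in> cospans T R \<longleftrightarrow> (\<exists>f r k. cdata T R (a, S, b) f r k)"
proof
  assume "(a, S, b) \<in> cospans T R"
  then obtain f where f: "full S" "reduced_cover T S f" "a = kl_of_etale T S f" "generic R S b"
    by (auto simp: cospans_def)
  obtain r k where "refines R S b r k" using generic_refines[OF assms(2) f(1,4)] .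
  then show "\<exists>f r k. cdata T R (a, S, b) f r k" using f assms by (auto simp: cdata_def)
next
  assume "\<exists>f r k. cdata T R (a, S, b) f r k"
  then show "(a, S, b) \<in> cospans T R"
    using refines_generic by (auto simp: cdata_def cospans_def)
qed

definition phi :: "'u::infinite gr \<Rightarrow> 'u gr \<Rightarrow> 'u cospan \<Rightarrow> 'u bm_mor" where
  "phi T R c = (SOME h. \<exists>f r k. cdata T R c f r k \<and> h = bmc T R (fst (snd c)) f r k)"

text \<open>The choice in \<open>phi\<close> is harmless: the first leg determines \<open>f\<close>
  because etale maps embed faithfully, and the generic leg determines \<open>r\<close> and
  \<open>k\<close> on the sets where \<open>bmc\<close> evaluates them.\<close>

lemma phi_eq:
  assumes d: "cdata T R (a, S, b) f r k" shows "phi T R (a, S, b) = bmc T R S f r k"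
proof -
  have "\<exists>h f r k. cdata T R (a, S, b) f r k \<and> h = bmc T R S f r k" using d by blast
  then obtain f' r' k' where d': "cdata T R (a, S, b) f' r' k'" "phi T R (a, S, b) = bmc T R S f' r' k'"
    unfolding phi_def using someI_ex[of "\<lambda>h. \<exists>f r k. cdata T R (a, S, b) f r k \<and> h = bmc T R S f r k"]
    by auto
  have full: "full T" "full R" "full S" using d by (auto simp: cdata_def)
  have "etale T S f" "etale T S f'" "kl_of_etale T S f' = kl_of_etale T S f"
    using d d'(1) unfolding cdata_def fst_conv snd_conv reduced_cover_def by metis+
  then have ff: "f' = f" using kl_inj[of T S f' f] full_jk[OF full(1)] full_jk[OF full(3)] by blast
  interpret x: cospan_data T S R f r k using cdata_locale[OF d] .
  interpret y: cospan_data T S R f' r' k' using cdata_locale[OF d'(1)] .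
  have ref: "refines R S b r k" and ref': "refines R S b r' k'"
    using d d'(1) unfolding cdata_def fst_conv snd_conv by blast+
  have k: "k' g = k g" if "g \<in> Halves R" for g
    using refines_unique_data(1)[OF full(2,3) ref' ref that] .
  have r: "r' y = r y" if "y \<in> Verts S" for y
    using refines_unique_data(2)[OF full(2,3) ref' ref that] .
  have "bmc T R S f r' k' = bmc T R S f r k"
  proof (rule x.bmc_eqI)
    show "bmc T R S f r' k' \<in> bm_hom (bmof T) (bmof R)" using y.hom ff by simp
    show "mH f (hF (bmc T R S f r' k') x) = k x" if "x \<in> Halves R" for x
      using y.hF(1)[OF that] k[OF that] ff by simp
    show "hV (bmc T R S f r' k') y = r (mV f y)" if "y \<in> Verts T" for y
      using y.hV[OF that] r[of "mV f y"] etale_mV[OF x.f.u that] ff by simp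
    show "mH f (hj (bmc T R S f r' k') x) = hinv S (mH f x)"
      if "x \<in> bmD (bmof T) (bmof R) (bmc T R S f r' k')" for x
      using y.hj(1)[of x] that ff by simp
  qed
  then show ?thesis using ff d'(2) by simp
qed

lemma reduced_cover_gcomp:
  assumes "jk_graph T" "reduced_cover T S f" "reduced_cover S P u"
  shows "reduced_cover T P (gcomp T u f)"
  unfolding reduced_cover_def
proof
  show "etale T P (gcomp T u f)" using assms by (auto simp: reduced_cover_def)
  have "bij_betw (mV u \<circ> mV f) (Verts T) (Verts P)"
    using assms by (auto simp: reduced_cover_def intro: bij_betw_trans)
  then show "bij_betw (mV (gcomp T u f)) (Verts T) (Verts P)"
    by (subst bij_betw_cong[where g = "mV u \<circ> mV f"]) simp_all
qed

lemma reduced_cover_iso: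
  assumes "jk_graph S" "jk_graph P" "graph_iso S P t" shows "reduced_cover S P t"
  using graph_isoD[OF assms(3,1,2)] by (simp add: reduced_cover_def)

text \<open>\<open>t\<close> is composed onto \<open>f\<close> and \<open>k\<close>, and its inverse
  into \<open>r\<close>, so it cancels in the formulas for \<open>bmc\<close>.\<close>

lemma cdata_iso:
  assumes d: "cdata T R (a, S, b) f r k" and P: "full P" and t: "graph_iso S P t"
  shows "cdata T R (Comp GrT T S P (kl_of_etale S P t) a, P, Comp GrT R S P (kl_of_etale S P t) b)
      (gcomp T t f) (r \<circ> inv_into (Verts S) (mV t)) (mH t \<circ> k)" (is "cdata T R ?c ?f ?r ?k")
    and "phi T R (Comp GrT T S P (kl_of_etale S P t) a, P, Comp GrT R S P (kl_of_etale S P t) b) =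
      phi T R (a, S, b)"
proof -
  interpret cospan_data T S R f r k using cdata_locale[OF d] .
  have full: "full T" "full R" "full S" and a: "a = kl_of_etale T S f" and b: "refines R S b r k"
    and rc: "reduced_cover T S f"
    using d by (auto simp: cdata_def)
  have J: "jk_graph T" "jk_graph R" "jk_graph S" "jk_graph P" using full P by auto
  note tt = graph_isoD[OF t J(3,4)]
  have "Comp GrT T S P (kl_of_etale S P t) a = kl_of_etale T P (gcomp T t f)"
    unfolding a by (rule kl_gcomp[OF J(1,3,4) f.u tt(1)])
  moreover have "refines R P (Comp GrT R S P (kl_of_etale S P t) b) ?r ?k"
    by (rule refines_comp[OF full(2,3) P b refines_iso[OF full(3) P t]])
  ultimately show d2: "cdata T R ?c ?f ?r ?k"
    using full P reduced_cover_gcomp[OF J(1) rc reduced_cover_iso[OF J(3,4) t]] by (simp add: cdata_def)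
  interpret n: cospan_data T P R ?f ?r ?k using cdata_locale[OF d2] .
  have "bmc T R S f r k = bmc T R P ?f ?r ?k"
  proof (rule n.bmc_eqI[OF hom])
    show "mH ?f (hF h x) = ?k x" if "x \<in> Halves R" for x using hF[OF that] by simp
    show "hV h y = ?r (mV ?f y)" if "y \<in> Verts T" for y
      using that hV etale_mV[OF f.u that] by (simp add: bij_betw_inv_into_left[OF tt(4)])
    show "mH ?f (hj h x) = hinv P (mH ?f x)" if "x \<in> bmD (bmof T) (bmof R) h" for x
      using hj[OF that] that fH graph_iso_hinv[OF full(3) P t] by (simp add: D_iff)
  qed
  then show "phi T R ?c = phi T R (a, S, b)" unfolding phi_eq[OF d] phi_eq[OF d2] by simp
qed

lemma cospan_isoD:
  fixes T R :: "'u::infinite gr"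
  assumes d: "cdata T R (a, S, b) f r k" and S': "full S'" and i: "cospan_iso T R (a, S, b) (a', S', b')"
  obtains t where "graph_iso S S' t" "a' = Comp GrT T S S' (kl_of_etale S S' t) a"
    "b' = Comp GrT R S S' (kl_of_etale S S' t) b"
proof -
  have S: "full S" using d by (simp add: cdata_def)
  obtain \<theta> where th: "iso_in GrT S S' \<theta>" "Comp GrT T S S' \<theta> a = a'" "Comp GrT R S S' \<theta> b = b'"
    using i by (auto simp: cospan_iso_def)
  obtain t where "graph_iso S S' t" "\<theta> = kl_of_etale S S' t" using iso_GrT[OF S S' th(1)] .
  then show ?thesis using that th by blast
qed

text \<open>The isomorphism of apexes can only be \<open>f'\<close> after the inverse of
  \<open>f\<close>. It respects the involutions: off the image of \<open>k\<close> both are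
  prescribed by the common \<open>hj\<close>, and on that image both are given by
  \<open>hinv R\<close>. The generic legs correspond because they have the same refinement
  data.\<close>

lemma phi_iso:
  fixes T R :: "'u::infinite gr"
  assumes d: "cdata T R (a, S, b) f r k" and d': "cdata T R (a', S', b') f' r' k'"
    and eq: "phi T R (a, S, b) = phi T R (a', S', b')"
  obtains t where "graph_iso S S' t" "a' = Comp GrT T S S' (kl_of_etale S S' t) a"
    "b' = Comp GrT R S S' (kl_of_etale S S' t) b"
proof -
  interpret x: cospan_data T S R f r k using cdata_locale[OF d] .
  interpret y: cospan_data T S' R f' r' k' using cdata_locale[OF d'] .
  have hh: "x.h = y.h" using eq unfolding phi_eq[OF d] phi_eq[OF d'] .
  have full: "full T" "full R" "full S" "full S'" using d d' by (auto simp: cdata_def)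
  have J: "jk_graph T" "jk_graph R" "jk_graph S" "jk_graph S'" using full by auto
  let ?fi = "inv_into (Halves T) (mH f)" and ?fv = "inv_into (Verts T) (mV f)"
  let ?t = "hv_mor S S' (mH f' \<circ> ?fi) (mV f' \<circ> ?fv)"
  have fi: "?fi (mH f z) = z" if "z \<in> Halves T" for z using bij_betw_inv_into_left[OF x.f.bH that] .
  have fv: "?fv (mV f z) = z" if "z \<in> Verts T" for z using bij_betw_inv_into_left[OF x.f.bV that] .
  have SH: "\<exists>z\<in>Halves T. s = mH f z" if "s \<in> Halves S" for s using x.fi that by metis
  have t: "graph_iso S S' ?t"
  proof (rule hv_graph_iso[OF full(3,4)])
    show "bij_betw (mH f' \<circ> ?fi) (Halves S) (Halves S')"
      by (rule bij_betw_trans[OF bij_betw_inv_into[OF x.f.bH] y.f.bH])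
    show "bij_betw (mV f' \<circ> ?fv) (Verts S) (Verts S')"
      by (rule bij_betw_trans[OF bij_betw_inv_into[OF x.f.bV] y.f.bV])
    fix s assume "s \<in> Halves S"
    then obtain z where z: "z \<in> Halves T" "s = mH f z" using SH by blast
    have "gp S s = mV f (gp T z)" using z etale_gp[OF x.f.u z(1)] by simp
    then show "gp S' ((mH f' \<circ> ?fi) s) = (mV f' \<circ> ?fv) (gp S s)"
      using z J by (simp add: fi fv etale_gp[OF y.f.u])
    show "hinv S' ((mH f' \<circ> ?fi) s) = (mH f' \<circ> ?fi) (hinv S s)"
    proof (cases "s \<in> k ` Halves R")
      case False
      then have D: "z \<in> bmD (bmof T) (bmof R) x.h" using z by (simp add: x.D_iff)
      have D': "z \<in> bmD (bmof T) (bmof R) y.h" using D hh by simp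
      have "hinv S s = mH f (hj x.h z)" using x.hj(1)[OF D] z by simp
      then have "(mH f' \<circ> ?fi) (hinv S s) = mH f' (hj y.h z)" using x.hj(2)[OF D] hh by (simp add: fi)
      then show ?thesis using y.hj(1)[OF D'] z by (simp add: fi)
    next
      case True
      then obtain g where g: "g \<in> Halves R" "s = k g" by blast
      then have zg: "z = hF x.h g" using z by (intro x.hF_eqI) simp_all
      have g': "hinv R g \<in> Halves R" using g J by simp
      have "hinv S s = mH f (hF x.h (hinv R g))" using x.hF(1)[OF g'] x.b.kD(3)[OF g(1)] g by simp
      then have "(mH f' \<circ> ?fi) (hinv S s) = mH f' (hF y.h (hinv R g))"
        using x.hF(2)[OF g'] hh by (simp add: fi)
      also have "\<dots> = hinv S' (k' g)" using y.hF(1)[OF g'] y.b.kD(3)[OF g(1)] by simp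
      also have "\<dots> = hinv S' (mH f' z)" using y.hF(1)[OF g(1)] zg hh by simp
      finally show ?thesis using z by (simp add: fi)
    qed
  qed
  note tt = graph_isoD[OF t J(3,4)]
  have tf: "gcomp T ?t f = f'"
    by (rule etale_eq_fullI[OF full(1) etale_gcomp[OF J(1) x.f.u tt(1)] y.f.u])
      (use x.f.u in \<open>auto simp: fi fv\<close>)
  have a: "a = kl_of_etale T S f" "a' = kl_of_etale T S' f'" and b: "refines R S b r k" "refines R S' b' r' k'"
    using d d' by (auto simp: cdata_def)
  have 1: "a' = Comp GrT T S S' (kl_of_etale S S' ?t) a"
    unfolding a kl_gcomp[OF J(1,3,4) x.f.u tt(1)] tf ..
  have "refines R S' (Comp GrT R S S' (kl_of_etale S S' ?t) b) (r \<circ> inv_into (Verts S) (mV ?t)) (mH ?t \<circ> k)"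
    by (rule refines_comp[OF full(2,3,4) b(1) refines_iso[OF full(3,4) t]])
  then have "refines R S' (Comp GrT R S S' (kl_of_etale S S' ?t) b) r' k'"
  proof (rule refines_cong[OF _ full(2,4)])
    fix y assume "y \<in> Verts S'"
    then have "y \<in> mV f' ` Verts T" using bij_betw_imp_surj_on[OF y.f.bV] by simp
    then obtain z where z: "z \<in> Verts T" "y = mV f' z" by blast
    have zS: "mV f z \<in> Verts S" using etale_mV[OF x.f.u z(1)] .
    have "y = mV ?t (mV f z)" using z zS by (simp add: fv)
    then have "inv_into (Verts S) (mV ?t) y = mV f z" using bij_betw_inv_into_left[OF tt(4) zS] by simp
    then show "(r \<circ> inv_into (Verts S) (mV ?t)) y = r' y"
      using x.hV[OF z(1)] y.hV[OF z(1)] hh z by simp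
  next
    fix g assume g: "g \<in> Halves R"
    have "mH ?t (k g) = mH f' (?fi (mH f (hF x.h g)))" using x.b.kD(1)[OF g] x.hF(1)[OF g] by simp
    also have "\<dots> = k' g" using fi[OF x.hF(2)[OF g]] y.hF(1)[OF g] hh by simp
    finally show "(mH ?t \<circ> k) g = k' g" by simp
  qed
  then have 2: "b' = Comp GrT R S S' (kl_of_etale S S' ?t) b"
    using refines_unique[OF full(2,4) b(2)] by simp
  show ?thesis by (rule that[OF t 1 2])
qed

section \<open>Isomorphism classes of cospans as the fibres of \<open>phi\<close>\<close>

lemma cospan_iso_iff:
  fixes T R :: "'u::infinite gr"
  assumes T: "full T" and R: "full R" and c: "c \<in> cospans T R" and c': "c' \<in> cospans T R"
  shows "cospan_iso T R c c' \<longleftrightarrow> phi T R c = phi T R c'"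
proof -
  obtain a S b where cc: "c = (a, S, b)" by (cases c)
  obtain a' S' b' where cc': "c' = (a', S', b')" by (cases c')
  obtain f r k where d: "cdata T R (a, S, b) f r k" using c cospans_cdata[OF T R] unfolding cc by blast
  obtain f' r' k' where d': "cdata T R (a', S', b') f' r' k'" using c' cospans_cdata[OF T R] unfolding cc' by blast
  have S: "full S" "full S'" using d d' by (simp_all add: cdata_def)
  show ?thesis unfolding cc cc'
  proof
    assume "cospan_iso T R (a, S, b) (a', S', b')"
    then obtain t where "graph_iso S S' t" "a' = Comp GrT T S S' (kl_of_etale S S' t) a"
      "b' = Comp GrT R S S' (kl_of_etale S S' t) b"
      using cospan_isoD[OF d S(2)] by metis
    then show "phi T R (a, S, b) = phi T R (a', S', b')" using cdata_iso(2)[OF d S(2)] by simp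
  next
    assume "phi T R (a, S, b) = phi T R (a', S', b')"
    then obtain t where t: "graph_iso S S' t" "a' = Comp GrT T S S' (kl_of_etale S S' t) a"
      "b' = Comp GrT R S S' (kl_of_etale S S' t) b"
      using phi_iso[OF d d'] by metis
    show "cospan_iso T R (a, S, b) (a', S', b')"
      unfolding cospan_iso_def using kl_iso[OF full_jk[OF S(1)] full_jk[OF S(2)] t(1)] t(2,3) by auto
  qed
qed

lemma cospan_class_eq:
  fixes T R :: "'u::infinite gr"
  assumes "full T" "full R" "c \<in> cospans T R"
  shows "cospan_class T R c = {c' \<in> cospans T R. phi T R c' = phi T R c}"
  using cospan_iso_iff[OF assms] by (auto simp: cospan_class_def)

lemma phi_surj:
  fixes T R :: "'u::infinite gr"
  assumes T: "full T" and R: "full R" and h: "h \<in> bm_hom (bmof T) (bmof R)"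
  obtains c where "c \<in> cospans T R" "phi T R c = h"
proof -
  have J: "jk_graph T" "jk_graph R" using T R by auto
  interpret h: bm_mor "bmof T" "bmof R" h using h bm_graph_bmof[OF J(1)] bm_graph_bmof[OF J(2)] by unfold_locales
  let ?D = "bmD (bmof T) (bmof R) h"
  let ?inv = "inv_into (Halves R) (hF h)"
  define S0 where "S0 = \<lparr>bV = Verts T, bF = Halves T, bd = gp T,
    bj = (\<lambda>x\<in>Halves T. if x \<in> ?D then hj h x else hF h (hinv R (?inv x)))\<rparr>"
  have inv: "?inv (hF h g) = g" if "g \<in> Halves R" for g using h.F_inv[of g] that by simp
  have jD: "bj S0 x = hj h x" if "x \<in> ?D" for x using that h.D_F[OF that] by (simp add: S0_def)
  have jK: "bj S0 (hF h g) = hF h (hinv R g)" if "g \<in> Halves R" for g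
    using that h.F_D[of g] h.F[of g] by (simp add: S0_def inv)
  have bF: "bF S0 = Halves T" by (simp add: S0_def)
  have jj: "bj S0 x \<in> Halves T \<and> bj S0 (bj S0 x) = x" if "x \<in> Halves T" for x
  proof -
    from that have "x \<in> bF (bmof T)" by simp
    then show ?thesis
    proof (cases rule: h.cases)
      case 1
      then show ?thesis using h.j(1,2)[OF 1] h.D_F[OF h.j(1)[OF 1]] by (simp add: jD)
    next
      case (2 g)
      then show ?thesis using J h.F[of "hinv R g"] by (simp add: jK)
    qed
  qed
  have S0: "bm_graph S0"
    unfolding bm_graph_def bF
  proof (intro conjI)
    show "finite (bV S0)" "finite (Halves T)" using jk_finite[OF J(1)] by (simp_all add: S0_def)
    have "gp T \<in> Halves T \<rightarrow>\<^sub>E Verts T" using J(1) unfolding jk_graph_def by blast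
    then show "bd S0 \<in> Halves T \<rightarrow>\<^sub>E bV S0" by (simp add: S0_def)
    show "bj S0 \<in> Halves T \<rightarrow>\<^sub>E Halves T"
    proof (rule PiE_I)
      show "bj S0 x = undefined" if "x \<notin> Halves T" for x using that by (simp add: S0_def)
    qed (use jj in blast)
    show "\<forall>x\<in>Halves T. bj S0 (bj S0 x) = x" using jj by blast
  qed
  define S where "S = jkof S0"
  have S: "full S" unfolding S_def by (rule full_jkof[OF S0])
  have JS: "jk_graph S" using S by simp
  have Ss: "Halves S = Halves T" "Verts S = Verts T" "gp S = gp T"
    by (simp_all add: S_def) (simp_all add: S0_def)
  have hS: "hinv S = bj S0" unfolding S_def by (rule hinv_jkof[OF S0])
  let ?f = "hv_mor T S (\<lambda>x. x) (\<lambda>y. y)"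
  have f: "etale T S ?f"
  proof (rule hv_etale[OF T JS])
    show "(\<lambda>x. x) ` Halves T \<subseteq> Halves S" "(\<lambda>y. y) ` Verts T \<subseteq> Verts S" by (simp_all add: Ss)
    show "gp S x = gp T x" for x by (simp add: Ss)
    show "bij_betw (\<lambda>x. x) (flags_at T y) (flags_at S y)" for y by (simp add: flags_at_def Ss bij_betw_def)
    fix x assume x: "x \<in> Halves T" "hinv T x \<noteq> x"
    then have "x \<in> bF (bmof T)" by simp
    \<comment> \<open>Edges of \<open>T\<close> survive in \<open>S\<close>: off the image of
      \<open>hF h\<close> the involution \<open>hj h\<close> agrees with them, and on the image they
      are edges of \<open>R\<close>.\<close>
    then have "hinv S x = hinv T x"
    proof (cases rule: h.cases)
      case 1
      then show ?thesis using h.j(4)[OF 1] x by (simp add: hS jD)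
    next
      case (2 g)
      then show ?thesis using h.Fj[of g] x by (simp add: hS jK)
    qed
    then show "gi S (gs S x) = gs S (hinv T x)" using gi_gs[OF JS, of x] x by (simp add: Ss)
  qed
  have rc: "reduced_cover T S ?f"
    unfolding reduced_cover_def
  proof (intro conjI f)
    show "bij_betw (mV ?f) (Verts T) (Verts S)"
      by (subst bij_betw_cong[where g = "\<lambda>y. y"]) (simp_all add: Ss bij_betw_def)
  qed
  have rf: "refn R S (hV h) (hF h)"
    unfolding refn_def Ss hS
  proof (intro conjI ballI)
    show "hF h ` Halves R \<subseteq> Halves T" using h.F by auto
    show "inj_on (hF h) (Halves R)" using h.F_inj by simp
    show "hV h ` Verts T = Verts R" using h.V_surj by simp
    show "hV h (gp T (hF h g)) = gp R g" if "g \<in> Halves R" for g using h.FV[of g] that by simp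
    show "bj S0 (hF h g) = hF h (hinv R g)" if "g \<in> Halves R" for g by (rule jK[OF that])
    fix x assume "x \<in> Halves T - hF h ` Halves R"
    then have D: "x \<in> ?D" by (simp add: bmD_def)
    show "bj S0 x \<noteq> x" "hV h (gp T (bj S0 x)) = hV h (gp T x)"
      using h.j(3,5)[OF D] by (simp_all add: jD[OF D])
  qed
  interpret rf: refinement R S "hV h" "hF h" using R S rf by unfold_locales
  obtain b where b: "refines R S b (hV h) (hF h)" using rf.refines_ex by blast
  have d: "cdata T R (kl_of_etale T S ?f, S, b) ?f (hV h) (hF h)"
    using T R S rc b by (simp add: cdata_def)
  interpret x: cospan_data T S R ?f "hV h" "hF h" using cdata_locale[OF d] .
  have "h = x.h"
  proof (rule x.bmc_eqI[OF h])
    show "mH ?f (hF h x) = hF h x" if "x \<in> Halves R" for x using h.F[of x] that by simp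
    show "mH ?f (hj h x) = hinv S (mH ?f x)" if "x \<in> ?D" for x
      using h.D_F[OF that] h.D_F[OF h.j(1)[OF that]] by (simp add: hS jD[OF that])
  qed simp
  then have "phi T R (kl_of_etale T S ?f, S, b) = h" unfolding phi_eq[OF d] by simp
  moreover have "(kl_of_etale T S ?f, S, b) \<in> cospans T R" using d cospans_cdata[OF T R] by blast
  ultimately show ?thesis using that by blast
qed

lemma phi_hom:
  fixes T R :: "'u::infinite gr"
  assumes "full T" "full R" "c \<in> cospans T R" shows "phi T R c \<in> bm_hom (bmof T) (bmof R)"
proof -
  obtain a S b where cc: "c = (a, S, b)" by (cases c)
  obtain f r k where d: "cdata T R (a, S, b) f r k" using assms(3) cospans_cdata[OF assms(1,2)] unfolding cc by blast
  interpret cospan_data T S R f r k using cdata_locale[OF d] .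
  show ?thesis unfolding cc phi_eq[OF d] by (rule hom)
qed

lemma phi_Ide:
  fixes T :: "'u::infinite gr"
  assumes T: "full T"
  shows "(Ide GrT T, T, Ide GrT T) \<in> cospans T T" "phi T T (Ide GrT T, T, Ide GrT T) = bm_id (bmof T)"
proof -
  have J: "jk_graph T" using T by simp
  have d: "cdata T T (Ide GrT T, T, Ide GrT T) (gid T) (\<lambda>y. y) (\<lambda>x. x)"
    using T refines_Ide[OF T] kl_gid[OF J] reduced_cover_iso[OF J J graph_iso_gid[OF J]] by (simp add: cdata_def)
  then show "(Ide GrT T, T, Ide GrT T) \<in> cospans T T" using cospans_cdata[OF T T] by blast
  interpret x: cospan_data T T T "gid T" "\<lambda>y. y" "\<lambda>x. x" using cdata_locale[OF d] .
  have "bm_id (bmof T) = x.h"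
    by (rule x.bmc_eqI[OF bm_id_hom[OF bm_graph_bmof[OF J]]]) simp_all
  then show "phi T T (Ide GrT T, T, Ide GrT T) = bm_id (bmof T)" unfolding phi_eq[OF d] by simp
qed

section \<open>Composition of classes through pushouts\<close>

lemma refines_nt: "refines R Y \<phi> r k \<Longrightarrow> \<phi> \<in> nt_hom (yon R) (bar (yon Y))"
  by (simp add: refines_def)

text \<open>\<open>V\<close>, \<open>H\<close> and \<open>J\<close> are the description of the
  pushout supplied by \<open>pushout_ex\<close>. Off the image of \<open>k\<close> the graph
  \<open>P\<close> keeps the edges of \<open>S\<close>, and on it the edges are those of
  \<open>S'\<close>; this is the case distinction in the definition of
  \<open>bm_comp\<close>.\<close>

lemma composite_bm:
  fixes T R Q :: "'u::infinite gr"
  assumes d: "cdata T R (a, S, b) f r k" and d': "cdata R Q (a', S', b') f' r' k'"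
    and e: "cdata T Q (a'', P, b'') (gcomp T u f) (r' \<circ> rv) (kv \<circ> k')"
    and v: "refines S' P v rv kv"
    and V: "\<And>y. y \<in> Verts S \<Longrightarrow> rv (mV u y) = mV f' (r y)"
    and H: "\<And>h. h \<in> Halves R \<Longrightarrow> kv (mH f' h) = mH u (k h)"
    and J: "\<And>h. h \<in> Halves S \<Longrightarrow> h \<notin> k ` Halves R \<Longrightarrow> hinv P (mH u h) = mH u (hinv S h)"
  shows "phi T Q (a'', P, b'') =
    bm_comp (bmof T) (bmof R) (bmof Q) (phi R Q (a', S', b')) (phi T R (a, S, b))"
proof -
  interpret x: cospan_data T S R f r k using cdata_locale[OF d] .
  interpret y: cospan_data R S' Q f' r' k' using cdata_locale[OF d'] .
  interpret e: cospan_data T P Q "gcomp T u f" "r' \<circ> rv" "kv \<circ> k'" using cdata_locale[OF e] .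
  have "full S'" "full P" using d' e by (simp_all add: cdata_def)
  then interpret v: refinement S' P rv kv using v by unfold_locales (auto simp: refines_def)
  interpret c: bm_comp2 "bmof T" "bmof R" "bmof Q" x.h y.h
    using x.hom y.hom bm_graph_bmof[OF x.f.jkc(1)] bm_graph_bmof[OF y.f.jkc(1)] bm_graph_bmof[OF y.b.jk(1)]
    by unfold_locales
  have "c.cg = e.h"
  proof (rule e.bmc_eqI[OF c.comp_hom])
    show "mH (gcomp T u f) (hF c.cg g) = (kv \<circ> k') g" if "g \<in> Halves Q" for g
      using that y.hF[OF that] x.hF[of "hF y.h g"] H[of "hF y.h g"] by simp
    show "hV c.cg z = (r' \<circ> rv) (mV (gcomp T u f) z)" if z: "z \<in> Verts T" for z
    proof -
      have m: "mV f z \<in> Verts S" using etale_mV[OF x.f.u z] .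
      have "hV c.cg z = r' (mV f' (r (mV f z)))" using z x.hV[OF z] y.hV[OF x.b.r_in[OF m]] by simp
      then show ?thesis using V[OF m] z by simp
    qed
    fix z assume "z \<in> bmD (bmof T) (bmof Q) c.cg"
    then consider "z \<in> bmD (bmof T) (bmof R) x.h" | y where "y \<in> bmD (bmof R) (bmof Q) y.h" "z = hF x.h y"
      unfolding c.comp_D by blast
    then show "mH (gcomp T u f) (hj c.cg z) = hinv P (mH (gcomp T u f) z)"
    proof cases
      case 1
      then have z: "z \<in> Halves T" "mH f z \<notin> k ` Halves R" by (simp_all add: x.D_iff)
      show ?thesis
        using c.comp_j1[OF 1] x.hj[OF 1] J[OF x.fH[OF z(1)] z(2)] z(1) by simp
    next
      case (2 y)
      have y: "y \<in> Halves R" using 2(1) by (simp add: y.D_iff)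
      note j = y.hj[OF 2(1)]
      have "mH (gcomp T u f) (hj c.cg z) = mH u (k (hj y.h y))"
        using c.comp_j2[OF 2(1)] 2(2) x.hF[OF j(2)] by simp
      also have "\<dots> = kv (hinv S' (mH f' y))" using H[OF j(2)] j(1) by simp
      also have "\<dots> = hinv P (kv (mH f' y))" using v.kD(3)[OF y.fH[OF y]] by simp
      also have "\<dots> = hinv P (mH (gcomp T u f) z)" using H[OF y] 2(2) x.hF[OF y] by simp
      finally show ?thesis .
    qed
  qed
  then show ?thesis unfolding phi_eq[OF d] phi_eq[OF d'] phi_eq[OF e] by simp
qed

lemma Comp_Comp_kl:
  fixes S :: "'u::infinite gr"
  assumes J: "jk_graph S" "jk_graph P" "jk_graph Y" "jk_graph Z" and u: "etale S P u"
    and t: "\<theta> \<in> nt_hom (yon P) (bar (yon Y))" and w: "\<psi> \<in> nt_hom (yon Y) (bar (yon Z))"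
  shows "Comp GrT S P Z (Comp GrT P Y Z \<psi> \<theta>) (kl_of_etale S P u) =
    Comp GrT S Y Z \<psi> (Comp GrT S P Y \<theta> (kl_of_etale S P u))"
  unfolding Comp_kl[OF J(1,2,4) u Comp_nt[OF J(2,3,4) t w]] Comp_kl[OF J(1,2,3) u t]
  unfolding Comp_GrT by (rule nt_comp_assoc[OF yon_map_nt[OF u J(1)]])

text \<open>The usual comparison maps \<open>\<theta>\<close> and \<open>\<psi>\<close>, arranged so
  that every use of associativity has an etale factor. Since \<open>u\<close> is an epimorphism, one
  composite is the identity; so \<open>\<theta>\<close> is a split monomorphism and hence etale.
  Then \<open>u'\<close> is etale as well, and the other composite can be handled.\<close>

lemma pushout_kl_unique:
  fixes R S S' P P' :: "'u::infinite gr"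
  assumes full: "full S" "full S'" "full P" "full P'" and u: "reduced_cover S P u"
    and p: "is_pushout GrT R S S' b c P (kl_of_etale S P u) v"
    and p': "is_pushout GrT R S S' b c P' u' v'"
  obtains t where "graph_iso P P' t" "u' = kl_of_etale S P' (gcomp S t u)"
    "v' = Comp GrT S' P P' (kl_of_etale P P' t) v"
proof -
  have J: "jk_graph S" "jk_graph S'" "jk_graph P" "jk_graph P'" using full by auto
  interpret u: cover S P u using full u by unfold_locales
  have uv: "v \<in> nt_hom (yon S') (bar (yon P))" "u' \<in> nt_hom (yon S) (bar (yon P'))"
    "v' \<in> nt_hom (yon S') (bar (yon P'))"
    using p p' by (simp_all add: is_pushout_def)
  have ku: "kl_of_etale S P u \<in> nt_hom (yon S) (bar (yon P))" using kl_nt[OF J(1,3) u.u] .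
  have uni: "\<exists>!w. w \<in> nt_hom (yon P0) (bar (yon Z)) \<and> Comp GrT S P0 Z w u0 = x \<and> Comp GrT S' P0 Z w v0 = y"
    if "is_pushout GrT R S S' b c P0 u0 v0" "is_pushout GrT R S S' b c Z x y" for P0 Z u0 v0 x y
    using that unfolding is_pushout_def Hom_GrT by blast
  obtain \<theta> where th: "\<theta> \<in> nt_hom (yon P) (bar (yon P'))"
    "Comp GrT S P P' \<theta> (kl_of_etale S P u) = u'" "Comp GrT S' P P' \<theta> v = v'"
    using uni[OF p p'] by blast
  obtain \<psi> where ps: "\<psi> \<in> nt_hom (yon P') (bar (yon P))"
    "Comp GrT S P' P \<psi> u' = kl_of_etale S P u" "Comp GrT S' P' P \<psi> v' = v"
    using uni[OF p' p] by blast
  have id: "Comp GrT P P' P \<psi> \<theta> = unit_nt (yon P)"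
  proof (rule u.epi[OF Comp_nt[OF J(3,4,3) th(1) ps(1)]])
    show un: "(unit_nt (yon P) :: 'u kl) \<in> nt_hom (yon P) (bar (yon P))"
      using kl_nt[OF J(3,3) graph_isoD(1)[OF graph_iso_gid[OF J(3)] J(3,3)]] kl_gid[OF J(3)] by simp
    show "nt_comp (yon S) (Comp GrT P P' P \<psi> \<theta>) (yon_map S u) =
        nt_comp (yon S) (unit_nt (yon P)) (yon_map S u)"
      unfolding Comp_kl[OF J(1,3,3) u.u Comp_nt[OF J(3,4,3) th(1) ps(1)], symmetric]
        Comp_kl[OF J(1,3,3) u.u un, symmetric] Comp_Comp_kl[OF J(1,3,4,3) u.u th(1) ps(1)] th(2) ps(2)
      by (rule Comp_Ide_left[OF J(1,3) ku, symmetric])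
  qed
  obtain t where t: "etale P P' t" "\<theta> = kl_of_etale P P' t"
    using split_mono_etale[OF full(3,4) th(1) ps(1) id] .
  have u': "u' = kl_of_etale S P' (gcomp S t u)"
    unfolding th(2)[symmetric] t(2) by (rule kl_gcomp[OF J(1,3,4) u.u t(1)])
  have tu: "etale S P' (gcomp S t u)" using etale_gcomp[OF J(1) u.u t(1)] .
  \<comment> \<open>Both \<open>\<theta>\<close> after \<open>\<psi>\<close> and the unit are
    endomorphisms of the cocone \<open>u'\<close>, \<open>v'\<close>, which is itself a
    pushout.\<close>
  have "Comp GrT P' P P' \<theta> \<psi> = unit_nt (yon P')"
  proof (rule ex1E[OF uni[OF p' p']])
    fix w assume *: "\<forall>y. y \<in> nt_hom (yon P') (bar (yon P')) \<and> Comp GrT S P' P' y u' = u' \<and>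
      Comp GrT S' P' P' y v' = v' \<longrightarrow> y = w"
    have "Comp GrT S P' P' (Comp GrT P' P P' \<theta> \<psi>) u' = u'"
      using Comp_Comp_kl[OF J(1,4,3,4) tu ps(1) th(1)] ps(2) th(2) unfolding u'[symmetric] by simp
    moreover have "Comp GrT S' P' P' (Comp GrT P' P P' \<theta> \<psi>) v' = v'"
      using Comp_kl_assoc2[OF J(2,4,3,4) t(1) uv(3) ps(1)] ps(3) th(3) unfolding t(2)[symmetric] by simp
    ultimately have "Comp GrT P' P P' \<theta> \<psi> = w" using * Comp_nt[OF J(4,3,4) ps(1) th(1)] by blast
    moreover have "unit_nt (yon P') = w"
      using * Comp_Ide_left[OF J(1,4) uv(2)] Comp_Ide_left[OF J(2,4) uv(3)]
        kl_nt[OF J(4,4) graph_isoD(1)[OF graph_iso_gid[OF J(4)] J(4,4)]] kl_gid[OF J(4)] by metis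
    ultimately show ?thesis by simp
  qed
  then have "iso_in GrT P P' \<theta>" using th(1) ps(1) id by (auto simp: iso_in_def)
  then obtain t' where t': "graph_iso P P' t'" "\<theta> = kl_of_etale P P' t'" using iso_GrT[OF full(3,4)] by blast
  have "t' = t" using kl_inj[OF J(3,4) graph_isoD(1)[OF t'(1) J(3,4)] t(1)] t t' by simp
  then show ?thesis using that t' u' th(3) by blast
qed

text \<open>The definition of \<open>Cosp\<close> collects the results of all pushouts. The last
  clause moves the constructed pushout along an isomorphism of its apex, which is how every cospan
  in the composite class is reached.\<close>

lemma cospan_composite_ex:
  fixes T R Q :: "'u::infinite gr"
  assumes d: "cdata T R (a, S, b) f r k" and d': "cdata R Q (a', S', b') f' r' k'"
  obtains P u v f'' r'' k'' where "full P" "reduced_cover S P u" "v \<in> nt_hom (yon S') (bar (yon P))"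
    "cdata T Q (Comp GrT T S P (kl_of_etale S P u) a, P, Comp GrT Q S' P v b') f'' r'' k''"
    "phi T Q (Comp GrT T S P (kl_of_etale S P u) a, P, Comp GrT Q S' P v b') =
      bm_comp (bmof T) (bmof R) (bmof Q) (phi R Q (a', S', b')) (phi T R (a, S, b))"
    "is_pushout GrT R S S' b a' P (kl_of_etale S P u) v"
    "\<And>P' t. full P' \<Longrightarrow> graph_iso P P' t \<Longrightarrow> is_pushout GrT R S S' b a' P'
      (kl_of_etale S P' (gcomp S t u)) (Comp GrT S' P P' (kl_of_etale P P' t) v)"
proof -
  have full: "full T" "full R" "full Q" "full S" "full S'" and b: "refines R S b r k"
    and b': "refines Q S' b' r' k'" and f: "reduced_cover T S f" and f': "reduced_cover R S' f'"
    and a: "a = kl_of_etale T S f" and a': "a' = kl_of_etale R S' f'"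
    using d d' unfolding cdata_def fst_conv snd_conv by blast+
  obtain P u v rv kv where P: "full P" and u: "reduced_cover S P u" and v: "refines S' P v rv kv"
    and comm: "nt_comp (yon R) v (yon_map R f') = Comp GrT R S P (kl_of_etale S P u) b"
    and edge: "\<And>h. h \<in> Halves S \<Longrightarrow> hinv P (mH u h) \<noteq> mH u h \<Longrightarrow> hinv S h = h \<Longrightarrow>
      \<exists>f1\<in>Halves R. \<exists>f2\<in>Halves R. h = k f1 \<and> hinv P (mH u h) = mH u (k f2) \<and>
        hinv S' (mH f' f1) = mH f' f2 \<and> mH f' f1 \<noteq> mH f' f2"
    and V: "\<And>y. y \<in> Verts S \<Longrightarrow> rv (mV u y) = mV f' (r y)"
    and H: "\<And>h. h \<in> Halves R \<Longrightarrow> kv (mH f' h) = mH u (k h)"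
    and I: "\<And>h. h \<in> Halves S \<Longrightarrow> h \<notin> k ` Halves R \<Longrightarrow> hinv P (mH u h) = mH u (hinv S h)"
    by (rule pushout_ex[OF full(2,4,5) b f']) (rule that; assumption)
  have J: "jk_graph T" "jk_graph R" "jk_graph Q" "jk_graph S" "jk_graph S'" "jk_graph P"
    using full P by auto
  have et: "etale T S f" "etale R S' f'" "etale S P u" using f f' u by (simp_all add: reduced_cover_def)
  have vn: "v \<in> nt_hom (yon S') (bar (yon P))" using refines_nt[OF v] .
  have bn: "b \<in> nt_hom (yon R) (bar (yon S))" using refines_nt[OF b] .
  have e: "cdata T Q (Comp GrT T S P (kl_of_etale S P u) a, P, Comp GrT Q S' P v b')
    (gcomp T u f) (r' \<circ> rv) (kv \<circ> k')"
    unfolding cdata_def fst_conv snd_conv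
    using full P reduced_cover_gcomp[OF J(1) f u] kl_gcomp[OF J(1,4,6) et(1,3)] a
      refines_comp[OF full(3,5) P b' v] by blast
  have "is_pushout GrT R S S' b a' P (kl_of_etale S P u) v"
    unfolding a' by (rule pushoutI[OF full(2,4,5) P b f' u vn comm edge])
  moreover have "is_pushout GrT R S S' b a' P' (kl_of_etale S P' (gcomp S t u))
      (Comp GrT S' P P' (kl_of_etale P P' t) v)" if P': "full P'" and t: "graph_iso P P' t" for P' t
    unfolding a'
  proof (rule pushoutI[OF full(2,4,5) P' b f'])
    have J': "jk_graph P'" using P' by simp
    note tt = graph_isoD[OF t J(6) J']
    note kt = kl_nt[OF J(6) J' tt(1)]
    note ku = kl_nt[OF J(4,6) et(3)]
    show "reduced_cover S P' (gcomp S t u)"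
      by (rule reduced_cover_gcomp[OF J(4) u reduced_cover_iso[OF J(6) J' t]])
    show vt: "Comp GrT S' P P' (kl_of_etale P P' t) v \<in> nt_hom (yon S') (bar (yon P'))"
      by (rule Comp_nt[OF J(5,6) J' vn kt])
    show "nt_comp (yon R) (Comp GrT S' P P' (kl_of_etale P P' t) v) (yon_map R f') =
        Comp GrT R S P' (kl_of_etale S P' (gcomp S t u)) b"
      unfolding Comp_kl[OF J(2,5) J' et(2) vt, symmetric] Comp_Comp_kl[OF J(2,5,6) J' et(2) vn kt]
        Comp_kl[OF J(2,5,6) et(2) vn] comm Comp_kl_assoc2[OF J(2,4,6) J' tt(1) bn ku]
        kl_gcomp[OF J(4,6) J' et(3) tt(1)] by (rule refl)
    fix h assume h: "h \<in> Halves S" "hinv P' (mH (gcomp S t u) h) \<noteq> mH (gcomp S t u) h" "hinv S h = h"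
    have uh: "mH u h \<in> Halves P" using et(3) h(1) by simp
    note hi = graph_iso_hinv[OF P P' t uh]
    have "hinv P (mH u h) \<noteq> mH u h" using h hi by auto
    then obtain f1 f2 where f12: "f1 \<in> Halves R" "f2 \<in> Halves R" "h = k f1" "hinv P (mH u h) = mH u (k f2)"
        "hinv S' (mH f' f1) = mH f' f2" "mH f' f1 \<noteq> mH f' f2"
      using edge[OF h(1) _ h(3)] by blast
    interpret cospan_data T S R f r k using cdata_locale[OF d] .
    have "hinv P' (mH (gcomp S t u) h) = mH (gcomp S t u) (k f2)"
      using hi h(1) f12(4) b.kD(1)[OF f12(2)] by simp
    then show "\<exists>f1\<in>Halves R. \<exists>f2\<in>Halves R. h = k f1 \<and>
        hinv P' (mH (gcomp S t u) h) = mH (gcomp S t u) (k f2) \<and>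
        hinv S' (mH f' f1) = mH f' f2 \<and> mH f' f1 \<noteq> mH f' f2"
      using f12 by blast
  qed
  ultimately show ?thesis
    using that[OF P u vn e composite_bm[OF d d' e v V H I]] by blast
qed

text \<open>An arbitrary pushout differs from the constructed one by a graph isomorphism, and
  \<open>phi\<close> is invariant under it. Conversely a cospan with the right \<open>phi\<close> is
  the constructed composite moved along some \<open>t\<close>, and the pushout moved along the same
  \<open>t\<close> produces exactly this cospan.\<close>

lemma composites:
  fixes T R Q :: "'u::infinite gr"
  assumes full: "full T" "full R" "full Q" and c: "c \<in> cospans T R" and d: "d \<in> cospans R Q"
  shows "{(Comp GrT T S P u a, P, Comp GrT Q S' P v b') | a S b a' S' b' P u v.
      (a, S, b) \<in> cospan_class T R c \<and> (a', S', b') \<in> cospan_class R Q d \<and> is_pushout GrT R S S' b a' P u v} =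
    {e \<in> cospans T Q. phi T Q e = bm_comp (bmof T) (bmof R) (bmof Q) (phi R Q d) (phi T R c)}"
    (is "?L = ?R")
proof (rule subset_antisym; rule subsetI)
  fix e assume "e \<in> ?L"
  then obtain a S b a' S' b' P' u' v' where e: "e = (Comp GrT T S P' u' a, P', Comp GrT Q S' P' v' b')"
    and ab: "(a, S, b) \<in> cospan_class T R c" "(a', S', b') \<in> cospan_class R Q d"
    and p': "is_pushout GrT R S S' b a' P' u' v'" by blast
  have m: "(a, S, b) \<in> cospans T R" "phi T R (a, S, b) = phi T R c"
    "(a', S', b') \<in> cospans R Q" "phi R Q (a', S', b') = phi R Q d"
    using ab cospan_class_eq[OF full(1,2) c] cospan_class_eq[OF full(2,3) d] by auto
  obtain f r k where cd: "cdata T R (a, S, b) f r k" using m(1) cospans_cdata[OF full(1,2)] by blast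
  obtain f' r' k' where cd': "cdata R Q (a', S', b') f' r' k'" using m(3) cospans_cdata[OF full(2,3)] by blast
  obtain P u v f'' r'' k'' where P: "full P" and u: "reduced_cover S P u" and v: "v \<in> nt_hom (yon S') (bar (yon P))"
    and e0: "cdata T Q (Comp GrT T S P (kl_of_etale S P u) a, P, Comp GrT Q S' P v b') f'' r'' k''"
    and ph: "phi T Q (Comp GrT T S P (kl_of_etale S P u) a, P, Comp GrT Q S' P v b') =
      bm_comp (bmof T) (bmof R) (bmof Q) (phi R Q (a', S', b')) (phi T R (a, S, b))"
    and p: "is_pushout GrT R S S' b a' P (kl_of_etale S P u) v"
    by (rule cospan_composite_ex[OF cd cd']) (rule that; assumption)
  have F: "full S" "full S'" "full P'" using cd cd' p' by (simp_all add: cdata_def is_pushout_def)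
  have J: "jk_graph T" "jk_graph Q" "jk_graph S" "jk_graph S'" "jk_graph P" "jk_graph P'" using full F P by auto
  obtain t where t: "graph_iso P P' t" "u' = kl_of_etale S P' (gcomp S t u)"
    "v' = Comp GrT S' P P' (kl_of_etale P P' t) v"
    using pushout_kl_unique[OF F(1,2) P F(3) u p p'] .
  have et: "etale S P u" "etale P P' t" using u graph_isoD(1)[OF t(1) J(5,6)] by (simp_all add: reduced_cover_def)
  have an: "a \<in> nt_hom (yon T) (bar (yon S))" "b' \<in> nt_hom (yon Q) (bar (yon S'))"
    using cd cd' kl_nt[OF J(1,3)] refines_nt unfolding cdata_def fst_conv snd_conv reduced_cover_def by blast+
  have e': "e = (Comp GrT T P P' (kl_of_etale P P' t) (Comp GrT T S P (kl_of_etale S P u) a), P',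
      Comp GrT Q P P' (kl_of_etale P P' t) (Comp GrT Q S' P v b'))"
    unfolding e t(2,3) Comp_kl_assoc2[OF J(1,3,5,6) et(2) an(1) kl_nt[OF J(3,5) et(1)]]
      Comp_kl_assoc2[OF J(2,4,5,6) et(2) an(2) v] kl_gcomp[OF J(3,5,6) et] by (rule refl)
  have "e \<in> cospans T Q"
    unfolding e' using cospans_cdata[OF full(1,3)] cdata_iso(1)[OF e0 F(3) t(1)] by blast
  moreover have "phi T Q e = bm_comp (bmof T) (bmof R) (bmof Q) (phi R Q d) (phi T R c)"
    unfolding e' cdata_iso(2)[OF e0 F(3) t(1)] ph m ..
  ultimately show "e \<in> ?R" by blast
next
  fix e assume e: "e \<in> ?R"
  obtain a S b where cc: "c = (a, S, b)" by (cases c)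
  obtain a' S' b' where dd: "d = (a', S', b')" by (cases d)
  obtain a1 P' b1 where ee: "e = (a1, P', b1)" by (cases e)
  obtain f r k where cd: "cdata T R (a, S, b) f r k" using c cospans_cdata[OF full(1,2)] unfolding cc by blast
  obtain f' r' k' where cd': "cdata R Q (a', S', b') f' r' k'" using d cospans_cdata[OF full(2,3)] unfolding dd by blast
  obtain f1 r1 k1 where ed: "cdata T Q (a1, P', b1) f1 r1 k1" using e cospans_cdata[OF full(1,3)] unfolding ee by blast
  obtain P u v f'' r'' k'' where P: "full P" and u: "reduced_cover S P u" and v: "v \<in> nt_hom (yon S') (bar (yon P))"
    and e0: "cdata T Q (Comp GrT T S P (kl_of_etale S P u) a, P, Comp GrT Q S' P v b') f'' r'' k''"
    and ph: "phi T Q (Comp GrT T S P (kl_of_etale S P u) a, P, Comp GrT Q S' P v b') =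
      bm_comp (bmof T) (bmof R) (bmof Q) (phi R Q (a', S', b')) (phi T R (a, S, b))"
    and p: "\<And>P' t. full P' \<Longrightarrow> graph_iso P P' t \<Longrightarrow> is_pushout GrT R S S' b a' P'
      (kl_of_etale S P' (gcomp S t u)) (Comp GrT S' P P' (kl_of_etale P P' t) v)"
    by (rule cospan_composite_ex[OF cd cd']) (rule that; assumption)
  have F: "full S" "full S'" "full P'" using cd cd' ed by (simp_all add: cdata_def)
  have J: "jk_graph T" "jk_graph Q" "jk_graph S" "jk_graph S'" "jk_graph P" "jk_graph P'" using full F P by auto
  have "phi T Q (Comp GrT T S P (kl_of_etale S P u) a, P, Comp GrT Q S' P v b') = phi T Q (a1, P', b1)"
    using e ph unfolding cc dd ee by simp
  then obtain t where t: "graph_iso P P' t"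
    "a1 = Comp GrT T P P' (kl_of_etale P P' t) (Comp GrT T S P (kl_of_etale S P u) a)"
    "b1 = Comp GrT Q P P' (kl_of_etale P P' t) (Comp GrT Q S' P v b')"
    using phi_iso[OF e0 ed] by blast
  have et: "etale S P u" "etale P P' t" using u graph_isoD(1)[OF t(1) J(5,6)] by (simp_all add: reduced_cover_def)
  have an: "a \<in> nt_hom (yon T) (bar (yon S))" "b' \<in> nt_hom (yon Q) (bar (yon S'))"
    using cd cd' kl_nt[OF J(1,3)] refines_nt unfolding cdata_def fst_conv snd_conv reduced_cover_def by blast+
  have "e = (Comp GrT T S P' (kl_of_etale S P' (gcomp S t u)) a, P',
      Comp GrT Q S' P' (Comp GrT S' P P' (kl_of_etale P P' t) v) b')"
    unfolding ee t(2,3) Comp_kl_assoc2[OF J(1,3,5,6) et(2) an(1) kl_nt[OF J(3,5) et(1)]]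
      Comp_kl_assoc2[OF J(2,4,5,6) et(2) an(2) v] kl_gcomp[OF J(3,5,6) et] by (rule refl)
  moreover have "(a, S, b) \<in> cospan_class T R c" "(a', S', b') \<in> cospan_class R Q d"
    using cospan_class_eq[OF full(1,2) c] cospan_class_eq[OF full(2,3) d] c d cc dd by auto
  ultimately show "e \<in> ?L" using p[OF F(3) t(1)] by blast
qed

lemma cospan_class_nonempty:
  fixes T R :: "'u::infinite gr"
  assumes "full T" "full R" "c \<in> cospans T R"
  shows "(SOME c'. c' \<in> cospan_class T R c) \<in> cospans T R"
    "phi T R (SOME c'. c' \<in> cospan_class T R c) = phi T R c"
proof -
  have "c \<in> cospan_class T R c" using cospan_class_eq[OF assms] assms(3) by simp
  then have "(SOME c'. c' \<in> cospan_class T R c) \<in> cospan_class T R c" by (rule someI)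
  then show "(SOME c'. c' \<in> cospan_class T R c) \<in> cospans T R"
    "phi T R (SOME c'. c' \<in> cospan_class T R c) = phi T R c"
    using cospan_class_eq[OF assms] by auto
qed

text \<open>Surjectivity of \<open>phi\<close> provides a cospan for the composite in
  \<open>BM\<close>; its class is the corresponding fibre of \<open>phi\<close>, which by
  \<open>composites\<close> is the composite in \<open>Cosp\<close>.\<close>

lemma Comp_Cosp:
  fixes T R Q :: "'u::infinite gr"
  assumes full: "full T" "full R" "full Q" and c: "c \<in> cospans T R" and d: "d \<in> cospans R Q"
  obtains e where "e \<in> cospans T Q" "Comp Cosp T R Q (cospan_class R Q d) (cospan_class T R c) = cospan_class T Q e"
    "phi T Q e = bm_comp (bmof T) (bmof R) (bmof Q) (phi R Q d) (phi T R c)"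
proof -
  interpret g: bm_comp2 "bmof T" "bmof R" "bmof Q" "phi T R c" "phi R Q d"
    using full phi_hom[OF full(1,2) c] phi_hom[OF full(2,3) d] bm_graph_bmof[of T] bm_graph_bmof[of R]
      bm_graph_bmof[of Q] by unfold_locales simp_all
  obtain e where e: "e \<in> cospans T Q" "phi T Q e = g.cg" using phi_surj[OF full(1,3) g.comp_hom] .
  have "Comp Cosp T R Q (cospan_class R Q d) (cospan_class T R c) = cospan_class T Q e"
    unfolding cospan_class_eq[OF full(1,3) e(1)] e(2) composites[OF full c d, symmetric] Cosp_def cat.simps by (rule refl)
  then show ?thesis using that e by blast
qed

theorem theorem6p6:
  "equivalent_categories (Cosp :: ('u::infinite gr, 'u cospan set) cat)
     (BM :: ('u bm_graph, 'u bm_mor) cat)"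
proof (rule equivalent_categoriesI[where Fo = bmof and Go = jkof and
      Fm = "\<lambda>T R C. phi T R (SOME c. c \<in> C)"])
  \<comment> \<open>Classes are fibres of \<open>phi\<close>, so evaluating \<open>phi\<close> on an
    arbitrary member of a class is well defined; \<open>jkof\<close> is a strict section of
    \<open>bmof\<close> on objects.\<close>
  let ?C = "Cosp :: ('u gr, 'u cospan set) cat"
  have Ob: "T \<in> Ob ?C \<longleftrightarrow> full T" for T by (simp add: Cosp_def del: Ob_GrT) simp
  have Hom: "Hom ?C T R = cospan_class T R ` cospans T R" for T R by (simp add: Cosp_def)
  have Ide: "Ide ?C T = cospan_class T T (Ide GrT T, T, Ide GrT T)" for T by (simp add: Cosp_def)
  show "category (BM :: ('u bm_graph, 'u bm_mor) cat)" by (rule category_BM)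
  show "bmof T \<in> Ob BM" if "T \<in> Ob ?C" for T :: "'u gr"
    using that bm_graph_bmof[of T] unfolding Ob by (simp add: BM_def)
  show "jkof \<tau> \<in> Ob ?C" "bmof (jkof \<tau>) = \<tau>" if "\<tau> \<in> Ob BM" for \<tau> :: "'u bm_graph"
    using that full_jkof bmof_jkof unfolding Ob by (simp_all add: BM_def)
  fix T R :: "'u gr" assume "T \<in> Ob ?C" "R \<in> Ob ?C"
  then have full: "full T" "full R" by (simp_all add: Ob)
  note ne = cospan_class_nonempty[OF full] cospan_class_eq[OF full]
  show "bij_betw (\<lambda>C. phi T R (SOME c. c \<in> C)) (Hom ?C T R) (Hom BM (bmof T) (bmof R))"
    unfolding bij_betw_def Hom
  proof
    show "inj_on (\<lambda>C. phi T R (SOME c. c \<in> C)) (cospan_class T R ` cospans T R)"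
    proof (rule inj_onI, elim imageE)
      fix C D c d assume *: "phi T R (SOME c. c \<in> C) = phi T R (SOME c. c \<in> D)"
        "C = cospan_class T R c" "c \<in> cospans T R" "D = cospan_class T R d" "d \<in> cospans T R"
      then have "phi T R c = phi T R d" using ne(2) by simp
      then show "C = D" using * ne(3) by simp
    qed
    have "(\<lambda>C. phi T R (SOME c. c \<in> C)) ` cospan_class T R ` cospans T R = phi T R ` cospans T R"
      unfolding image_image using ne(2) by (intro image_cong) auto
    also have "\<dots> = bm_hom (bmof T) (bmof R)"
    proof (intro subset_antisym subsetI)
      show "h \<in> bm_hom (bmof T) (bmof R)" if "h \<in> phi T R ` cospans T R" for h
        using that phi_hom[OF full] by blast
      show "h \<in> phi T R ` cospans T R" if "h \<in> bm_hom (bmof T) (bmof R)" for h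
        using phi_surj[OF full that] by blast
    qed
    finally show "(\<lambda>C. phi T R (SOME c. c \<in> C)) ` cospan_class T R ` cospans T R = Hom BM (bmof T) (bmof R)"
      by (simp add: BM_def)
  qed
next
  let ?C = "Cosp :: ('u gr, 'u cospan set) cat"
  fix T :: "'u gr" assume "T \<in> Ob ?C"
  then have T: "full T" by (simp add: Cosp_def del: Ob_GrT) simp
  note I = phi_Ide[OF T]
  show "Ide ?C T \<in> Hom ?C T T" using I(1) by (simp add: Cosp_def del: Ide_GrT)
  show "phi T T (SOME c. c \<in> Ide ?C T) = Ide BM (bmof T)"
    using cospan_class_nonempty(2)[OF T T I(1)] I(2) by (simp add: Cosp_def BM_def del: Ide_GrT)
next
  let ?C = "Cosp :: ('u gr, 'u cospan set) cat"
  fix T R Q :: "'u gr" and C D assume o: "T \<in> Ob ?C" "R \<in> Ob ?C" "Q \<in> Ob ?C"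
    and C: "C \<in> Hom ?C T R" and D: "D \<in> Hom ?C R Q"
  have full: "full T" "full R" "full Q" using o by (simp_all add: Cosp_def del: Ob_GrT) simp_all
  obtain c d where c: "C = cospan_class T R c" "c \<in> cospans T R" and d: "D = cospan_class R Q d" "d \<in> cospans R Q"
    using C D by (auto simp: Cosp_def)
  obtain e where e: "e \<in> cospans T Q" "Comp ?C T R Q D C = cospan_class T Q e"
    "phi T Q e = bm_comp (bmof T) (bmof R) (bmof Q) (phi R Q d) (phi T R c)"
    using Comp_Cosp[OF full c(2) d(2)] unfolding c(1) d(1) .
  show "Comp ?C T R Q D C \<in> Hom ?C T Q" unfolding e(2) using e(1) by (simp add: Cosp_def)
  show "phi T Q (SOME c. c \<in> Comp ?C T R Q D C) =
      Comp BM (bmof T) (bmof R) (bmof Q) (phi R Q (SOME c. c \<in> D)) (phi T R (SOME c. c \<in> C))"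
    unfolding e(2)
    unfolding c(1) d(1) cospan_class_nonempty(2)[OF full(1,3) e(1)] e(3)
      cospan_class_nonempty(2)[OF full(1,2) c(2)] cospan_class_nonempty(2)[OF full(2,3) d(2)]
    by (simp add: BM_def)
qed

end
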